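(* Let $\xi$ be a discrete random variable. There is $\epsilon_0>0$ depending only on $\min(\vec p)$ such that the following holds. For all $0 < \delta < 1/4$, $K_3 > K_2 > K_1 > 1$ and $0<\epsilon\le\epsilon_0$, there are $L = L(\xi,\epsilon,\delta,K_1,K_2,K_3) > 0$ and $\gamma = \gamma(\xi,\epsilon,\delta,K_1,K_2,K_3)\in(0,\epsilon)$ such that for every $M\ge 1$ there are $n_0 = n_0(\xi,\epsilon,\delta,K_1,K_2,K_3,M)\ge 1$ and $\eta=\eta(\xi,\epsilon,\delta,K_1,K_2,K_3,M)>0$ with the following property. Let $n\ge n_0$ be an integer, let $N$ be an integer with $1\le N\le\exp((H(\vec{p})-\epsilon)n)$, let $f\in L^1(\mathbb{R})$ be a nonnegative function such that $\|f\|_1 = 1$ and $\log_2 f$ is $\eta$-Lipschitz, and let $\mathcal{A}$ be $(N,n,K_1,K_2,K_3,\delta)$-admissible. Then, for any $\vec{m} \in \mathbb{Z}_{\ge 0}^{k}$ such that $\|\vec{m}\|_{1} = n$ and $\|\vec{m}-\vec{p}\,n\|_{\infty}\le\gamma n$, $$\mathbb{P}\big[\|f_{\mathcal{A},\vec{m}, n}\|_\infty\ge L(N\sqrt{n})^{-1}\big]\le \exp(-Mn),$$ where the probability is over the random vector $(X_1,\dots,X_n)$ uniformly distributed on $\mathcal{A}$.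
   Context: A random variable $\xi$ is called discrete if it is real-valued, its support is finite, and its support contains at least two distinct points. Write $\mathrm{supp}(\xi)=\{a_1,\dots,a_k\}$ ($k\ge2$ distinct points), $\vec p=(p_1,\dots,p_k)$ with $p_j=\mathbb{P}[\xi=a_j]>0$, $\min(\vec p)=\min_j p_j$, and $H(\vec p)=-\sum_{j}p_j\log p_j$ (natural logarithm). Admissibility. Let $N,n\ge 1$ be integers, $0<\delta<1/4$, $K_3>K_2>K_1>1$ real. A set $\mathcal{A}\subseteq\mathbb{Z}^n$ is $(N,n,K_1,K_2,K_3,\delta)$-admissible if: $\mathcal{A}=A_1\times\cdots\times A_n$ with each $A_i$ a nonempty subset of $\mathbb{Z}$; $|A_1|\cdots|A_n|\le (K_3N)^n$; $\max_i\max\{|a|:a\in A_i\}\le nN$; $A_i$ is an integer interval of size at least $2N+1$ for $i>2\delta n$; and either (P1) and (P2) hold, or (Q1) and (Q2) hold: (P1) $A_{2i}$ is an integer interval of size at least $2N+1$ contained in $[-K_1N,K_1N]$ for $i\le\delta n$; (P2) $A_{2i-1}$ is symmetric about $0$, is a union of two integer intervals of total size at least $2N$, and satisfies $A_{2i-1}\cap[-K_2N,K_2N]=\emptyset$ for $i\le\delta n$; (Q1) $A_{2i}$ is an integer interval of size at least $2N+1$ contained in $[K_1N,K_2N]$ for $i\le\delta n$; (Q2) $A_{2i-1}$ is an integer interval of size at least $2N+1$ contained in $[-K_2N,-K_1N]$ for $i\le\delta n$. Random averages. Let $(X_1,\dots,X_n)$ be uniformly distributed on $\mathcal{A}$. For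 $f:\mathbb{R}\to\mathbb{R}$, $0\le\ell\le n$, and $\vec s\in\mathbb{Z}_{\ge0}^k$ with $\|\vec s\|_1=\ell$, define the random function (depending on $X_1,\dots,X_n$) $$f_{\mathcal{A},\vec s,\ell}(t)=\mathbb{E}_b\Big[f\Big(t+\sum_{i=1}^\ell b_iX_i\Big)\,\Big|\,\#\{i:b_i=a_j\}=s_j\ \forall j\in\{1,\dots,k\}\Big],$$ where $\mathbb{E}_b$ is expectation over $b=(b_1,\dots,b_\ell)$ with independent coordinates distributed as $\xi$, independent of $(X_i)$. *)

theory Defs
  imports "HOL-Probability.Probability"
begin

text \<open>
  A discrete random variable enters only through its law, so it is represented by a
  \<^typ>\<open>real pmf\<close>; its support \<open>{a\<^sub>1, \<dots>, a\<^sub>k}\<close> is \<^term>\<open>set_pmf \<xi>\<close> and \<open>p\<^sub>j\<close> is \<^term>\<open>pmf \<xi> a\<^sub>j\<close>.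
  Vectors in \<open>\<int>\<^sup>k\<close> are indexed by the support points themselves: such a vector is a
  function \<^typ>\<open>real \<Rightarrow> nat\<close> of which only the values on \<^term>\<open>set_pmf \<xi>\<close> are ever used.
\<close>

definition discrete_rv :: "real pmf \<Rightarrow> bool" where
  "discrete_rv \<xi> \<longleftrightarrow> finite (set_pmf \<xi>) \<and> 2 \<le> card (set_pmf \<xi>)"

definition min_prob :: "real pmf \<Rightarrow> real" where
  "min_prob \<xi> = Min (pmf \<xi> ` set_pmf \<xi>)"

definition shannon_entropy :: "real pmf \<Rightarrow> real" where
  "shannon_entropy \<xi> = - (\<Sum>a\<in>set_pmf \<xi>. pmf \<xi> a * ln (pmf \<xi> a))"

definition int_interval :: "int set \<Rightarrow> bool" where
  "int_interval I \<longleftrightarrow> (\<exists>a b. I = {a..b})"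

definition cond_P1 :: "nat \<Rightarrow> nat \<Rightarrow> real \<Rightarrow> real \<Rightarrow> (nat \<Rightarrow> int set) \<Rightarrow> bool" where
  "cond_P1 N n K1 \<delta> A \<longleftrightarrow>
     (\<forall>i\<ge>1. real i \<le> \<delta> * real n \<longrightarrow>
        int_interval (A (2 * i)) \<and> 2 * N + 1 \<le> card (A (2 * i)) \<and>
        real_of_int ` A (2 * i) \<subseteq> {- (K1 * real N)..K1 * real N})"

definition cond_P2 :: "nat \<Rightarrow> nat \<Rightarrow> real \<Rightarrow> real \<Rightarrow> (nat \<Rightarrow> int set) \<Rightarrow> bool" where
  "cond_P2 N n K2 \<delta> A \<longleftrightarrow>
     (\<forall>i\<ge>1. real i \<le> \<delta> * real n \<longrightarrow>
        uminus ` A (2 * i - 1) = A (2 * i - 1) \<and>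
        (\<exists>I J. int_interval I \<and> int_interval J \<and> A (2 * i - 1) = I \<union> J \<and>
               2 * N \<le> card I + card J) \<and>
        real_of_int ` A (2 * i - 1) \<inter> {- (K2 * real N)..K2 * real N} = {})"

definition cond_Q1 :: "nat \<Rightarrow> nat \<Rightarrow> real \<Rightarrow> real \<Rightarrow> real \<Rightarrow> (nat \<Rightarrow> int set) \<Rightarrow> bool" where
  "cond_Q1 N n K1 K2 \<delta> A \<longleftrightarrow>
     (\<forall>i\<ge>1. real i \<le> \<delta> * real n \<longrightarrow>
        int_interval (A (2 * i)) \<and> 2 * N + 1 \<le> card (A (2 * i)) \<and>
        real_of_int ` A (2 * i) \<subseteq> {K1 * real N..K2 * real N})"

definition cond_Q2 :: "nat \<Rightarrow> nat \<Rightarrow> real \<Rightarrow> real \<Rightarrow> real \<Rightarrow> (nat \<Rightarrow> int set) \<Rightarrow> bool" where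
  "cond_Q2 N n K1 K2 \<delta> A \<longleftrightarrow>
     (\<forall>i\<ge>1. real i \<le> \<delta> * real n \<longrightarrow>
        int_interval (A (2 * i - 1)) \<and> 2 * N + 1 \<le> card (A (2 * i - 1)) \<and>
        real_of_int ` A (2 * i - 1) \<subseteq> {- (K2 * real N)..- (K1 * real N)})"

text \<open>
  A vector in \<open>\<int>\<^sup>n\<close> is a function on \<open>{1..n}\<close> that is \<^const>\<open>undefined\<close> elsewhere. The bound
  on the absolute values makes every \<open>A i\<close> finite, so all cardinalities below are genuine.
\<close>

definition admissible ::
    "nat \<Rightarrow> nat \<Rightarrow> real \<Rightarrow> real \<Rightarrow> real \<Rightarrow> real \<Rightarrow> (nat \<Rightarrow> int) set \<Rightarrow> bool" where
  "admissible N n K1 K2 K3 \<delta> \<A> \<longleftrightarrow>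
     (\<exists>A. \<A> = (\<Pi>\<^sub>E i\<in>{1..n}. A i) \<and>
          (\<forall>i\<in>{1..n}. A i \<noteq> {}) \<and>
          real (\<Prod>i=1..n. card (A i)) \<le> (K3 * real N) ^ n \<and>
          (\<forall>i\<in>{1..n}. \<forall>a\<in>A i. \<bar>a\<bar> \<le> int n * int N) \<and>
          (\<forall>i\<in>{1..n}. real i > 2 * \<delta> * real n \<longrightarrow>
             int_interval (A i) \<and> 2 * N + 1 \<le> card (A i)) \<and>
          ((cond_P1 N n K1 \<delta> A \<and> cond_P2 N n K2 \<delta> A) \<or>
           (cond_Q1 N n K1 K2 \<delta> A \<and> cond_Q2 N n K1 K2 \<delta> A)))"

text \<open>
  \<^term>\<open>Pi_pmf {1..l} 0 (\<lambda>_. \<xi>)\<close> is the law of \<open>(b\<^sub>1, \<dots>, b\<^sub>l)\<close> with independent coordinates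
  distributed as \<open>\<xi>\<close>. The conditioning event has positive probability exactly when \<open>s\<close> sums
  to \<open>l\<close> over the support of \<open>\<xi>\<close>; the definition is meaningful only then.
\<close>

definition random_average ::
    "real pmf \<Rightarrow> (real \<Rightarrow> real) \<Rightarrow> (real \<Rightarrow> nat) \<Rightarrow> nat \<Rightarrow> (nat \<Rightarrow> int) \<Rightarrow> real \<Rightarrow> real" where
  "random_average \<xi> f s l X t =
     measure_pmf.expectation
       (cond_pmf (Pi_pmf {1..l} 0 (\<lambda>_. \<xi>))
          {b. \<forall>a\<in>set_pmf \<xi>. card {i\<in>{1..l}. b i = a} = s a})
       (\<lambda>b. f (t + (\<Sum>i=1..l. b i * real_of_int (X i))))"

definition L1_norm :: "(real \<Rightarrow> real) \<Rightarrow> real" where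
  "L1_norm f = (\<integral>t. \<bar>f t\<bar> \<partial>lborel)"

definition Linf_norm :: "(real \<Rightarrow> real) \<Rightarrow> ereal" where
  "Linf_norm g = esssup lborel (\<lambda>t. ereal \<bar>g t\<bar>)"

text \<open>
  Positivity is part of \<open>log\<^sub>2 f\<close> being a (finite) Lipschitz function; it has to be
  explicit because \<^prop>\<open>log 2 0 = 0\<close> here.
\<close>

definition log2_lipschitz :: "real \<Rightarrow> (real \<Rightarrow> real) \<Rightarrow> bool" where
  "log2_lipschitz \<eta> f \<longleftrightarrow> (\<forall>t. 0 < f t) \<and> \<eta>-lipschitz_on UNIV (\<lambda>t. log 2 (f t))"

end

theory Submission
 imports Defs "HOL-Combinatorics.Multiset_Permutations" "HOL-Real_Asymp.Real_Asymp"
begin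

text \<open>
 Write \<open>S\<close> for the support of \<open>\<xi>\<close>, \<open>p\<close> for its probabilities and \<open>v = L / (N sqrt n)\<close> for the level that
 the random average should not exceed. Conditioning on the type of \<open>b\<close> makes \<open>b\<close> uniform on a slice, so
 the random average is the function \<open>favg\<close>, which satisfies a recursion: \<open>favg\<close> at level \<open>l + 1\<close> is a convex
 combination of translates, by \<open>a X\<^sub>l\<^sub>+\<^sub>1\<close> for letters \<open>a \<in> S\<close>, of \<open>favg\<close> at level \<open>l\<close>, with weights \<open>s a / (l + 1)\<close>.
 A point where \<open>favg\<close> is large at the top can therefore be followed down to level \<open>0\<close>, always to a child
 that is at least as large. The point reached at level \<open>0\<close> is a point where \<open>f\<close> itself is at least \<open>v\<close>, and since
 \<open>f\<close> is an almost constant density on unit scale there are only \<open>O(1 / v)\<close> candidates up to rounding;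
 together with the word \<open>b\<close> of letters chosen on the way there are only exponentially many possible
 paths, with a base independent of \<open>L\<close>. It remains to show that each path has tiny probability.

 Two facts control the children. Averages over a slice are anticoncentrated: swapping the letters at
 positions \<open>2 j - 1\<close> and \<open>2 j\<close> keeps the type, and the gap between the two factors of an
 admissible set makes every such swap move the linear form by at least a constant times \<open>N\<close>, so the
 Littlewood--Offord inequality gives concentration at most \<open>O(1 / sqrt n)\<close> on intervals of length \<open>N\<close>
 (\<open>anticoncentration\<close>). Consequently the mean of \<open>favg\<close> over an interval of translates of length at
 least \<open>N\<close> is \<open>O(1 / (N sqrt n))\<close> on all levels close to the top (\<open>progression_sum_le\<close>).

 First, for each \<open>M\<close> there is a constant \<open>L'\<close>, depending on \<open>M\<close>, for which the claim holds
 (\<open>sup_bound_depending_on_exponent\<close>). On the way down, a step either multiplies the value by almost the inverse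
 weight of the letter, or has a rival, a second child that is not much smaller than the largest. If
 there were few rivals the value would grow by the size of the slice, which exceeds \<open>N\<close> exponentially
 because \<open>N \<le> exp ((H - \<epsilon>) n)\<close>; this is impossible for \<open>f \<le> 2\<close>. But a rival at a given step has probability
 \<open>O(1 / L')\<close>, so linearly many of them have probability \<open>L' powr (- c n)\<close>.

 Secondly, \<open>L\<close> is made independent of \<open>M\<close> by looking at blocks of \<open>r = r(M)\<close> consecutive levels among the top
 \<open>\<theta> n\<close> ones (\<open>sup_bound_uniform\<close>). In a block either some descendant gains a fixed factor, which happens only a bounded
 number of times as long as the value below stays under \<open>L' / (N sqrt n)\<close>, or all descendants are at least half as large as
 the ancestor. In the latter case flipping one letter into another at the positions \<open>I\<close> of the block shows
 that a truncation of \<open>favg\<close>, which vanishes on at least half of every window of length \<open>N\<close> as soon as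
 \<open>L\<close> is large enough, takes the value \<open>1\<close> at all points of a cube \<open>{\<Sum>i\<in>I. X i | I}\<close> with random sides. Such cubes are
 superexponentially rare in the dimension: their probability is at most \<open>\<omega> ^ g\<close> in dimension \<open>16 g\<close>, with \<open>\<omega>\<close>
 arbitrarily small provided that \<open>g\<close> is large (\<open>cube_bound\<close>). This is where \<open>\<eta>\<close> has to depend on \<open>M\<close>. Taking \<open>\<omega>\<close> small
 in terms of \<open>M\<close>, the linearly many good blocks have probability at most \<open>exp (- M n)\<close>.
\<close>

section \<open>Averaging over independent coordinates\<close>

definition avg1 :: "(nat \<Rightarrow> 'a \<Rightarrow> real) \<Rightarrow> (nat \<Rightarrow> 'a set) \<Rightarrow> nat \<Rightarrow> ((nat \<Rightarrow> 'a) \<Rightarrow> real) \<Rightarrow> (nat \<Rightarrow> 'a) \<Rightarrow> real" where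
 "avg1 w A i \<phi> Z = (\<Sum>x\<in>A i. w i x * \<phi> (Z(i := x)))"

text \<open>
 An explicit iterated integral: keeping the values at the remaining coordinates as the parameter \<open>Z\<close> is what
 allows conditioning on some coordinates while the others are still to be averaged.
\<close>

definition avg :: "(nat \<Rightarrow> 'a \<Rightarrow> real) \<Rightarrow> (nat \<Rightarrow> 'a set) \<Rightarrow> nat list \<Rightarrow> ((nat \<Rightarrow> 'a) \<Rightarrow> real) \<Rightarrow> (nat \<Rightarrow> 'a) \<Rightarrow> real" where
 "avg w A is = foldr (avg1 w A) is"

definition law :: "(nat \<Rightarrow> 'a \<Rightarrow> real) \<Rightarrow> (nat \<Rightarrow> 'a set) \<Rightarrow> nat \<Rightarrow> bool" where
 "law w A i \<longleftrightarrow> finite (A i) \<and> (\<forall>x\<in>A i. 0 \<le> w i x) \<and> (\<Sum>x\<in>A i. w i x) = 1"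

definition unif :: "(nat \<Rightarrow> 'a set) \<Rightarrow> nat \<Rightarrow> 'a \<Rightarrow> real" where
 "unif A i x = 1 / real (card (A i))"

lemma law_unif: "finite (A i) \<Longrightarrow> A i \<noteq> {} \<Longrightarrow> law (unif A) A i"
 by (simp add: law_def unif_def)

lemma avg_Nil [simp]: "avg w A [] \<phi> = \<phi>"
 by (simp add: avg_def)

lemma avg_Cons: "avg w A (i # is) \<phi> Z = (\<Sum>x\<in>A i. w i x * avg w A is \<phi> (Z(i := x)))"
 by (simp add: avg_def avg1_def)

lemma avg_append: "avg w A (is @ js) \<phi> = avg w A is (avg w A js \<phi>)"
 by (simp add: avg_def)

lemma avg_mono_on:
 assumes "\<forall>i\<in>set is. law w A i"
  and "\<And>Y. (\<forall>i\<in>set is. Y i \<in> A i) \<Longrightarrow> (\<forall>i. i \<notin> set is \<longrightarrow> Y i = Z i) \<Longrightarrow> \<phi> Y \<le> \<psi> Y"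
 shows "avg w A is \<phi> Z \<le> avg w A is \<psi> Z"
 using assms
proof (induction "is" arbitrary: Z)
 case Nil
 show ?case using Nil(2)[of Z] by simp
next
 case (Cons i "is")
 have "avg w A is \<phi> (Z(i := x)) \<le> avg w A is \<psi> (Z(i := x))" if "x \<in> A i" for x
 proof (rule Cons.IH)
  show "\<forall>i\<in>set is. law w A i" using Cons.prems by simp
  fix Y assume Y: "\<forall>i\<in>set is. Y i \<in> A i" "\<forall>j. j \<notin> set is \<longrightarrow> Y j = (Z(i := x)) j"
  then show "\<phi> Y \<le> \<psi> Y"
   using that by (intro Cons.prems(2)) (metis fun_upd_apply set_ConsD, metis fun_upd_apply list.set_intros)
 qed
 then show ?case
  unfolding avg_Cons using Cons.prems(1)
  by (intro sum_mono mult_left_mono) (auto simp: law_def)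
qed

lemma avg_mono:
 assumes "\<forall>i\<in>set is. law w A i" and "\<And>Y. \<phi> Y \<le> \<psi> Y"
 shows "avg w A is \<phi> Z \<le> avg w A is \<psi> Z"
 by (rule avg_mono_on) (use assms in auto)

lemma avg_const: "\<forall>i\<in>set is. law w A i \<Longrightarrow> avg w A is (\<lambda>_. c) Z = c"
 by (induction "is" arbitrary: Z) (auto simp: avg_Cons law_def simp flip: sum_distrib_right)

lemma avg_add: "avg w A is (\<lambda>Y. \<phi> Y + \<psi> Y) Z = avg w A is \<phi> Z + avg w A is \<psi> Z"
 by (induction "is" arbitrary: Z) (auto simp: avg_Cons sum.distrib algebra_simps)

lemma avg_cmult: "avg w A is (\<lambda>Y. c * \<phi> Y) Z = c * avg w A is \<phi> Z"
 by (induction "is" arbitrary: Z) (auto simp: avg_Cons sum_distrib_left algebra_simps)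

lemma avg_sum: "finite T \<Longrightarrow> avg w A is (\<lambda>Y. \<Sum>t\<in>T. \<phi> t Y) Z = (\<Sum>t\<in>T. avg w A is (\<phi> t) Z)"
proof (induction T rule: finite_induct)
 case empty
 show ?case using avg_cmult[of w A "is" 0 "\<lambda>_. 0" Z] by simp
qed (simp add: avg_add)

lemma avg_mult_indep:
 assumes "\<And>i Y x. i \<in> set is \<Longrightarrow> g (Y(i := x)) = g Y"
 shows "avg w A is (\<lambda>Y. g Y * \<phi> Y) Z = g Z * avg w A is \<phi> Z"
 using assms
proof (induction "is" arbitrary: Z)
 case (Cons i "is")
 have "avg w A is (\<lambda>Y. g Y * \<phi> Y) (Z(i := x)) = g Z * avg w A is \<phi> (Z(i := x))" for x
 proof -
  have "avg w A is (\<lambda>Y. g Y * \<phi> Y) (Z(i := x)) = g (Z(i := x)) * avg w A is \<phi> (Z(i := x))"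
   by (rule Cons.IH) (rule Cons.prems, simp)
  also have "g (Z(i := x)) = g Z" by (rule Cons.prems) simp
  finally show ?thesis .
 qed
 then show ?case
  by (simp add: avg_Cons sum_distrib_left algebra_simps)
qed simp

lemma avg_indep:
 assumes "\<forall>i\<in>set is. law w A i" and "\<And>i Y x. i \<in> set is \<Longrightarrow> \<phi> (Y(i := x)) = \<phi> Y"
 shows "avg w A is \<phi> Z = \<phi> Z"
 using avg_mult_indep[of "is" \<phi> w A "\<lambda>_. 1" Z] assms avg_const[of "is" w A 1 Z] by simp

lemma avg_upd_out:
 assumes "i \<notin> set is"
 shows "avg w A is \<phi> (Z(i := x)) = avg w A is (\<lambda>Y. \<phi> (Y(i := x))) Z"
 using assms by (induction "is" arbitrary: Z) (auto simp: avg_Cons fun_upd_twist)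

lemma avg_indep_upd:
 assumes "\<And>Y x. \<phi> (Y(i := x)) = \<phi> Y"
 shows "avg w A is \<phi> (Z(i := x)) = avg w A is \<phi> Z"
proof (induction "is" arbitrary: Z)
 case Nil
 show ?case using assms[of Z x] by (simp only: avg_Nil)
next
 case (Cons j "is")
 show ?case
 proof (cases "i = j")
  case True
  then show ?thesis by (simp only: avg_Cons fun_upd_upd)
 next
  case False
  then have "Z(i := x, j := y) = Z(j := y, i := x)" for y by (simp add: fun_upd_twist)
  then show ?thesis by (simp only: avg_Cons Cons.IH)
 qed
qed

lemma avg_eq_sum:
 assumes "distinct is" "\<forall>i\<in>set is. finite (A i)"
 shows "avg w A is \<phi> (\<lambda>_. undefined) = (\<Sum>X\<in>Pi\<^sub>E (set is) A. (\<Prod>i\<in>set is. w i (X i)) * \<phi> X)"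
 using assms
proof (induction "is" arbitrary: \<phi>)
 case Nil
 then show ?case by simp
next
 case (Cons i "is")
 have inj: "inj_on (\<lambda>(y, g). g(i := y)) (A i \<times> Pi\<^sub>E (set is) A)"
  using Cons.prems by (intro inj_combinator) auto
 have pr: "(\<Prod>j\<in>set (i # is). w j ((g(i := y)) j)) = w i y * (\<Prod>j\<in>set is. w j (g j))" for y g
 proof -
  have "(\<Prod>j\<in>set is. w j ((g(i := y)) j)) = (\<Prod>j\<in>set is. w j (g j))"
   using Cons.prems by (intro prod.cong) auto
  then show ?thesis using Cons.prems by simp
 qed
 have "avg w A (i # is) \<phi> (\<lambda>_. undefined) = (\<Sum>y\<in>A i. w i y * (\<Sum>X\<in>Pi\<^sub>E (set is) A. (\<Prod>j\<in>set is. w j (X j)) * \<phi> (X(i := y))))"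
  unfolding avg_Cons using Cons by (simp add: avg_upd_out)
 also have "... = (\<Sum>(y, g)\<in>A i \<times> Pi\<^sub>E (set is) A. (\<Prod>j\<in>set (i # is). w j ((g(i := y)) j)) * \<phi> (g(i := y)))"
  unfolding pr by (simp add: sum_distrib_left sum.cartesian_product mult.assoc)
 also have "... = (\<Sum>X\<in>(\<lambda>(y, g). g(i := y)) ` (A i \<times> Pi\<^sub>E (set is) A). (\<Prod>j\<in>set (i # is). w j (X j)) * \<phi> X)"
  using inj by (subst sum.reindex) (simp_all add: case_prod_unfold)
 finally show ?case by (simp add: PiE_insert_eq)
qed

text \<open>
 The form of independence used throughout: if \<open>q \<beta>\<close> depends only on coordinates up to block \<open>\<beta>\<close> and has
 conditional mean at most \<open>a\<close> whatever happened in the earlier blocks, the conditional bounds multiply. The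
 last block is integrated first.
\<close>

lemma avg_blocks:
 assumes "\<forall>i\<in>set (concat bls). law w A i"
  and "Y \<subseteq> {..<length bls}"
  and "\<And>\<beta> Z. \<beta> \<in> Y \<Longrightarrow> 0 \<le> q \<beta> Z"
  and "\<And>\<beta> \<gamma> i Z x. \<beta> \<in> Y \<Longrightarrow> \<beta> < \<gamma> \<Longrightarrow> \<gamma> < length bls \<Longrightarrow> i \<in> set (bls ! \<gamma>) \<Longrightarrow> q \<beta> (Z(i := x)) = q \<beta> Z"
  and "\<And>\<beta> Z. \<beta> \<in> Y \<Longrightarrow> (\<forall>i\<in>set (concat (take \<beta> bls)). Z i \<in> A i) \<Longrightarrow> avg w A (bls ! \<beta>) (q \<beta>) Z \<le> a"
  and "0 \<le> a"
 shows "avg w A (concat bls) (\<lambda>Z. \<Prod>\<beta>\<in>Y. q \<beta> Z) Z0 \<le> a ^ card Y"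
 using assms(1-5)
proof (induction bls arbitrary: Y Z0 rule: rev_induct)
 case Nil
 then show ?case by simp
next
 case (snoc bl bls)
 let ?m = "length bls"
 let ?Y' = "Y - {?m}"
 have Y': "?Y' \<subseteq> {..<length bls}" using snoc.prems(2) by auto
 have finY: "finite Y" using snoc.prems(2) finite_subset by blast
 let ?g = "\<lambda>Z. \<Prod>\<beta>\<in>?Y'. q \<beta> Z"
 have g0: "0 \<le> ?g Z" for Z using snoc.prems(3) by (intro prod_nonneg) auto
 have gind: "?g (Z(i := x)) = ?g Z" if "i \<in> set bl" for i Z x
 proof (rule prod.cong[OF refl])
  fix \<beta> assume "\<beta> \<in> ?Y'"
  then show "q \<beta> (Z(i := x)) = q \<beta> Z"
   using Y' that by (intro snoc.prems(4)[of \<beta> ?m]) (auto simp: nth_append)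
 qed
 have IH: "avg w A (concat bls) ?g Z0 \<le> a ^ card ?Y'"
 proof (rule snoc.IH[OF _ Y'])
  fix \<beta> Z assume b: "\<beta> \<in> ?Y'" and Z: "\<forall>i\<in>set (concat (take \<beta> bls)). Z i \<in> A i"
  then have "\<beta> < ?m" using Y' by auto
  then show "avg w A (bls ! \<beta>) (q \<beta>) Z \<le> a"
   using snoc.prems(5)[of \<beta> Z] b Z by (simp add: nth_append)
 next
  fix \<beta> \<gamma> i Z x assume "\<beta> \<in> ?Y'" "\<beta> < \<gamma>" "\<gamma> < length bls" "i \<in> set (bls ! \<gamma>)"
  then show "q \<beta> (Z(i := x)) = q \<beta> Z" by (intro snoc.prems(4)[of \<beta> \<gamma>]) (auto simp: nth_append)
 qed (use snoc.prems in auto)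
 have law: "\<forall>i\<in>set (concat bls). law w A i" "\<forall>i\<in>set bl. law w A i" using snoc.prems(1) by auto
 have split: "avg w A (concat (bls @ [bl])) (\<lambda>Z. \<Prod>\<beta>\<in>Y. q \<beta> Z) Z0
   = avg w A (concat bls) (avg w A bl (\<lambda>Z. \<Prod>\<beta>\<in>Y. q \<beta> Z)) Z0"
  by (simp add: avg_append)
 show ?case
 proof (cases "?m \<in> Y")
  case True
  have pr: "(\<Prod>\<beta>\<in>Y. q \<beta> Z) = ?g Z * q ?m Z" for Z
   using prod.remove[OF finY True, of "\<lambda>\<beta>. q \<beta> Z"] by (simp add: mult.commute)
  have "avg w A (concat bls) (avg w A bl (\<lambda>Z. \<Prod>\<beta>\<in>Y. q \<beta> Z)) Z0 \<le> avg w A (concat bls) (\<lambda>Z. a * ?g Z) Z0"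
  proof (rule avg_mono_on[OF law(1)])
   fix Z assume Z: "\<forall>i\<in>set (concat bls). Z i \<in> A i"
   have "avg w A bl (\<lambda>Z. \<Prod>\<beta>\<in>Y. q \<beta> Z) Z = ?g Z * avg w A bl (q ?m) Z"
    unfolding pr by (rule avg_mult_indep) (rule gind)
   also have "... \<le> ?g Z * a"
    using snoc.prems(5)[OF True, of Z] Z g0 by (intro mult_left_mono) auto
   finally show "avg w A bl (\<lambda>Z. \<Prod>\<beta>\<in>Y. q \<beta> Z) Z \<le> a * ?g Z" by (simp add: mult.commute)
  qed
  also have "... \<le> a * a ^ card ?Y'"
   unfolding avg_cmult using IH assms(6) by (rule mult_left_mono)
  also have "... = a ^ card Y"
   using card.remove[OF finY True] by simp
  finally show ?thesis unfolding split .
 next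
  case False
  then have Yeq: "?Y' = Y" by auto
  have "avg w A bl (\<lambda>Z. \<Prod>\<beta>\<in>Y. q \<beta> Z) = (\<lambda>Z. \<Prod>\<beta>\<in>Y. q \<beta> Z)"
   by (rule ext, rule avg_indep[OF law(2)]) (use gind Yeq in auto)
  then show ?thesis unfolding split using IH Yeq by simp
 qed
qed

section \<open>Almost translation-invariant means\<close>

definition bddf :: "(nat \<Rightarrow> int \<Rightarrow> real) \<Rightarrow> bool" where
 "bddf F \<longleftrightarrow> (\<exists>C. \<forall>d u. \<bar>F d u\<bar> \<le> C)"

lemma bddf_const [intro, simp]: "bddf (\<lambda>_ _. c)"
 by (auto simp: bddf_def)

lemma bddf_add [intro]: "bddf F \<Longrightarrow> bddf G \<Longrightarrow> bddf (\<lambda>d u. F d u + G d u)"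
 unfolding bddf_def by (meson abs_triangle_ineq add_mono order_trans)

lemma bddf_cmult [intro]: "bddf F \<Longrightarrow> bddf (\<lambda>d u. c * F d u)"
 unfolding bddf_def by (metis abs_ge_zero abs_mult mult_left_mono)

lemma bddf_diff [intro]: "bddf F \<Longrightarrow> bddf G \<Longrightarrow> bddf (\<lambda>d u. F d u - G d u)"
 using bddf_add[of F "\<lambda>d u. (-1) * G d u"] bddf_cmult[of G "-1"] by simp

lemma bddf_abs [intro]: "bddf F \<Longrightarrow> bddf (\<lambda>d u. \<bar>F d u\<bar>)"
 by (simp add: bddf_def)

lemma bddf_min [intro]:
 assumes "bddf F" "bddf G" shows "bddf (\<lambda>d u. min (F d u) (G d u))"
proof -
 from assms obtain C D where "\<And>d u. \<bar>F d u\<bar> \<le> C" "\<And>d u. \<bar>G d u\<bar> \<le> D" unfolding bddf_def by auto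
 then have "\<bar>min (F d u) (G d u)\<bar> \<le> max C D" for d u
  by (metis max.coboundedI1 max.coboundedI2 min_def)
 then show ?thesis unfolding bddf_def by blast
qed

lemma bddf_shift [intro]: "bddf F \<Longrightarrow> bddf (\<lambda>d u. F (g d) (h d u))"
 by (auto simp: bddf_def)

lemma bddf_shift' [intro]: "bddf F \<Longrightarrow> bddf (\<lambda>d u. F d (h u))"
 by (auto simp: bddf_def)

lemma bddf_01: "(\<And>d u. 0 \<le> F d u) \<Longrightarrow> (\<And>d u. F d u \<le> 1) \<Longrightarrow> bddf F"
 unfolding bddf_def by (rule exI[of _ 1]) auto

lemma bddf_sum [intro]: "(\<And>t. t \<in> T \<Longrightarrow> bddf (F t)) \<Longrightarrow> bddf (\<lambda>d u. \<Sum>t\<in>T. F t d u)"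
 by (induction T rule: infinite_finite_induct) auto

text \<open>
 A positive linear functional of total mass at most \<open>\<Omega>\<close> on bounded functions that is translation invariant up to the factor
 \<open>\<sigma>\<close> for shifts up to \<open>r\<close>. Functions carry a second argument \<open>d\<close>, which later counts how many sides of a cube have been
 used.
\<close>

definition qmean :: "((nat \<Rightarrow> int \<Rightarrow> real) \<Rightarrow> real) \<Rightarrow> real \<Rightarrow> real \<Rightarrow> int \<Rightarrow> bool" where
 "qmean \<Lambda> \<Omega> \<sigma> r \<longleftrightarrow>
   (\<forall>F G. bddf F \<longrightarrow> bddf G \<longrightarrow> \<Lambda> (\<lambda>d u. F d u + G d u) = \<Lambda> F + \<Lambda> G) \<and>
   (\<forall>c F. bddf F \<longrightarrow> \<Lambda> (\<lambda>d u. c * F d u) = c * \<Lambda> F) \<and>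
   (\<forall>F. bddf F \<longrightarrow> (\<forall>d u. 0 \<le> F d u) \<longrightarrow> 0 \<le> \<Lambda> F) \<and>
   \<Lambda> (\<lambda>_ _. 1) \<le> \<Omega> \<and>
   (\<forall>F z. bddf F \<longrightarrow> (\<forall>d u. 0 \<le> F d u) \<longrightarrow> \<bar>z\<bar> \<le> r \<longrightarrow> \<Lambda> (\<lambda>d u. F d (u + z)) \<le> \<sigma> * \<Lambda> F)"

context
 fixes \<Lambda> \<Omega> \<sigma> r
 assumes Lam: "qmean \<Lambda> \<Omega> \<sigma> r"
begin

lemma qmean_add: "bddf F \<Longrightarrow> bddf G \<Longrightarrow> \<Lambda> (\<lambda>d u. F d u + G d u) = \<Lambda> F + \<Lambda> G"
 using Lam by (simp add: qmean_def)

lemma qmean_cmult: "bddf F \<Longrightarrow> \<Lambda> (\<lambda>d u. c * F d u) = c * \<Lambda> F"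
 using Lam by (simp add: qmean_def)

lemma qmean_nonneg: "bddf F \<Longrightarrow> (\<And>d u. 0 \<le> F d u) \<Longrightarrow> 0 \<le> \<Lambda> F"
 using Lam by (simp add: qmean_def)

lemma qmean_total: "\<Lambda> (\<lambda>_ _. 1) \<le> \<Omega>"
 using Lam by (simp add: qmean_def)

lemma qmean_shift: "bddf F \<Longrightarrow> (\<And>d u. 0 \<le> F d u) \<Longrightarrow> \<bar>z\<bar> \<le> r \<Longrightarrow> \<Lambda> (\<lambda>d u. F d (u + z)) \<le> \<sigma> * \<Lambda> F"
 using Lam by (simp add: qmean_def)

lemma qmean_diff: "bddf F \<Longrightarrow> bddf G \<Longrightarrow> \<Lambda> (\<lambda>d u. F d u - G d u) = \<Lambda> F - \<Lambda> G"
 using qmean_add[of F "\<lambda>d u. (-1) * G d u"] qmean_cmult[of G "-1"] bddf_cmult[of G "-1"] by simp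

lemma qmean_mono:
 assumes "bddf F" "bddf G" "\<And>d u. F d u \<le> G d u" shows "\<Lambda> F \<le> \<Lambda> G"
proof -
 have "0 \<le> \<Lambda> (\<lambda>d u. G d u - F d u)"
  by (rule qmean_nonneg) (use assms in auto)
 then show ?thesis using qmean_diff[OF assms(2,1)] by simp
qed

lemma qmean_const_le: "0 \<le> c \<Longrightarrow> \<Lambda> (\<lambda>_ _. c) \<le> c * \<Omega>"
 using qmean_cmult[of "\<lambda>_ _. 1" c] mult_left_mono[OF qmean_total] by simp

lemma qmean_sum:
 assumes "finite T" "\<And>t. t \<in> T \<Longrightarrow> bddf (F t)"
 shows "\<Lambda> (\<lambda>d u. \<Sum>t\<in>T. F t d u) = (\<Sum>t\<in>T. \<Lambda> (F t))"
 using assms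
proof (induction T rule: finite_induct)
 case empty
 then show ?case using qmean_cmult[of "\<lambda>_ _. 0" 0] by simp
next
 case (insert t T)
 have "\<Lambda> (\<lambda>d u. F t d u + (\<Sum>t\<in>T. F t d u)) = \<Lambda> (F t) + \<Lambda> (\<lambda>d u. \<Sum>t\<in>T. F t d u)"
  using insert.prems by (intro qmean_add bddf_sum) auto
 then show ?case using insert by simp
qed

lemma qmean_abs_triangle:
 assumes "bddf F" "bddf G" "bddf K"
 shows "\<Lambda> (\<lambda>d u. \<bar>F d u - K d u\<bar>) \<le> \<Lambda> (\<lambda>d u. \<bar>F d u - G d u\<bar>) + \<Lambda> (\<lambda>d u. \<bar>G d u - K d u\<bar>)"
proof -
 have "\<Lambda> (\<lambda>d u. \<bar>F d u - K d u\<bar>) \<le> \<Lambda> (\<lambda>d u. \<bar>F d u - G d u\<bar> + \<bar>G d u - K d u\<bar>)"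
  using assms by (intro qmean_mono bddf_add bddf_abs bddf_diff) auto
 also have "... = \<Lambda> (\<lambda>d u. \<bar>F d u - G d u\<bar>) + \<Lambda> (\<lambda>d u. \<bar>G d u - K d u\<bar>)"
  using assms by (intro qmean_add bddf_abs bddf_diff)
 finally show ?thesis .
qed

end

text \<open>
 The first index at which the sequence reaches \<open>y\<close> overshoots by at most one step.
\<close>

lemma discrete_ivt:
 fixes \<psi> :: "nat \<Rightarrow> real"
 assumes "\<psi> 0 \<le> y" "y \<le> \<psi> n" "\<And>i. i < n \<Longrightarrow> \<psi> (Suc i) \<le> \<psi> i + s" "0 \<le> s"
 shows "\<exists>i\<le>n. y \<le> \<psi> i \<and> \<psi> i \<le> y + s"
proof -
 define i where "i = (LEAST i. y \<le> \<psi> i)"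
 have i: "y \<le> \<psi> i" unfolding i_def by (rule LeastI) (rule assms(2))
 have le: "i \<le> n" unfolding i_def by (rule Least_le) (rule assms(2))
 have "\<psi> i \<le> y + s"
 proof (cases i)
  case 0
  then show ?thesis using assms by simp
 next
  case (Suc j)
  have "\<not> y \<le> \<psi> j" using not_less_Least[of j "\<lambda>i. y \<le> \<psi> i"] Suc unfolding i_def by simp
  then show ?thesis using assms(3)[of j] Suc le by simp
 qed
 with i le show ?thesis by blast
qed

text \<open>
 Replacing the mean \<open>A\<close> of \<open>G\<close> and of the translate \<open>H (\<cdot> + x\<^sub>0)\<close> by the mean of the minimum of \<open>G\<close> and a random translate
 \<open>H (\<cdot> + x)\<close> loses a factor \<open>1 - c\<close>, except with probability \<open>O(c)\<close>. For two exceptional values \<open>x\<close> and \<open>b\<close> the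
 translates of \<open>H\<close> both almost coincide with \<open>G\<close>, so \<open>\<psi> (x - b)\<close>, the mean of
 \<open>\<bar>H (\<cdot> + b) - H (\<cdot> + x)\<bar>\<close>, is \<open>O(c A)\<close>. On the other hand \<open>H\<close> vanishes on half of every window of length \<open>N\<close>,
 so \<open>\<psi>\<close> reaches size comparable to \<open>A\<close> on \<open>{0..N}\<close>, and it gets there slowly because \<open>H\<close> is almost constant on
 unit scale. Hence there are about \<open>1 / c\<close> shifts \<open>z k\<close> at which \<open>\<psi>\<close> has well separated values; by the
 triangle inequality the corresponding translates of the set of exceptional differences are disjoint, and they all lie in an
 interval of length \<open>O(N)\<close>.
\<close>

lemma one_step_decay:
 fixes N :: int and c \<phi> \<Omega> :: real and G H :: "nat \<Rightarrow> int \<Rightarrow> real"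
 assumes Lam: "qmean \<Lambda> \<Omega> (1 + c) (4 * N)"
  and N: "1 \<le> N" and c: "0 < c" "c \<le> 1/100" and \<phi>: "0 < \<phi>" and \<Omega>: "0 \<le> \<Omega>"
  and G: "\<And>d u. 0 \<le> G d u" "\<And>d u. G d u \<le> 1"
  and H: "\<And>d u. 0 \<le> H d u" "\<And>d u. H d u \<le> 1"
  and Lip: "\<And>d u. \<bar>H d (u + 1) - H d u\<bar> \<le> c * \<phi> / 2"
  and sparse: "\<And>d u. 2 * int (card {z\<in>{0..N}. 0 < H d (u + z)}) \<le> N + 1"
  and J: "J = {x1..x2}" "N \<le> x2 - x1 + 1" "x2 - x1 + 1 \<le> 2 * N" and x0: "x0 \<in> J"
  and A: "A = (\<Lambda> G + \<Lambda> (\<lambda>d u. H d (u + x0))) / 2"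
 shows "real (card {x\<in>J. \<phi> * \<Omega> \<le> A \<and> (1 - c) * A < \<Lambda> (\<lambda>d u. min (G d u) (H d (u + x)))})
     \<le> 1200 * c * real (card J)"
  (is "real (card ?B) \<le> _")
proof (cases "?B = {}")
 case True
 show ?thesis unfolding True using c by simp
next
 case False
 then obtain b where b: "b \<in> ?B" by blast
 have bG: "bddf G" and bH: "bddf H" using G H by (auto intro: bddf_01)
 note bd = bG bH
 have bHs: "bddf (\<lambda>d u. H d (u + x))" for x using bH by auto
 define h where "h x = \<Lambda> (\<lambda>d u. H d (u + x))" for x
 define m where "m x = \<Lambda> (\<lambda>d u. min (G d u) (H d (u + x)))" for x
 have hsh: "h x \<le> (1 + c) * h y" if "\<bar>x - y\<bar> \<le> 4 * N" for x y
  unfolding h_def using qmean_shift[OF Lam bHs[of y], of "x - y"] H that by (simp add: algebra_simps)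
 have mG: "m x \<le> \<Lambda> G" and mh: "m x \<le> h x" for x
  unfolding m_def h_def using bd by (intro qmean_mono[OF Lam] bddf_min bHs; simp)+
 have h0: "0 \<le> h x" and G0: "0 \<le> \<Lambda> G" for x
  unfolding h_def by (rule qmean_nonneg[OF Lam]; use bHs H bG G in simp)+
 have A2: "2 * A = \<Lambda> G + h x0" using A by (simp add: h_def)
 have A0: "0 \<le> A" using A2 h0[of x0] G0 by simp
 have AO: "\<phi> * \<Omega> \<le> A" using b by auto
 have B: "x \<in> J" "(1 - c) * A < m x" if "x \<in> ?B" for x
  using that by (auto simp: m_def)
 have near: "\<bar>x - y\<bar> \<le> 4 * N" if "x \<in> J" "y \<in> J" for x y
  using that J by auto
 have Apos: "0 < A"
 proof (rule ccontr)
  assume "\<not> 0 < A"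
  then have "A = 0" using A0 by simp
  then have "\<Lambda> G = 0" using A2 G0 h0[of x0] by simp
  then show False using mG[of b] B(2)[OF b] \<open>A = 0\<close> by simp
 qed
 have cA: "c * A \<le> A / 100" "c * c * A \<le> c * A / 100" "0 < c * A"
  using c Apos by (auto simp: mult_right_mono)
 have defect: "\<Lambda> (\<lambda>d u. \<bar>G d u - H d (u + x)\<bar>) \<le> 8 * c * A" if "x \<in> ?B" for x
 proof -
  have "\<Lambda> (\<lambda>d u. \<bar>G d u - H d (u + x)\<bar>) = \<Lambda> (\<lambda>d u. (G d u + H d (u + x)) - 2 * min (G d u) (H d (u + x)))"
   by (intro arg_cong[where f = \<Lambda>] ext) (simp add: min_def abs_if)
  also have "... = \<Lambda> G + h x - 2 * m x"
   using qmean_diff[OF Lam bddf_add[OF bG bHs[of x]] bddf_cmult[OF bddf_min[OF bG bHs[of x]], of 2]]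
    qmean_add[OF Lam bG bHs[of x]] qmean_cmult[OF Lam bddf_min[OF bG bHs[of x]], of 2]
   by (simp add: h_def m_def)
  finally have eq: "\<Lambda> (\<lambda>d u. \<bar>G d u - H d (u + x)\<bar>) = \<Lambda> G + h x - 2 * m x" .
  have hx: "h x \<le> (1 + c) * h x0" "(1 - c) * A < m x"
   using hsh near B[OF that] x0 by auto
  have "(1 - c) * A \<le> \<Lambda> G" using hx(2) mG[of x] by simp
  then have hx0: "h x0 \<le> (1 + c) * A" using A2 by (simp add: algebra_simps)
  have "(1 - c) * A \<le> (1 + c) * h x0" using hx mh[of x] by simp
  moreover have "(1 + c) * ((1 - 2 * c) * A) \<le> (1 - c) * A" using c A0 by (simp add: algebra_simps)
  ultimately have "(1 + c) * ((1 - 2 * c) * A) \<le> (1 + c) * h x0" by simp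
  then have "(1 - 2 * c) * A \<le> h x0" using c by simp
  then have w: "\<Lambda> G \<le> (1 + 2 * c) * A" using A2 by (simp add: algebra_simps)
  have "h x \<le> (1 + c) * ((1 + c) * A)" using hx(1) hx0 c by (smt (verit) mult_left_mono)
  then have 1: "h x \<le> A + A * (c * c) + 2 * (A * c)" by (simp add: algebra_simps)
  have 2: "\<Lambda> G \<le> A + 2 * (A * c)" "A - A * c < m x" using w hx(2) by (simp_all add: algebra_simps)
  have "c * c \<le> c * 1" using c by (intro mult_left_mono) auto
  then have 3: "A * (c * c) \<le> A * c" using A0 by (intro mult_left_mono) auto
  have 4: "8 * c * A = 8 * (A * c)" "0 < A * c" using c Apos by simp_all
  show ?thesis unfolding eq 4(1) using 1 2 3 4(2) by linarith
 qed
 define \<psi> where "\<psi> z = \<Lambda> (\<lambda>d u. \<bar>H d (u + b) - H d (u + b + z)\<bar>)" for z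
 have psib: "\<psi> (x - b) \<le> 16 * c * A" if "x \<in> ?B" for x
 proof -
  have "\<psi> (x - b) \<le> \<Lambda> (\<lambda>d u. \<bar>H d (u + b) - G d u\<bar>) + \<Lambda> (\<lambda>d u. \<bar>G d u - H d (u + x)\<bar>)"
   unfolding \<psi>_def using qmean_abs_triangle[OF Lam bHs[of b] bG bHs[of x]] by simp
  also have "(\<lambda>d u. \<bar>H d (u + b) - G d u\<bar>) = (\<lambda>d u. \<bar>G d u - H d (u + b)\<bar>)"
   by (simp add: abs_minus_commute)
  finally show ?thesis using defect[OF that] defect[OF b] by simp
 qed
 have bpsi: "bddf (\<lambda>d u. \<bar>H d (u + b) - H d (u + b + z)\<bar>)" for z
  using bHs[of b] bHs[of "b + z"] by (auto simp: add.assoc)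
 have psitri: "\<bar>\<psi> (z + \<beta>) - \<psi> z\<bar> \<le> (1 + c) * \<psi> \<beta>" if "\<bar>z\<bar> \<le> 4 * N" for z \<beta>
 proof -
  have sh: "\<Lambda> (\<lambda>d u. \<bar>H d (u + b + z) - H d (u + b + (z + \<beta>))\<bar>) \<le> (1 + c) * \<psi> \<beta>"
   unfolding \<psi>_def using qmean_shift[OF Lam bpsi[of \<beta>] _ that] by (simp add: algebra_simps)
  have b3: "bddf (\<lambda>d u. H d (u + b))" "bddf (\<lambda>d u. H d (u + b + z))" "bddf (\<lambda>d u. H d (u + b + (z + \<beta>)))"
   using bHs[of b] bHs[of "b + z"] bHs[of "b + (z + \<beta>)"] by (simp_all add: algebra_simps)
  have "\<psi> (z + \<beta>) \<le> \<psi> z + (1 + c) * \<psi> \<beta>"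
   using qmean_abs_triangle[OF Lam b3(1,2,3)] sh unfolding \<psi>_def by simp
  moreover have "\<psi> z \<le> \<psi> (z + \<beta>) + (1 + c) * \<psi> \<beta>"
   using qmean_abs_triangle[OF Lam b3(1,3,2)] sh unfolding \<psi>_def by (simp add: abs_minus_commute)
  ultimately show ?thesis by simp
 qed
 have psi1: "(1 + c) * \<psi> 1 \<le> c * A"
 proof -
  have "\<psi> 1 \<le> \<Lambda> (\<lambda>_ _. c * \<phi> / 2)"
   unfolding \<psi>_def
  proof (rule qmean_mono[OF Lam bpsi])
   show "\<bar>H d (u + b) - H d (u + b + 1)\<bar> \<le> c * \<phi> / 2" for d u
    using Lip[of d "u + b"] by (simp add: abs_minus_commute)
  qed simp
  also have "... \<le> c * \<phi> / 2 * \<Omega>" using qmean_const_le[OF Lam, of "c * \<phi> / 2"] c \<phi> by simp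
  also have "... \<le> c * A / 2" using AO c by (simp add: mult.assoc)
  finally have p: "\<psi> 1 \<le> c * A / 2" .
  have "(1 + c) * \<psi> 1 \<le> 2 * (c * A / 2)"
   using p c Apos by (intro mult_mono) (auto simp: \<psi>_def intro!: qmean_nonneg[OF Lam bpsi])
  then show ?thesis by simp
 qed
 have psi0: "\<psi> 0 = 0"
  unfolding \<psi>_def using qmean_cmult[OF Lam bddf_const[of 0], of 0] by simp
 have "\<exists>z\<in>{0..N}. A / 4 \<le> \<psi> z"
 proof (rule ccontr)
  assume "\<not> ?thesis"
  then have less: "\<psi> z < A / 4" if "z \<in> {0..N}" for z using that by (auto simp: not_le)
  have cz: "real (card {0..N}) = real_of_int N + 1" using N by simp
  let ?F = "\<lambda>z d u. H d (u + b) - H d (u + b) * (if 0 < H d (u + b + z) then 1 else 0)"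
  have bF: "bddf (?F z)" for z
   by (rule bddf_01) (use H in \<open>auto simp: mult_le_one\<close>)
  have "h b * ((real_of_int N + 1) / 2) \<le> \<Lambda> (\<lambda>d u. \<Sum>z\<in>{0..N}. ?F z d u)"
  proof -
   have "h b * ((real_of_int N + 1) / 2) = \<Lambda> (\<lambda>d u. ((real_of_int N + 1) / 2) * H d (u + b))"
    unfolding h_def by (subst qmean_cmult[OF Lam bHs]) simp
   also have "... \<le> \<Lambda> (\<lambda>d u. \<Sum>z\<in>{0..N}. ?F z d u)"
   proof (rule qmean_mono[OF Lam])
    fix d u
    have "(\<Sum>z\<in>{0..N}. ?F z d u) = H d (u + b) * (real_of_int N + 1) - H d (u + b) * real (card {z\<in>{0..N}. 0 < H d (u + b + z)})"
    proof -
     have "(\<Sum>z\<in>{0..N}. (if 0 < H d (u + b + z) then 1 else 0::real)) = real (card {z\<in>{0..N}. 0 < H d (u + b + z)})"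
      by (simp add: sum.If_cases Int_def)
     then show ?thesis using cz by (simp add: sum_subtractf flip: sum_distrib_left)
    qed
    moreover have "2 * real (card {z\<in>{0..N}. 0 < H d (u + b + z)}) \<le> real_of_int N + 1"
     using sparse[of d "u + b"] by linarith
    then have "H d (u + b) * (2 * real (card {z\<in>{0..N}. 0 < H d (u + b + z)})) \<le> H d (u + b) * (real_of_int N + 1)"
     by (rule mult_left_mono) (rule H)
    ultimately show "(real_of_int N + 1) / 2 * H d (u + b) \<le> (\<Sum>z\<in>{0..N}. ?F z d u)"
     by (simp add: algebra_simps)
   next
    show "bddf (\<lambda>d u. \<Sum>z\<in>{0..N}. ?F z d u)" using bF by (rule bddf_sum)
    show "bddf (\<lambda>d u. (real_of_int N + 1) / 2 * H d (u + b))" using bHs by (rule bddf_cmult)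
   qed
   finally show ?thesis .
  qed
  also have "... = (\<Sum>z\<in>{0..N}. \<Lambda> (?F z))"
   using qmean_sum[OF Lam, of "{0..N}" ?F] bF by simp
  also have "... \<le> (\<Sum>z\<in>{0..N}. \<psi> z)"
  proof (rule sum_mono)
   fix z
   show "\<Lambda> (?F z) \<le> \<psi> z"
    unfolding \<psi>_def
   proof (rule qmean_mono[OF Lam bF bpsi])
    fix d u
    show "?F z d u \<le> \<bar>H d (u + b) - H d (u + b + z)\<bar>"
     using H(1)[of d "u + b"] H(1)[of d "u + b + z"] by (auto simp: not_less)
   qed
  qed
  also have "... \<le> (\<Sum>z\<in>{0..N}. A / 4)" using less by (intro sum_mono) (simp add: less_imp_le)
  also have "... = (real_of_int N + 1) * (A / 4)" using N by simp
  finally have "(real_of_int N + 1) * (h b / 2) \<le> (real_of_int N + 1) * (A / 4)" by (simp add: algebra_simps)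
  then have "h b / 2 \<le> A / 4" using N by (smt (verit) mult_le_cancel_left_pos of_int_1_le_iff)
  moreover have "(1 - c) * A < h b" using B(2)[OF b] mh[of b] by simp
  moreover have "(1 - c) * A = A - c * A" by (simp add: algebra_simps)
  ultimately show False using cA(1) Apos by linarith
 qed
 then obtain z1 where z1: "0 \<le> z1" "z1 \<le> N" "A / 4 \<le> \<psi> z1" by auto
 have level: "\<exists>z\<in>{0..N}. y \<le> \<psi> z \<and> \<psi> z \<le> y + c * A" if "0 \<le> y" "y \<le> A / 4" for y
 proof -
  have "\<exists>i\<le>nat z1. y \<le> \<psi> (int i) \<and> \<psi> (int i) \<le> y + c * A"
  proof (rule discrete_ivt)
   show "\<psi> (int (Suc i)) \<le> \<psi> (int i) + c * A" if "i < nat z1" for i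
   proof -
    have "\<bar>int i\<bar> \<le> 4 * N" using that z1 N by linarith
    from psitri[OF this, of 1] psi1 show ?thesis by (simp add: add.commute)
   qed
  qed (use that z1 psi0 cA in auto)
  then obtain i where "i \<le> nat z1" "y \<le> \<psi> (int i)" "\<psi> (int i) \<le> y + c * A" by blast
  then show ?thesis using z1 by (intro bexI[of _ "int i"]) auto
 qed
 define K where "K = nat \<lfloor>1 / (200 * c)\<rfloor> + 1"
 have Kge: "1 / (200 * c) \<le> real K" unfolding K_def using c by linarith
 have kle: "50 * c * real k * A \<le> A / 4" if "k < K" for k
 proof -
  have "real k \<le> 1 / (200 * c)" using that c unfolding K_def
   by (smt (verit, ccfv_threshold) Suc_eq_plus1 divide_pos_pos less_Suc_eq_le of_nat_floor of_nat_le_iff zero_le_floor nat_floor_neg of_nat_nat of_int_floor_le of_int_of_nat_eq)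
  then have "50 * c * real k \<le> 1 / 4" using c by (simp add: field_simps)
  then have "50 * c * real k * A \<le> 1 / 4 * A" using A0 by (rule mult_right_mono)
  then show ?thesis by simp
 qed
 have "\<forall>k<K. \<exists>z\<in>{0..N}. 50 * c * real k * A \<le> \<psi> z \<and> \<psi> z \<le> 50 * c * real k * A + c * A"
  using level kle c A0 by auto
 then obtain z where z: "\<And>k. k < K \<Longrightarrow> z k \<in> {0..N} \<and> 50 * c * real k * A \<le> \<psi> (z k) \<and> \<psi> (z k) \<le> 50 * c * real k * A + c * A"
  by metis
 define T where "T k = (\<lambda>x. z k + (x - b)) ` ?B" for k
 have finB: "finite ?B" by (rule finite_subset[of _ J]) (use J in auto)
 have annulus: "50 * c * real k * A - 20 * c * A \<le> \<psi> t \<and> \<psi> t \<le> 50 * c * real k * A + 21 * c * A"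
  if k: "k < K" and t: "t \<in> T k" for k t
 proof -
  from t obtain x where x: "x \<in> ?B" "t = z k + (x - b)" unfolding T_def by blast
  have "\<bar>\<psi> t - \<psi> (z k)\<bar> \<le> (1 + c) * \<psi> (x - b)" unfolding x(2) using z[OF k] N by (intro psitri) auto
  also have "... \<le> (1 + c) * (16 * c * A)" using psib[OF x(1)] c by (intro mult_left_mono) auto
  also have "... \<le> (5 / 4) * (16 * c * A)" using c Apos by (intro mult_right_mono) auto
  also have "... = 20 * c * A" by simp
  finally show ?thesis using z[OF k] by (auto simp: abs_le_iff)
 qed
 have disj: "T k \<inter> T l = {}" if "k < l" "l < K" for k l
 proof (rule ccontr)
  assume "T k \<inter> T l \<noteq> {}"
  then obtain t where "t \<in> T k" "t \<in> T l" by blast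
  then have "50 * c * real l * A - 20 * c * A \<le> 50 * c * real k * A + 21 * c * A"
   using annulus[of k t] annulus[of l t] that by linarith
  moreover have "(c * A) * (real k + 1) \<le> (c * A) * real l" using that cA by (intro mult_left_mono) auto
  ultimately show False using cA by (simp add: algebra_simps)
 qed
 have disj': "\<forall>k\<in>{..<K}. \<forall>l\<in>{..<K}. k \<noteq> l \<longrightarrow> T k \<inter> T l = {}"
  using disj by (metis Int_commute lessThan_iff linorder_neqE_nat)
 have finT: "finite (T k)" for k unfolding T_def using finB by simp
 have "K * card ?B = (\<Sum>k<K. card (T k))"
  unfolding T_def by (subst card_image) (auto simp: inj_on_def)
 also have "... = card (\<Union>k<K. T k)"
  using disj' finT by (intro card_UN_disjoint[symmetric]) auto
 also have "... \<le> card {- 2 * N..3 * N}"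
 proof (rule card_mono)
  show "(\<Union>k<K. T k) \<subseteq> {- 2 * N..3 * N}"
  proof
   fix t assume "t \<in> (\<Union>k<K. T k)"
   then obtain k x where "k < K" "x \<in> ?B" "t = z k + (x - b)" unfolding T_def by blast
   then show "t \<in> {- 2 * N..3 * N}" using z[of k] B(1)[of x] B(1)[OF b] J by auto
  qed
 qed simp
 also have "... \<le> nat (6 * N)" using N by simp
 finally have "real (K * card ?B) \<le> real (nat (6 * N))" by (rule of_nat_mono)
 then have KB: "real K * real (card ?B) \<le> 6 * real_of_int N" using N by simp
 have "1 / (200 * c) * real (card ?B) \<le> 6 * real_of_int N"
  by (rule order_trans[OF mult_right_mono[OF Kge] KB]) simp
 then have "real (card ?B) \<le> 1200 * c * real_of_int N" using c by (simp add: field_simps)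
 also have "... \<le> 1200 * c * real (card J)" using J N c by (intro mult_left_mono) auto
 finally show ?thesis .
qed

section \<open>Cubes in sparse slowly varying functions\<close>

subsection \<open>The two-sided geometric mean\<close>

lemma two_sided_geometric_sum:
 fixes q :: real
 assumes q: "0 < q" "q < 1" and F: "finite F"
 shows "(\<Sum>u\<in>F. q ^ nat \<bar>u - x\<bar>) \<le> 2 / (1 - q)"
proof -
 have half: "(\<Sum>u\<in>T. q ^ nat \<bar>u - x\<bar>) \<le> 1 / (1 - q)"
  if "finite T" "inj_on (\<lambda>u. nat \<bar>u - x\<bar>) T" for T
 proof -
  have "(\<Sum>u\<in>T. q ^ nat \<bar>u - x\<bar>) = (\<Sum>n\<in>(\<lambda>u. nat \<bar>u - x\<bar>) ` T. q ^ n)"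
   using that(2) by (simp add: sum.reindex)
  also have "... \<le> (\<Sum>n. q ^ n)"
   using q that(1) by (intro sum_le_suminf summable_geometric) auto
  also have "... = 1 / (1 - q)" using q by (simp add: suminf_geometric)
  finally show ?thesis .
 qed
 have "F = {u\<in>F. x \<le> u} \<union> {u\<in>F. u < x}" by auto
 then have "(\<Sum>u\<in>F. q ^ nat \<bar>u - x\<bar>)
   = (\<Sum>u\<in>{u\<in>F. x \<le> u}. q ^ nat \<bar>u - x\<bar>) + (\<Sum>u\<in>{u\<in>F. u < x}. q ^ nat \<bar>u - x\<bar>)"
  using F by (metis (no_types, lifting) disjoint_iff finite_Un leD mem_Collect_eq sum.union_disjoint)
 moreover have "(\<Sum>u\<in>{u\<in>F. x \<le> u}. q ^ nat \<bar>u - x\<bar>) \<le> 1 / (1 - q)"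
  by (rule half) (use F in \<open>auto simp: inj_on_def\<close>)
 moreover have "(\<Sum>u\<in>{u\<in>F. u < x}. q ^ nat \<bar>u - x\<bar>) \<le> 1 / (1 - q)"
  by (rule half) (use F in \<open>auto simp: inj_on_def\<close>)
 ultimately show ?thesis by (simp add: add_divide_distrib[symmetric])
qed

lemma two_sided_geometric_summable:
 fixes q :: real
 assumes q: "0 < q" "q < 1"
 shows "(\<lambda>u::int. q ^ nat \<bar>u - x\<bar>) summable_on UNIV"
 by (rule nonneg_bounded_partial_sums_imp_summable_on[where C = "2 / (1 - q)"])
   (use q two_sided_geometric_sum[OF q] in \<open>auto simp: eventually_finite_subsets_at_top intro!: exI[of _ "{}"]\<close>)

text \<open>
 Sums with weights decaying on the scale \<open>1 / (1 - q)\<close> around \<open>x\<close>, applied to the first layer of \<open>F\<close>. A uniform mean over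
 an interval would not be almost invariant at the ends of the interval.
\<close>

definition geo :: "real \<Rightarrow> int \<Rightarrow> (nat \<Rightarrow> int \<Rightarrow> real) \<Rightarrow> real" where
 "geo q x F = (\<Sum>\<^sub>\<infinity>u. q ^ nat \<bar>u - x\<bar> * F 1 u)"

lemma geo_summable:
 fixes q :: real
 assumes q: "0 < q" "q < 1" and "bddf F"
 shows "(\<lambda>u::int. q ^ nat \<bar>u - x\<bar> * F 1 u) summable_on UNIV"
proof -
 obtain C where C: "\<And>d u. \<bar>F d u\<bar> \<le> C" using assms(3) unfolding bddf_def by blast
 have "(\<lambda>u::int. C * q ^ nat \<bar>u - x\<bar>) summable_on UNIV"
  by (intro summable_on_cmult_right two_sided_geometric_summable q)
 then have "(\<lambda>u::int. norm (q ^ nat \<bar>u - x\<bar> * F 1 u)) summable_on UNIV"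
 proof (rule Infinite_Sum.abs_summable_on_comparison_test')
  fix u :: int
  show "norm (q ^ nat \<bar>u - x\<bar> * F 1 u) \<le> C * q ^ nat \<bar>u - x\<bar>"
   using C[of 1 u] q by (simp add: abs_mult mult.commute mult_right_mono)
 qed
 then show ?thesis by (rule abs_summable_summable)
qed

lemma qmean_geo:
 fixes q s :: real
 assumes q: "0 < q" "q < 1" and \<sigma>: "1 \<le> \<sigma> * q ^ nat r" "0 \<le> r"
 shows "qmean (geo q x) (2 / (1 - q)) \<sigma> r"
 unfolding qmean_def
proof (intro conjI allI impI)
 fix F G assume "bddf F" "bddf G"
 then show "geo q x (\<lambda>d u. F d u + G d u) = geo q x F + geo q x G"
  unfolding geo_def using geo_summable[OF q] by (simp add: distrib_left infsum_add)
next
 fix c F assume "bddf F"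
 show "geo q x (\<lambda>d u. c * F d u) = c * geo q x F"
  unfolding geo_def by (simp add: mult.left_commute flip: infsum_cmult_right')
next
 fix F assume "bddf F" "\<forall>d u. (0::real) \<le> F d u"
 then show "0 \<le> geo q x F" unfolding geo_def using q by (intro infsum_nonneg) auto
next
 show "geo q x (\<lambda>_ _. 1) \<le> 2 / (1 - q)"
  unfolding geo_def using two_sided_geometric_summable[OF q, of x] two_sided_geometric_sum[OF q, of _ x]
  by (simp add: infsum_le_finite_sums)
next
 fix F z assume F: "bddf F" "\<forall>d u. (0::real) \<le> F d u" and z: "\<bar>z\<bar> \<le> r"
 have bF: "bddf (\<lambda>d u. F d (u + z))" using F(1) by (rule bddf_shift')
 have s0: "0 \<le> \<sigma>"
 proof (rule ccontr)
  assume "\<not> 0 \<le> \<sigma>"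
  then have "\<sigma> * q ^ nat r \<le> 0" using q by (simp add: mult_nonpos_nonneg)
  then show False using \<sigma> by simp
 qed
 have "geo q x (\<lambda>d u. F d (u + z)) = (\<Sum>\<^sub>\<infinity>u. q ^ nat \<bar>u - z - x\<bar> * F 1 u)"
  unfolding geo_def
  by (rule infsum_reindex_bij_witness[where i = "\<lambda>u. u - z" and j = "\<lambda>u. u + z"]) auto
 also have "... \<le> (\<Sum>\<^sub>\<infinity>u. \<sigma> * (q ^ nat \<bar>u - x\<bar> * F 1 u))"
 proof (rule infsum_mono)
  show "(\<lambda>u. q ^ nat \<bar>u - z - x\<bar> * F 1 u) summable_on UNIV"
   using geo_summable[OF q F(1), of "z + x"] by (simp add: algebra_simps)
  show "(\<lambda>u. \<sigma> * (q ^ nat \<bar>u - x\<bar> * F 1 u)) summable_on UNIV"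
   by (intro summable_on_cmult_right geo_summable q F)
  fix u :: int
  have "q ^ (nat \<bar>u - z - x\<bar> + nat r) \<le> q ^ nat \<bar>u - x\<bar>"
   using q z \<sigma>(2) by (intro power_decreasing) auto
  then have "q ^ nat \<bar>u - z - x\<bar> * q ^ nat r \<le> q ^ nat \<bar>u - x\<bar>" by (simp add: power_add)
  then have "\<sigma> * (q ^ nat \<bar>u - z - x\<bar> * q ^ nat r) \<le> \<sigma> * q ^ nat \<bar>u - x\<bar>"
   using s0 by (rule mult_left_mono)
  moreover have "q ^ nat \<bar>u - z - x\<bar> * 1 \<le> q ^ nat \<bar>u - z - x\<bar> * (\<sigma> * q ^ nat r)"
   using \<sigma> q by (intro mult_left_mono) auto
  ultimately have "q ^ nat \<bar>u - z - x\<bar> \<le> \<sigma> * q ^ nat \<bar>u - x\<bar>" by (simp add: algebra_simps)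
  then show "q ^ nat \<bar>u - z - x\<bar> * F 1 u \<le> \<sigma> * (q ^ nat \<bar>u - x\<bar> * F 1 u)"
   using mult_right_mono[of "q ^ nat \<bar>u - z - x\<bar>" "\<sigma> * q ^ nat \<bar>u - x\<bar>" "F 1 u"] F(2) by (simp add: mult.assoc)
 qed
 also have "... = \<sigma> * geo q x F" unfolding geo_def by (simp add: infsum_cmult_right')
 finally show "geo q x (\<lambda>d u. F d (u + z)) \<le> \<sigma> * geo q x F" .
qed

lemma sum_le_geo:
 fixes q :: real
 assumes q: "0 < q" "q < 1" and F: "bddf F" "\<And>d u. 0 \<le> F d u" and T: "finite T"
  and near: "\<And>u. u \<in> T \<Longrightarrow> 1 / 2 \<le> q ^ nat \<bar>u - x\<bar>"
 shows "(\<Sum>u\<in>T. F 1 u) \<le> 2 * geo q x F"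
proof -
 have "(\<Sum>u\<in>T. 1 / 2 * F 1 u) \<le> (\<Sum>u\<in>T. q ^ nat \<bar>u - x\<bar> * F 1 u)"
  using near F(2) by (intro sum_mono mult_right_mono) auto
 also have "... \<le> geo q x F"
  unfolding geo_def using q F T by (intro finite_sum_le_infsum geo_summable) auto
 finally have "1 / 2 * (\<Sum>u\<in>T. F 1 u) \<le> geo q x F" by (simp only: sum_distrib_left)
 then show ?thesis by simp
qed

subsection \<open>Thinning by cubes and the potential\<close>

text \<open>
 \<open>thin G xs d u\<close> is the minimum of \<open>G (d + \<bar>I\<bar>) (u + \<Sum>I)\<close> over all subfamilies \<open>I\<close> of \<open>xs\<close>, that is, over the cube with sides \<open>xs\<close>
 at \<open>u\<close>; it is organised as a recursion that adds one side at a time.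
\<close>

fun thin :: "(nat \<Rightarrow> int \<Rightarrow> real) \<Rightarrow> int list \<Rightarrow> nat \<Rightarrow> int \<Rightarrow> real" where
 "thin G [] = G"
| "thin G (x # xs) = thin (\<lambda>d u. min (G d u) (G (Suc d) (u + x))) xs"

lemma thin_snoc: "thin G (xs @ [x]) = (\<lambda>d u. min (thin G xs d u) (thin G xs (Suc d) (u + x)))"
 by (induction xs arbitrary: G) auto

lemma thin_bounds:
 assumes "\<And>d u. 0 \<le> G d u" "\<And>d u. G d u \<le> 1"
 shows "0 \<le> thin G xs d u" "thin G xs d u \<le> 1" "thin G xs d u \<le> G d u"
proof -
 have "0 \<le> thin G xs d u \<and> thin G xs d u \<le> 1 \<and> thin G xs d u \<le> G d u"
  using assms
 proof (induction xs arbitrary: G)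
  case (Cons x xs)
  let ?G = "\<lambda>d u. min (G d u) (G (Suc d) (u + x))"
  have "0 \<le> ?G d u" "?G d u \<le> 1" for d u
   using Cons.prems(1)[of d u] Cons.prems(1)[of "Suc d" "u + x"] Cons.prems(2)[of d u] by auto
  then show ?case using Cons.IH[of ?G] by simp
 qed simp
 then show "0 \<le> thin G xs d u" "thin G xs d u \<le> 1" "thin G xs d u \<le> G d u" by auto
qed

lemma thin_lipschitz:
 assumes "\<And>d u. \<bar>G d (u + 1) - G d u\<bar> \<le> e"
 shows "\<bar>thin G xs d (u + 1) - thin G xs d u\<bar> \<le> e"
 using assms
proof (induction xs arbitrary: G d u)
 case (Cons x xs)
 let ?G = "\<lambda>d u. min (G d u) (G (Suc d) (u + x))"
 have "\<bar>?G d (u + 1) - ?G d u\<bar> \<le> e" for d u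
  using Cons.prems[of d u] Cons.prems[of "Suc d" "u + x"] by (simp add: min_def abs_if algebra_simps split: if_splits)
 then show ?case using Cons.IH[of ?G] by simp
qed auto

lemma thin_cube:
 assumes "distinct is" and "\<And>I. I \<subseteq> set is \<Longrightarrow> a \<le> G (d + card I) (u + (\<Sum>i\<in>I. Z i))"
 shows "a \<le> thin G (map Z is) d u"
 using assms
proof (induction "is" arbitrary: G d u)
 case Nil
 then show ?case using Nil(2)[of "{}"] by simp
next
 case (Cons i "is")
 let ?G = "\<lambda>d u. min (G d u) (G (Suc d) (u + Z i))"
 have "a \<le> ?G (d + card I) (u + (\<Sum>i\<in>I. Z i))" if I: "I \<subseteq> set is" for I
 proof -
  have fin: "finite I" "i \<notin> I" using I Cons.prems(1) finite_subset by auto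
  have "a \<le> G (d + card I) (u + (\<Sum>i\<in>I. Z i))"
   using I by (intro Cons.prems(2)) auto
  moreover have "a \<le> G (d + card (insert i I)) (u + (\<Sum>i\<in>insert i I. Z i))"
   using I by (intro Cons.prems(2)) auto
  ultimately show ?thesis using fin by (simp add: algebra_simps)
 qed
 then show ?case using Cons.IH[of ?G d u] Cons.prems(1) by simp
qed

text \<open>
 The same operation with the minimum replaced by the arithmetic mean, for sides that have not been revealed yet.
\<close>

fun pot :: "((nat \<Rightarrow> int \<Rightarrow> real) \<Rightarrow> real) \<Rightarrow> int list \<Rightarrow> (nat \<Rightarrow> int \<Rightarrow> real) \<Rightarrow> real" where
 "pot \<Lambda> [] G = \<Lambda> G"
| "pot \<Lambda> (x # xs) G = (pot \<Lambda> xs G + pot \<Lambda> xs (\<lambda>d u. G (Suc d) (u + x))) / 2"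

lemma qmean_pot:
 assumes "qmean \<Lambda> \<Omega> \<sigma> r"
 shows "qmean (pot \<Lambda> xs) \<Omega> \<sigma> r"
proof (induction xs)
 case Nil
 have "pot \<Lambda> [] = \<Lambda>" by (rule ext) simp
 then show ?case using assms by simp
next
 case (Cons x xs)
 note Q = Cons.IH
 have b: "bddf (\<lambda>d u. F (Suc d) (u + x))" if "bddf F" for F using that by (rule bddf_shift)
 show ?case unfolding qmean_def
 proof (intro conjI allI impI)
  fix F G assume "bddf F" "bddf G"
  then show "pot \<Lambda> (x # xs) (\<lambda>d u. F d u + G d u) = pot \<Lambda> (x # xs) F + pot \<Lambda> (x # xs) G"
   using qmean_add[OF Q, of F G] qmean_add[OF Q b[of F] b[of G]] by (simp add: add_divide_distrib[symmetric])
 next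
  fix c F assume "bddf F"
  then show "pot \<Lambda> (x # xs) (\<lambda>d u. c * F d u) = c * pot \<Lambda> (x # xs) F"
   using qmean_cmult[OF Q, of F c] qmean_cmult[OF Q b[of F], of c] by (simp add: algebra_simps)
 next
  fix F assume "bddf F" "\<forall>d u. (0::real) \<le> F d u"
  then show "0 \<le> pot \<Lambda> (x # xs) F"
   using qmean_nonneg[OF Q, of F] qmean_nonneg[OF Q b[of F]] by simp
 next
  show "pot \<Lambda> (x # xs) (\<lambda>_ _. 1) \<le> \<Omega>" using qmean_total[OF Q] by simp
 next
  fix F z assume F: "bddf F" "\<forall>d u. (0::real) \<le> F d u" and z: "\<bar>z\<bar> \<le> r"
  have "pot \<Lambda> xs (\<lambda>d u. F d (u + z)) \<le> \<sigma> * pot \<Lambda> xs F"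
   using qmean_shift[OF Q F(1) _ z] F(2) by simp
  moreover have "pot \<Lambda> xs (\<lambda>d u. F (Suc d) (u + z + x)) \<le> \<sigma> * pot \<Lambda> xs (\<lambda>d u. F (Suc d) (u + x))"
   using qmean_shift[OF Q b[OF F(1)] _ z] F(2) by (simp add: algebra_simps)
  ultimately show "pot \<Lambda> (x # xs) (\<lambda>d u. F d (u + z)) \<le> \<sigma> * pot \<Lambda> (x # xs) F"
   by (simp add: algebra_simps)
 qed
qed

lemma qmean_weaken:
 assumes "qmean \<Lambda> \<Omega> \<sigma> r" "\<sigma> \<le> \<sigma>'"
 shows "qmean \<Lambda> \<Omega> \<sigma>' r"
 unfolding qmean_def
proof (intro conjI allI impI)
 fix F z assume F: "bddf F" "\<forall>d u. (0::real) \<le> F d u" and z: "\<bar>z\<bar> \<le> r"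
 have "\<sigma> * \<Lambda> F \<le> \<sigma>' * \<Lambda> F" using assms(2) qmean_nonneg[OF assms(1) F(1)] F(2) by (intro mult_right_mono) auto
 then show "\<Lambda> (\<lambda>d u. F d (u + z)) \<le> \<sigma>' * \<Lambda> F" using qmean_shift[OF assms(1) F(1) _ z] F(2) by fastforce
qed (use assms(1) in \<open>auto simp: qmean_def\<close>)

text \<open>
 The potential after \<open>k\<close> sides have been revealed: these are used for thinning, the remaining ones are
 replaced by reference points \<open>x0\<close> and averaged. Passing from \<open>k\<close> to \<open>k + 1\<close> turns one mean into a minimum.
\<close>

definition stage where
 "stage \<Lambda> x0 is G Z k = pot \<Lambda> (map x0 (drop k is)) (thin G (map Z (take k is)))"

text \<open>
 A step at which the potential is still above its floor but does not lose the factor \<open>1 - c\<close>.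
\<close>

definition stuck where
 "stuck \<Lambda> x0 is G \<phi> \<Omega> c k Z \<longleftrightarrow>
   \<phi> * \<Omega> \<le> stage \<Lambda> x0 is G Z k \<and>
   (1 - c) * stage \<Lambda> x0 is G Z k < stage \<Lambda> x0 is G Z (Suc k)"

lemma stage_expand:
 fixes G :: "nat \<Rightarrow> int \<Rightarrow> real" and Z x0 :: "nat \<Rightarrow> int"
 assumes "k < length is"
 defines "T \<equiv> thin G (map Z (take k is))" and "ss \<equiv> map x0 (drop (Suc k) is)" and "i \<equiv> is ! k"
 shows "stage \<Lambda> x0 is G Z k = (pot \<Lambda> ss T + pot \<Lambda> ss (\<lambda>d u. T (Suc d) (u + x0 i))) / 2"
  and "stage \<Lambda> x0 is G Z (Suc k) = pot \<Lambda> ss (\<lambda>d u. min (T d u) (T (Suc d) (u + Z i)))"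
proof -
 have "drop k is = i # drop (Suc k) is" unfolding i_def using assms(1) by (simp add: Cons_nth_drop_Suc)
 then show "stage \<Lambda> x0 is G Z k = (pot \<Lambda> ss T + pot \<Lambda> ss (\<lambda>d u. T (Suc d) (u + x0 i))) / 2"
  by (simp add: stage_def T_def ss_def)
 have "take (Suc k) is = take k is @ [i]" unfolding i_def using assms(1) by (simp add: take_Suc_conv_app_nth)
 then show "stage \<Lambda> x0 is G Z (Suc k) = pot \<Lambda> ss (\<lambda>d u. min (T d u) (T (Suc d) (u + Z i)))"
  by (simp add: stage_def T_def ss_def thin_snoc)
qed

lemma stage_step:
 fixes Z x0 :: "nat \<Rightarrow> int"
 assumes Lam: "qmean \<Lambda> \<Omega> (1 + e) (4 * N)" and e: "0 \<le> e"
  and G: "\<And>d u. 0 \<le> G d u" "\<And>d u. G d u \<le> 1"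
  and k: "k < length is" and near: "\<bar>Z (is ! k) - x0 (is ! k)\<bar> \<le> 4 * N"
 shows "stage \<Lambda> x0 is G Z (Suc k) \<le> (1 + e) * stage \<Lambda> x0 is G Z k"
proof -
 define T where "T = thin G (map Z (take k is))"
 define i where "i = is ! k"
 define M where "M = pot \<Lambda> (map x0 (drop (Suc k) is))"
 have Q: "qmean M \<Omega> (1 + e) (4 * N)" unfolding M_def by (rule qmean_pot[OF Lam])
 have T: "0 \<le> T d u" "T d u \<le> 1" for d u unfolding T_def using thin_bounds[of G] G by auto
 have bT: "bddf T" using T by (rule bddf_01)
 have bTs: "bddf (\<lambda>d u. T (Suc d) (u + x))" for x by (rule bddf_01) (use T in auto)
 have e1: "stage \<Lambda> x0 is G Z k = (M T + M (\<lambda>d u. T (Suc d) (u + x0 i))) / 2"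
  and e2: "stage \<Lambda> x0 is G Z (Suc k) = M (\<lambda>d u. min (T d u) (T (Suc d) (u + Z i)))"
  using stage_expand[OF k, of \<Lambda> x0 G Z] unfolding M_def[symmetric] T_def[symmetric] i_def[symmetric] .
 let ?m = "stage \<Lambda> x0 is G Z (Suc k)"
 have 1: "?m \<le> M T"
  unfolding e2 by (rule qmean_mono[OF Q bddf_min[OF bT bTs] bT]) simp
 have "?m \<le> M (\<lambda>d u. T (Suc d) (u + Z i))"
  unfolding e2 by (rule qmean_mono[OF Q bddf_min[OF bT bTs] bTs]) simp
 also have "... \<le> (1 + e) * M (\<lambda>d u. T (Suc d) (u + x0 i))"
  using qmean_shift[OF Q bTs[of "x0 i"], of "Z i - x0 i"] T near unfolding i_def by (simp add: algebra_simps)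
 finally have 2: "?m \<le> (1 + e) * M (\<lambda>d u. T (Suc d) (u + x0 i))" .
 have "0 \<le> M T" using qmean_nonneg[OF Q bT] T by simp
 then have "?m \<le> (1 + e) * M T" using 1 e mult_right_mono[of 1 "1 + e" "M T"] by simp
 with 2 have "2 * ?m \<le> (1 + e) * (M T + M (\<lambda>d u. T (Suc d) (u + x0 i)))" by (simp add: algebra_simps)
 then show ?thesis unfolding e1 by simp
qed

text \<open>
 Every step costs at most a factor \<open>1 + e\<close>, and a step that is not stuck gains \<open>1 - c\<close> until the floor is reached.
\<close>

lemma stage_decay:
 fixes Z x0 :: "nat \<Rightarrow> int"
 assumes Lam: "qmean \<Lambda> \<Omega> (1 + e) (4 * N)" and e: "0 \<le> e" and c: "0 < c" "c < 1" and \<phi>: "0 < \<phi>"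
  and \<Omega>: "0 \<le> \<Omega>"
  and G: "\<And>d u. 0 \<le> G d u" "\<And>d u. G d u \<le> 1"
  and near: "\<And>i. i \<in> set is \<Longrightarrow> \<bar>Z i - x0 i\<bar> \<le> 4 * N"
  and k: "k \<le> length is"
 shows "stage \<Lambda> x0 is G Z k \<le>
  (1 + e) ^ k * (max \<phi> ((1 - c) ^ card {l. l < k \<and> \<not> stuck \<Lambda> x0 is G \<phi> \<Omega> c l Z}) * \<Omega>)"
 using k
proof (induction k)
 case 0
 have "stage \<Lambda> x0 is G Z 0 \<le> pot \<Lambda> (map x0 is) (\<lambda>_ _. 1)"
  unfolding stage_def using G by (auto intro!: qmean_mono[OF qmean_pot[OF Lam]] bddf_01)
 also have "... \<le> \<Omega>" by (rule qmean_total[OF qmean_pot[OF Lam]])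
 also have "... \<le> max \<phi> 1 * \<Omega>" using \<Omega> mult_right_mono[of 1 "max \<phi> 1" \<Omega>] by simp
 finally show ?case by simp
next
 case (Suc k)
 let ?P = "stage \<Lambda> x0 is G Z"
 let ?S = "\<lambda>k. {l. l < k \<and> \<not> stuck \<Lambda> x0 is G \<phi> \<Omega> c l Z}"
 let ?B = "\<lambda>k. max \<phi> ((1 - c) ^ card (?S k)) * \<Omega>"
 have IH: "?P k \<le> (1 + e) ^ k * ?B k" using Suc by simp
 have step: "?P (Suc k) \<le> (1 + e) * ?P k"
  using Suc.prems near by (intro stage_step[OF Lam e G]) auto
 have ek: "1 \<le> (1 + e) ^ k" "1 \<le> (1 + e) ^ Suc k" using e one_le_power[of "1 + e" k] one_le_power[of "1 + e" "Suc k"] by auto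
 show ?case
 proof (cases "stuck \<Lambda> x0 is G \<phi> \<Omega> c k Z")
  case True
  then have "?S (Suc k) = ?S k" by (auto simp: less_Suc_eq)
  moreover have "?P (Suc k) \<le> (1 + e) * ((1 + e) ^ k * ?B k)"
   using step IH e by (meson add_nonneg_nonneg mult_left_mono order_trans zero_le_one)
  ultimately show ?thesis by (simp add: mult.assoc)
 next
  case False
  then have S: "?S (Suc k) = insert k (?S k)" by (auto simp: less_Suc_eq)
  have cS: "card (?S (Suc k)) = Suc (card (?S k))" unfolding S by (subst card_insert_disjoint) auto
  consider "?P k < \<phi> * \<Omega>" | "?P (Suc k) \<le> (1 - c) * ?P k"
   using False unfolding stuck_def by linarith
  then show ?thesis
  proof cases
   case 1
   have "?P (Suc k) \<le> (1 + e) * (\<phi> * \<Omega>)" using step 1 e by (smt (verit) mult_left_mono)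
   also have "... \<le> (1 + e) ^ Suc k * (\<phi> * \<Omega>)"
   proof (rule mult_right_mono)
    show "1 + e \<le> (1 + e) ^ Suc k" using ek(1) e mult_left_mono[of 1 "(1 + e) ^ k" "1 + e"] by simp
   qed (use \<phi> \<Omega> in auto)
   also have "... \<le> (1 + e) ^ Suc k * ?B (Suc k)"
    using ek \<Omega> by (intro mult_left_mono mult_right_mono) auto
   finally show ?thesis .
  next
   case 2
   have Bk: "(1 - c) * max \<phi> ((1 - c) ^ card (?S k)) \<le> max \<phi> ((1 - c) ^ card (?S (Suc k)))"
   proof -
    have 1: "(1 - c) * \<phi> \<le> \<phi>" using c \<phi> by (simp add: algebra_simps)
    have "(1 - c) * max \<phi> y = max ((1 - c) * \<phi>) ((1 - c) * y)" for y
     using c by (simp add: max_def)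
    then show ?thesis unfolding cS power_Suc using 1 max.mono[OF 1 order_refl] by simp
   qed
   have "?P (Suc k) \<le> (1 - c) * ((1 + e) ^ k * ?B k)"
    using 2 IH c by (smt (verit) mult_left_mono)
   also have "... = (1 + e) ^ k * (((1 - c) * max \<phi> ((1 - c) ^ card (?S k))) * \<Omega>)" by simp
   also have "... \<le> (1 + e) ^ k * ?B (Suc k)"
    using Bk \<Omega> ek by (intro mult_left_mono mult_right_mono) auto
   also have "... \<le> (1 + e) ^ Suc k * ?B (Suc k)"
   proof (rule mult_right_mono)
    show "(1 + e) ^ k \<le> (1 + e) ^ Suc k" using e by (intro power_increasing) auto
    show "0 \<le> ?B (Suc k)" using \<Omega> \<phi> by (intro mult_nonneg_nonneg) (auto simp: le_max_iff_disj)
   qed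
   finally show ?thesis .
  qed
 qed
qed

text \<open>
 A side at which the potential is stuck is exceptional in the sense of \<open>one_step_decay\<close>, applied to two
 consecutive layers of the thinned function.
\<close>

lemma stuck_rare:
 fixes N :: int and Z x0 :: "nat \<Rightarrow> int"
 assumes Lam: "qmean \<Lambda> \<Omega> (1 + c) (4 * N)"
  and N: "1 \<le> N" and c: "0 < c" "c \<le> 1/100" and \<phi>: "0 < \<phi>" and \<Omega>: "0 \<le> \<Omega>"
  and G: "\<And>d u. 0 \<le> G d u" "\<And>d u. G d u \<le> 1"
  and Lip: "\<And>d u. \<bar>G d (u + 1) - G d u\<bar> \<le> c * \<phi> / 2"
  and sparse: "\<And>d u. 2 * int (card {z\<in>{0..N}. 0 < G d (u + z)}) \<le> N + 1"
  and "distinct is" and k: "k < length is"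
  and J: "J = {x1..x2}" "N \<le> x2 - x1 + 1" "x2 - x1 + 1 \<le> 2 * N" and x0: "x0 (is ! k) \<in> J"
 shows "real (card {x\<in>J. stuck \<Lambda> x0 is G \<phi> \<Omega> c k (Z(is ! k := x))}) \<le> 1200 * c * real (card J)"
proof -
 define i where "i = is ! k"
 define T where "T = thin G (map Z (take k is))"
 define M where "M = pot \<Lambda> (map x0 (drop (Suc k) is))"
 have "i \<notin> set (take k is)"
  unfolding i_def using assms(11) k by (auto simp: in_set_conv_nth nth_eq_iff_index_eq)
 then have Tx: "thin G (map (Z(i := x)) (take k is)) = T" for x unfolding T_def by (simp only: map_fun_upd not_False_eq_True)
 have e1: "stage \<Lambda> x0 is G (Z(i := x)) k = (M T + M (\<lambda>d u. T (Suc d) (u + x0 i))) / 2"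
  and e2: "stage \<Lambda> x0 is G (Z(i := x)) (Suc k) = M (\<lambda>d u. min (T d u) (T (Suc d) (u + x)))" for x
  using stage_expand[OF k, of \<Lambda> x0 G "Z(i := x)"]
  unfolding M_def[symmetric] i_def[symmetric] Tx fun_upd_same .
 have T: "0 \<le> T d u" "T d u \<le> 1" "T d u \<le> G d u" for d u unfolding T_def using thin_bounds[of G] G by auto
 have "real (card {x\<in>J. \<phi> * \<Omega> \<le> (M T + M (\<lambda>d u. T (Suc d) (u + x0 i))) / 2 \<and>
   (1 - c) * ((M T + M (\<lambda>d u. T (Suc d) (u + x0 i))) / 2) < M (\<lambda>d u. min (T d u) (T (Suc d) (u + x)))})
   \<le> 1200 * c * real (card J)"
 proof (rule one_step_decay[where N = N and H = "\<lambda>d u. T (Suc d) u" and G = T])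
  show "qmean M \<Omega> (1 + c) (4 * N)" unfolding M_def by (rule qmean_pot[OF Lam])
  show "\<bar>T (Suc d) (u + 1) - T (Suc d) u\<bar> \<le> c * \<phi> / 2" for d u
   unfolding T_def by (rule thin_lipschitz) (rule Lip)
  show "2 * int (card {z \<in> {0..N}. 0 < T (Suc d) (u + z)}) \<le> N + 1" for d u
  proof -
   have "card {z \<in> {0..N}. 0 < T (Suc d) (u + z)} \<le> card {z \<in> {0..N}. 0 < G (Suc d) (u + z)}"
    using T(3) by (intro card_mono) (auto simp: order.strict_trans2 intro: finite_subset[of _ "{0..N}"])
   then show ?thesis using sparse[of "Suc d" u] by linarith
  qed
  show "x0 i \<in> J" unfolding i_def by (rule x0)
 qed (use N c \<phi> \<Omega> T J in auto)
 then show ?thesis unfolding stuck_def i_def[symmetric] e1 e2 .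
qed

lemma avg_prod:
 assumes "distinct js"
 shows "avg w J js (\<lambda>Y. \<Prod>j\<in>set js. r j (Y j)) Z = (\<Prod>j\<in>set js. \<Sum>x\<in>J j. w j x * r j x)"
 using assms
proof (induction js arbitrary: Z)
 case (Cons j js)
 have "avg w J js (\<lambda>Y. \<Prod>l\<in>set (j # js). r l (Y l)) (Z(j := x)) = r j x * (\<Prod>l\<in>set js. \<Sum>x\<in>J l. w l x * r l x)" for x
 proof -
  have "avg w J js (\<lambda>Y. \<Prod>l\<in>set (j # js). r l (Y l)) (Z(j := x))
    = avg w J js (\<lambda>Y. r j (Y j) * (\<Prod>l\<in>set js. r l (Y l))) (Z(j := x))"
   using Cons.prems by simp
  also have "... = r j ((Z(j := x)) j) * avg w J js (\<lambda>Y. \<Prod>l\<in>set js. r l (Y l)) (Z(j := x))"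
   using Cons.prems by (intro avg_mult_indep) auto
  finally show ?thesis using Cons by simp
 qed
 then show ?case using Cons.prems by (simp add: avg_Cons sum_distrib_right mult.assoc)
qed simp

text \<open>
 The layer \<open>card I\<close> is needed because in the application the type of the slice changes with the number of flipped letters.
\<close>

definition cube :: "(nat \<Rightarrow> int \<Rightarrow> real) \<Rightarrow> nat set \<Rightarrow> (nat \<Rightarrow> int) \<Rightarrow> bool" where
 "cube G C Z \<longleftrightarrow> (\<forall>I\<subseteq>C. 1 \<le> G (card I) (\<Sum>i\<in>I. Z i))"

text \<open>
 Double counting of the pairs \<open>(j, k)\<close> with \<open>bad j k\<close>.
\<close>

lemma many_stuck_steps:
 fixes g :: nat
 assumes fin: "finite Js" and cJ: "card Js = 8 * g" and g: "1 \<le> g"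
  and many: "4 * g < card {j\<in>Js. 4 * g < card {k. k < 8 * g \<and> bad j k}}"
 shows "\<exists>Y\<subseteq>{..<8 * g}. card Y = g \<and> (\<forall>k\<in>Y. g \<le> card {j\<in>Js. bad j k})"
proof -
 define B where "B = {k. k < 8 * g \<and> g \<le> card {j\<in>Js. bad j k}}"
 have B: "B \<subseteq> {..<8 * g}" unfolding B_def by auto
 have "g \<le> card B"
 proof (rule ccontr)
  assume "\<not> g \<le> card B"
  then have cB: "card B \<le> g" by simp
  let ?D = "{j\<in>Js. 4 * g < card {k. k < 8 * g \<and> bad j k}}"
  have "(4 * g + 1) * (4 * g + 1) \<le> card ?D * (4 * g + 1)" using many by (intro mult_le_mono1) simp
  also have "... = (\<Sum>j\<in>?D. 4 * g + 1)" by (simp only: sum_constant of_nat_id)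
  also have "... \<le> (\<Sum>j\<in>?D. card {k. k < 8 * g \<and> bad j k})" by (intro sum_mono) auto
  also have "... \<le> (\<Sum>j\<in>Js. card {k. k < 8 * g \<and> bad j k})" using fin by (intro sum_mono2) auto
  also have "... = (\<Sum>j\<in>Js. card {k\<in>{..<8 * g}. bad j k})" by simp
  also have "... = (\<Sum>k<8 * g. card {j\<in>Js. bad j k})"
   using sum_multicount_gen[of Js "{..<8 * g}" bad "\<lambda>k. card {j\<in>Js. bad j k}"] fin by simp
  also have "... \<le> (\<Sum>k<8 * g. if k \<in> B then 8 * g else g)"
  proof (rule sum_mono)
   fix k assume k: "k \<in> {..<8 * g}"
   have "card {j\<in>Js. bad j k} \<le> 8 * g" unfolding cJ[symmetric] using fin by (intro card_mono) auto
   then show "card {j\<in>Js. bad j k} \<le> (if k \<in> B then 8 * g else g)"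
    using k unfolding B_def by auto
  qed
  also have "... \<le> card B * (8 * g) + 8 * g * g"
  proof -
   have "(\<Sum>k<8 * g. if k \<in> B then 8 * g else g) \<le> (\<Sum>k<8 * g. (if k \<in> B then 8 * g else 0) + g)"
    by (intro sum_mono) auto
   also have "... = (\<Sum>k\<in>{..<8 * g} \<inter> B. 8 * g) + 8 * g * g"
    using sum.inter_restrict[of "{..<8 * g}" "\<lambda>_. 8 * g" B] by (simp add: sum.distrib)
   also have "{..<8 * g} \<inter> B = B" using B by auto
   finally show ?thesis by simp
  qed
  also have "... \<le> g * (8 * g) + 8 * g * g" using cB by simp
  finally show False by (simp add: algebra_simps)
 qed
 then obtain Y where "Y \<subseteq> B" "card Y = g" by (meson obtain_subset_with_card_n)
 then show ?thesis using B unfolding B_def by blast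
qed

lemma real_power_Suc_inverse_le_3: "1 \<le> n \<Longrightarrow> (1 + 1 / real n) ^ n \<le> 3"
proof -
 assume n: "1 \<le> n"
 have "(1 + 1 / real n) ^ n \<le> exp (1 / real n) ^ n"
  by (intro power_mono exp_ge_add_one_self) auto
 also have "... = exp 1" using n by (simp flip: exp_of_nat_mult)
 finally show ?thesis using exp_le by simp
qed

text \<open>
 Half of the sides are used for thinning, the other half serve as test points. Let \<open>T\<close> be \<open>G\<close> thinned by the first
 half \<open>is\<close>. A cube on all sides forces \<open>T\<close> to be \<open>1\<close> at each of the \<open>8 g\<close> test points. For each test
 coordinate \<open>j\<close> a potential centred at the window of \<open>j\<close> is followed through the \<open>8 g\<close> steps. If it is stuck in at most half of the
 steps, it ends so small that the test point hits \<open>T = 1\<close> with probability at most \<open>\<omega> / 2\<close>. So either \<open>g\<close> of the tests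
 have this small probability, or the potentials of more than half of the tests are stuck more than half of the time; then
 at least \<open>g\<close> steps are stuck for at least \<open>g\<close> tests simultaneously, and each of these
 steps has conditional probability \<open>O(c)\<close> given the earlier ones.
\<close>

lemma cube_small_windows:
 fixes N :: int and g :: nat and c :: real
 assumes g: "1 \<le> g" and c: "0 < c" "c \<le> 1 / 100" and gc: "1 \<le> 8 * real g * c"
  and pay: "768 * real g * (1 - c) ^ (4 * g) \<le> \<omega> / 2"
  and \<omega>: "0 < \<omega>" "\<omega> \<le> 1" and c\<omega>: "c = \<omega> / 4915200"
  and N: "1 \<le> N"
  and G: "\<And>d u. 0 \<le> G d u" "\<And>d u. G d u \<le> 1"
  and Lip: "\<And>d u. \<bar>G d (u + 1) - G d u\<bar> \<le> c * (1 - c) ^ (4 * g) / 2"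
  and sparse: "\<And>d u. 2 * int (card {z\<in>{0..N}. 0 < G d (u + z)}) \<le> N + 1"
  and cs: "distinct cs" "length cs = 16 * g"
  and J: "\<And>i. i \<in> set cs \<Longrightarrow> \<exists>x1 x2. J i = {x1..x2} \<and> N \<le> x2 - x1 + 1 \<and> x2 - x1 + 1 \<le> 2 * N"
 shows "avg (unif J) J cs (\<lambda>Z. of_bool (cube G (set cs) Z)) Z0 \<le> \<omega> ^ g"
proof -
 define "is" where "is = take (8 * g) cs"
 define js where "js = drop (8 * g) cs"
 have csplit: "cs = is @ js" unfolding is_def js_def by simp
 have di: "distinct is" "distinct js" "set is \<inter> set js = {}" "length is = 8 * g" "length js = 8 * g"
  using cs unfolding is_def js_def by (auto simp: set_take_disj_set_drop_if_distinct)
 have sub: "set is \<subseteq> set cs" "set js \<subseteq> set cs" unfolding csplit by auto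
 define q where "q = 8 * g"
 have q1: "1 \<le> q" "1 \<le> real q" unfolding q_def using g by auto
 define \<phi> where "\<phi> = (1 - c) ^ (4 * g)"
 have \<phi>: "0 < \<phi>" unfolding \<phi>_def using c by simp
 (* decay on the scale 8 q N: shifts by 4 N then change the geometric means by at most 1 + 1 / q, which over the q
  steps amounts to a factor of at most 3 *)
 define \<theta> where "\<theta> = 1 - 1 / (8 * real q * real_of_int N)"
 have qN: "1 \<le> real q * real_of_int N" using q1 N mult_mono[of 1 "real q" 1 "real_of_int N"] by simp
 have \<theta>: "0 < \<theta>" "\<theta> < 1" unfolding \<theta>_def using qN by (auto simp: field_simps)
 have bern: "1 - real n / (8 * real q * real_of_int N) \<le> \<theta> ^ n" for n
 proof -
  have "1 + real n * (- (1 / (8 * real q * real_of_int N))) \<le> (1 + - (1 / (8 * real q * real_of_int N))) ^ n"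
   by (rule Bernoulli_inequality) (use qN in \<open>simp add: field_simps\<close>)
  then show ?thesis unfolding \<theta>_def by simp
 qed
 define e where "e = 1 / real q"
 have e0: "0 \<le> e" "e \<le> c" unfolding e_def q_def using g gc by (auto simp: field_simps)
 have sig: "1 \<le> (1 + e) * \<theta> ^ nat (4 * N)"
 proof -
  have "1 - 1 / (2 * real q) \<le> \<theta> ^ nat (4 * N)" using bern[of "nat (4 * N)"] N by simp
  then have "(1 + e) * (1 - 1 / (2 * real q)) \<le> (1 + e) * \<theta> ^ nat (4 * N)"
   using e0 by (intro mult_left_mono) auto
  moreover have "1 \<le> (1 + e) * (1 - 1 / (2 * real q))"
  proof -
   have "(1 + e) * (1 - 1 / (2 * real q)) - 1 = (real q - 1) / (2 * real q * real q)"
    unfolding e_def using q1 by (simp add: field_simps)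
   also have "... \<ge> 0" using q1 by simp
   finally show ?thesis by simp
  qed
  ultimately show ?thesis by linarith
 qed
 define \<Omega> where "\<Omega> = 2 / (1 - \<theta>)"
 have \<Omega>: "\<Omega> = 16 * real q * real_of_int N" unfolding \<Omega>_def \<theta>_def using qN by (simp add: field_simps)
 have \<Omega>0: "0 \<le> \<Omega>" unfolding \<Omega> using q1 N by (intro mult_nonneg_nonneg) auto
 define x0 where "x0 i = (SOME x. x \<in> J i)" for i
 have x0: "x0 i \<in> J i" if "i \<in> set cs" for i
 proof -
  have "\<exists>x. x \<in> J i" using J[OF that] N by (metis atLeastAtMost_iff add.commute diff_add_cancel order_refl zle_diff1_eq zle_add1_eq_le order_trans zero_le_one diff_ge_0_iff_ge add_le_cancel_left)
  then show ?thesis unfolding x0_def by (rule someI_ex)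
 qed
 have lawJ: "law (unif J) J i" if "i \<in> set cs" for i
  using J[OF that] x0[OF that] by (intro law_unif) auto
 have close: "\<bar>x - y\<bar> \<le> 2 * N" if "i \<in> set cs" "x \<in> J i" "y \<in> J i" for x y i
  using J[OF that(1)] that(2,3) by auto
 have cardJ: "real_of_int N \<le> real (card (J i))" "0 < card (J i)" if "i \<in> set cs" for i
  using J[OF that] N by auto
 define \<Lambda> where "\<Lambda> j = geo \<theta> (x0 j)" for j
 have Lam: "qmean (\<Lambda> j) \<Omega> (1 + e) (4 * N)" for j
  unfolding \<Lambda>_def \<Omega>_def by (rule qmean_geo[OF \<theta> sig]) (use N in simp)
 have Lamc: "qmean (\<Lambda> j) \<Omega> (1 + c) (4 * N)" for j
  by (rule qmean_weaken[OF Lam]) (use e0 in simp)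
 define T where "T Z = thin G (map Z is)" for Z
 have Tb: "0 \<le> T Z d u" "T Z d u \<le> 1" for Z d u unfolding T_def using thin_bounds[of G] G by auto
 define bad where "bad Z j k \<longleftrightarrow> stuck (\<Lambda> j) x0 is G \<phi> \<Omega> c k Z" for Z j k
 define pay' where "pay' Z j = (\<Sum>x\<in>J j. unif J j x * of_bool (1 \<le> T Z 1 x))" for Z j
 have pay01: "0 \<le> pay' Z j" "pay' Z j \<le> 1" if "j \<in> set js" for Z j
 proof -
  have L: "law (unif J) J j" using lawJ that sub by auto
  show "0 \<le> pay' Z j" unfolding pay'_def using L by (intro sum_nonneg) (auto simp: law_def)
  have "pay' Z j \<le> (\<Sum>x\<in>J j. unif J j x * 1)"
   unfolding pay'_def using L by (intro sum_mono mult_left_mono) (auto simp: law_def)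
  then show "pay' Z j \<le> 1" using L by (simp add: law_def)
 qed
 have payoff: "pay' Z j \<le> \<omega> / 2"
  if j: "j \<in> set js" and Z: "\<forall>i\<in>set is. Z i \<in> J i" and few: "\<not> 4 * g < card {k. k < 8 * g \<and> bad Z j k}" for Z j
 proof -
  have jc: "j \<in> set cs" using j sub by auto
  let ?nb = "card {l. l < 8 * g \<and> \<not> bad Z j l}"
  have "{k. k < 8 * g \<and> bad Z j k} \<union> {l. l < 8 * g \<and> \<not> bad Z j l} = {..<8 * g}" by auto
  then have "8 * g \<le> card {k. k < 8 * g \<and> bad Z j k} + ?nb"
   by (metis card_Un_le card_lessThan)
  then have nb: "4 * g \<le> ?nb" using few by linarith
  have st: "stage (\<Lambda> j) x0 is G Z (8 * g) = \<Lambda> j (T Z)"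
   unfolding stage_def T_def using di by simp
  have "stage (\<Lambda> j) x0 is G Z (8 * g) \<le>
    (1 + e) ^ (8 * g) * (max \<phi> ((1 - c) ^ card {l. l < 8 * g \<and> \<not> stuck (\<Lambda> j) x0 is G \<phi> \<Omega> c l Z}) * \<Omega>)"
  proof (rule stage_decay[OF Lam e0(1) c(1) _ \<phi> \<Omega>0 G])
   fix i assume i: "i \<in> set is"
   show "\<bar>Z i - x0 i\<bar> \<le> 4 * N" using close[of i "Z i" "x0 i"] i sub Z x0[of i] N by auto
  qed (use c di in auto)
  also have "... \<le> 3 * (\<phi> * \<Omega>)"
  proof (rule mult_mono)
   show "(1 + e) ^ (8 * g) \<le> 3" unfolding e_def q_def using real_power_Suc_inverse_le_3[of "8 * g"] g by simp
   have "(1 - c) ^ ?nb \<le> \<phi>" unfolding \<phi>_def using nb c by (intro power_decreasing) auto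
   then show "max \<phi> ((1 - c) ^ card {l. l < 8 * g \<and> \<not> stuck (\<Lambda> j) x0 is G \<phi> \<Omega> c l Z}) * \<Omega> \<le> \<phi> * \<Omega>"
    unfolding bad_def using \<Omega>0 by (intro mult_right_mono) auto
   show "0 \<le> max \<phi> ((1 - c) ^ card {l. l < 8 * g \<and> \<not> stuck (\<Lambda> j) x0 is G \<phi> \<Omega> c l Z}) * \<Omega>"
    using \<phi> \<Omega>0 by (intro mult_nonneg_nonneg) (auto simp: le_max_iff_disj)
  qed simp
  finally have LT: "\<Lambda> j (T Z) \<le> 3 * (\<phi> * \<Omega>)" unfolding st .
  have "(\<Sum>x\<in>J j. of_bool (1 \<le> T Z 1 x)) \<le> (\<Sum>x\<in>J j. T Z 1 x)"
   using Tb by (intro sum_mono) (auto simp: of_bool_def)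
  also have "... \<le> 2 * \<Lambda> j (T Z)"
   unfolding \<Lambda>_def
  proof (rule sum_le_geo[OF \<theta>])
   show "bddf (T Z)" using Tb by (rule bddf_01)
   show "finite (J j)" using J[OF jc] by auto
   fix u assume u: "u \<in> J j"
   have "nat \<bar>u - x0 j\<bar> \<le> nat (2 * N)" using close[OF jc u x0[OF jc]] by simp
   then have "\<theta> ^ nat (2 * N) \<le> \<theta> ^ nat \<bar>u - x0 j\<bar>" using \<theta> by (intro power_decreasing) auto
   moreover have "1 / 2 \<le> \<theta> ^ nat (2 * N)"
   proof -
    have "1 - real (nat (2 * N)) / (8 * real q * real_of_int N) = 1 - 1 / (4 * real q)" using N q1 by simp
    moreover have "1 / (4 * real q) \<le> 1 / 2" using q1 by (simp add: field_simps)
    ultimately show ?thesis using bern[of "nat (2 * N)"] by linarith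
   qed
   ultimately show "1 / 2 \<le> \<theta> ^ nat \<bar>u - x0 j\<bar>" by linarith
  qed (use Tb in auto)
  also have "... \<le> 6 * (\<phi> * \<Omega>)" using LT by linarith
  also have "... = real_of_int N * (768 * real g * \<phi>)" unfolding \<Omega> q_def by simp
  also have "... \<le> real_of_int N * (\<omega> / 2)" using pay N unfolding \<phi>_def by (intro mult_left_mono) auto
  also have "... \<le> real (card (J j)) * (\<omega> / 2)" using cardJ[OF jc] \<omega> by (intro mult_right_mono) auto
  finally have "(\<Sum>x\<in>J j. of_bool (1 \<le> T Z 1 x)) / real (card (J j)) \<le> \<omega> / 2"
   using cardJ[OF jc] by (simp add: divide_le_eq mult.commute)
  then show ?thesis unfolding pay'_def unif_def by (simp flip: sum_divide_distrib)
 qed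
 define \<beta> where "\<beta> k Z = (of_bool (g \<le> card {j\<in>set js. bad Z j k}) :: real)" for k Z
 define \<Y> where "\<Y> = {Y. Y \<subseteq> {..<8 * g} \<and> card Y = g}"
 have fin\<Y>: "finite \<Y>" unfolding \<Y>_def by (rule finite_subset[of _ "Pow {..<8 * g}"]) auto
 have card\<Y>: "real (card \<Y>) \<le> 256 ^ g"
 proof -
  have "card \<Y> \<le> card (Pow {..<8 * g})" unfolding \<Y>_def by (intro card_mono) auto
  also have "... = 256 ^ g" by (simp add: card_Pow power_mult)
  finally show ?thesis by (metis of_nat_le_iff of_nat_numeral of_nat_power)
 qed
 have \<beta>0: "0 \<le> \<beta> k Z" for k Z unfolding \<beta>_def by simp
 have pointwise: "(\<Prod>j\<in>set js. pay' Z j) \<le> (\<omega> / 2) ^ g + (\<Sum>Y\<in>\<Y>. \<Prod>k\<in>Y. \<beta> k Z)"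
  if Z: "\<forall>i\<in>set is. Z i \<in> J i" for Z
 proof (cases "4 * g < card {j\<in>set js. 4 * g < card {k. k < 8 * g \<and> bad Z j k}}")
  case True
  then obtain Y where Y: "Y \<in> \<Y>" "\<forall>k\<in>Y. \<beta> k Z = 1"
   using many_stuck_steps[of "set js" g "bad Z"] di g distinct_card[OF di(2)] unfolding \<Y>_def \<beta>_def by auto
  have "(\<Prod>j\<in>set js. pay' Z j) \<le> 1" using pay01 by (intro prod_le_1) auto
  also have "1 = (\<Prod>k\<in>Y. \<beta> k Z)" using Y by simp
  also have "... \<le> (\<Sum>Y\<in>\<Y>. \<Prod>k\<in>Y. \<beta> k Z)"
   using Y(1) fin\<Y> \<beta>0 by (intro member_le_sum prod_nonneg) auto
  finally show ?thesis using \<omega> by (simp add: add_increasing)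
 next
  case False
  let ?F = "{j\<in>set js. \<not> 4 * g < card {k. k < 8 * g \<and> bad Z j k}}"
  have "{j\<in>set js. 4 * g < card {k. k < 8 * g \<and> bad Z j k}} \<union> ?F = set js" by auto
  then have "8 * g \<le> card {j\<in>set js. 4 * g < card {k. k < 8 * g \<and> bad Z j k}} + card ?F"
   by (metis (no_types, lifting) card_Un_le distinct_card[OF di(2)] di(5))
  then have cF: "g \<le> card ?F" using False by linarith
  have "(\<Prod>j\<in>set js. pay' Z j) = (\<Prod>j\<in>?F. pay' Z j) * (\<Prod>j\<in>set js - ?F. pay' Z j)"
   by (subst prod.subset_diff[of ?F "set js"]) auto
  also have "... \<le> (\<Prod>j\<in>?F. pay' Z j) * 1"
   using pay01 by (intro mult_left_mono prod_le_1 prod_nonneg) auto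
  also have "... \<le> (\<Prod>j\<in>?F. \<omega> / 2)"
   using pay01 payoff[OF _ Z] by (simp only: mult_1_right, intro prod_mono) auto
  also have "... \<le> (\<omega> / 2) ^ g" using cF \<omega> by (simp only: prod_constant, intro power_decreasing) auto
  finally show ?thesis using \<beta>0 by (simp add: add_increasing2 sum_nonneg prod_nonneg)
 qed
 have rare: "avg (unif J) J is (\<lambda>Z. \<Prod>k\<in>Y. \<beta> k Z) Z0 \<le> (9600 * c) ^ g" if Y: "Y \<in> \<Y>" for Y
 proof -
  let ?bls = "map (\<lambda>i. [i]) is"
  have cc: "concat ?bls = is" by (induction "is") auto
  have "avg (unif J) J (concat ?bls) (\<lambda>Z. \<Prod>k\<in>Y. \<beta> k Z) Z0 \<le> (9600 * c) ^ card Y"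
  proof (rule avg_blocks)
   show "\<forall>i\<in>set (concat ?bls). law (unif J) J i" using lawJ sub unfolding cc by auto
   show "Y \<subseteq> {..<length ?bls}" using Y di unfolding \<Y>_def by auto
   show "0 \<le> 9600 * c" using c by simp
   show "0 \<le> \<beta> k Z" for k Z by (rule \<beta>0)
  next
   fix k \<gamma> i and Z :: "nat \<Rightarrow> int" and x assume a: "k \<in> Y" "k < \<gamma>" "\<gamma> < length ?bls" "i \<in> set (?bls ! \<gamma>)"
   then have i: "i = is ! \<gamma>" "\<gamma> < length is" by auto
   have notin: "i \<notin> set (take (Suc k) is)" "i \<notin> set (take k is)"
    using i a(2) di(1) by (auto simp: in_set_conv_nth nth_eq_iff_index_eq)
   then have "map (Z(i := x)) (take k is) = map Z (take k is)"
    "map (Z(i := x)) (take (Suc k) is) = map Z (take (Suc k) is)" by (simp_all only: map_fun_upd not_False_eq_True)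
   then have "bad (Z(i := x)) j k = bad Z j k" for j
    unfolding bad_def stuck_def stage_def by (simp only:)
   then show "\<beta> k (Z(i := x)) = \<beta> k Z" unfolding \<beta>_def by (simp only:)
  next
   fix k and Z :: "nat \<Rightarrow> int" assume kY: "k \<in> Y"
   then have k: "k < length is" using Y di unfolding \<Y>_def by auto
   define i where "i = is ! k"
   have ic: "i \<in> set cs" unfolding i_def using k sub by auto
   obtain x1 x2 where J12: "J i = {x1..x2}" "N \<le> x2 - x1 + 1" "x2 - x1 + 1 \<le> 2 * N" using J[OF ic] by blast
   have b: "(\<Sum>x\<in>J i. of_bool (bad (Z(i := x)) j k)) \<le> 1200 * c * real (card (J i))" for j
   proof -
    have "real (card {x\<in>J i. stuck (\<Lambda> j) x0 is G \<phi> \<Omega> c k (Z(is ! k := x))}) \<le> 1200 * c * real (card (J i))"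
    proof (rule stuck_rare[OF Lamc N c \<phi> \<Omega>0 G _ sparse di(1) k J12])
     show "\<bar>G d (u + 1) - G d u\<bar> \<le> c * \<phi> / 2" for d u unfolding \<phi>_def by (rule Lip)
     show "x0 (is ! k) \<in> J i" using x0[OF ic] unfolding i_def .
    qed
    then show ?thesis unfolding bad_def i_def using J12(1) unfolding i_def by (simp add: of_bool_def sum.If_cases Int_def)
   qed
   have "avg (unif J) J (?bls ! k) (\<beta> k) Z = (\<Sum>x\<in>J i. unif J i x * \<beta> k (Z(i := x)))"
    using k unfolding i_def by (simp add: avg_Cons)
   also have "... \<le> (\<Sum>x\<in>J i. unif J i x * ((\<Sum>j\<in>set js. of_bool (bad (Z(i := x)) j k)) / real g))"
   proof (intro sum_mono mult_left_mono)
    fix x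
    show "\<beta> k (Z(i := x)) \<le> (\<Sum>j\<in>set js. of_bool (bad (Z(i := x)) j k)) / real g"
     unfolding \<beta>_def using g by (auto simp: of_bool_def sum.If_cases Int_def le_divide_eq sum_nonneg)
   qed (simp add: unif_def)
   also have "... = (\<Sum>x\<in>J i. \<Sum>j\<in>set js. of_bool (bad (Z(i := x)) j k) / (real (card (J i)) * real g))"
   proof (rule sum.cong[OF refl])
    fix x
    have "unif J i x * (s / real g) = s / (real (card (J i)) * real g)" for s by (simp add: unif_def)
    note u = this
    show "unif J i x * ((\<Sum>j\<in>set js. of_bool (bad (Z(i := x)) j k)) / real g)
     = (\<Sum>j\<in>set js. of_bool (bad (Z(i := x)) j k) / (real (card (J i)) * real g))"
     unfolding u by (rule sum_divide_distrib)
   qed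
   also have "... = (\<Sum>j\<in>set js. \<Sum>x\<in>J i. of_bool (bad (Z(i := x)) j k) / (real (card (J i)) * real g))"
    by (rule sum.swap)
   also have "... = (\<Sum>j\<in>set js. (\<Sum>x\<in>J i. of_bool (bad (Z(i := x)) j k)) / (real (card (J i)) * real g))"
    by (simp only: sum_divide_distrib)
   also have "... \<le> (\<Sum>j\<in>set js. 1200 * c / real g)"
   proof (rule sum_mono)
    fix j
    have "(\<Sum>x\<in>J i. of_bool (bad (Z(i := x)) j k)) / real (card (J i)) \<le> 1200 * c"
     using b[of j] cardJ[OF ic] by (simp add: divide_le_eq)
    then have "(\<Sum>x\<in>J i. of_bool (bad (Z(i := x)) j k)) / real (card (J i)) / real g \<le> 1200 * c / real g"
     by (rule divide_right_mono) simp
    then show "(\<Sum>x\<in>J i. of_bool (bad (Z(i := x)) j k)) / (real (card (J i)) * real g) \<le> 1200 * c / real g"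
     by (simp only: divide_divide_eq_left)
   qed
   also have "... = 9600 * c" using g distinct_card[OF di(2)] di(5) by (simp add: field_simps)
   finally show "avg (unif J) J (?bls ! k) (\<beta> k) Z \<le> 9600 * c" .
  qed
  then show ?thesis unfolding cc using Y unfolding \<Y>_def by simp
 qed
 have inner: "avg (unif J) J js (\<lambda>Z. of_bool (cube G (set cs) Z)) Z \<le> (\<Prod>j\<in>set js. pay' Z j)" for Z
 proof -
  have lj: "\<forall>i\<in>set js. law (unif J) J i" using lawJ sub by auto
  have "avg (unif J) J js (\<lambda>Z. of_bool (cube G (set cs) Z)) Z
    \<le> avg (unif J) J js (\<lambda>Y. \<Prod>j\<in>set js. of_bool (1 \<le> T Z 1 (Y j))) Z"
  proof (rule avg_mono_on[OF lj])
   fix Y assume Y: "\<forall>i. i \<notin> set js \<longrightarrow> Y i = Z i"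
   have TY: "T Y = T Z" unfolding T_def using Y di(3) by (intro arg_cong[where f = "thin G"]) auto
   have "1 \<le> T Z 1 (Y j)" if cub: "cube G (set cs) Y" and j: "j \<in> set js" for j
   proof -
    have "1 \<le> G (1 + card I) (Y j + (\<Sum>i\<in>I. Y i))" if I: "I \<subseteq> set is" for I
    proof -
     have fin: "finite I" "j \<notin> I" using I j di(3) finite_subset by auto
     have "insert j I \<subseteq> set cs" using I j sub by auto
     then have "1 \<le> G (card (insert j I)) (\<Sum>i\<in>insert j I. Y i)" using cub unfolding cube_def by blast
     then show ?thesis using fin by simp
    qed
    then have "1 \<le> T Y 1 (Y j)" unfolding T_def by (intro thin_cube[OF di(1)]) auto
    then show ?thesis unfolding TY .
   qed
   then show "of_bool (cube G (set cs) Y) \<le> (\<Prod>j\<in>set js. of_bool (1 \<le> T Z 1 (Y j)) :: real)"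
    by (cases "cube G (set cs) Y") (auto intro!: prod_nonneg)
  qed
  also have "... = (\<Prod>j\<in>set js. pay' Z j)"
   unfolding pay'_def using avg_prod[OF di(2), of "unif J" J "\<lambda>j x. of_bool (1 \<le> T Z 1 x)" Z] by simp
  finally show ?thesis .
 qed
 have li: "\<forall>i\<in>set is. law (unif J) J i" using lawJ sub by auto
 have "avg (unif J) J cs (\<lambda>Z. of_bool (cube G (set cs) Z)) Z0
   = avg (unif J) J is (avg (unif J) J js (\<lambda>Z. of_bool (cube G (set cs) Z))) Z0"
  unfolding csplit by (simp only: avg_append)
 also have "... \<le> avg (unif J) J is (\<lambda>Z. (\<omega> / 2) ^ g + (\<Sum>Y\<in>\<Y>. \<Prod>k\<in>Y. \<beta> k Z)) Z0"
  by (rule avg_mono_on[OF li]) (rule order_trans[OF inner pointwise])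
 also have "... = (\<omega> / 2) ^ g + (\<Sum>Y\<in>\<Y>. avg (unif J) J is (\<lambda>Z. \<Prod>k\<in>Y. \<beta> k Z) Z0)"
  by (simp add: avg_add avg_const[OF li] avg_sum[OF fin\<Y>])
 also have "... \<le> (\<omega> / 2) ^ g + (\<Sum>Y\<in>\<Y>. (9600 * c) ^ g)"
  using rare by (intro add_left_mono sum_mono)
 also have "... \<le> (\<omega> / 2) ^ g + 256 ^ g * (9600 * c) ^ g"
  using card\<Y> c by (simp add: mult_right_mono)
 also have "256 ^ g * (9600 * c) ^ g = (\<omega> / 2) ^ g"
  unfolding power_mult_distrib[symmetric] c\<omega> by simp
 also have "(\<omega> / 2) ^ g + (\<omega> / 2) ^ g \<le> \<omega> ^ g"
 proof -
  have "(1 / 2 :: real) ^ g \<le> (1 / 2) ^ 1" using g by (intro power_decreasing) auto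
  then have "2 * (1 / 2) ^ g * \<omega> ^ g \<le> 1 * \<omega> ^ g" using \<omega> by (intro mult_right_mono) auto
  then show ?thesis by (simp add: power_divide)
 qed
 finally show ?thesis .
qed

lemma avg_cong_law:
 assumes "\<And>i. i \<in> set is \<Longrightarrow> A i = A' i \<and> w i = w' i"
 shows "avg w A is \<phi> Z = avg w' A' is \<phi> Z"
 using assms by (induction "is" arbitrary: Z) (auto simp: avg_Cons)

text \<open>
 The uniform law on a disjoint union is a mixture of the uniform laws on the parts, in a single coordinate.
\<close>

lemma avg_unif_split:
 assumes "distinct is" "i \<in> set is" "finite S" "finite T" "S \<inter> T = {}" "S \<noteq> {}" "T \<noteq> {}"
 shows "real (card (S \<union> T)) * avg (unif (J(i := S \<union> T))) (J(i := S \<union> T)) is \<phi> Z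
  = real (card S) * avg (unif (J(i := S))) (J(i := S)) is \<phi> Z
   + real (card T) * avg (unif (J(i := T))) (J(i := T)) is \<phi> Z"
 using assms(1,2)
proof (induction "is" arbitrary: Z)
 case (Cons k ks)
 show ?case
 proof (cases "k = i")
  case True
  then have i: "i \<notin> set ks" using Cons.prems by simp
  define \<psi> where "\<psi> x = avg (unif J) J ks \<phi> (Z(i := x))" for x
  have r: "avg (unif (J(i := R))) (J(i := R)) ks \<phi> Y = avg (unif J) J ks \<phi> Y" for R Y
   using i by (intro avg_cong_law) (auto simp: unif_def fun_eq_iff)
  have e: "real (card R) * avg (unif (J(i := R))) (J(i := R)) (k # ks) \<phi> Z = (\<Sum>x\<in>R. \<psi> x)"
   if "finite R" "R \<noteq> {}" for R
   using that unfolding True avg_Cons r \<psi>_def by (simp add: unif_def sum_distrib_left)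
  show ?thesis
  proof -
   have ne: "finite (S \<union> T)" "S \<union> T \<noteq> {}" using assms(3-7) by auto
   show ?thesis
    unfolding e[OF ne] e[OF assms(3,6)] e[OF assms(4,7)] by (rule sum.union_disjoint[OF assms(3-5)])
  qed
 next
  case False
  define a where "a = 1 / real (card (J k))"
  have IH: "real (card (S \<union> T)) * avg (unif (J(i := S \<union> T))) (J(i := S \<union> T)) ks \<phi> Y
   = real (card S) * avg (unif (J(i := S))) (J(i := S)) ks \<phi> Y
   + real (card T) * avg (unif (J(i := T))) (J(i := T)) ks \<phi> Y" for Y
   by (rule Cons.IH) (use Cons.prems False in auto)
  have e: "real c * avg (unif (J(i := R))) (J(i := R)) (k # ks) \<phi> Z
    = (\<Sum>x\<in>J k. a * (real c * avg (unif (J(i := R))) (J(i := R)) ks \<phi> (Z(k := x))))" for R c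
   using False unfolding avg_Cons a_def by (simp add: unif_def sum_distrib_left mult.left_commute)
  show ?thesis
   unfolding e IH by (simp add: distrib_left sum.distrib)
 qed
qed simp

lemma interval_induct_split:
 fixes P :: "int set \<Rightarrow> bool" and N :: int
 assumes N: "1 \<le> N"
  and small: "\<And>x1 x2. N \<le> x2 - x1 + 1 \<Longrightarrow> x2 - x1 + 1 \<le> 2 * N \<Longrightarrow> P {x1..x2}"
  and union: "\<And>x1 x2 x3. x1 \<le> x2 \<Longrightarrow> x2 < x3 \<Longrightarrow> P {x1..x2} \<Longrightarrow> P {x2 + 1..x3} \<Longrightarrow> P {x1..x3}"
  and ge: "N \<le> x2 - x1 + 1"
 shows "P {x1..x2}"
 using ge
proof (induction "nat (x2 - x1)" arbitrary: x1 rule: less_induct)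
 case less
 show ?case
 proof (cases "x2 - x1 + 1 \<le> 2 * N")
  case True
  then show ?thesis using less.prems small by simp
 next
  case False
  have 1: "P {x1..x1 + N - 1}" using N by (intro small) auto
  have 2: "P {x1 + N - 1 + 1..x2}" using False N less.prems by (intro less.hyps) auto
  show ?thesis by (rule union[of x1 "x1 + N - 1"]) (use 1 2 N False in auto)
 qed
qed

text \<open>
 A long interval is a disjoint union of intervals of length between \<open>N\<close> and \<open>2 N\<close>, so by \<open>avg_unif_split\<close> a bound
 for windows of such lengths extends to arbitrarily long ones.
\<close>

lemma avg_split_windows:
 fixes N :: int
 assumes N: "1 \<le> N" and d: "distinct cs"
  and small: "\<And>J'. (\<And>i. i \<in> set cs \<Longrightarrow> \<exists>x1 x2. J' i = {x1..x2} \<and> N \<le> x2 - x1 + 1 \<and> x2 - x1 + 1 \<le> 2 * N)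
    \<Longrightarrow> avg (unif J') J' cs \<phi> Z \<le> p"
  and J: "\<And>i. i \<in> set cs \<Longrightarrow> \<exists>x1 x2. J i = {x1..x2} \<and> N \<le> x2 - x1 + 1"
 shows "avg (unif J) J cs \<phi> Z \<le> p"
proof -
 have "avg (unif J) J cs \<phi> Z \<le> p"
  if "finite D" "D \<subseteq> set cs"
   "\<And>i. i \<in> set cs \<Longrightarrow> \<exists>x1 x2. J i = {x1..x2} \<and> N \<le> x2 - x1 + 1 \<and> (i \<notin> D \<longrightarrow> x2 - x1 + 1 \<le> 2 * N)" for D J
  using that
 proof (induction D arbitrary: J rule: finite_induct)
  case empty
  then show ?case by (intro small) auto
 next
  case (insert i D)
  have ic: "i \<in> set cs" using insert.prems by auto
  obtain x1 x2 where x: "J i = {x1..x2}" "N \<le> x2 - x1 + 1" using insert.prems(2)[OF ic] by auto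
  have "avg (unif (J(i := {x1..x2}))) (J(i := {x1..x2})) cs \<phi> Z \<le> p"
  proof (rule interval_induct_split[OF N _ _ x(2)])
   fix y1 y2 assume y: "N \<le> y2 - y1 + 1" "y2 - y1 + 1 \<le> 2 * N"
   show "avg (unif (J(i := {y1..y2}))) (J(i := {y1..y2})) cs \<phi> Z \<le> p"
   proof (rule insert.IH)
    show "D \<subseteq> set cs" using insert.prems by auto
    fix k assume k: "k \<in> set cs"
    show "\<exists>x1 x2. (J(i := {y1..y2})) k = {x1..x2} \<and> N \<le> x2 - x1 + 1 \<and> (k \<notin> D \<longrightarrow> x2 - x1 + 1 \<le> 2 * N)"
    proof (cases "k = i")
     case True
     then show ?thesis using y by auto
    next
     case False
     then show ?thesis using insert.prems(2)[OF k] by simp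
    qed
   qed
  next
   fix y1 y2 y3 :: int
   assume y: "y1 \<le> y2" "y2 < y3"
    and 1: "avg (unif (J(i := {y1..y2}))) (J(i := {y1..y2})) cs \<phi> Z \<le> p"
    and 2: "avg (unif (J(i := {y2 + 1..y3}))) (J(i := {y2 + 1..y3})) cs \<phi> Z \<le> p"
   have U: "{y1..y3} = {y1..y2} \<union> {y2 + 1..y3}" using y by auto
   let ?c = "real (card {y1..y2})" and ?d = "real (card {y2 + 1..y3})"
   have cd: "real (card {y1..y3}) = ?c + ?d" "0 < real (card {y1..y3})" using y by auto
   have "real (card {y1..y3}) * avg (unif (J(i := {y1..y3}))) (J(i := {y1..y3})) cs \<phi> Z
     = ?c * avg (unif (J(i := {y1..y2}))) (J(i := {y1..y2})) cs \<phi> Z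
     + ?d * avg (unif (J(i := {y2 + 1..y3}))) (J(i := {y2 + 1..y3})) cs \<phi> Z"
    unfolding U using y by (intro avg_unif_split[OF d ic]) auto
   also have "... \<le> ?c * p + ?d * p" using 1 2 by (intro add_mono mult_left_mono) auto
   also have "... = real (card {y1..y3}) * p" using cd(1) by (simp add: distrib_right)
   finally show "avg (unif (J(i := {y1..y3}))) (J(i := {y1..y3})) cs \<phi> Z \<le> p"
    using cd(2) by (simp only: mult_le_cancel_left_pos)
  qed
  moreover have "J(i := {x1..x2}) = J" by (rule fun_upd_idem) (rule x(1))
  ultimately show ?case by (simp only:)
 qed
 from this[of "set cs" J] J show ?thesis by auto
qed

text \<open>
 Cubes of dimension \<open>16 g\<close> with random sides are unlikely to lie in the level set of any slowly varying
 function (slope at most \<open>\<eta>\<close>) whose support is sparse at scale \<open>N\<close>.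
\<close>

definition rare_cubes :: "real \<Rightarrow> nat \<Rightarrow> real \<Rightarrow> bool" where
 "rare_cubes \<omega> g \<eta> \<longleftrightarrow> (\<forall>(N::int) (G::nat \<Rightarrow> int \<Rightarrow> real) cs (J::nat \<Rightarrow> int set) Z. 1 \<le> N \<longrightarrow> (\<forall>d u. 0 \<le> G d u \<and> G d u \<le> 1) \<longrightarrow>
   (\<forall>d u. \<bar>G d (u + 1) - G d u\<bar> \<le> \<eta>) \<longrightarrow>
   (\<forall>d u. 2 * int (card {z\<in>{0..N}. 0 < G d (u + z)}) \<le> N + 1) \<longrightarrow>
   distinct cs \<longrightarrow> length cs = 16 * g \<longrightarrow>
   (\<forall>i\<in>set cs. \<exists>x1 x2. J i = {x1..x2} \<and> N \<le> x2 - x1 + 1) \<longrightarrow>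
   avg (unif J) J cs (\<lambda>Z. of_bool (cube G (set cs) Z)) Z \<le> \<omega> ^ g)"

lemma rare_cubesD:
 assumes "rare_cubes \<omega> g \<eta>" "1 \<le> N" "\<And>d u. 0 \<le> G d u \<and> G d u \<le> 1" "\<And>d u. \<bar>G d (u + 1) - G d u\<bar> \<le> \<eta>"
  "\<And>d u. 2 * int (card {z\<in>{0..N}. 0 < G d (u + z)}) \<le> N + 1" "distinct cs" "length cs = 16 * g"
  "\<And>i. i \<in> set cs \<Longrightarrow> \<exists>x1 x2. J i = {x1..x2} \<and> N \<le> x2 - x1 + 1"
 shows "avg (unif J) J cs (\<lambda>Z. of_bool (cube G (set cs) Z)) Z \<le> \<omega> ^ g"
 by (rule assms(1)[unfolded rare_cubes_def, rule_format]) (rule assms; assumption?)+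

text \<open>
 The probability of a cube beats every exponential in its dimension. The constant in \<open>c\<close> balances
 the at most \<open>256 ^ g\<close> choices of stuck steps, each of conditional probability \<open>9600 c\<close>, against \<open>(\<omega> / 2) ^ g\<close>.
\<close>

lemma cube_bound:
 fixes \<omega> :: real
 assumes \<omega>: "0 < \<omega>" "\<omega> \<le> 1"
 obtains g :: nat and \<eta> :: real where "1 \<le> g" "0 < \<eta>" "rare_cubes \<omega> g \<eta>"
proof -
 (* 2 * 256 * 9600 = 4915200 *)
 define c where "c = \<omega> / 4915200"
 have c: "0 < c" "c \<le> 1 / 100" unfolding c_def using \<omega> by auto
 have "(\<lambda>n. real n * ((1 - c) ^ 4) ^ n) \<longlonglongrightarrow> 0"
  using c by (intro powser_times_n_limit_0) (auto simp: power_less_one_iff abs_if)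
 then have "(\<lambda>n. 768 * (real n * ((1 - c) ^ 4) ^ n)) \<longlonglongrightarrow> 768 * 0"
  by (intro tendsto_mult_left)
 then have "\<forall>\<^sub>F n in sequentially. 768 * (real n * ((1 - c) ^ 4) ^ n) < \<omega> / 2"
  using \<omega> by (intro order_tendstoD(2)[where y = "768 * 0"]) auto
 moreover have "\<forall>\<^sub>F n in sequentially. max 1 (nat \<lceil>1 / c\<rceil>) \<le> n" by (rule eventually_ge_at_top)
 ultimately have "\<forall>\<^sub>F n in sequentially. 768 * (real n * ((1 - c) ^ 4) ^ n) < \<omega> / 2 \<and> max 1 (nat \<lceil>1 / c\<rceil>) \<le> n"
  by (rule eventually_conj)
 then obtain g where g: "768 * (real g * ((1 - c) ^ 4) ^ g) < \<omega> / 2" "max 1 (nat \<lceil>1 / c\<rceil>) \<le> g"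
  by (auto simp: eventually_sequentially)
 have g1: "1 \<le> g" using g(2) by simp
 have "1 / c \<le> real g" using g(2) by linarith
 then have gc: "1 \<le> 8 * real g * c" using c g1 by (simp add: divide_le_eq)
 have pay: "768 * real g * (1 - c) ^ (4 * g) \<le> \<omega> / 2" using g(1) by (simp add: power_mult mult.assoc)
 show thesis
 proof (rule that[OF g1, of "c * (1 - c) ^ (4 * g) / 2"])
  show "0 < c * (1 - c) ^ (4 * g) / 2" using c by simp
  show "rare_cubes \<omega> g (c * (1 - c) ^ (4 * g) / 2)"
   unfolding rare_cubes_def
  proof (intro allI impI)
   fix N :: int and G :: "nat \<Rightarrow> int \<Rightarrow> real" and cs and J :: "nat \<Rightarrow> int set" and Z
   assume N: "1 \<le> N" and G: "\<forall>d u. 0 \<le> G d u \<and> G d u \<le> 1"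
    and lip: "\<forall>d u. \<bar>G d (u + 1) - G d u\<bar> \<le> c * (1 - c) ^ (4 * g) / 2"
    and sparse: "\<forall>d u. 2 * int (card {z\<in>{0..N}. 0 < G d (u + z)}) \<le> N + 1"
    and cs: "distinct cs" "length cs = 16 * g"
    and J: "\<forall>i\<in>set cs. \<exists>x1 x2. J i = {x1..x2} \<and> N \<le> x2 - x1 + 1"
   have G': "0 \<le> G d u" "G d u \<le> 1" for d u using G by auto
   show "avg (unif J) J cs (\<lambda>Z. of_bool (cube G (set cs) Z)) Z \<le> \<omega> ^ g"
    by (rule avg_split_windows[OF N cs(1)
     cube_small_windows[OF g1 c gc pay \<omega> c_def N G' lip[rule_format] sparse[rule_format] cs] J[rule_format]])
  qed
 qed
qed

section \<open>Averages over slices\<close>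

definition cnt :: "(nat \<Rightarrow> real) \<Rightarrow> nat \<Rightarrow> real \<Rightarrow> nat" where
 "cnt b l a = card {i\<in>{1..l}. b i = a}"

definition slice :: "real set \<Rightarrow> nat \<Rightarrow> (real \<Rightarrow> nat) \<Rightarrow> (nat \<Rightarrow> real) set" where
 "slice S l s = {b \<in> {1..l} \<rightarrow>\<^sub>E S. \<forall>a\<in>S. cnt b l a = s a}"

lemma sliceI: "b \<in> {1..l} \<rightarrow>\<^sub>E S \<Longrightarrow> (\<And>a. a \<in> S \<Longrightarrow> cnt b l a = s a) \<Longrightarrow> b \<in> slice S l s"
 unfolding slice_def by blast

definition dot :: "(nat \<Rightarrow> real) \<Rightarrow> (nat \<Rightarrow> int) \<Rightarrow> nat \<Rightarrow> real" where
 "dot b X l = (\<Sum>i=1..l. b i * real_of_int (X i))"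

definition dec :: "(real \<Rightarrow> nat) \<Rightarrow> real \<Rightarrow> real \<Rightarrow> nat" where
 "dec s a c = (if c = a then s a - 1 else s c)"

text \<open>
 The average of \<open>f (t + \<Sum>i. b i * X i)\<close> over words \<open>b\<close> of type \<open>s\<close>, as a recursion on the last letter. It does not
 mention the slice, so it also makes sense for a type that has the wrong sum; the two descriptions agree by
 \<open>favg_eq_slice\<close>.
\<close>

fun favg :: "real set \<Rightarrow> (real \<Rightarrow> real) \<Rightarrow> (nat \<Rightarrow> int) \<Rightarrow> nat \<Rightarrow> (real \<Rightarrow> nat) \<Rightarrow> real \<Rightarrow> real" where
 "favg S f X 0 s t = f t"
| "favg S f X (Suc l) s t =
   (\<Sum>a\<in>S. real (s a) / real (Suc l) * favg S f X l (dec s a) (t + a * real_of_int (X (Suc l))))"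

lemma favg_cong_type: "(\<And>a. a \<in> S \<Longrightarrow> s a = s' a) \<Longrightarrow> favg S f X l s t = favg S f X l s' t"
proof (induction l arbitrary: s s' t)
 case (Suc l)
 have "favg S f X l (dec s a) u = favg S f X l (dec s' a) u" if "a \<in> S" for a u
  using Suc.prems that by (intro Suc.IH) (auto simp: dec_def)
 then show ?case using Suc.prems by (auto intro!: sum.cong)
qed simp

lemma favg_cong_X: "(\<And>i. 1 \<le> i \<Longrightarrow> i \<le> l \<Longrightarrow> X i = X' i) \<Longrightarrow> favg S f X l s t = favg S f X' l s t"
proof (induction l arbitrary: s t)
 case (Suc l)
 have "favg S f X l u v = favg S f X' l u v" for u v
  using Suc.prems by (intro Suc.IH) auto
 then show ?case using Suc.prems[of "Suc l"] by simp
qed simp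

lemma favg_nonneg: "(\<And>t. 0 \<le> f t) \<Longrightarrow> 0 \<le> favg S f X l s t"
 by (induction l arbitrary: s t) (auto intro!: sum_nonneg)

lemma favg_shift_le:
 assumes "\<And>u. f (u + h) \<le> C * f u"
 shows "favg S f X l s (t + h) \<le> C * favg S f X l s t"
proof (induction l arbitrary: s t)
 case (Suc l)
 have "favg S f X (Suc l) s (t + h)
   = (\<Sum>a\<in>S. real (s a) / real (Suc l) * favg S f X l (dec s a) ((t + a * real_of_int (X (Suc l))) + h))"
  by (simp add: algebra_simps)
 also have "... \<le> (\<Sum>a\<in>S. real (s a) / real (Suc l) * (C * favg S f X l (dec s a) (t + a * real_of_int (X (Suc l)))))"
  using Suc.IH by (intro sum_mono mult_left_mono) auto
 also have "... = C * favg S f X (Suc l) s t" by (simp add: sum_distrib_left mult.left_commute)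
 finally show ?case .
qed (simp add: assms)

lemma favg_weights:
 assumes "(\<Sum>a\<in>S. s a) = Suc l"
 shows "(\<Sum>a\<in>S. real (s a) / real (Suc l)) = 1"
 unfolding sum_divide_distrib[symmetric] of_nat_sum[symmetric] assms by simp

lemma cnt_Suc: "cnt b (Suc l) a = cnt b l a + (if b (Suc l) = a then 1 else 0)"
proof -
 have "{i\<in>{1..Suc l}. b i = a} = (if b (Suc l) = a then insert (Suc l) {i\<in>{1..l}. b i = a} else {i\<in>{1..l}. b i = a})"
  by (auto simp: le_Suc_eq)
 then show ?thesis unfolding cnt_def by simp
qed

lemma cnt_0 [simp]: "cnt b 0 a = 0"
 by (simp add: cnt_def)

lemma cnt_cong: "(\<And>i. 1 \<le> i \<Longrightarrow> i \<le> l \<Longrightarrow> b i = b' i) \<Longrightarrow> cnt b l a = cnt b' l a"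
 unfolding cnt_def by (intro arg_cong[where f = card]) auto

lemma dot_Suc: "dot b X (Suc l) = dot b X l + b (Suc l) * real_of_int (X (Suc l))"
 by (simp add: dot_def)

lemma dot_cong: "(\<And>i. 1 \<le> i \<Longrightarrow> i \<le> l \<Longrightarrow> b i * real_of_int (X i) = b' i * real_of_int (X' i)) \<Longrightarrow> dot b X l = dot b' X' l"
 unfolding dot_def by (intro sum.cong) auto

lemma finite_slice: "finite S \<Longrightarrow> finite (slice S l s)"
 unfolding slice_def by (rule finite_subset[OF _ finite_PiE[of "{1..l}" "\<lambda>_. S"]]) auto

lemma sum_cnt:
 assumes "finite S" "\<And>i. 1 \<le> i \<Longrightarrow> i \<le> l \<Longrightarrow> b i \<in> S"
 shows "(\<Sum>a\<in>S. cnt b l a) = l"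
 using assms(2)
proof (induction l)
 case (Suc l)
 then show ?case using assms(1) by (simp add: cnt_Suc sum.distrib)
qed simp

lemma sum_slice_Suc:
 fixes \<phi> :: "(nat \<Rightarrow> real) \<Rightarrow> 'b::comm_monoid_add"
 assumes S: "finite S"
 shows "(\<Sum>b\<in>slice S (Suc l) s. \<phi> b) =
  (\<Sum>a\<in>S. if 0 < s a then \<Sum>b\<in>slice S l (dec s a). \<phi> (b(Suc l := a)) else 0)"
proof -
 let ?T = "\<lambda>a. if 0 < s a then (\<lambda>b. b(Suc l := a)) ` slice S l (dec s a) else {}"
 have eq: "slice S (Suc l) s = (\<Union>a\<in>S. ?T a)"
 proof (intro equalityI subsetI)
  fix b assume b: "b \<in> slice S (Suc l) s"
  define a where "a = b (Suc l)"
  define b' where "b' = restrict b {1..l}"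
  have aS: "a \<in> S" using b unfolding slice_def a_def by auto
  have cb: "cnt b (Suc l) c = s c" if "c \<in> S" for c using b that unfolding slice_def by auto
  have c': "cnt b' l c = cnt b l c" for c unfolding b'_def by (intro cnt_cong) auto
  have sa: "0 < s a" using cb[OF aS] unfolding cnt_Suc a_def by simp
  have "cnt b' l c = dec s a c" if "c \<in> S" for c
   using cb[OF that] unfolding c' cnt_Suc a_def by (auto simp: dec_def split: if_splits)
  moreover have "b' \<in> {1..l} \<rightarrow>\<^sub>E S" using b unfolding b'_def slice_def by auto
  ultimately have "b' \<in> slice S l (dec s a)" by (intro sliceI)
  moreover have "b = b'(Suc l := a)"
  proof
   fix i show "b i = (b'(Suc l := a)) i"
   proof -
    have bE: "b \<in> {1..Suc l} \<rightarrow>\<^sub>E S" using b unfolding slice_def by simp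
    consider "i = Suc l" | "i \<in> {1..l}" | "i \<notin> {1..Suc l}" by fastforce
    then show ?thesis
    proof cases
     case 1
     then show ?thesis by (simp add: a_def)
    next
     case 2
     then show ?thesis by (simp add: b'_def)
    next
     case 3
     then have "b i = undefined" by (rule PiE_arb[OF bE])
     moreover have "i \<noteq> Suc l" "i \<notin> {1..l}" using 3 by auto
     ultimately show ?thesis unfolding b'_def by (simp only: fun_upd_apply restrict_apply if_False)
    qed
   qed
  qed
  ultimately have "b \<in> (\<lambda>b. b(Suc l := a)) ` slice S l (dec s a)" by (intro image_eqI[where x = b'])
  then show "b \<in> (\<Union>a\<in>S. ?T a)" using aS sa by (intro UN_I[of a]) simp_all
 next
  fix b assume "b \<in> (\<Union>a\<in>S. ?T a)"
  then obtain a b' where a: "a \<in> S" "0 < s a" and b': "b' \<in> slice S l (dec s a)" and b: "b = b'(Suc l := a)"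
   by (auto split: if_splits)
  have "b \<in> {1..Suc l} \<rightarrow>\<^sub>E S" using b' a unfolding b slice_def by (auto simp: PiE_def extensional_def Pi_def le_Suc_eq)
  moreover have "cnt b (Suc l) c = s c" if "c \<in> S" for c
  proof -
   have "cnt b l c = cnt b' l c" unfolding b by (intro cnt_cong) auto
   also have "... = dec s a c" using b' that unfolding slice_def by auto
   finally show ?thesis unfolding cnt_Suc using a(2) by (auto simp: b dec_def)
  qed
  ultimately show "b \<in> slice S (Suc l) s" by (intro sliceI)
 qed
 have T: "?T a \<subseteq> {b. b (Suc l) = a}" for a by auto
 have "(\<Sum>b\<in>slice S (Suc l) s. \<phi> b) = (\<Sum>a\<in>S. \<Sum>b\<in>?T a. \<phi> b)"
  unfolding eq
 proof (rule sum.UNION_disjoint)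
  show "\<forall>a\<in>S. finite (?T a)" using finite_slice[OF S] by auto
  show "\<forall>a\<in>S. \<forall>c\<in>S. a \<noteq> c \<longrightarrow> ?T a \<inter> ?T c = {}"
   using T by blast
 qed (rule S)
 also have "... = (\<Sum>a\<in>S. if 0 < s a then \<Sum>b\<in>slice S l (dec s a). \<phi> (b(Suc l := a)) else 0)"
 proof (rule sum.cong[OF refl])
  fix a
  have "inj_on (\<lambda>b. b(Suc l := a)) (slice S l (dec s a))"
  proof (rule inj_onI)
   fix b b' assume b: "b \<in> slice S l (dec s a)" "b' \<in> slice S l (dec s a)"
    and e: "b(Suc l := a) = b'(Suc l := a)"
   show "b = b'"
   proof
    fix i show "b i = b' i"
    proof (cases "i = Suc l")
     case True
     have P: "b \<in> {1..l} \<rightarrow>\<^sub>E S" "b' \<in> {1..l} \<rightarrow>\<^sub>E S" using b unfolding slice_def by simp_all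
     have i: "i \<notin> {1..l}" using True by simp
     show ?thesis by (rule trans[OF PiE_arb[OF P(1) i] PiE_arb[OF P(2) i, symmetric]])
    next
     case False
     then show ?thesis using fun_cong[OF e, of i] by (simp only: fun_upd_apply if_False)
    qed
   qed
  qed
  then show "(\<Sum>b\<in>?T a. \<phi> b) = (if 0 < s a then \<Sum>b\<in>slice S l (dec s a). \<phi> (b(Suc l := a)) else 0)"
   by (simp add: sum.reindex)
 qed
 finally show ?thesis .
qed

lemma sum_dec:
 assumes "finite S" "a \<in> S" "0 < s a" "(\<Sum>c\<in>S. s c) = Suc l"
 shows "(\<Sum>c\<in>S. dec s a c) = (l::nat)"
proof -
 have "(\<Sum>c\<in>S. s c) = s a + (\<Sum>c\<in>S - {a}. s c)" using assms by (simp add: sum.remove)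
 moreover have "(\<Sum>c\<in>S. dec s a c) = (s a - 1) + (\<Sum>c\<in>S - {a}. s c)"
  using assms by (subst sum.remove[of S a]) (auto simp: dec_def intro!: sum.cong)
 ultimately show ?thesis using assms by linarith
qed

lemma card_slice:
 assumes S: "finite S" and s: "(\<Sum>a\<in>S. s a) = l"
 shows "real (card (slice S l s)) * (\<Prod>a\<in>S. fact (s a)) = fact l"
 using s
proof (induction l arbitrary: s)
 case 0
 then have s0: "\<forall>a\<in>S. s a = 0" using S by simp
 have "slice S 0 s = {\<lambda>_. undefined}" unfolding slice_def using s0 by auto
 then show ?case using s0 by simp
next
 case (Suc l)
 let ?P = "\<lambda>s. \<Prod>a\<in>S. (fact (s a) :: real)"
 have "real (card (slice S (Suc l) s)) = (\<Sum>b\<in>slice S (Suc l) s. 1)" by simp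
 also have "... = (\<Sum>a\<in>S. if 0 < s a then real (card (slice S l (dec s a))) else 0)"
  unfolding sum_slice_Suc[OF S] by (intro sum.cong) auto
 finally have "real (card (slice S (Suc l) s)) * ?P s
   = (\<Sum>a\<in>S. if 0 < s a then real (card (slice S l (dec s a))) * ?P s else 0)"
  unfolding sum_distrib_right by (simp only: sum_distrib_right if_distribR mult_zero_left) (auto intro!: sum.cong)
 also have "... = (\<Sum>a\<in>S. real (s a) * fact l)"
 proof (rule sum.cong[OF refl])
  fix a assume a: "a \<in> S"
  show "(if 0 < s a then real (card (slice S l (dec s a))) * ?P s else 0) = real (s a) * fact l"
  proof (cases "0 < s a")
   case True
   have "?P s = fact (s a) * (\<Prod>c\<in>S - {a}. fact (s c))" using S a by (simp add: prod.remove)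
   also have "fact (s a) = real (s a) * fact (s a - 1)" using True by (simp add: fact_reduce)
   also have "(\<Prod>c\<in>S - {a}. fact (s c)) = (\<Prod>c\<in>S - {a}. (fact (dec s a c) :: real))" by (intro prod.cong) (auto simp: dec_def)
   also have "real (s a) * fact (s a - 1) * ... = real (s a) * ?P (dec s a)"
    proof -
    have "?P (dec s a) = fact (s a - 1) * (\<Prod>c\<in>S - {a}. (fact (dec s a c) :: real))"
     using S a by (subst prod.remove[of S a]) (auto simp: dec_def)
    then show ?thesis by simp
   qed
   finally have "?P s = real (s a) * ?P (dec s a)" .
   moreover have "real (card (slice S l (dec s a))) * ?P (dec s a) = fact l"
    using sum_dec[OF S a True Suc.prems] by (intro Suc.IH)
   ultimately show ?thesis using True by (simp add: mult.left_commute)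
  qed simp
 qed
 also have "... = fact (Suc l)"
  unfolding sum_distrib_right[symmetric] of_nat_sum[symmetric] Suc.prems by simp
 finally show ?case .
qed

lemma card_slice_pos:
 assumes "finite S" "(\<Sum>a\<in>S. s a) = l"
 shows "0 < card (slice S l s)"
proof (rule ccontr)
 assume "\<not> 0 < card (slice S l s)"
 then show False using card_slice[OF assms] by simp
qed

lemma card_slice_dec:
 assumes S: "finite S" and a: "a \<in> S" "0 < s a" and s: "(\<Sum>c\<in>S. s c) = Suc l"
 shows "real (card (slice S l (dec s a))) = real (s a) / real (Suc l) * real (card (slice S (Suc l) s))"
proof -
 let ?P = "\<lambda>s. \<Prod>a\<in>S. (fact (s a) :: real)"
 have "?P s = fact (s a) * (\<Prod>c\<in>S - {a}. fact (s c))" using S a by (simp add: prod.remove)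
 also have "fact (s a) = real (s a) * fact (s a - 1)" using a by (simp add: fact_reduce)
 also have "(\<Prod>c\<in>S - {a}. fact (s c)) = (\<Prod>c\<in>S - {a}. (fact (dec s a c) :: real))" by (intro prod.cong) (auto simp: dec_def)
 also have "real (s a) * fact (s a - 1) * ... = real (s a) * ?P (dec s a)"
  proof -
    have "?P (dec s a) = fact (s a - 1) * (\<Prod>c\<in>S - {a}. (fact (dec s a c) :: real))"
     using S a by (subst prod.remove[of S a]) (auto simp: dec_def)
    then show ?thesis by simp
   qed
 finally have P: "?P s = real (s a) * ?P (dec s a)" .
 have pos: "0 < ?P (dec s a)" by (intro prod_pos) auto
 have "real (card (slice S l (dec s a))) * ?P (dec s a) = fact l"
  using sum_dec[OF S a s] by (intro card_slice[OF S])
 moreover have "real (card (slice S (Suc l) s)) * (real (s a) * ?P (dec s a)) = real (Suc l) * fact l"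
  using card_slice[OF S s] unfolding P by simp
 ultimately have "real (Suc l) * real (card (slice S l (dec s a))) * ?P (dec s a)
   = real (s a) * real (card (slice S (Suc l) s)) * ?P (dec s a)" by (simp only: mult.assoc mult.left_commute)
 then have "real (Suc l) * real (card (slice S l (dec s a))) = real (s a) * real (card (slice S (Suc l) s))"
  using pos by simp
 then show ?thesis by (simp add: field_simps)
qed

lemma favg_eq_slice:
 assumes S: "finite S" and s: "(\<Sum>a\<in>S. s a) = l"
 shows "favg S f X l s t = (\<Sum>b\<in>slice S l s. f (t + dot b X l)) / real (card (slice S l s))"
 using s
proof (induction l arbitrary: s t)
 case 0
 then have s0: "\<forall>a\<in>S. s a = 0" using S by simp
 have "slice S 0 s = {\<lambda>_. undefined}" unfolding slice_def using s0 by auto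
 then show ?case by (simp add: dot_def)
next
 case (Suc l)
 let ?C = "real (card (slice S (Suc l) s))"
 have C: "0 < ?C" using card_slice_pos[OF S Suc.prems] by simp
 have "favg S f X (Suc l) s t = (\<Sum>a\<in>S. (if 0 < s a then \<Sum>b\<in>slice S l (dec s a). f (t + dot (b(Suc l := a)) X (Suc l)) else 0) / ?C)"
  unfolding favg.simps
 proof (rule sum.cong[OF refl])
  fix a assume a: "a \<in> S"
  show "real (s a) / real (Suc l) * favg S f X l (dec s a) (t + a * real_of_int (X (Suc l)))
   = (if 0 < s a then \<Sum>b\<in>slice S l (dec s a). f (t + dot (b(Suc l := a)) X (Suc l)) else 0) / ?C"
  proof (cases "0 < s a")
   case True
   have d: "(\<Sum>c\<in>S. dec s a c) = l" by (rule sum_dec[OF S a True Suc.prems])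
   have D: "0 < real (card (slice S l (dec s a)))" using card_slice_pos[OF S d] by simp
   have dd: "t + a * real_of_int (X (Suc l)) + dot b X l = t + dot (b(Suc l := a)) X (Suc l)" for b
   proof -
    have "dot (b(Suc l := a)) X l = dot b X l" by (intro dot_cong) auto
    then show ?thesis unfolding dot_Suc by simp
   qed
   have e: "real (s a) / real (Suc l) = real (card (slice S l (dec s a))) / ?C"
    using card_slice_dec[OF S a True Suc.prems] C by (simp add: field_simps)
   have "favg S f X l (dec s a) (t + a * real_of_int (X (Suc l)))
     = (\<Sum>b\<in>slice S l (dec s a). f (t + dot (b(Suc l := a)) X (Suc l))) / real (card (slice S l (dec s a)))"
    unfolding Suc.IH[OF d] dd ..
   then show ?thesis unfolding e using True D by simp
  qed simp
 qed
 also have "... = (\<Sum>b\<in>slice S (Suc l) s. f (t + dot b X (Suc l))) / ?C"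
  unfolding sum_slice_Suc[OF S] by (simp only: sum_divide_distrib)
 finally show ?case .
qed

lemma prod_by_cnt:
 fixes g :: "real \<Rightarrow> real"
 assumes "finite S" "\<And>i. 1 \<le> i \<Longrightarrow> i \<le> l \<Longrightarrow> b i \<in> S"
 shows "(\<Prod>i\<in>{1..l}. g (b i)) = (\<Prod>a\<in>S. g a ^ cnt b l a)"
proof -
 have "(\<Prod>a\<in>S. \<Prod>i\<in>{i\<in>{1..l}. b i = a}. g (b i)) = (\<Prod>i\<in>{1..l}. g (b i))"
  using assms by (intro prod.group) auto
 moreover have "(\<Prod>i\<in>{i\<in>{1..l}. b i = a}. g (b i)) = g a ^ cnt b l a" for a
  unfolding cnt_def by simp
 ultimately show ?thesis by simp
qed

text \<open>
 All words of the same type have the same probability, so conditioning on the type gives the uniform law on the slice.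
\<close>

lemma random_average_eq_favg:
 assumes S: "finite (set_pmf \<xi>)" and s: "(\<Sum>a\<in>set_pmf \<xi>. s a) = l"
 shows "random_average \<xi> f s l X t = favg (set_pmf \<xi>) f X l s t"
proof -
 let ?S = "set_pmf \<xi>"
 define p where "p = Pi_pmf {1..l} 0 (\<lambda>_. \<xi>)"
 define E where "E = {b. \<forall>a\<in>?S. card {i\<in>{1..l}. b i = a} = s a}"
 define D where "D = set_pmf p \<inter> E"
 define ext where "ext b = (\<lambda>i. if i \<in> {1..l} then b i else (0::real))" for b :: "nat \<Rightarrow> real"
 define w where "w = (\<Prod>a\<in>?S. pmf \<xi> a ^ s a)"
 have sp: "set_pmf p = PiE_dflt {1..l} 0 (\<lambda>_. ?S)" unfolding p_def by (subst set_Pi_pmf) (auto simp: o_def)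
 have wpos: "0 < w" unfolding w_def by (intro prod_pos) (auto simp: pmf_positive)
 have bij: "bij_betw (\<lambda>b. restrict b {1..l}) D (slice ?S l s)"
 proof (rule bij_betw_byWitness[where f' = ext])
  show "\<forall>b\<in>D. ext (restrict b {1..l}) = b"
   unfolding D_def sp ext_def PiE_dflt_def by (auto simp: fun_eq_iff)
  show "\<forall>b\<in>slice ?S l s. restrict (ext b) {1..l} = b"
  proof
   fix b assume "b \<in> slice ?S l s"
   then have P: "b \<in> {1..l} \<rightarrow>\<^sub>E ?S" unfolding slice_def by simp
   have "restrict (ext b) {1..l} = restrict b {1..l}" unfolding ext_def by (intro restrict_ext) simp
   then show "restrict (ext b) {1..l} = b" using PiE_restrict[OF P] by simp
  qed
  have c: "cnt (restrict b {1..l}) l a = card {i\<in>{1..l}. b i = a}" for b a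
   unfolding cnt_def by (intro arg_cong[where f = card]) auto
  show "(\<lambda>b. restrict b {1..l}) ` D \<subseteq> slice ?S l s"
   unfolding D_def sp E_def slice_def PiE_dflt_def using c by auto
  have c': "card {i\<in>{1..l}. ext b i = a} = cnt b l a" for b a
   unfolding cnt_def ext_def by (intro arg_cong[where f = card]) auto
  show "ext ` slice ?S l s \<subseteq> D"
  proof (clarify)
   fix b assume b: "b \<in> slice ?S l s"
   have "ext b \<in> set_pmf p" using b unfolding sp PiE_dflt_def ext_def slice_def by auto
   moreover have "ext b \<in> E" using b c' unfolding E_def slice_def by auto
   ultimately show "ext b \<in> D" unfolding D_def by simp
  qed
 qed
 have pw: "pmf p b = w" if "b \<in> D" for b
 proof -
  have b: "\<forall>i\<in>{1..l}. b i \<in> ?S" "\<forall>i. i \<notin> {1..l} \<longrightarrow> b i = 0"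
   using that unfolding D_def sp PiE_dflt_def by auto
  have "pmf p b = (\<Prod>i\<in>{1..l}. pmf \<xi> (b i))" unfolding p_def using b by (subst pmf_Pi') auto
  also have "... = (\<Prod>a\<in>?S. pmf \<xi> a ^ cnt b l a)" by (rule prod_by_cnt[OF S]) (use b in auto)
  also have "... = w" unfolding w_def using that unfolding D_def E_def cnt_def by (intro prod.cong) auto
  finally show ?thesis .
 qed
 have cardD: "card D = card (slice ?S l s)" using bij by (rule bij_betw_same_card)
 have Cpos: "0 < card D" unfolding cardD by (rule card_slice_pos[OF S s])
 then have finD: "finite D" by (rule card_ge_0_finite)
 have ne: "set_pmf p \<inter> E \<noteq> {}" using Cpos unfolding D_def by auto
 have "measure_pmf.prob p E = measure_pmf.prob p D"
  unfolding D_def by (subst measure_Int_set_pmf[symmetric]) (simp add: Int_commute)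
 also have "... = (\<Sum>b\<in>D. pmf p b)" by (rule measure_measure_pmf_finite[OF finD])
 also have "... = real (card D) * w" using pw by simp
 finally have PE: "measure_pmf.prob p E = real (card D) * w" .
 have "random_average \<xi> f s l X t = measure_pmf.expectation (cond_pmf p E) (\<lambda>b. f (t + dot b X l))"
  unfolding random_average_def p_def E_def dot_def ..
 also have "... = (\<Sum>b\<in>D. f (t + dot b X l) * pmf (cond_pmf p E) b)"
  using finD ne unfolding D_def by (subst integral_measure_pmf_real[of "set_pmf p \<inter> E"]) (auto simp: set_cond_pmf[OF ne])
 also have "... = (\<Sum>b\<in>D. f (t + dot b X l) / real (card D))"
 proof (rule sum.cong[OF refl])
  fix b assume b: "b \<in> D"
  have "pmf (cond_pmf p E) b = w / (real (card D) * w)"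
   using b pw[OF b] PE by (subst pmf_cond[OF ne]) (auto simp: D_def)
  then show "f (t + dot b X l) * pmf (cond_pmf p E) b = f (t + dot b X l) / real (card D)"
   using wpos by simp
 qed
 also have "... = (\<Sum>b\<in>D. f (t + dot (restrict b {1..l}) X l)) / real (card (slice ?S l s))"
  unfolding cardD sum_divide_distrib[symmetric]
  by (intro arg_cong2[where f = "(/)"] sum.cong refl arg_cong[where f = f] arg_cong2[where f = "(+)"] dot_cong) auto
 also have "(\<Sum>b\<in>D. f (t + dot (restrict b {1..l}) X l)) = (\<Sum>b\<in>slice ?S l s. f (t + dot b X l))"
  using bij by (rule sum.reindex_bij_betw)
 also have "... / real (card (slice ?S l s)) = favg ?S f X l s t"
  by (rule favg_eq_slice[OF S s, symmetric])
 finally show ?thesis .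
qed

section \<open>Antichains and the Littlewood--Offord inequality\<close>

lemma card_permutations_with_prefix:
 assumes V: "finite V" and A: "A \<subseteq> V"
 shows "card {xs \<in> permutations_of_set V. set (take (card A) xs) = A} = fact (card A) * fact (card V - card A)"
proof -
 have fA: "finite A" using A V finite_subset by auto
 have "bij_betw (\<lambda>(xs, ys). xs @ ys) (permutations_of_set A \<times> permutations_of_set (V - A))
   {xs \<in> permutations_of_set V. set (take (card A) xs) = A}"
 proof (rule bij_betw_byWitness[where f' = "\<lambda>xs. (take (card A) xs, drop (card A) xs)"])
  show "\<forall>a\<in>permutations_of_set A \<times> permutations_of_set (V - A). (take (card A) (case a of (xs, ys) \<Rightarrow> xs @ ys), drop (card A) (case a of (xs, ys) \<Rightarrow> xs @ ys)) = a"
   by (auto simp: permutations_of_set_def distinct_card)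
  show "\<forall>a'\<in>{xs \<in> permutations_of_set V. set (take (card A) xs) = A}. (case (take (card A) a', drop (card A) a') of (xs, ys) \<Rightarrow> xs @ ys) = a'"
   by auto
  show "(\<lambda>(xs, ys). xs @ ys) ` (permutations_of_set A \<times> permutations_of_set (V - A)) \<subseteq> {xs \<in> permutations_of_set V. set (take (card A) xs) = A}"
   using A by (auto simp: permutations_of_set_def distinct_card)
  show "(\<lambda>xs. (take (card A) xs, drop (card A) xs)) ` {xs \<in> permutations_of_set V. set (take (card A) xs) = A} \<subseteq> permutations_of_set A \<times> permutations_of_set (V - A)"
  proof clarify
   fix xs assume xs: "xs \<in> permutations_of_set V" "set (take (card A) xs) = A"
   then have d: "distinct xs" "set xs = V" by (auto simp: permutations_of_set_def)
   have "set xs = set (take (card A) xs) \<union> set (drop (card A) xs)" by (metis append_take_drop_id set_append)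
   moreover have "set (take (card A) xs) \<inter> set (drop (card A) xs) = {}" using d(1) by (simp add: set_take_disj_set_drop_if_distinct)
   ultimately have "set (drop (card A) xs) = V - A" using xs(2) d(2) by auto
   then show "take (card A) xs \<in> permutations_of_set A \<and> drop (card A) xs \<in> permutations_of_set (V - A)"
    using xs d by (auto simp: permutations_of_set_def)
  qed
 qed
 then have "card {xs \<in> permutations_of_set V. set (take (card A) xs) = A} = card (permutations_of_set A \<times> permutations_of_set (V - A))"
  by (simp add: bij_betw_same_card)
 also have "... = fact (card A) * fact (card V - card A)"
  using V fA A by (simp add: card_cartesian_product card_Diff_subset)
 finally show ?thesis .
qed

text \<open>
 Each member \<open>A\<close> of the antichain is an initial segment of \<open>\<bar>A\<bar>! (\<bar>V\<bar> - \<bar>A\<bar>)!\<close> orderings of \<open>V\<close>, and no ordering has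
 two members as initial segments.
\<close>

lemma sperner:
 assumes V: "finite V" and F: "F \<subseteq> Pow V" and anti: "\<And>A B. A \<in> F \<Longrightarrow> B \<in> F \<Longrightarrow> A \<subseteq> B \<Longrightarrow> A = B"
 shows "card F \<le> card V choose (card V div 2)"
proof -
 define P where "P A = {xs \<in> permutations_of_set V. set (take (card A) xs) = A}" for A
 have finF: "finite F" using V F finite_subset by auto
 have nested: "A \<subseteq> B" if "xs \<in> P A" "xs \<in> P B" "card A \<le> card B" for A B xs
  using that set_take_subset_set_take[OF that(3), of xs] unfolding P_def by auto
 have disj: "P A \<inter> P B = {}" if "A \<in> F" "B \<in> F" "A \<noteq> B" for A B
 proof (rule ccontr)
  assume "P A \<inter> P B \<noteq> {}"
  then obtain xs where "xs \<in> P A" "xs \<in> P B" by auto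
  then show False using nested[of xs A B] nested[of xs B A] anti that by (metis nat_le_linear)
 qed
 have "(\<Sum>A\<in>F. fact (card A) * fact (card V - card A)) = (\<Sum>A\<in>F. card (P A))"
  using F card_permutations_with_prefix[OF V] unfolding P_def by (intro sum.cong) auto
 also have "... = card (\<Union>A\<in>F. P A)"
  using finF disj by (intro card_UN_disjoint[symmetric]) (auto simp: P_def)
 also have "... \<le> card (permutations_of_set V)" unfolding P_def by (intro card_mono) auto
 finally have le: "(\<Sum>A\<in>F. fact (card A) * fact (card V - card A)) \<le> (fact (card V) :: nat)" using V by simp
 have "card F * fact (card V) = (\<Sum>A\<in>F. fact (card A) * fact (card V - card A) * (card V choose card A))"
 proof -
  have "fact (card A) * fact (card V - card A) * (card V choose card A) = fact (card V)" if "A \<in> F" for A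
   using F V that by (intro binomial_fact_lemma card_mono) auto
  then show ?thesis by simp
 qed
 also have "... \<le> (\<Sum>A\<in>F. fact (card A) * fact (card V - card A) * (card V choose (card V div 2)))"
  by (intro sum_mono mult_left_mono binomial_maximum) auto
 also have "... \<le> fact (card V) * (card V choose (card V div 2))"
  unfolding sum_distrib_right[symmetric] using le by (rule mult_right_mono) simp
 finally show ?thesis by simp
qed

lemma central_binomial_even: "real (2 * n choose n) * sqrt (2 * real n + 1) \<le> 4 ^ n"
proof -
 have "real (2 * n choose n) ^ 2 * (2 * real n + 1) \<le> (4 ^ n) ^ 2"
 proof (induction n)
  case (Suc n)
  define C where "C = (2 * Suc n choose Suc n)"
  define D where "D = (Suc (2 * n) choose n)"
  define E where "E = (2 * n choose n)"
  have a: "Suc n * C = 2 * Suc n * D"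
  proof -
   have e: "2 * Suc n = Suc (Suc (2 * n))" by simp
   show ?thesis
    unfolding C_def D_def e using Suc_times_binomial_eq[of "Suc (2 * n)" n] by (metis mult.commute)
  qed
  have b: "Suc n * D = Suc (2 * n) * E"
   using binomial_absorb_comp[of "Suc (2 * n)" n] unfolding D_def E_def by (simp add: Suc_diff_le mult.commute)
  have "real (Suc n) * real C = 2 * (real (Suc n) * real D)" using arg_cong[OF a, of real] by (simp only: of_nat_mult of_nat_numeral mult.assoc)
  also have "real (Suc n) * real D = real (Suc (2 * n)) * real E" using arg_cong[OF b, of real] by (simp only: of_nat_mult)
  finally have rec: "real C * (real n + 1) = 2 * (2 * real n + 1) * real E" by (simp add: algebra_simps)
  have pos: "0 < (real n + 1)\<^sup>2" by simp
  have IH: "real E ^ 2 * (2 * real n + 1) \<le> (4 ^ n) ^ 2" using Suc.IH unfolding E_def .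
  have "(real C ^ 2 * (2 * real (Suc n) + 1)) * (real n + 1)\<^sup>2
    = (real C * (real n + 1))\<^sup>2 * (2 * real n + 3)" by (simp add: power_mult_distrib mult.commute mult.left_commute add.commute)
  also have "... = (real E ^ 2 * (2 * real n + 1)) * (4 * (2 * real n + 1) * (2 * real n + 3))"
   unfolding rec by (simp add: power2_eq_square algebra_simps)
  also have "... \<le> (4 ^ n) ^ 2 * (16 * (real n + 1)\<^sup>2)"
   by (rule mult_mono[OF IH]) (auto simp: power2_eq_square algebra_simps)
  also have "... = (4 ^ Suc n) ^ 2 * (real n + 1)\<^sup>2" by (simp add: power_mult_distrib)
  finally show ?case using pos unfolding C_def by (simp only: mult_le_cancel_right_pos)
 qed simp
 then have "(real (2 * n choose n) * sqrt (2 * real n + 1)) ^ 2 \<le> (4 ^ n) ^ 2" by (simp add: power_mult_distrib)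
 then show ?thesis by (rule power2_le_imp_le) simp
qed

lemma central_binomial_bound: "real (q choose (q div 2)) * sqrt (real q + 1) \<le> 2 ^ q"
proof (cases "even q")
 case True
 then obtain n where q: "q = 2 * n" by auto
 show ?thesis using central_binomial_even[of n] unfolding q by (simp add: power_mult)
next
 case False
 then obtain n where q: "q = 2 * n + 1" by (auto elim: oddE)
 have "2 * (q choose (q div 2)) = (2 * Suc n choose Suc n)"
 proof -
  have "(2 * Suc n choose Suc n) = (Suc (2 * n) choose n) + (Suc (2 * n) choose Suc n)" by simp
  also have "(Suc (2 * n) choose Suc n) = (Suc (2 * n) choose n)"
   using binomial_symmetric[of n "Suc (2 * n)"] by (simp add: Suc_diff_le)
  finally show ?thesis unfolding q by simp
 qed
 then have e: "real (q choose (q div 2)) = real (2 * Suc n choose Suc n) / 2"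
  by (metis nonzero_mult_div_cancel_left of_nat_mult of_nat_numeral zero_neq_numeral)
 have "real (q choose (q div 2)) * sqrt (real q + 1) \<le> real (2 * Suc n choose Suc n) / 2 * sqrt (2 * real (Suc n) + 1)"
  unfolding e by (intro mult_left_mono) (auto simp: q)
 also have "... \<le> 4 ^ Suc n / 2" using central_binomial_even[of "Suc n"] by simp
 also have "... = 2 ^ q" unfolding q by (simp add: power_mult)
 finally show ?thesis .
qed

text \<open>
 After complementing on the indices where \<open>e\<close> is negative, all steps increase the sum by at least \<open>g\<close>, so the
 sets with sum in a half-open interval of length \<open>g\<close> form an antichain.
\<close>

lemma littlewood_offord_full:
 fixes e :: "'a \<Rightarrow> real"
 assumes V: "finite V" and g: "0 < g" "\<And>i. i \<in> V \<Longrightarrow> g \<le> \<bar>e i\<bar>"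
 shows "card {\<sigma> \<in> Pow V. a \<le> sum e \<sigma> \<and> sum e \<sigma> < a + g} \<le> card V choose (card V div 2)"
proof -
 define N where "N = {i\<in>V. e i < 0}"
 define F where "F = {\<sigma> \<in> Pow V. a \<le> sum e \<sigma> \<and> sum e \<sigma> < a + g}"
 define fl where "fl \<sigma> = (\<sigma> - N) \<union> (N - \<sigma>)" for \<sigma>
 have flV: "fl \<sigma> \<subseteq> V" if "\<sigma> \<subseteq> V" for \<sigma> using that unfolding fl_def N_def by auto
 have flfl: "fl (fl \<sigma>) = \<sigma>" for \<sigma> unfolding fl_def by auto
 have s: "(\<Sum>i\<in>fl \<sigma>. \<bar>e i\<bar>) = sum e \<sigma> + (\<Sum>i\<in>N. \<bar>e i\<bar>)" if "\<sigma> \<subseteq> V" for \<sigma>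
 proof -
  have f: "finite \<sigma>" "finite N" using that V finite_subset unfolding N_def by auto
  have "(\<Sum>i\<in>fl \<sigma>. \<bar>e i\<bar>) = (\<Sum>i\<in>\<sigma> - N. \<bar>e i\<bar>) + (\<Sum>i\<in>N - \<sigma>. \<bar>e i\<bar>)"
   unfolding fl_def using f by (intro sum.union_disjoint) auto
  moreover have "(\<Sum>i\<in>\<sigma> - N. \<bar>e i\<bar>) = sum e (\<sigma> - N)" using that by (intro sum.cong) (auto simp: N_def)
  moreover have "sum e \<sigma> = sum e (\<sigma> - N) + sum e (\<sigma> \<inter> N)"
   using f by (metis add.commute sum.Int_Diff)
  moreover have "(\<Sum>i\<in>N. \<bar>e i\<bar>) = (\<Sum>i\<in>N \<inter> \<sigma>. \<bar>e i\<bar>) + (\<Sum>i\<in>N - \<sigma>. \<bar>e i\<bar>)" using f by (intro sum.Int_Diff)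
  moreover have "(\<Sum>i\<in>N \<inter> \<sigma>. \<bar>e i\<bar>) = - sum e (\<sigma> \<inter> N)"
   unfolding sum_negf[symmetric] by (intro sum.cong) (auto simp: N_def)
  ultimately show ?thesis by simp
 qed
 have "card (fl ` F) \<le> card V choose (card V div 2)"
 proof (rule sperner[OF V])
  show "fl ` F \<subseteq> Pow V" using flV unfolding F_def by auto
  fix A B assume A: "A \<in> fl ` F" and B: "B \<in> fl ` F" and sub: "A \<subseteq> B"
  obtain \<sigma> \<tau> where st: "\<sigma> \<in> F" "A = fl \<sigma>" "\<tau> \<in> F" "B = fl \<tau>" using A B by blast
  show "A = B"
  proof (rule ccontr)
   assume "A \<noteq> B"
   then obtain i where i: "i \<in> B" "i \<notin> A" using sub by auto
   have BV: "B \<subseteq> V" "finite B" "finite A" using st flV V sub unfolding F_def by (auto intro: finite_subset)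
   have "g + (\<Sum>i\<in>A. \<bar>e i\<bar>) \<le> \<bar>e i\<bar> + (\<Sum>i\<in>A. \<bar>e i\<bar>)" using g(2)[of i] i BV by auto
   also have "... = (\<Sum>i\<in>insert i A. \<bar>e i\<bar>)" using i BV by simp
   also have "... \<le> (\<Sum>i\<in>B. \<bar>e i\<bar>)" using i sub BV by (intro sum_mono2) auto
   finally show False using s[of \<sigma>] s[of \<tau>] st unfolding F_def by auto
  qed
 qed
 moreover have "inj_on fl F" by (rule inj_on_inverseI[where g = fl]) (rule flfl)
 ultimately show ?thesis unfolding F_def by (simp add: card_image)
qed

text \<open>
 Condition on the intersection with \<open>V - D\<close> and apply the full inequality on \<open>D\<close>.
\<close>

lemma littlewood_offord_part:
 fixes e :: "'a \<Rightarrow> real"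
 assumes V: "finite V" and D: "D \<subseteq> V" and g: "0 < g" "\<And>i. i \<in> D \<Longrightarrow> g \<le> \<bar>e i\<bar>"
 shows "real (card {\<sigma> \<in> Pow V. a \<le> sum e \<sigma> \<and> sum e \<sigma> < a + g}) * sqrt (real (card D) + 1) \<le> 2 ^ card V"
proof -
 have fD: "finite D" "finite (V - D)" using V D finite_subset by auto
 let ?F = "{\<sigma> \<in> Pow V. a \<le> sum e \<sigma> \<and> sum e \<sigma> < a + g}"
 let ?G = "\<lambda>\<tau>. {\<rho> \<in> Pow D. a - sum e \<tau> \<le> sum e \<rho> \<and> sum e \<rho> < a - sum e \<tau> + g}"
 have "?F \<subseteq> (\<Union>\<tau>\<in>Pow (V - D). (\<lambda>\<rho>. \<rho> \<union> \<tau>) ` ?G \<tau>)"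
 proof
  fix \<sigma> assume s: "\<sigma> \<in> ?F"
  have "sum e \<sigma> = sum e (\<sigma> \<inter> D) + sum e (\<sigma> - D)" using s V by (intro sum.Int_Diff) (auto intro: finite_subset)
  then have "\<sigma> \<inter> D \<in> ?G (\<sigma> - D)" using s by auto
  moreover have "\<sigma> = (\<sigma> \<inter> D) \<union> (\<sigma> - D)" by auto
  ultimately have "\<sigma> \<in> (\<lambda>\<rho>. \<rho> \<union> (\<sigma> - D)) ` ?G (\<sigma> - D)" by (rule rev_image_eqI)
  moreover have "\<sigma> - D \<in> Pow (V - D)" using s by auto
  ultimately show "\<sigma> \<in> (\<Union>\<tau>\<in>Pow (V - D). (\<lambda>\<rho>. \<rho> \<union> \<tau>) ` ?G \<tau>)" by blast
 qed
 then have "card ?F \<le> card (\<Union>\<tau>\<in>Pow (V - D). (\<lambda>\<rho>. \<rho> \<union> \<tau>) ` ?G \<tau>)"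
  using fD by (intro card_mono) auto
 also have "... \<le> (\<Sum>\<tau>\<in>Pow (V - D). card ((\<lambda>\<rho>. \<rho> \<union> \<tau>) ` ?G \<tau>))" using fD by (intro card_UN_le) auto
 also have "... \<le> (\<Sum>\<tau>\<in>Pow (V - D). card D choose (card D div 2))"
 proof (rule sum_mono)
  fix \<tau>
  have "card ((\<lambda>\<rho>. \<rho> \<union> \<tau>) ` ?G \<tau>) \<le> card (?G \<tau>)" using fD by (intro card_image_le) auto
  also have "... \<le> card D choose (card D div 2)" by (rule littlewood_offord_full[OF fD(1) g])
  finally show "card ((\<lambda>\<rho>. \<rho> \<union> \<tau>) ` ?G \<tau>) \<le> card D choose (card D div 2)" .
 qed
 also have "... = 2 ^ (card V - card D) * (card D choose (card D div 2))"
  using fD D V by (simp add: card_Pow card_Diff_subset)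
 finally have "real (card ?F) \<le> real (2 ^ (card V - card D) * (card D choose (card D div 2)))" by (simp only: of_nat_le_iff)
 then have "real (card ?F) \<le> 2 ^ (card V - card D) * real (card D choose (card D div 2))" by (simp only: of_nat_mult of_nat_power of_nat_numeral)
 then have "real (card ?F) * sqrt (real (card D) + 1) \<le> 2 ^ (card V - card D) * real (card D choose (card D div 2)) * sqrt (real (card D) + 1)"
  by (rule mult_right_mono) simp
 also have "... \<le> 2 ^ (card V - card D) * 2 ^ card D"
  unfolding mult.assoc by (intro mult_left_mono central_binomial_bound) simp
 also have "... = 2 ^ card V" using card_mono[OF V D] by (simp flip: power_add)
 finally show ?thesis .
qed

lemma littlewood_offord:
 fixes e :: "'a \<Rightarrow> real"
 assumes V: "finite V" and D: "D \<subseteq> V" and g: "0 < g" "\<And>i. i \<in> D \<Longrightarrow> g \<le> \<bar>e i\<bar>" and \<Lambda>: "0 \<le> \<Lambda>"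
 shows "real (card {\<sigma> \<in> Pow V. a \<le> sum e \<sigma> \<and> sum e \<sigma> \<le> a + \<Lambda>}) \<le> (\<Lambda> / g + 1) * (2 ^ card V / sqrt (real (card D) + 1))"
proof -
 define K where "K = nat \<lfloor>\<Lambda> / g\<rfloor> + 1"
 have K: "real K \<le> \<Lambda> / g + 1" unfolding K_def using \<Lambda> g by simp
 let ?F = "{\<sigma> \<in> Pow V. a \<le> sum e \<sigma> \<and> sum e \<sigma> \<le> a + \<Lambda>}"
 let ?G = "\<lambda>k. {\<sigma> \<in> Pow V. a + real k * g \<le> sum e \<sigma> \<and> sum e \<sigma> < a + real k * g + g}"
 have "?F \<subseteq> (\<Union>k<K. ?G k)"
 proof
  fix \<sigma> assume s: "\<sigma> \<in> ?F"
  define k where "k = nat \<lfloor>(sum e \<sigma> - a) / g\<rfloor>"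
  have nn: "0 \<le> (sum e \<sigma> - a) / g" using s g by simp
  have "(sum e \<sigma> - a) / g \<le> \<Lambda> / g" using s g by (intro divide_right_mono) auto
  then have "k < K" unfolding k_def K_def using nn by (simp add: floor_mono nat_mono le_imp_less_Suc)
  moreover have "real k \<le> (sum e \<sigma> - a) / g" "(sum e \<sigma> - a) / g < real k + 1" unfolding k_def using nn by linarith+
  then have "real k * g \<le> sum e \<sigma> - a" "sum e \<sigma> - a < (real k + 1) * g" using g by (simp_all add: field_simps)
  then have "\<sigma> \<in> ?G k" using s by (auto simp: algebra_simps)
  ultimately show "\<sigma> \<in> (\<Union>k<K. ?G k)" by blast
 qed
 then have "card ?F \<le> card (\<Union>k<K. ?G k)" using V by (intro card_mono) auto
 also have "... \<le> (\<Sum>k<K. card (?G k))" by (intro card_UN_le) auto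
 finally have "real (card ?F) \<le> real (\<Sum>k<K. card (?G k))" by (simp only: of_nat_le_iff)
 also have "... = (\<Sum>k<K. real (card (?G k)))" by (rule of_nat_sum)
 also have "... \<le> (\<Sum>k<K. 2 ^ card V / sqrt (real (card D) + 1))"
 proof (rule sum_mono)
  fix k
  show "real (card (?G k)) \<le> 2 ^ card V / sqrt (real (card D) + 1)"
   using littlewood_offord_part[OF V D g, where a = "a + real k * g"] by (simp add: le_divide_eq add_pos_nonneg)
 qed
 also have "... = real K * (2 ^ card V / sqrt (real (card D) + 1))" by simp
 also have "... \<le> (\<Lambda> / g + 1) * (2 ^ card V / sqrt (real (card D) + 1))" using K by (intro mult_right_mono) auto
 finally show ?thesis .
qed

section \<open>Anticoncentration over slices by swapping neighbouring coordinates\<close>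

text \<open>
 The involution of the positions that exchanges \<open>2 j - 1\<close> and \<open>2 j\<close> for every \<open>j \<in> \<sigma>\<close>.
\<close>

definition swp :: "nat set \<Rightarrow> nat \<Rightarrow> nat" where
 "swp \<sigma> i = (if 1 \<le> i \<and> (i + 1) div 2 \<in> \<sigma> then (if odd i then i + 1 else i - 1) else i)"

definition differ :: "nat \<Rightarrow> (nat \<Rightarrow> real) \<Rightarrow> nat set" where
 "differ Q b = {j\<in>{1..Q}. b (2 * j - 1) \<noteq> b (2 * j)}"

lemma swp_swp: "swp \<sigma> (swp \<sigma> i) = i"
proof (cases "1 \<le> i \<and> (i + 1) div 2 \<in> \<sigma>")
 case True
 show ?thesis
 proof (cases "odd i")
  case odd: True
  then obtain k where k: "i = 2 * k + 1" by (auto elim: oddE)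
  show ?thesis using True unfolding swp_def k by auto
 next
  case False
  then obtain k where k: "i = 2 * k" by auto
  then have "1 \<le> k" using True by auto
  then obtain m where m: "k = Suc m" by (cases k) auto
  show ?thesis using True unfolding swp_def k m by auto
 qed
qed (auto simp: swp_def)

lemma swp_range:
 assumes "\<sigma> \<subseteq> {1..Q}" "2 * Q \<le> l"
 shows "swp \<sigma> i \<in> {1..l} \<longleftrightarrow> i \<in> {1..l}"
proof -
 have a: "swp \<sigma> i \<in> {1..l}" if i: "i \<in> {1..l}" for i
 proof (cases "(i + 1) div 2 \<in> \<sigma>")
  case True
  then have "(i + 1) div 2 \<le> Q" using assms by auto
  then have "odd i \<Longrightarrow> i + 1 \<le> l" using assms by (elim oddE) auto
  moreover have "even i \<Longrightarrow> 1 \<le> i - 1" using i by (elim evenE) auto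
  ultimately show ?thesis using i by (auto simp: swp_def)
 qed (use i in \<open>simp add: swp_def\<close>)
 show ?thesis
 proof
  assume "swp \<sigma> i \<in> {1..l}"
  from a[OF this] show "i \<in> {1..l}" unfolding swp_swp .
 next
  assume "i \<in> {1..l}"
  then show "swp \<sigma> i \<in> {1..l}" by (rule a)
 qed
qed

lemma slice_swp:
 assumes "\<sigma> \<subseteq> {1..Q}" "2 * Q \<le> l" "b \<in> slice S l s"
 shows "b \<circ> swp \<sigma> \<in> slice S l s"
proof -
 have b: "b \<in> {1..l} \<rightarrow>\<^sub>E S" "\<And>a. a \<in> S \<Longrightarrow> cnt b l a = s a" using assms(3) unfolding slice_def by auto
 have "b \<circ> swp \<sigma> \<in> {1..l} \<rightarrow>\<^sub>E S"
 proof (rule PiE_I)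
  fix i assume "i \<in> {1..l}"
  then have "swp \<sigma> i \<in> {1..l}" using swp_range[OF assms(1,2)] by blast
  then show "(b \<circ> swp \<sigma>) i \<in> S" using b(1) unfolding o_def by (rule PiE_mem[rotated])
 next
  fix i assume "i \<notin> {1..l}"
  then have "swp \<sigma> i \<notin> {1..l}" using swp_range[OF assms(1,2)] by blast
  then show "(b \<circ> swp \<sigma>) i = undefined" using b(1) unfolding o_def by (rule PiE_arb[rotated])
 qed
 moreover have "cnt (b \<circ> swp \<sigma>) l a = cnt b l a" for a
 proof -
  have "bij_betw (swp \<sigma>) {i\<in>{1..l}. (b \<circ> swp \<sigma>) i = a} {i\<in>{1..l}. b i = a}"
   by (rule bij_betw_byWitness[where f' = "swp \<sigma>"]) (use swp_range[OF assms(1,2)] in \<open>auto simp: swp_swp simp del: atLeastAtMost_iff\<close>)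
  then show ?thesis unfolding cnt_def by (rule bij_betw_same_card)
 qed
 ultimately show ?thesis using b(2) unfolding slice_def by auto
qed

lemma dot_upd:
 assumes "p \<in> {1..l}"
 shows "dot (b(p := u)) X l = dot b X l + (u - b p) * real_of_int (X p)"
proof -
 have "dot c X l = c p * real_of_int (X p) + (\<Sum>i\<in>{1..l} - {p}. c i * real_of_int (X i))" for c
  unfolding dot_def using assms by (simp add: sum.remove)
 moreover have "(\<Sum>i\<in>{1..l} - {p}. (b(p := u)) i * real_of_int (X i)) = (\<Sum>i\<in>{1..l} - {p}. b i * real_of_int (X i))"
  by (intro sum.cong) auto
 ultimately show ?thesis by (simp add: algebra_simps)
qed

lemma dot_swp:
 assumes "finite \<sigma>" "\<sigma> \<subseteq> {1..Q}" "2 * Q \<le> l"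
 shows "dot (b \<circ> swp \<sigma>) X l = dot b X l + (\<Sum>j\<in>\<sigma>. (b (2 * j) - b (2 * j - 1)) * real_of_int (X (2 * j - 1) - X (2 * j)))"
 using assms(1,2)
proof (induction \<sigma> rule: finite_induct)
 case empty
 have "b \<circ> swp {} = b" by (auto simp: swp_def fun_eq_iff)
 then show ?case by simp
next
 case (insert j \<sigma>)
 have j: "1 \<le> j" "2 * j \<le> l" using insert.prems assms(3) by auto
 let ?c = "b \<circ> swp \<sigma>"
 have eq: "b \<circ> swp (insert j \<sigma>) = ?c(2 * j - 1 := b (2 * j), 2 * j := b (2 * j - 1))"
 proof
  fix i
  consider "i = 2 * j - 1" | "i = 2 * j" | "i \<noteq> 2 * j - 1" "i \<noteq> 2 * j" by auto
  then show "(b \<circ> swp (insert j \<sigma>)) i = (?c(2 * j - 1 := b (2 * j), 2 * j := b (2 * j - 1))) i"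
  proof cases
   case 1
   then show ?thesis using j by (auto simp: swp_def)
  next
   case 2
   then show ?thesis using j by (auto simp: swp_def)
  next
   case 3
   then have "(i + 1) div 2 \<noteq> j \<or> i = 0" by presburger
   then have "swp (insert j \<sigma>) i = swp \<sigma> i" by (auto simp: swp_def)
   then show ?thesis using 3 by simp
  qed
 qed
 have cj: "?c (2 * j - 1) = b (2 * j - 1)" "?c (2 * j) = b (2 * j)"
  using insert.hyps j by (auto simp: swp_def)
 have "dot (b \<circ> swp (insert j \<sigma>)) X l
   = dot ?c X l + (b (2 * j) - b (2 * j - 1)) * real_of_int (X (2 * j - 1)) + (b (2 * j - 1) - b (2 * j)) * real_of_int (X (2 * j))"
  unfolding eq using j cj by (subst dot_upd, force, subst dot_upd, force) auto
 also have "... = dot ?c X l + (b (2 * j) - b (2 * j - 1)) * real_of_int (X (2 * j - 1) - X (2 * j))"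
  by (simp add: algebra_simps)
 also have "dot ?c X l = dot b X l + (\<Sum>j\<in>\<sigma>. (b (2 * j) - b (2 * j - 1)) * real_of_int (X (2 * j - 1) - X (2 * j)))"
  by (rule insert.IH) (use insert.prems in auto)
 finally show ?case unfolding sum.insert[OF insert.hyps] by (simp only: ac_simps)
qed

text \<open>
 The swaps act on the slice, so the number of words with linear form in an interval is the average over
 the group of swaps of the number of such words in the orbit. Along an orbit the linear form is a
 subset sum in which the pairs with different letters contribute steps of size at least \<open>g\<close>.
\<close>

lemma slice_concentration_le:
 assumes S: "finite S" and l: "2 * Q \<le> l" and g: "0 < g" and \<Lambda>: "0 \<le> \<Lambda>"
  and gap: "\<And>b j. b \<in> slice S l s \<Longrightarrow> j \<in> differ Q b \<Longrightarrow> g \<le> \<bar>(b (2 * j) - b (2 * j - 1)) * real_of_int (X (2 * j - 1) - X (2 * j))\<bar>"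
 shows "real (card {b \<in> slice S l s. a \<le> dot b X l \<and> dot b X l \<le> a + \<Lambda>})
   \<le> (\<Lambda> / g + 1) * (\<Sum>b\<in>slice S l s. 1 / sqrt (real (card (differ Q b)) + 1))"
proof -
 let ?P = "\<lambda>x. a \<le> x \<and> x \<le> a + \<Lambda>"
 let ?N = "real (card {b \<in> slice S l s. ?P (dot b X l)})"
 let ?V = "{1..Q}"
 have inv: "(\<Sum>b\<in>slice S l s. of_bool (?P (dot (b \<circ> swp \<sigma>) X l)) :: real) = ?N" if "\<sigma> \<in> Pow ?V" for \<sigma>
 proof -
  have "(\<Sum>b\<in>slice S l s. of_bool (?P (dot (b \<circ> swp \<sigma>) X l)) :: real) = (\<Sum>b\<in>slice S l s. of_bool (?P (dot b X l)))"
   by (rule sum.reindex_bij_witness[where i = "\<lambda>b. b \<circ> swp \<sigma>" and j = "\<lambda>b. b \<circ> swp \<sigma>"])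
     (use that slice_swp[OF _ l, of \<sigma> _ S s] in \<open>auto simp: o_def swp_swp\<close>)
  also have "... = ?N" using finite_slice[OF S] by (simp add: of_bool_def sum.If_cases Int_def)
  finally show ?thesis .
 qed
 have "2 ^ Q * ?N = (\<Sum>\<sigma>\<in>Pow ?V. \<Sum>b\<in>slice S l s. of_bool (?P (dot (b \<circ> swp \<sigma>) X l)))"
  using inv by (simp add: card_Pow)
 also have "... = (\<Sum>b\<in>slice S l s. \<Sum>\<sigma>\<in>Pow ?V. of_bool (?P (dot (b \<circ> swp \<sigma>) X l)))" by (rule sum.swap)
 also have "... \<le> (\<Sum>b\<in>slice S l s. (\<Lambda> / g + 1) * (2 ^ Q / sqrt (real (card (differ Q b)) + 1)))"
 proof (rule sum_mono)
  fix b assume b: "b \<in> slice S l s"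
  let ?e = "\<lambda>j. (b (2 * j) - b (2 * j - 1)) * real_of_int (X (2 * j - 1) - X (2 * j))"
  have "(\<Sum>\<sigma>\<in>Pow ?V. of_bool (?P (dot (b \<circ> swp \<sigma>) X l)) :: real) = real (card {\<sigma> \<in> Pow ?V. ?P (dot (b \<circ> swp \<sigma>) X l)})"
   by (simp add: of_bool_def sum.If_cases Int_def)
  also have "{\<sigma> \<in> Pow ?V. ?P (dot (b \<circ> swp \<sigma>) X l)} = {\<sigma> \<in> Pow ?V. a - dot b X l \<le> sum ?e \<sigma> \<and> sum ?e \<sigma> \<le> a - dot b X l + \<Lambda>}"
  proof (rule Collect_cong)
   fix \<sigma>
   show "\<sigma> \<in> Pow ?V \<and> ?P (dot (b \<circ> swp \<sigma>) X l) \<longleftrightarrow> \<sigma> \<in> Pow ?V \<and> a - dot b X l \<le> sum ?e \<sigma> \<and> sum ?e \<sigma> \<le> a - dot b X l + \<Lambda>"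
   proof (cases "\<sigma> \<in> Pow ?V")
    case True
    then have "finite \<sigma>" by (auto intro: finite_subset)
    then show ?thesis using True dot_swp[OF _ _ l, of \<sigma> b X] by auto
   qed simp
  qed
  also have "real (card ...) \<le> (\<Lambda> / g + 1) * (2 ^ card ?V / sqrt (real (card (differ Q b)) + 1))"
   by (rule littlewood_offord) (use g \<Lambda> gap[OF b] in \<open>auto simp: differ_def\<close>)
  finally show "(\<Sum>\<sigma>\<in>Pow ?V. of_bool (?P (dot (b \<circ> swp \<sigma>) X l)) :: real)
   \<le> (\<Lambda> / g + 1) * (2 ^ Q / sqrt (real (card (differ Q b)) + 1))" by (simp only: card_atLeastAtMost diff_Suc_1 Suc_eq_plus1[symmetric])
 qed
 also have "... = 2 ^ Q * ((\<Lambda> / g + 1) * (\<Sum>b\<in>slice S l s. 1 / sqrt (real (card (differ Q b)) + 1)))"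
  unfolding sum_distrib_left by (intro sum.cong) auto
 finally show ?thesis by simp
qed

section \<open>Entropy of slices\<close>

lemma power_div_fact_le_exp:
 fixes x :: real
 assumes "0 \<le> x"
 shows "x ^ n / fact n \<le> exp x"
proof -
 have "(\<Sum>k\<in>{n}. x ^ k / fact k) \<le> (\<Sum>k. x ^ k / fact k)"
  using assms summable_exp_generic[of x] by (intro sum_le_suminf) (auto simp: divide_inverse mult.commute)
 also have "... = exp x" unfolding exp_def by (simp add: divide_inverse mult.commute scaleR_conv_of_real)
 finally show ?thesis by simp
qed

lemma ln_fact_ge: "real n * ln (real n) - real n \<le> ln (fact n)"
proof (cases "n = 0")
 case False
 have "real n ^ n / fact n \<le> exp (real n)" by (rule power_div_fact_le_exp) simp
 then have "real n ^ n \<le> exp (real n) * fact n" by (simp add: divide_le_eq)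
 then have "ln (real n ^ n) \<le> ln (exp (real n) * fact n)" using False by (subst ln_le_cancel_iff) auto
 then show ?thesis using False by (simp add: ln_mult ln_realpow)
qed simp

lemma ln_fact_le: "1 \<le> n \<Longrightarrow> ln (fact n) \<le> real n * ln (real n) - real n + 1 + ln (real n)"
proof (induction n rule: nat_induct_at_least)
 case base
 then show ?case by simp
next
 case (Suc n)
 have n: "1 \<le> n" by fact
 have "ln (real n / (real n + 1)) \<le> real n / (real n + 1) - 1" using n by (intro ln_le_minus_one) simp
 also have "... = - 1 / (real n + 1)" using n by (simp add: field_simps)
 finally have "ln (real n) - ln (real n + 1) \<le> - 1 / (real n + 1)" using n by (simp add: ln_div)
 then have "(real n + 1) * (ln (real n) - ln (real n + 1)) \<le> (real n + 1) * (- 1 / (real n + 1))"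
  by (intro mult_left_mono) auto
 then have k: "(real n + 1) * ln (real n) + 1 \<le> (real n + 1) * ln (real n + 1)" using n by (simp add: algebra_simps)
 have "ln (fact (Suc n)) = ln (real n + 1) + ln (fact n)"
  by (simp add: ln_mult add.commute)
 then show ?case using Suc.IH k by (simp add: algebra_simps)
qed

lemma ln_card_slice_ge:
 assumes S: "finite S" and s: "(\<Sum>a\<in>S. s a) = l" and s1: "\<And>a. a \<in> S \<Longrightarrow> 1 \<le> s a"
  and p: "\<And>a. a \<in> S \<Longrightarrow> 0 < p a" and l: "1 \<le> l"
 shows "- (\<Sum>a\<in>S. real (s a) * (real (s a) / (real l * p a) - 1)) - real (card S) - (\<Sum>a\<in>S. ln (real (s a)))
  \<le> ln (real (card (slice S l s))) + (\<Sum>a\<in>S. real (s a) * ln (p a))"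
proof -
 have pos: "0 < real (card (slice S l s))" using card_slice_pos[OF S s] by simp
 have "ln (fact l) = ln (real (card (slice S l s)) * (\<Prod>a\<in>S. fact (s a)))" using card_slice[OF S s] by simp
 also have "... = ln (real (card (slice S l s))) + (\<Sum>a\<in>S. ln (fact (s a)))"
  using pos S by (simp add: ln_mult_pos prod_pos ln_prod)
 finally have e: "ln (real (card (slice S l s))) = ln (fact l) - (\<Sum>a\<in>S. ln (fact (s a)))" by simp
 have ls: "real l = (\<Sum>a\<in>S. real (s a))" using s by (simp flip: of_nat_sum)
 have "(\<Sum>a\<in>S. ln (fact (s a))) \<le> (\<Sum>a\<in>S. real (s a) * ln (real (s a)) - real (s a) + 1 + ln (real (s a)))"
  using s1 by (intro sum_mono ln_fact_le) auto
 also have "... = (\<Sum>a\<in>S. real (s a) * ln (real (s a))) - real l + real (card S) + (\<Sum>a\<in>S. ln (real (s a)))"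
  using S unfolding ls by (simp add: sum.distrib sum_subtractf)
 finally have u: "(\<Sum>a\<in>S. ln (fact (s a))) \<le> (\<Sum>a\<in>S. real (s a) * ln (real (s a))) - real l + real (card S) + (\<Sum>a\<in>S. ln (real (s a)))" .
 have "real l * ln (real l) = (\<Sum>a\<in>S. real (s a) * ln (real l))" unfolding ls by (simp add: sum_distrib_right)
 then have lo: "(\<Sum>a\<in>S. real (s a) * ln (real l)) - real l \<le> ln (fact l)" using ln_fact_ge[of l] by simp
 have "- (\<Sum>a\<in>S. real (s a) * (real (s a) / (real l * p a) - 1))
   \<le> (\<Sum>a\<in>S. real (s a) * ln (real l)) - (\<Sum>a\<in>S. real (s a) * ln (real (s a))) + (\<Sum>a\<in>S. real (s a) * ln (p a))"
  unfolding sum_negf[symmetric] sum_subtractf[symmetric] sum.distrib[symmetric]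
 proof (rule sum_mono)
  fix a assume a: "a \<in> S"
  have "ln (real (s a) / (real l * p a)) \<le> real (s a) / (real l * p a) - 1"
   using s1[OF a] p[OF a] l by (intro ln_le_minus_one) auto
  moreover have "ln (real (s a) / (real l * p a)) = ln (real (s a)) - ln (real l) - ln (p a)"
   using s1[OF a] p[OF a] l by (simp add: ln_div ln_mult)
  ultimately have "real (s a) * (ln (real (s a)) - ln (real l) - ln (p a)) \<le> real (s a) * (real (s a) / (real l * p a) - 1)"
   by (intro mult_left_mono) auto
  then show "- (real (s a) * (real (s a) / (real l * p a) - 1)) \<le> real (s a) * ln (real l) - real (s a) * ln (real (s a)) + real (s a) * ln (p a)"
   by (simp add: algebra_simps)
 qed
 then show ?thesis using e u lo by linarith
qed

lemma exp_poly_decay: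
 fixes x k A :: real
 assumes "0 < x" "0 < k"
 shows "((\<lambda>n. exp (- 2 * x * real n + A + k * ln (real n)) * sqrt (real n)) \<longlongrightarrow> 0) at_top"
 using assms by real_asymp

text \<open>
 The data of a discrete law: support, probabilities, a lower bound for the probabilities, and bounds from
 below and above for the distances between letters.
\<close>

locale alphabet =
 fixes S :: "real set" and p :: "real \<Rightarrow> real" and pm gS dS :: real
 assumes S: "finite S" "2 \<le> card S"
  and pm: "0 < pm" "\<And>a. a \<in> S \<Longrightarrow> pm \<le> p a" and psum: "(\<Sum>a\<in>S. p a) = 1"
  and gS: "0 < gS" "\<And>a b. a \<in> S \<Longrightarrow> b \<in> S \<Longrightarrow> a \<noteq> b \<Longrightarrow> gS \<le> \<bar>a - b\<bar>"
  and dS: "\<And>a b. a \<in> S \<Longrightarrow> b \<in> S \<Longrightarrow> \<bar>a - b\<bar> \<le> dS"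
begin

lemma ppos: "a \<in> S \<Longrightarrow> 0 < p a"
 using pm by force

lemma two_letters: obtains a b where "a \<in> S" "b \<in> S" "a \<noteq> b"
proof -
 have "\<not> card S \<le> Suc 0" using S(2) by simp
 then show ?thesis using card_le_Suc0_iff_eq[OF S(1)] that by blast
qed

lemma other_letter:
 assumes "a \<in> S" obtains b where "b \<in> S" "b \<noteq> a"
 using two_letters assms by metis

lemma p_le: "a \<in> S \<Longrightarrow> p a \<le> 1 - pm"
proof -
 assume a: "a \<in> S"
 then obtain b where b: "b \<in> S" "b \<noteq> a" by (rule other_letter)
 have "p a + p b = (\<Sum>c\<in>{a, b}. p c)" using b by simp
 also have "... \<le> (\<Sum>c\<in>S. p c)" using S a b ppos by (intro sum_mono2) (auto simp: less_imp_le)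
 finally show ?thesis using psum pm(2)[OF b(1)] by simp
qed

lemma pm_le: "pm \<le> 1 / 2"
proof -
 obtain a where a: "a \<in> S" using two_letters by metis
 show ?thesis using p_le[OF a] pm(2)[OF a] by simp
qed

text \<open>
 A crude Stirling estimate: under the product law a slice of typical type has probability at least
 \<open>exp (- \<tau>' n)\<close>, where \<open>\<tau>'\<close> is small with the deviation of the type. It is used both to transfer exponentially small events
 from independent letters to the slice and to compare the size of the slice with the entropy.
\<close>

lemma slice_weight_ge:
 assumes s: "(\<Sum>a\<in>S. s a) = l" "1 \<le> l" "l \<le> n"
  and typc: "\<And>a. a \<in> S \<Longrightarrow> \<bar>real (s a) - p a * real l\<bar> \<le> \<tau> * real n"
  and s1: "\<And>a. a \<in> S \<Longrightarrow> 1 \<le> s a"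
 shows "- (real (card S) * (\<tau> * real n / pm + 1 + ln (real n))) \<le> ln (real (card (slice S l s))) + (\<Sum>a\<in>S. real (s a) * ln (p a))"
proof -
 have sl: "s a \<le> l" if "a \<in> S" for a using member_le_sum[OF that, of s] S s by simp
 have "(\<Sum>a\<in>S. real (s a) * (real (s a) / (real l * p a) - 1)) \<le> (\<Sum>a\<in>S. \<tau> * real n / pm)"
 proof (rule sum_mono)
  fix a assume a: "a \<in> S"
  have "real (s a) * (real (s a) / (real l * p a) - 1) = (real (s a) / real l) * ((real (s a) - p a * real l) / p a)"
   using s ppos[OF a] by (simp add: field_simps)
  also have "... \<le> \<bar>real (s a) / real l\<bar> * \<bar>(real (s a) - p a * real l) / p a\<bar>"
   by (metis abs_ge_self abs_mult)
  also have "... \<le> 1 * (\<tau> * real n / pm)"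
  proof (rule mult_mono)
   show "\<bar>real (s a) / real l\<bar> \<le> 1" using sl[OF a] s by simp
   have "\<bar>real (s a) - p a * real l\<bar> / p a \<le> \<tau> * real n / pm"
    using typc[OF a] pm a by (intro frac_le) auto
   then show "\<bar>(real (s a) - p a * real l) / p a\<bar> \<le> \<tau> * real n / pm" using ppos[OF a] by simp
  qed auto
  finally show "real (s a) * (real (s a) / (real l * p a) - 1) \<le> \<tau> * real n / pm" by simp
 qed
 moreover have "(\<Sum>a\<in>S. ln (real (s a))) \<le> (\<Sum>a\<in>S. ln (real n))"
 proof (rule sum_mono)
  fix a assume a: "a \<in> S"
  show "ln (real (s a)) \<le> ln (real n)" using s1[OF a] sl[OF a] s by (subst ln_le_cancel_iff) auto
 qed
 moreover have "(\<Sum>a\<in>S. \<tau> * real n / pm) = real (card S) * (\<tau> * real n / pm)" "(\<Sum>a\<in>S. ln (real n)) = real (card S) * ln (real n)"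
  by (simp_all only: sum_constant)
 moreover have "real (card S) * (\<tau> * real n / pm + 1 + ln (real n))
   = real (card S) * (\<tau> * real n / pm) + real (card S) + real (card S) * ln (real n)"
  by (simp only: distrib_left mult_1_right)
 ultimately show ?thesis
  using ln_card_slice_ge[of S s l p, OF S(1) s(1) s1 ppos s(2)] by linarith
qed

definition \<kappa> :: real where "\<kappa> = (\<Sum>x\<in>S. \<Sum>y\<in>S. p x * p y * exp (- of_bool (x \<noteq> y)))"

lemma \<kappa>_bounds: "0 < \<kappa>" "\<kappa> < 1"
proof -
 obtain a b where ab: "a \<in> S" "b \<in> S" "a \<noteq> b" by (rule two_letters)
 have pp: "0 < p x * p y * exp (- of_bool (x \<noteq> y))" if "x \<in> S" "y \<in> S" for x y
  using ppos that by simp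
 have ne: "S \<noteq> {}" using ab by auto
 show "0 < \<kappa>" unfolding \<kappa>_def using S ne pp by (intro sum_pos) auto
 have "(\<Sum>x\<in>S. \<Sum>y\<in>S. p x * p y * exp (- of_bool (x \<noteq> y))) < (\<Sum>x\<in>S. \<Sum>y\<in>S. p x * p y)"
 proof (rule sum_strict_mono_ex1[OF S(1)])
  have le: "p x * p y * exp (- of_bool (x \<noteq> y)) \<le> p x * p y" if "x \<in> S" "y \<in> S" for x y
   using ppos[OF that(1)] ppos[OF that(2)] by (simp add: mult_le_cancel_left1)
  show "\<forall>x\<in>S. (\<Sum>y\<in>S. p x * p y * exp (- of_bool (x \<noteq> y))) \<le> (\<Sum>y\<in>S. p x * p y)"
   using le by (auto intro!: sum_mono)
  have "(\<Sum>y\<in>S. p a * p y * exp (- of_bool (a \<noteq> y))) < (\<Sum>y\<in>S. p a * p y)"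
  proof (rule sum_strict_mono_ex1[OF S(1)])
   show "\<forall>y\<in>S. p a * p y * exp (- of_bool (a \<noteq> y)) \<le> p a * p y" using le ab by auto
   have "p a * p b * exp (- of_bool (a \<noteq> b)) < p a * p b" using ppos ab by simp
   then show "\<exists>y\<in>S. p a * p y * exp (- of_bool (a \<noteq> y)) < p a * p y" using ab by blast
  qed
  then show "\<exists>x\<in>S. (\<Sum>y\<in>S. p x * p y * exp (- of_bool (x \<noteq> y))) < (\<Sum>y\<in>S. p x * p y)" using ab by blast
 qed
 also have "... = 1" using psum by (simp flip: sum_distrib_left)
 finally show "\<kappa> < 1" unfolding \<kappa>_def .
qed

text \<open>
 A Chernoff bound under the product law, for which the letters of the pairs are independent. Here \<open>\<kappa>\<close> is the mean of
 \<open>exp (- 1)\<close> to the indicator that a pair has different letters.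
\<close>

lemma few_differ:
 assumes l: "2 * Q \<le> l"
 shows "real (card {b \<in> slice S l s. real (card (differ Q b)) < y}) * (\<Prod>a\<in>S. p a ^ s a) \<le> exp y * \<kappa> ^ Q"
proof -
 define A where "A = (\<lambda>_::nat. S)"
 define w where "w = (\<lambda>_::nat. p)"
 define q where "q = (\<lambda>\<beta> (Z::nat \<Rightarrow> real). exp (- of_bool (Z (2 * \<beta> + 1) \<noteq> Z (2 * \<beta> + 2))) :: real)"
 define bls where "bls = map (\<lambda>\<beta>. [2 * \<beta> + 1, 2 * \<beta> + 2]) [0..<Q] @ [[2 * Q + 1..<l + 1]]"
 have law: "law w A i" for i unfolding law_def w_def A_def using S psum ppos by (auto simp: less_imp_le)
 have c1: "concat (map (\<lambda>\<beta>. [2 * \<beta> + 1, 2 * \<beta> + 2]) [0..<Q]) = [1..<2 * Q + 1]"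
  by (induction Q) (auto simp: upt_Suc)
 have cc: "concat bls = [1..<l + 1]"
 proof -
  have "concat bls = [1..<2 * Q + 1] @ [2 * Q + 1..<l + 1]"
   unfolding bls_def by (simp only: concat_append c1 concat.simps append_Nil2)
  also have "... = [1..<(2 * Q + 1) + (l - 2 * Q)]"
   using upt_add_eq_append[of 1 "2 * Q + 1" "l - 2 * Q"] l by simp
  also have "(2 * Q + 1) + (l - 2 * Q) = l + 1" using l by simp
  finally show ?thesis .
 qed
 have lenb: "length bls = Suc Q" unfolding bls_def by simp
 have nthb: "bls ! \<beta> = [2 * \<beta> + 1, 2 * \<beta> + 2]" if "\<beta> < Q" for \<beta> unfolding bls_def using that by (simp add: nth_append)
 have nthQ: "bls ! Q = [2 * Q + 1..<l + 1]" unfolding bls_def by (simp add: nth_append)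
 have "avg w A (concat bls) (\<lambda>Z. \<Prod>\<beta>\<in>{..<Q}. q \<beta> Z) (\<lambda>_. undefined) \<le> \<kappa> ^ card {..<Q}"
 proof (rule avg_blocks)
  show "\<forall>i\<in>set (concat bls). law w A i" using law by simp
  show "{..<Q} \<subseteq> {..<length bls}" unfolding lenb by auto
  show "0 \<le> \<kappa>" using \<kappa>_bounds by simp
  show "0 \<le> q \<beta> Z" for \<beta> Z unfolding q_def by simp
 next
  fix \<beta> \<gamma> i x and Z :: "nat \<Rightarrow> real" assume a: "\<beta> \<in> {..<Q}" "\<beta> < \<gamma>" "\<gamma> < length bls" "i \<in> set (bls ! \<gamma>)"
  have "2 * \<beta> + 2 < i"
  proof (cases "\<gamma> = Q")
   case True
   then show ?thesis using a nthQ by auto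
  next
   case False
   then show ?thesis using a nthb[of \<gamma>] lenb by auto
  qed
  then show "q \<beta> (Z(i := x)) = q \<beta> Z" unfolding q_def by simp
 next
  fix \<beta> and Z :: "nat \<Rightarrow> real" assume "\<beta> \<in> {..<Q}"
  then have "avg w A (bls ! \<beta>) (q \<beta>) Z = \<kappa>"
   unfolding \<kappa>_def by (simp add: nthb avg_Cons w_def A_def q_def sum_distrib_left mult.assoc)
  then show "avg w A (bls ! \<beta>) (q \<beta>) Z \<le> \<kappa>" by simp
 qed
 then have main: "avg w A [1..<l + 1] (\<lambda>Z. \<Prod>\<beta>\<in>{..<Q}. q \<beta> Z) (\<lambda>_. undefined) \<le> \<kappa> ^ Q" unfolding cc by simp
 have set1: "set [1..<l + 1] = {1..l}" by auto
 have qd: "(\<Prod>\<beta>\<in>{..<Q}. q \<beta> b) = exp (- real (card (differ Q b)))" for b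
 proof -
  have "(\<Prod>\<beta>\<in>{..<Q}. q \<beta> b) = exp (\<Sum>\<beta><Q. - of_bool (b (2 * \<beta> + 1) \<noteq> b (2 * \<beta> + 2)))"
   unfolding q_def by (simp add: exp_sum)
  also have "(\<Sum>\<beta><Q. - of_bool (b (2 * \<beta> + 1) \<noteq> b (2 * \<beta> + 2)) :: real) = - (\<Sum>j\<in>{1..Q}. of_bool (b (2 * j - 1) \<noteq> b (2 * j)))"
   unfolding sum_negf
   by (rule arg_cong[where f = uminus], rule sum.reindex_bij_witness[where i = "\<lambda>j. j - 1" and j = Suc]) auto
  also have "(\<Sum>j\<in>{1..Q}. of_bool (b (2 * j - 1) \<noteq> b (2 * j)) :: real) = real (card (differ Q b))"
   unfolding differ_def by (simp add: of_bool_def sum.If_cases Int_def)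
  finally show ?thesis .
 qed
 have wp: "(\<Prod>i\<in>{1..l}. w i (b i)) = (\<Prod>a\<in>S. p a ^ s a)" if "b \<in> slice S l s" for b
 proof -
  have b: "b \<in> {1..l} \<rightarrow>\<^sub>E S" "\<And>a. a \<in> S \<Longrightarrow> cnt b l a = s a" using that unfolding slice_def by auto
  have "(\<Prod>i\<in>{1..l}. p (b i)) = (\<Prod>a\<in>S. p a ^ cnt b l a)" by (rule prod_by_cnt[OF S(1)]) (use b in auto)
  then show ?thesis unfolding w_def using b(2) by simp
 qed
 let ?B = "{b \<in> slice S l s. real (card (differ Q b)) < y}"
 have "real (card ?B) * (\<Prod>a\<in>S. p a ^ s a) * exp (- y) = (\<Sum>b\<in>?B. (\<Prod>a\<in>S. p a ^ s a) * exp (- y))" by simp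
 also have "... \<le> (\<Sum>b\<in>?B. (\<Prod>i\<in>{1..l}. w i (b i)) * (\<Prod>\<beta>\<in>{..<Q}. q \<beta> b))"
 proof (rule sum_mono)
  fix b assume b: "b \<in> ?B"
  then have bs: "b \<in> slice S l s" and e: "exp (- y) \<le> exp (- real (card (differ Q b)))" by auto
  have "0 \<le> (\<Prod>a\<in>S. p a ^ s a)" using ppos by (intro prod_nonneg) (auto simp: less_imp_le)
  then show "(\<Prod>a\<in>S. p a ^ s a) * exp (- y) \<le> (\<Prod>i\<in>{1..l}. w i (b i)) * (\<Prod>\<beta>\<in>{..<Q}. q \<beta> b)"
   unfolding qd wp[OF bs] using e by (intro mult_left_mono)
 qed
 also have "... \<le> (\<Sum>b\<in>Pi\<^sub>E {1..l} A. (\<Prod>i\<in>{1..l}. w i (b i)) * (\<Prod>\<beta>\<in>{..<Q}. q \<beta> b))"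
 proof (rule sum_mono2)
  show "finite (Pi\<^sub>E {1..l} A)" unfolding A_def using S by (intro finite_PiE) auto
  show "?B \<subseteq> Pi\<^sub>E {1..l} A" unfolding A_def slice_def by auto
  fix b assume "b \<in> Pi\<^sub>E {1..l} A - ?B"
  then have "b i \<in> S" if "i \<in> {1..l}" for i using that unfolding A_def by auto
  then show "0 \<le> (\<Prod>i\<in>{1..l}. w i (b i)) * (\<Prod>\<beta>\<in>{..<Q}. q \<beta> b)"
   unfolding qd w_def using ppos by (intro mult_nonneg_nonneg prod_nonneg) (auto simp: less_imp_le)
 qed
 also have "... = avg w A [1..<l + 1] (\<lambda>Z. \<Prod>\<beta>\<in>{..<Q}. q \<beta> Z) (\<lambda>_. undefined)"
  using avg_eq_sum[of "[1..<l + 1]" A w "\<lambda>Z. \<Prod>\<beta>\<in>{..<Q}. q \<beta> Z"] S unfolding set1 by (simp add: A_def)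
 also have "... \<le> \<kappa> ^ Q" by (rule main)
 finally have "real (card ?B) * (\<Prod>a\<in>S. p a ^ s a) * exp (- y) * exp y \<le> \<kappa> ^ Q * exp y" by (intro mult_right_mono) auto
 then show ?thesis by (simp add: mult.assoc mult.commute[of "exp y"] flip: exp_add)
qed

text \<open>
 All but an exponentially small part of the slice consists of words in which linearly many pairs have
 different letters (\<open>few_differ\<close> and \<open>slice_weight_ge\<close>). Swapping such a pair moves the linear form by at least
 \<open>gS * d0 * N\<close>, so \<open>slice_concentration_le\<close> gives the factor \<open>1 / sqrt n\<close>.
\<close>

lemma anticoncentration:
 assumes \<delta>: "0 < \<delta>" and d0: "0 < d0"
 obtains C \<tau> :: real and n0 :: nat where "0 < C" "0 < \<tau>"
  "\<And>n l s Q X N y \<Lambda>. n0 \<le> n \<Longrightarrow> 1 \<le> l \<Longrightarrow> l \<le> n \<Longrightarrow> (\<Sum>a\<in>S. s a) = l \<Longrightarrow>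
   (\<And>a. a \<in> S \<Longrightarrow> \<bar>real (s a) - p a * real l\<bar> \<le> \<tau> * real n) \<Longrightarrow> (\<And>a. a \<in> S \<Longrightarrow> 1 \<le> s a) \<Longrightarrow>
   \<delta> * real n - 1 \<le> real Q \<Longrightarrow> 2 * Q \<le> l \<Longrightarrow> 0 < N \<Longrightarrow> 0 \<le> \<Lambda> \<Longrightarrow>
   (\<And>j. 1 \<le> j \<Longrightarrow> j \<le> Q \<Longrightarrow> d0 * N \<le> \<bar>real_of_int (X (2 * j - 1) - X (2 * j))\<bar>) \<Longrightarrow>
   real (card {b \<in> slice S l s. y \<le> dot b X l \<and> dot b X l \<le> y + \<Lambda>})
    \<le> C * (\<Lambda> / N + 1) / sqrt (real n) * real (card (slice S l s))"
proof -
 define x where "x = - \<delta> * ln \<kappa> / 4"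
 have x: "0 < x" unfolding x_def using \<delta> \<kappa>_bounds by (simp add: mult_pos_neg)
 define k where "k = real (card S)"
 have k: "2 \<le> k" unfolding k_def using S by simp
 define \<tau> where "\<tau> = x * pm / k"
 have \<tau>: "0 < \<tau>" unfolding \<tau>_def using x pm k by simp
 define C where "C = (1 / (gS * d0) + 1) * (1 / sqrt x + 1)"
 have C: "0 < C" unfolding C_def using gS d0 x by (intro mult_pos_pos add_pos_pos) auto
 have "((\<lambda>n. exp (- 2 * x * real n + k + k * ln (real n) - ln \<kappa>) * sqrt (real n)) \<longlongrightarrow> 0) at_top"
  using exp_poly_decay[OF x, of k "k - ln \<kappa>"] k by (simp add: algebra_simps)
 then have "\<forall>\<^sub>F n in at_top. exp (- 2 * x * real n + k + k * ln (real n) - ln \<kappa>) * sqrt (real n) < 1"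
  by (rule order_tendstoD) simp
 then obtain n1 where n1: "\<And>n. n1 \<le> n \<Longrightarrow> exp (- 2 * x * real n + k + k * ln (real n) - ln \<kappa>) * sqrt (real n) < 1"
  unfolding eventually_sequentially by blast
 show thesis
 proof (rule that[OF C \<tau>, of "max 1 n1"])
  fix n l Q :: nat and s and X :: "nat \<Rightarrow> int" and N y \<Lambda> :: real
  assume n: "max 1 n1 \<le> n" and l: "1 \<le> l" "l \<le> n" and s: "(\<Sum>a\<in>S. s a) = l"
   and typc: "\<And>a. a \<in> S \<Longrightarrow> \<bar>real (s a) - p a * real l\<bar> \<le> \<tau> * real n" and s1: "\<And>a. a \<in> S \<Longrightarrow> 1 \<le> s a"
   and Q: "\<delta> * real n - 1 \<le> real Q" "2 * Q \<le> l" and N: "0 < N" and \<Lambda>: "0 \<le> \<Lambda>"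
   and gap: "\<And>j. 1 \<le> j \<Longrightarrow> j \<le> Q \<Longrightarrow> d0 * N \<le> \<bar>real_of_int (X (2 * j - 1) - X (2 * j))\<bar>"
  let ?sl = "slice S l s"
  have fin: "finite ?sl" by (rule finite_slice[OF S(1)])
  have n0: "0 < real n" "1 \<le> real n" using n by auto
  have cpos: "0 < real (card ?sl)" using card_slice_pos[OF S(1) s] by simp
  define W where "W = (\<Prod>a\<in>S. p a ^ s a)"
  have W: "0 < W" unfolding W_def using ppos by (intro prod_pos) auto
  have lnW: "ln W = (\<Sum>a\<in>S. real (s a) * ln (p a))"
  proof -
   have "p a \<noteq> 0" if "a \<in> S" for a using ppos[OF that] by simp
   then have "ln W = (\<Sum>a\<in>S. ln (p a ^ s a))" unfolding W_def using S by (intro ln_prod) auto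
   also have "... = (\<Sum>a\<in>S. real (s a) * ln (p a))" using ppos by (intro sum.cong) (auto simp: ln_realpow)
   finally show ?thesis .
  qed
  have "k * (\<tau> * real n / pm) = x * real n" unfolding \<tau>_def using k pm by simp
  then have "- (x * real n + k + k * ln (real n)) \<le> ln (real (card ?sl)) + ln W"
   using slice_weight_ge[OF s l typc s1] unfolding lnW k_def[symmetric] by (simp add: algebra_simps)
  then have "exp (- (x * real n + k + k * ln (real n))) \<le> exp (ln (real (card ?sl)) + ln W)" by simp
  also have "... = real (card ?sl) * W" using cpos W by (simp add: exp_add)
  finally have lo: "exp (- (x * real n + k + k * ln (real n))) \<le> real (card ?sl) * W" .
  let ?B = "{b \<in> ?sl. real (card (differ Q b)) < x * real n}"
  have "real (card ?B) * W \<le> exp (x * real n) * \<kappa> ^ Q" unfolding W_def by (rule few_differ[OF Q(2)])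
  also have "\<kappa> ^ Q = exp (real Q * ln \<kappa>)" using \<kappa>_bounds by (simp add: exp_of_nat_mult)
  also have "... \<le> exp ((\<delta> * real n - 1) * ln \<kappa>)" using Q(1) \<kappa>_bounds by (simp add: mult_right_mono_neg)
  also have "exp (x * real n) * exp ((\<delta> * real n - 1) * ln \<kappa>) = exp (- 3 * x * real n - ln \<kappa>)"
   unfolding x_def by (simp add: algebra_simps flip: exp_add)
  finally have "real (card ?B) * W \<le> exp (- 3 * x * real n - ln \<kappa>)" by simp
  also have "... = exp (- 2 * x * real n + k + k * ln (real n) - ln \<kappa>) * exp (- (x * real n + k + k * ln (real n)))"
   by (simp add: algebra_simps flip: exp_add)
  also have "... \<le> exp (- 2 * x * real n + k + k * ln (real n) - ln \<kappa>) * (real (card ?sl) * W)"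
   using lo by (intro mult_left_mono) auto
  finally have "real (card ?B) \<le> exp (- 2 * x * real n + k + k * ln (real n) - ln \<kappa>) * real (card ?sl)"
   using W by (simp add: mult.assoc[symmetric])
  also have "... \<le> 1 / sqrt (real n) * real (card ?sl)"
   using n1[of n] n n0 by (intro mult_right_mono) (auto simp: pos_le_divide_eq less_imp_le)
  finally have B: "real (card ?B) \<le> real (card ?sl) / sqrt (real n)" by simp
  have "(\<Sum>b\<in>?sl. 1 / sqrt (real (card (differ Q b)) + 1)) \<le> (\<Sum>b\<in>?sl. 1 / sqrt (x * real n) + of_bool (b \<in> ?B))"
  proof (rule sum_mono)
   fix b assume b: "b \<in> ?sl"
   show "1 / sqrt (real (card (differ Q b)) + 1) \<le> 1 / sqrt (x * real n) + of_bool (b \<in> ?B)"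
   proof (cases "b \<in> ?B")
    case True
    have "1 / sqrt (real (card (differ Q b)) + 1) \<le> 1" by (simp add: divide_le_eq)
    moreover have "0 \<le> 1 / sqrt (x * real n)" using x by simp
    moreover have "of_bool (b \<in> ?B) = (1::real)" using True by simp
    ultimately show ?thesis by linarith
   next
    case False
    then have "x * real n \<le> real (card (differ Q b)) + 1" using b by auto
    then have "1 / sqrt (real (card (differ Q b)) + 1) \<le> 1 / sqrt (x * real n)"
     using x n0 by (intro divide_left_mono) (auto intro!: mult_pos_pos add_pos_pos add_nonneg_pos)
    then show ?thesis by simp
   qed
  qed
  also have "... = real (card ?sl) / sqrt (x * real n) + real (card ?B)"
   using fin by (simp add: sum.distrib of_bool_def sum.If_cases Int_def)
  also have "... \<le> real (card ?sl) / sqrt (x * real n) + real (card ?sl) / sqrt (real n)" using B by simp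
  also have "... = (1 / sqrt x + 1) * (real (card ?sl) / sqrt (real n))" by (simp add: real_sqrt_mult distrib_right add_divide_distrib)
  finally have sm: "(\<Sum>b\<in>?sl. 1 / sqrt (real (card (differ Q b)) + 1)) \<le> (1 / sqrt x + 1) * (real (card ?sl) / sqrt (real n))" .
  have g0: "0 < gS * (d0 * N)" using gS d0 N by simp
  have "real (card {b \<in> ?sl. y \<le> dot b X l \<and> dot b X l \<le> y + \<Lambda>})
    \<le> (\<Lambda> / (gS * (d0 * N)) + 1) * (\<Sum>b\<in>?sl. 1 / sqrt (real (card (differ Q b)) + 1))"
  proof (rule slice_concentration_le[OF S(1) Q(2) g0 \<Lambda>])
   fix b j assume b: "b \<in> ?sl" and j: "j \<in> differ Q b"
   have j1: "1 \<le> j" "j \<le> Q" "b (2 * j - 1) \<noteq> b (2 * j)" using j unfolding differ_def by auto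
   have bE: "b \<in> {1..l} \<rightarrow>\<^sub>E S" using b unfolding slice_def by simp
   have bS: "b (2 * j) \<in> S" "b (2 * j - 1) \<in> S" by (rule PiE_mem[OF bE], use j1 Q in auto)+
   have "gS * (d0 * N) \<le> \<bar>b (2 * j) - b (2 * j - 1)\<bar> * \<bar>real_of_int (X (2 * j - 1) - X (2 * j))\<bar>"
    using gS(2)[OF bS] j1 gap[OF j1(1,2)] gS(1) d0 N by (intro mult_mono) auto
   then show "gS * (d0 * N) \<le> \<bar>(b (2 * j) - b (2 * j - 1)) * real_of_int (X (2 * j - 1) - X (2 * j))\<bar>"
    by (simp add: abs_mult)
  qed
  also have "... \<le> ((1 / (gS * d0) + 1) * (\<Lambda> / N + 1)) * ((1 / sqrt x + 1) * (real (card ?sl) / sqrt (real n)))"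
  proof (rule mult_mono[OF _ sm])
   have e: "\<Lambda> / (gS * (d0 * N)) = 1 / (gS * d0) * (\<Lambda> / N)" by simp
   have "u * v + 1 \<le> (u + 1) * (v + 1)" if "0 \<le> u" "0 \<le> v" for u v :: real using that by (simp add: algebra_simps)
   moreover have "0 \<le> 1 / (gS * d0)" "0 \<le> \<Lambda> / N" using gS d0 \<Lambda> N by auto
   ultimately show "\<Lambda> / (gS * (d0 * N)) + 1 \<le> (1 / (gS * d0) + 1) * (\<Lambda> / N + 1)" unfolding e by blast
   show "0 \<le> (1 / (gS * d0) + 1) * (\<Lambda> / N + 1)" using gS d0 \<Lambda> N by (intro mult_nonneg_nonneg add_nonneg_nonneg) auto
   show "0 \<le> (\<Sum>b\<in>?sl. 1 / sqrt (real (card (differ Q b)) + 1))" by (intro sum_nonneg) auto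
  qed
  also have "... = C * (\<Lambda> / N + 1) / sqrt (real n) * real (card ?sl)" unfolding C_def by simp
  finally show "real (card {b \<in> ?sl. y \<le> dot b X l \<and> dot b X l \<le> y + \<Lambda>}) \<le> C * (\<Lambda> / N + 1) / sqrt (real n) * real (card ?sl)" .
 qed
qed

end

section \<open>Sums over arithmetic progressions\<close>

text \<open>
 A probability density that is constant up to a factor \<open>2\<close> on intervals of length \<open>r\<close>.
\<close>

definition tame :: "real \<Rightarrow> (real \<Rightarrow> real) \<Rightarrow> bool" where
 "tame r f \<longleftrightarrow> (\<forall>t. 0 \<le> f t) \<and> integrable lborel f \<and> (\<integral>t. f t \<partial>lborel) = 1 \<and>
   (\<forall>t h. \<bar>h\<bar> \<le> r \<longrightarrow> f (t + h) \<le> 2 * f t)"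

lemma tameD:
 assumes "tame r f"
 shows "0 \<le> f t" "integrable lborel f" "(\<integral>t. f t \<partial>lborel) = 1" "\<bar>h\<bar> \<le> r \<Longrightarrow> f (t + h) \<le> 2 * f t"
 using assms by (auto simp: tame_def)

lemma integrable_on_cell:
 fixes f :: "real \<Rightarrow> real"
 assumes f: "integrable lborel f"
 shows "integrable lborel (\<lambda>u. f u * of_bool (\<lfloor>(u - v) / c\<rfloor> \<in> A))"
proof -
 have fl: "(\<lambda>u. \<lfloor>(u - v) / c\<rfloor>) \<in> lborel \<rightarrow>\<^sub>M count_space UNIV"
  by (rule measurable_compose[OF _ measurable_real_floor]) measurable
 have "(\<lambda>u. \<lfloor>(u - v) / c\<rfloor>) -` A \<inter> space lborel \<in> sets lborel"
  by (rule measurable_sets[OF fl]) simp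
 then have m: "{u. \<lfloor>(u - v) / c\<rfloor> \<in> A} \<in> sets lborel" by (simp add: vimage_def)
 have "integrable lborel (\<lambda>u. indicator {u. \<lfloor>(u - v) / c\<rfloor> \<in> A} u *\<^sub>R f u)"
  by (rule integrable_mult_indicator[OF m f])
 then show ?thesis by (simp add: indicator_def mult.commute of_bool_def)
qed

lemma tame_le_cell_integral:
 assumes f: "tame r f" and c: "0 < c" "c \<le> r"
 shows "f (v + c * real_of_int x) \<le> 2 / c * (\<integral>u. f u * of_bool (\<lfloor>(u - v) / c\<rfloor> = x) \<partial>lborel)"
proof -
 let ?I = "{v + c * real_of_int x..<v + c * real_of_int x + c}"
 have fl: "\<lfloor>(u - v) / c\<rfloor> = x \<longleftrightarrow> u \<in> ?I" for u
  using c by (auto simp: floor_eq_iff field_simps)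
 have "f (v + c * real_of_int x) / 2 * c = (\<integral>u. f (v + c * real_of_int x) / 2 * indicator ?I u \<partial>lborel)"
  using c by simp
 also have "... \<le> (\<integral>u. f u * of_bool (\<lfloor>(u - v) / c\<rfloor> \<in> {x}) \<partial>lborel)"
 proof (rule integral_mono)
  show "integrable lborel (\<lambda>u. f (v + c * real_of_int x) / 2 * indicator ?I u)" using c by simp
  show "integrable lborel (\<lambda>u. f u * of_bool (\<lfloor>(u - v) / c\<rfloor> \<in> {x}))"
   by (rule integrable_on_cell[OF tameD(2)[OF f]])
  fix u
  show "f (v + c * real_of_int x) / 2 * indicator ?I u \<le> f u * of_bool (\<lfloor>(u - v) / c\<rfloor> \<in> {x})"
  proof (cases "u \<in> ?I")
   case True
   then have "\<bar>v + c * real_of_int x - u\<bar> \<le> r" using c by auto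
   then have "f (u + (v + c * real_of_int x - u)) \<le> 2 * f u" by (rule tameD(4)[OF f])
   then show ?thesis using True fl[of u] by (simp add: indicator_def)
  next
   case False
   then have z: "indicator ?I u = (0::real)" by simp
   show ?thesis unfolding z using tameD(1)[OF f, of u] by simp
  qed
 qed
 finally show ?thesis using c by (simp add: field_simps)
qed

text \<open>
 A tame function is bounded at a point by twice its mean over the cell of length \<open>c\<close> to the right of it. The number of cells
 that cover a given point is at most \<open>K\<close>, and the integral of \<open>f\<close> is \<open>1\<close>.
\<close>

lemma lattice_sum_bound:
 fixes D :: "'b \<Rightarrow> real"
 assumes f: "tame r f" and c: "0 < c" "c \<le> r" and A: "finite A" and B: "finite B"
  and K: "\<And>u. real (card {b\<in>B. \<lfloor>(u - D b) / c\<rfloor> \<in> A}) \<le> K"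
 shows "(\<Sum>b\<in>B. \<Sum>x\<in>A. f (D b + c * real_of_int x)) \<le> 2 / c * K"
proof -
 have int: "integrable lborel (\<lambda>u. f u * of_bool (\<lfloor>(u - D b) / c\<rfloor> \<in> A))" for b A
  by (rule integrable_on_cell[OF tameD(2)[OF f]])
 have "(\<Sum>b\<in>B. \<Sum>x\<in>A. f (D b + c * real_of_int x))
   \<le> (\<Sum>b\<in>B. \<Sum>x\<in>A. 2 / c * (\<integral>u. f u * of_bool (\<lfloor>(u - D b) / c\<rfloor> \<in> {x}) \<partial>lborel))"
  using tame_le_cell_integral[OF f c] by (intro sum_mono) simp
 also have "... = 2 / c * (\<Sum>b\<in>B. \<Sum>x\<in>A. (\<integral>u. f u * of_bool (\<lfloor>(u - D b) / c\<rfloor> \<in> {x}) \<partial>lborel))"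
  by (simp only: sum_distrib_left)
 also have "(\<Sum>b\<in>B. \<Sum>x\<in>A. (\<integral>u. f u * of_bool (\<lfloor>(u - D b) / c\<rfloor> \<in> {x}) \<partial>lborel))
   = (\<integral>u. (\<Sum>b\<in>B. \<Sum>x\<in>A. f u * of_bool (\<lfloor>(u - D b) / c\<rfloor> \<in> {x})) \<partial>lborel)"
  using int by (simp only: Bochner_Integration.integral_sum Bochner_Integration.integrable_sum)
 also have "... \<le> (\<integral>u. K * f u \<partial>lborel)"
 proof (rule integral_mono)
  show "integrable lborel (\<lambda>u. \<Sum>b\<in>B. \<Sum>x\<in>A. f u * of_bool (\<lfloor>(u - D b) / c\<rfloor> \<in> {x}))"
   using int by (intro Bochner_Integration.integrable_sum)
  show "integrable lborel (\<lambda>u. K * f u)" using tameD(2)[OF f] by simp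
  fix u
  have "(\<Sum>x\<in>A. of_bool (\<lfloor>(u - D b) / c\<rfloor> \<in> {x}) :: real) = of_bool (\<lfloor>(u - D b) / c\<rfloor> \<in> A)" for b
   using A by (simp add: of_bool_def sum.delta)
  then have "(\<Sum>b\<in>B. \<Sum>x\<in>A. f u * of_bool (\<lfloor>(u - D b) / c\<rfloor> \<in> {x}))
    = f u * (\<Sum>b\<in>B. of_bool (\<lfloor>(u - D b) / c\<rfloor> \<in> A))"
   by (simp only: sum_distrib_left[symmetric])
  also have "(\<Sum>b\<in>B. of_bool (\<lfloor>(u - D b) / c\<rfloor> \<in> A) :: real) = real (card {b\<in>B. \<lfloor>(u - D b) / c\<rfloor> \<in> A})"
   using B by (simp add: of_bool_def sum.If_cases Int_def)
  also have "f u * ... \<le> f u * K" by (intro mult_left_mono K tameD(1)[OF f])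
  finally show "(\<Sum>b\<in>B. \<Sum>x\<in>A. f u * of_bool (\<lfloor>(u - D b) / c\<rfloor> \<in> {x})) \<le> K * f u" by (simp only: mult.commute)
 qed
 also have "... = K" using tameD(3)[OF f] by simp
 finally show ?thesis using c by (simp add: mult_left_mono divide_right_mono)
qed

lemma tame_le_2:
 assumes f: "tame r f" and r: "1 \<le> r"
 shows "f t \<le> 2"
proof -
 have "(\<Sum>b\<in>{t}. \<Sum>x\<in>{0}. f (b + 1 * real_of_int x)) \<le> 2 / 1 * 1"
 proof (rule lattice_sum_bound[OF f])
  fix u
  have "card {b\<in>{t}. \<lfloor>(u - b) / 1\<rfloor> \<in> {0}} \<le> card {t}" by (intro card_mono) auto
  then show "real (card {b\<in>{t}. \<lfloor>(u - b) / 1\<rfloor> \<in> {0}}) \<le> 1" by simp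
 qed (use r in auto)
 then show ?thesis by simp
qed

lemma tame_level_finite:
 assumes f: "tame r f" and r: "1 \<le> r" and y: "0 < y"
 shows "finite {z::int. y \<le> f (real_of_int z)} \<and> real (card {z::int. y \<le> f (real_of_int z)}) \<le> 2 / y"
proof -
 have fin: "real (card G) \<le> 2 / y" if G: "G \<subseteq> {z::int. y \<le> f (real_of_int z)}" "finite G" for G
 proof -
  have "(\<Sum>b\<in>{0::real}. \<Sum>x\<in>G. f (b + 1 * real_of_int x)) \<le> 2 / 1 * 1"
  proof (rule lattice_sum_bound[OF f])
   fix u
   have "card {b\<in>{0::real}. \<lfloor>(u - b) / 1\<rfloor> \<in> G} \<le> card {0::real}" by (intro card_mono) auto
   then show "real (card {b\<in>{0::real}. \<lfloor>(u - b) / 1\<rfloor> \<in> G}) \<le> 1" by simp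
  qed (use r G in auto)
  then have "(\<Sum>x\<in>G. f (real_of_int x)) \<le> 2" by simp
  moreover have "(\<Sum>x\<in>G. y) \<le> (\<Sum>x\<in>G. f (real_of_int x))" using G by (intro sum_mono) auto
  ultimately show ?thesis using y by (simp add: le_divide_eq)
 qed
 have "finite {z::int. y \<le> f (real_of_int z)} \<and> card {z::int. y \<le> f (real_of_int z)} \<le> nat \<lfloor>2 / y\<rfloor>"
  by (rule finite_if_finite_subsets_card_bdd) (use fin le_nat_floor in blast)
 then show ?thesis using fin by blast
qed

context alphabet
begin

lemma favg_progression_sum:
 assumes f: "tame r f" and c: "0 < \<bar>c\<bar>" "\<bar>c\<bar> \<le> r" and A: "finite A" and s: "(\<Sum>a\<in>S. s a) = l"
  and K: "\<And>u B. (\<And>x. x \<in> B \<longleftrightarrow> sgn c * x \<in> real_of_int ` A) \<Longrightarrow>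
   real (card {b\<in>slice S l s. real_of_int \<lfloor>(u - dot b X l) / \<bar>c\<bar>\<rfloor> \<in> B}) \<le> K * real (card (slice S l s))"
 shows "(\<Sum>x\<in>A. favg S f X l s (t + c * real_of_int x)) \<le> 2 / \<bar>c\<bar> * K"
proof -
 let ?sl = "slice S l s"
 have fin: "finite ?sl" by (rule finite_slice[OF S(1)])
 have pos: "0 < real (card ?sl)" using card_slice_pos[OF S(1) s] by simp
 define A' where "A' = (if 0 < c then A else uminus ` A)"
 have A': "finite A'" unfolding A'_def using A by simp
 define B where "B = real_of_int ` A'"
 have Bx: "x \<in> B \<longleftrightarrow> sgn c * x \<in> real_of_int ` A" for x
 proof (cases "0 < c")
  case True
  then show ?thesis unfolding B_def A'_def by simp
 next
  case False
  then have "sgn c = - 1" using c by simp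
  moreover have "B = uminus ` real_of_int ` A" unfolding B_def A'_def using False by (simp add: image_image)
  ultimately show ?thesis by (auto simp: image_iff) (metis add.inverse_inverse)
 qed
 have re: "(\<Sum>x\<in>A. g (c * real_of_int x)) = (\<Sum>x\<in>A'. g (\<bar>c\<bar> * real_of_int x))" for g :: "real \<Rightarrow> real"
 proof (cases "0 < c")
  case True
  then show ?thesis unfolding A'_def by simp
 next
  case False
  then have c': "\<bar>c\<bar> = - c" "\<not> 0 < c" using c by auto
  show ?thesis unfolding A'_def c' using c'(2) by (simp add: sum.reindex inj_on_def)
 qed
 have "(\<Sum>x\<in>A. favg S f X l s (t + c * real_of_int x))
   = (\<Sum>x\<in>A'. favg S f X l s (t + \<bar>c\<bar> * real_of_int x))" by (rule re[of "\<lambda>u. favg S f X l s (t + u)"])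
 also have "... = (\<Sum>x\<in>A'. (\<Sum>b\<in>?sl. f (t + \<bar>c\<bar> * real_of_int x + dot b X l)) / real (card ?sl))"
  unfolding favg_eq_slice[OF S(1) s] ..
 also have "... = (\<Sum>b\<in>?sl. \<Sum>x\<in>A'. f ((t + dot b X l) + \<bar>c\<bar> * real_of_int x)) / real (card ?sl)"
  unfolding sum_divide_distrib[symmetric] by (subst sum.swap) (simp only: add.assoc add.commute add.left_commute)
 also have "... \<le> (2 / \<bar>c\<bar> * (K * real (card ?sl))) / real (card ?sl)"
 proof (rule divide_right_mono[OF lattice_sum_bound[OF f c A' fin]])
  fix u
  have "{b\<in>?sl. \<lfloor>(u - (t + dot b X l)) / \<bar>c\<bar>\<rfloor> \<in> A'} = {b\<in>?sl. real_of_int \<lfloor>((u - t) - dot b X l) / \<bar>c\<bar>\<rfloor> \<in> B}"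
   unfolding B_def by (auto simp: image_iff algebra_simps)
  then show "real (card {b\<in>?sl. \<lfloor>(u - (t + dot b X l)) / \<bar>c\<bar>\<rfloor> \<in> A'}) \<le> K * real (card ?sl)"
   using K[OF Bx, of "u - t"] by simp
 qed simp
 also have "... = 2 / \<bar>c\<bar> * K" using pos by simp
 finally show ?thesis .
qed

text \<open>
 Distinct \<open>x\<close> move the argument by at least \<open>\<bar>c\<bar>\<close>, so the sum is a Riemann sum of an integral equal to \<open>1\<close>.
\<close>

lemma favg_progression_total:
 assumes f: "tame r f" and c: "0 < \<bar>c\<bar>" "\<bar>c\<bar> \<le> r" and A: "finite A" and s: "(\<Sum>a\<in>S. s a) = l"
 shows "(\<Sum>x\<in>A. favg S f X l s (t + c * real_of_int x)) \<le> 2 / \<bar>c\<bar>"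
proof -
 have "(\<Sum>x\<in>A. favg S f X l s (t + c * real_of_int x)) \<le> 2 / \<bar>c\<bar> * 1"
 proof (rule favg_progression_sum[OF f c A s])
  fix u B
  have "card {b\<in>slice S l s. real_of_int \<lfloor>(u - dot b X l) / \<bar>c\<bar>\<rfloor> \<in> B} \<le> card (slice S l s)"
   by (intro card_mono finite_slice S) auto
  then show "real (card {b\<in>slice S l s. real_of_int \<lfloor>(u - dot b X l) / \<bar>c\<bar>\<rfloor> \<in> B}) \<le> 1 * real (card (slice S l s))"
   by simp
 qed
 then show ?thesis by simp
qed

text \<open>
 For an interval of shifts, only the words whose linear form falls into an interval of length \<open>\<bar>c\<bar> \<bar>A\<bar>\<close> contribute at
 a given point, which brings in the concentration function of the slice.
\<close>

lemma favg_progression_interval: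
 assumes f: "tame r f" and c: "0 < \<bar>c\<bar>" "\<bar>c\<bar> \<le> r" and A: "A = {x1..x2}" "x1 \<le> x2" and s: "(\<Sum>a\<in>S. s a) = l"
  and conc: "\<And>y. real (card {b \<in> slice S l s. y \<le> dot b X l \<and> dot b X l \<le> y + \<bar>c\<bar> * real (card A)})
    \<le> K * real (card (slice S l s))"
 shows "(\<Sum>x\<in>A. favg S f X l s (t + c * real_of_int x)) \<le> 2 / \<bar>c\<bar> * K"
proof (rule favg_progression_sum[OF f c _ s])
 show "finite A" using A by simp
 fix u B assume B: "\<And>x. x \<in> B \<longleftrightarrow> sgn c * x \<in> real_of_int ` A"
 define y1 where "y1 = (if 0 < c then x1 else - x2)"
 define y2 where "y2 = (if 0 < c then x2 else - x1)"
 have cA: "real (card A) = real_of_int y2 - real_of_int y1 + 1" using A unfolding y1_def y2_def by simp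
 have Bsub: "real_of_int y1 \<le> x \<and> x \<le> real_of_int y2" if "x \<in> B" for x
 proof (cases "0 < c")
  case True
  then show ?thesis using B[of x] that A unfolding y1_def y2_def by auto
 next
  case False
  then have "sgn c = - 1" using c by simp
  then show ?thesis using B[of x] that A False unfolding y1_def y2_def by auto
 qed
 define y where "y = u - \<bar>c\<bar> * (real_of_int y2 + 1)"
 have "card {b\<in>slice S l s. real_of_int \<lfloor>(u - dot b X l) / \<bar>c\<bar>\<rfloor> \<in> B}
   \<le> card {b \<in> slice S l s. y \<le> dot b X l \<and> dot b X l \<le> y + \<bar>c\<bar> * real (card A)}"
 proof (rule card_mono)
  show "finite {b \<in> slice S l s. y \<le> dot b X l \<and> dot b X l \<le> y + \<bar>c\<bar> * real (card A)}"
   using finite_slice[OF S(1)] by simp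
  show "{b\<in>slice S l s. real_of_int \<lfloor>(u - dot b X l) / \<bar>c\<bar>\<rfloor> \<in> B}
   \<subseteq> {b \<in> slice S l s. y \<le> dot b X l \<and> dot b X l \<le> y + \<bar>c\<bar> * real (card A)}"
  proof clarify
   fix b assume b: "b \<in> slice S l s" "real_of_int \<lfloor>(u - dot b X l) / \<bar>c\<bar>\<rfloor> \<in> B"
   define v where "v = (u - dot b X l) / \<bar>c\<bar>"
   have v: "real_of_int y1 \<le> v" "v \<le> real_of_int y2 + 1" using Bsub[OF b(2)] unfolding v_def[symmetric] by linarith+
   have d: "dot b X l = u - \<bar>c\<bar> * v" unfolding v_def using c by simp
   have "\<bar>c\<bar> * real_of_int y1 \<le> \<bar>c\<bar> * v" "\<bar>c\<bar> * v \<le> \<bar>c\<bar> * (real_of_int y2 + 1)" using v by (auto intro: mult_left_mono)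
   then show "y \<le> dot b X l \<and> dot b X l \<le> y + \<bar>c\<bar> * real (card A)"
    unfolding d y_def cA by (simp add: algebra_simps)
  qed
 qed
 then show "real (card {b\<in>slice S l s. real_of_int \<lfloor>(u - dot b X l) / \<bar>c\<bar>\<rfloor> \<in> B}) \<le> K * real (card (slice S l s))"
  using conc[of y] by linarith
qed

end

section \<open>Tracing a large value back through the levels\<close>

lemma avg_coords:
 assumes law: "\<And>i. 1 \<le> i \<Longrightarrow> i \<le> l \<Longrightarrow> law w A i"
  and Y: "Y \<subseteq> {1..l}"
  and q0: "\<And>i Z. i \<in> Y \<Longrightarrow> 0 \<le> q i Z"
  and qi: "\<And>i j Z x. i \<in> Y \<Longrightarrow> i < j \<Longrightarrow> q i (Z(j := x)) = q i Z"
  and qa: "\<And>i Z. i \<in> Y \<Longrightarrow> (\<forall>j. 1 \<le> j \<and> j < i \<longrightarrow> Z j \<in> A j) \<Longrightarrow> (\<Sum>x\<in>A i. w i x * q i (Z(i := x))) \<le> a"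
  and a: "0 \<le> a"
 shows "avg w A [1..<l + 1] (\<lambda>Z. \<Prod>i\<in>Y. q i Z) Z0 \<le> a ^ card Y"
proof -
 let ?bls = "map (\<lambda>\<beta>. [Suc \<beta>]) [0..<l]"
 let ?Y = "(\<lambda>i. i - 1) ` Y"
 have cc: "concat ?bls = [1..<l + 1]" by (induction l) auto
 have tk: "set (concat (take \<beta> ?bls)) = {j. 1 \<le> j \<and> j < Suc \<beta>}" if "\<beta> < l" for \<beta>
 proof -
  have "take \<beta> ?bls = map (\<lambda>\<beta>. [Suc \<beta>]) [0..<\<beta>]" using that by (simp add: take_map take_upt)
  then show ?thesis by (auto simp: image_iff)
 qed
 have inj: "inj_on (\<lambda>i. i - 1) Y"
 proof (rule inj_onI)
  fix i j assume "i \<in> Y" "j \<in> Y" "i - 1 = j - 1"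
  moreover have "1 \<le> i" "1 \<le> j" using Y calculation(1,2) by auto
  ultimately show "i = j" by linarith
 qed
 have pr: "(\<Prod>\<beta>\<in>?Y. q (Suc \<beta>) Z) = (\<Prod>i\<in>Y. q i Z)" for Z
  using Y by (subst prod.reindex[OF inj]) (auto intro!: prod.cong)
 have Yb: "\<beta> < l \<and> Suc \<beta> \<in> Y" if "\<beta> \<in> ?Y" for \<beta>
 proof -
  from that obtain i where i: "i \<in> Y" "\<beta> = i - 1" by auto
  then have "1 \<le> i" "i \<le> l" using Y by auto
  then show ?thesis using i by simp
 qed
 have "avg w A (concat ?bls) (\<lambda>Z. \<Prod>\<beta>\<in>?Y. q (Suc \<beta>) Z) Z0 \<le> a ^ card ?Y"
 proof (rule avg_blocks)
  show "\<forall>i\<in>set (concat ?bls). law w A i" unfolding cc using law by auto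
  show "?Y \<subseteq> {..<length ?bls}" using Yb by auto
  show "0 \<le> a" by (rule a)
  show "0 \<le> q (Suc \<beta>) Z" if "\<beta> \<in> ?Y" for \<beta> Z using Yb[OF that] q0 by blast
 next
  fix \<beta> \<gamma> i Z x assume "\<beta> \<in> ?Y" "\<beta> < \<gamma>" "\<gamma> < length ?bls" "i \<in> set (?bls ! \<gamma>)"
  then show "q (Suc \<beta>) (Z(i := x)) = q (Suc \<beta>) Z" using Yb[of \<beta>] by (intro qi) auto
 next
  fix \<beta> Z assume b: "\<beta> \<in> ?Y" and Z: "\<forall>i\<in>set (concat (take \<beta> ?bls)). Z i \<in> A i"
  have "avg w A (?bls ! \<beta>) (q (Suc \<beta>)) Z = (\<Sum>x\<in>A (Suc \<beta>). w (Suc \<beta>) x * q (Suc \<beta>) (Z(Suc \<beta> := x)))"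
   using Yb[OF b] by (simp add: avg_Cons)
  also have "... \<le> a"
  proof (rule qa)
   show "Suc \<beta> \<in> Y" using Yb[OF b] by simp
   have "\<forall>i\<in>{j. 1 \<le> j \<and> j < Suc \<beta>}. Z i \<in> A i" using Z tk[of \<beta>] Yb[OF b] by (simp only:)
   then show "\<forall>j. 1 \<le> j \<and> j < Suc \<beta> \<longrightarrow> Z j \<in> A j" by blast
  qed
  finally show "avg w A (?bls ! \<beta>) (q (Suc \<beta>)) Z \<le> a" .
 qed
 then show ?thesis unfolding cc pr card_image[OF inj] .
qed

text \<open>
 The value at level \<open>i\<close> on the path from the point \<open>t0\<close> at level \<open>0\<close> upwards that is spelled by the word \<open>b\<close>. Anchoring
 the path at the bottom is what makes the union bound over paths finite.
\<close>

definition lev :: "real set \<Rightarrow> (real \<Rightarrow> real) \<Rightarrow> (nat \<Rightarrow> int) \<Rightarrow> (nat \<Rightarrow> real) \<Rightarrow> real \<Rightarrow> nat \<Rightarrow> real" where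
 "lev S f X b t0 i = favg S f X i (cnt b i) (t0 - dot b X i)"

text \<open>
 At level \<open>i\<close> of that path, another letter than the one on the path also leads to a value at least \<open>y\<close>.
\<close>

definition rival :: "real set \<Rightarrow> (real \<Rightarrow> real) \<Rightarrow> (nat \<Rightarrow> real) \<Rightarrow> real \<Rightarrow> nat \<Rightarrow> real \<Rightarrow> (nat \<Rightarrow> int) \<Rightarrow> bool" where
 "rival S f b t0 i y X \<longleftrightarrow> (\<exists>a\<in>S. a \<noteq> b i \<and> 0 < cnt b i a \<and>
   y \<le> favg S f X (i - 1) (dec (cnt b i) a) (t0 - dot b X (i - 1) + (a - b i) * real_of_int (X i)))"

text \<open>
 The largest child \<open>V a\<close> is at least the average \<open>v\<close>. If all other children are below \<open>\<mu> v\<close>, it has to carry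
 \<open>(1 - \<mu>) v\<close> alone with weight \<open>s a / (l + 1)\<close>.
\<close>

lemma max_child:
 fixes X :: "nat \<Rightarrow> int" and t :: real
 assumes S: "finite S" and f0: "\<And>t. 0 \<le> f t" and s: "(\<Sum>a\<in>S. s a) = Suc l" and \<mu>: "0 < \<mu>" "\<mu> < 1"
 defines "v \<equiv> favg S f X (Suc l) s t"
 defines "V \<equiv> \<lambda>a. favg S f X l (dec s a) (t + a * real_of_int (X (Suc l)))"
 shows "\<exists>a\<in>S. 0 < s a \<and> v \<le> V a \<and>
   ((1 - \<mu>) * (real (Suc l) / real (s a)) * v \<le> V a \<or> (\<exists>c\<in>S. c \<noteq> a \<and> 0 < s c \<and> \<mu> * v \<le> V c))"
proof -
 let ?T = "{a\<in>S. 0 < s a}"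
 have ne: "?T \<noteq> {}"
 proof
  assume "?T = {}"
  then have "(\<Sum>a\<in>S. s a) = 0" by (intro sum.neutral) auto
  then show False using s by simp
 qed
 have finT: "finite (V ` ?T)" using S by simp
 have "Max (V ` ?T) \<in> V ` ?T" using finT ne by (intro Max_in) auto
 then obtain a where a0: "a \<in> ?T" "Max (V ` ?T) = V a" by blast
 have a: "a \<in> ?T" "\<And>c. c \<in> ?T \<Longrightarrow> V c \<le> V a"
  using a0 Max_ge[OF finT] by (auto simp flip: a0(2))
 have V0: "0 \<le> V c" for c unfolding V_def by (rule favg_nonneg[OF f0])
 have v0: "0 \<le> v" unfolding v_def by (rule favg_nonneg[OF f0])
 have w: "(\<Sum>a\<in>S. real (s a) / real (Suc l)) = 1" by (rule favg_weights[OF s])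
 have vV: "v = (\<Sum>c\<in>S. real (s c) / real (Suc l) * V c)" unfolding v_def V_def by simp
 have le: "v \<le> V a"
 proof -
  have "v \<le> (\<Sum>c\<in>S. real (s c) / real (Suc l) * V a)" unfolding vV
  proof (rule sum_mono)
   fix c assume "c \<in> S"
   then show "real (s c) / real (Suc l) * V c \<le> real (s c) / real (Suc l) * V a"
   proof (cases "0 < s c")
    case True
    with \<open>c \<in> S\<close> have "V c \<le> V a" by (intro a(2)) simp
    then show ?thesis by (intro mult_left_mono) simp_all
   qed simp
  qed
  also have "... = V a" unfolding sum_distrib_right[symmetric] w by simp
  finally show ?thesis .
 qed
 have "(1 - \<mu>) * (real (Suc l) / real (s a)) * v \<le> V a" if no: "\<not> (\<exists>c\<in>S. c \<noteq> a \<and> 0 < s c \<and> \<mu> * v \<le> V c)"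
 proof -
  have "v = real (s a) / real (Suc l) * V a + (\<Sum>c\<in>S - {a}. real (s c) / real (Suc l) * V c)"
   unfolding vV using S a(1) by (subst sum.remove[of S a]) auto
  also have "(\<Sum>c\<in>S - {a}. real (s c) / real (Suc l) * V c) \<le> (\<Sum>c\<in>S - {a}. real (s c) / real (Suc l) * (\<mu> * v))"
  proof (rule sum_mono)
   fix c assume c: "c \<in> S - {a}"
   show "real (s c) / real (Suc l) * V c \<le> real (s c) / real (Suc l) * (\<mu> * v)"
   proof (cases "0 < s c")
    case True
    then have "V c \<le> \<mu> * v" using no c by fastforce
    then show ?thesis by (intro mult_left_mono) simp_all
   qed simp
  qed
  also have "... \<le> (\<Sum>c\<in>S. real (s c) / real (Suc l) * (\<mu> * v))"
   using S v0 \<mu> by (intro sum_mono2) auto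
  also have "... = \<mu> * v" unfolding sum_distrib_right[symmetric] w by simp
  finally have "(1 - \<mu>) * v \<le> real (s a) / real (Suc l) * V a" by (simp add: algebra_simps)
  then show ?thesis using a(1) by (simp add: field_simps)
 qed
 then show ?thesis using a(1) le by blast
qed

text \<open>
 Iterating \<open>max_child\<close> from the top; the word is built from its last letter to its first.
\<close>

lemma max_path:
 assumes S: "finite S" and f0: "\<And>t. 0 \<le> f t" and \<mu>: "0 < \<mu>" "\<mu> < 1"
 shows "(\<Sum>a\<in>S. s a) = l \<Longrightarrow> \<exists>b \<in> {1..l} \<rightarrow>\<^sub>E S. (\<forall>a\<in>S. cnt b l a = s a) \<and>
  (\<forall>i\<in>{1..l}. lev S f X b (t + dot b X l) i \<le> lev S f X b (t + dot b X l) (i - 1) \<and>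
   ((1 - \<mu>) * (real i / real (cnt b i (b i))) * lev S f X b (t + dot b X l) i \<le> lev S f X b (t + dot b X l) (i - 1)
    \<or> rival S f b (t + dot b X l) i (\<mu> * lev S f X b (t + dot b X l) i) X))"
proof (induction l arbitrary: s t)
 case 0
 then have s0: "\<forall>a\<in>S. s a = 0" using S by simp
 show ?case
 proof (intro bexI[of _ "\<lambda>_. undefined"] conjI)
  show "\<forall>a\<in>S. cnt (\<lambda>_. undefined) 0 a = s a" using s0 by simp
 qed (simp_all only: PiE_empty_domain singleton_iff atLeastatMost_empty zero_less_one Ball_def empty_iff simp_thms)
next
 case (Suc l)
 from max_child[where X = X and t = t, OF S f0 Suc.prems \<mu>]
 obtain a where aS: "a \<in> S" and ha: "0 < s a \<and>
   favg S f X (Suc l) s t \<le> favg S f X l (dec s a) (t + a * real_of_int (X (Suc l))) \<and>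
   ((1 - \<mu>) * (real (Suc l) / real (s a)) * favg S f X (Suc l) s t \<le> favg S f X l (dec s a) (t + a * real_of_int (X (Suc l)))
   \<or> (\<exists>c\<in>S. c \<noteq> a \<and> 0 < s c \<and> \<mu> * favg S f X (Suc l) s t \<le> favg S f X l (dec s c) (t + c * real_of_int (X (Suc l)))))"
  by (rule bexE)
 note a = aS ha[THEN conjunct1] and le = ha[THEN conjunct2, THEN conjunct1] and alt = ha[THEN conjunct2, THEN conjunct2]
 define t' where "t' = t + a * real_of_int (X (Suc l))"
 from Suc.IH[OF sum_dec[OF S a Suc.prems], of t']
 obtain b where b: "b \<in> {1..l} \<rightarrow>\<^sub>E S" and hb: "(\<forall>c\<in>S. cnt b l c = dec s a c) \<and>
  (\<forall>i\<in>{1..l}. lev S f X b (t' + dot b X l) i \<le> lev S f X b (t' + dot b X l) (i - 1) \<and>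
   ((1 - \<mu>) * (real i / real (cnt b i (b i))) * lev S f X b (t' + dot b X l) i \<le> lev S f X b (t' + dot b X l) (i - 1)
    \<or> rival S f b (t' + dot b X l) i (\<mu> * lev S f X b (t' + dot b X l) i) X))"
  by (rule bexE)
 note cb = hb[THEN conjunct1, rule_format] and step = hb[THEN conjunct2, THEN bspec]
 define b' where "b' = b(Suc l := a)"
 have b'l: "b' i = b i" if "i \<le> l" for i unfolding b'_def using that by simp
 have b'a: "b' (Suc l) = a" unfolding b'_def by simp
 have cnt': "cnt b' i = cnt b i" if "i \<le> l" for i by (rule ext, rule cnt_cong) (use b'l that in auto)
 have dot': "dot b' X i = dot b X i" if "i \<le> l" for i by (rule dot_cong) (use b'l that in auto)
 have cS: "cnt b' (Suc l) c = s c" if "c \<in> S" for c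
  unfolding cnt_Suc b'a cnt'[OF order_refl] using cb[OF that] a by (auto simp: dec_def)
 have t0: "t + dot b' X (Suc l) = t' + dot b X l" unfolding dot_Suc dot'[OF order_refl] b'a t'_def by simp
 have lev': "lev S f X b' u i = lev S f X b u i" if "i \<le> l" for i u
  unfolding lev_def using cnt'[OF that] dot'[OF that] by simp
 have riv': "rival S f b' u i y X = rival S f b u i y X" if "i \<in> {1..l}" for i u y
 proof -
  have i: "i \<le> l" "i - 1 \<le> l" using that by auto
  show ?thesis unfolding rival_def cnt'[OF i(1)] dot'[OF i(2)] b'l[OF i(1)] ..
 qed
 have b'E: "b' \<in> {1..Suc l} \<rightarrow>\<^sub>E S"
 proof (rule PiE_I)
  fix i assume "i \<in> {1..Suc l}"
  then show "b' i \<in> S" using b'l[of i] b'a a(1) PiE_mem[OF b, of i] by (cases "i = Suc l") auto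
 next
  fix i assume i: "i \<notin> {1..Suc l}"
  then have "i \<notin> {1..l}" "i \<noteq> Suc l" by auto
  then show "b' i = undefined" unfolding b'_def using PiE_arb[OF b, of i] by simp
 qed
 have top: "lev S f X b' (t' + dot b X l) (Suc l) = favg S f X (Suc l) s t"
 proof -
  have "lev S f X b' (t' + dot b X l) (Suc l) = favg S f X (Suc l) (cnt b' (Suc l)) t"
   unfolding lev_def t0[symmetric] by (simp only: add_diff_cancel_right')
  also have "... = favg S f X (Suc l) s t" by (rule favg_cong_type) (rule cS)
  finally show ?thesis .
 qed
 have below: "lev S f X b' (t' + dot b X l) l = favg S f X l (dec s a) t'"
 proof -
  have "lev S f X b' (t' + dot b X l) l = favg S f X l (cnt b l) t'"
   unfolding lev'[OF order_refl] unfolding lev_def by (simp only: add_diff_cancel_right')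
  also have "... = favg S f X l (dec s a) t'" by (rule favg_cong_type) (rule cb)
  finally show ?thesis .
 qed
 show ?case
 proof (intro bexI[OF _ b'E] conjI ballI)
  show "cnt b' (Suc l) c = s c" if "c \<in> S" for c by (rule cS[OF that])
 next
  fix i assume i: "i \<in> {1..Suc l}"
  show "lev S f X b' (t + dot b' X (Suc l)) i \<le> lev S f X b' (t + dot b' X (Suc l)) (i - 1)"
  proof (cases "i = Suc l")
   case True
   have "favg S f X (Suc l) s t \<le> favg S f X l (dec s a) t'" unfolding t'_def by (rule le)
   then show ?thesis unfolding t0 True top diff_Suc_1 below .
  next
   case False
   then have il: "i \<in> {1..l}" "i \<le> l" "i - 1 \<le> l" using i by auto
   show ?thesis unfolding t0 lev'[OF il(2)] lev'[OF il(3)] by (rule step[OF il(1), THEN conjunct1])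
  qed
  show "(1 - \<mu>) * (real i / real (cnt b' i (b' i))) * lev S f X b' (t + dot b' X (Suc l)) i \<le> lev S f X b' (t + dot b' X (Suc l)) (i - 1)
    \<or> rival S f b' (t + dot b' X (Suc l)) i (\<mu> * lev S f X b' (t + dot b' X (Suc l)) i) X"
  proof (cases "i = Suc l")
   case True
   have r: "rival S f b' (t' + dot b X l) (Suc l) y X"
    if "c \<in> S" "c \<noteq> a" "0 < s c" "y \<le> favg S f X l (dec s c) (t + c * real_of_int (X (Suc l)))" for c y
   proof -
    have e: "t' + dot b X l - dot b' X l + (c - a) * real_of_int (X (Suc l)) = t + c * real_of_int (X (Suc l))"
     unfolding dot'[OF order_refl] t'_def by (simp add: algebra_simps)
    have "favg S f X l (dec (cnt b' (Suc l)) c) u = favg S f X l (dec s c) u" for u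
     by (rule favg_cong_type) (use cS that(1) in \<open>auto simp: dec_def\<close>)
    then show ?thesis unfolding rival_def b'a diff_Suc_1
     using that cS[OF that(1)] e by (intro bexI[of _ c]) simp_all
   qed
   from alt have "(1 - \<mu>) * (real (Suc l) / real (s a)) * favg S f X (Suc l) s t \<le> favg S f X l (dec s a) t'
     \<or> rival S f b' (t' + dot b X l) (Suc l) (\<mu> * favg S f X (Suc l) s t) X" (is ?goal)
   proof
    assume "(1 - \<mu>) * (real (Suc l) / real (s a)) * favg S f X (Suc l) s t \<le> favg S f X l (dec s a) (t + a * real_of_int (X (Suc l)))"
    then show ?goal unfolding t'_def by (rule disjI1)
   next
    assume "\<exists>c\<in>S. c \<noteq> a \<and> 0 < s c \<and> \<mu> * favg S f X (Suc l) s t \<le> favg S f X l (dec s c) (t + c * real_of_int (X (Suc l)))"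
    then obtain c where "c \<in> S" "c \<noteq> a" "0 < s c" "\<mu> * favg S f X (Suc l) s t \<le> favg S f X l (dec s c) (t + c * real_of_int (X (Suc l)))"
     by (elim bexE conjE)
    then show ?goal by (intro disjI2 r)
   qed
   then show ?thesis unfolding t0 True top diff_Suc_1 below b'a cS[OF a(1)] .
  next
   case False
   then have il: "i \<in> {1..l}" "i \<le> l" "i - 1 \<le> l" using i by auto
   show ?thesis unfolding t0 lev'[OF il(2)] lev'[OF il(3)] cnt'[OF il(2)] b'l[OF il(2)] riv'[OF il(1)] by (rule step[OF il(1), THEN conjunct2])
  qed
 qed
qed

lemma prod_ranks:
 assumes S: "finite S" and b: "b \<in> {1..l} \<rightarrow>\<^sub>E S"
 shows "(\<Prod>i\<in>{1..l}. real (cnt b i (b i))) = (\<Prod>a\<in>S. fact (cnt b l a))"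
proof -
 have "(\<Prod>i\<in>{1..m}. real (cnt b i (b i))) = (\<Prod>a\<in>S. fact (cnt b m a))" if "m \<le> l" for m
  using that
 proof (induction m)
  case 0
  then show ?case by simp
 next
  case (Suc m)
  define c where "c = b (Suc m)"
  have cS: "c \<in> S" unfolding c_def by (rule PiE_mem[OF b]) (use Suc.prems in simp)
  have "(\<Prod>a\<in>S. fact (cnt b (Suc m) a) :: real) = fact (cnt b m c + 1) * (\<Prod>a\<in>S - {c}. fact (cnt b m a))"
   using S cS by (subst prod.remove[of S c]) (auto simp: cnt_Suc c_def intro!: prod.cong)
  also have "... = (real (cnt b m c) + 1) * (\<Prod>a\<in>S. fact (cnt b m a))"
   using prod.remove[OF S cS, of "\<lambda>a. fact (cnt b m a) :: real"] by (simp add: mult.assoc add.commute)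
  also have "... = (\<Prod>i\<in>{1..Suc m}. real (cnt b i (b i)))"
   using Suc by (simp add: c_def cnt_Suc atLeastAtMostSuc_conv algebra_simps)
  finally show ?case by simp
 qed
 then show ?thesis by simp
qed

lemma prod_ranks_subset:
 assumes S: "finite S" and b: "b \<in> {1..l} \<rightarrow>\<^sub>E S" and P: "P \<subseteq> {1..l}"
 shows "(\<Prod>a\<in>S. fact (card {i\<in>P. b i = a})) \<le> (\<Prod>i\<in>P. real (cnt b i (b i)))"
proof -
 have "(\<Prod>a\<in>S. fact (card {i\<in>P. i \<le> m \<and> b i = a})) \<le> (\<Prod>i\<in>{i\<in>P. i \<le> m}. real (cnt b i (b i)))" if "m \<le> l" for m
  using that
 proof (induction m)
  case 0
  have "0 \<notin> P" using P by auto
  then have e: "{i\<in>P. i \<le> 0} = {}" "\<And>a. {i\<in>P. i \<le> 0 \<and> b i = a} = {}" by auto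
  show ?case unfolding e by (simp only: card.empty fact_0 prod.neutral_const prod.empty order_refl)
 next
  case (Suc m)
  have fP: "finite P" using P finite_subset by blast
  show ?case
  proof (cases "Suc m \<in> P")
   case False
   then have "{i\<in>P. i \<le> Suc m} = {i\<in>P. i \<le> m}" "\<And>a. {i\<in>P. i \<le> Suc m \<and> b i = a} = {i\<in>P. i \<le> m \<and> b i = a}"
    by (auto simp: le_Suc_eq)
   then show ?thesis using Suc by simp
  next
   case True
   define c where "c = b (Suc m)"
   have cS: "c \<in> S" unfolding c_def by (rule PiE_mem[OF b]) (use Suc.prems in simp)
   let ?K = "\<lambda>m a. {i\<in>P. i \<le> m \<and> b i = a}"
   have K: "?K (Suc m) a = (if a = c then insert (Suc m) (?K m a) else ?K m a)" for a
    using True by (auto simp: c_def le_Suc_eq)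
   have Kc: "card (?K (Suc m) c) = Suc (card (?K m c))" unfolding K using fP by simp
   have le: "card (?K (Suc m) c) \<le> cnt b (Suc m) c"
    unfolding cnt_def using P by (intro card_mono) auto
   have "(\<Prod>a\<in>S. fact (card (?K (Suc m) a)) :: real) = fact (card (?K (Suc m) c)) * (\<Prod>a\<in>S - {c}. fact (card (?K m a)))"
    using S cS by (subst prod.remove[of S c]) (auto simp: K intro!: prod.cong)
   also have "... = real (card (?K (Suc m) c)) * (\<Prod>a\<in>S. fact (card (?K m a)))"
    unfolding Kc using prod.remove[OF S cS, of "\<lambda>a. fact (card (?K m a)) :: real"] by (simp only: fact_Suc of_nat_mult of_nat_fact mult.assoc)
   also have "... \<le> real (cnt b (Suc m) c) * (\<Prod>i\<in>{i\<in>P. i \<le> m}. real (cnt b i (b i)))"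
    using le Suc by (intro mult_mono) (auto intro!: prod_nonneg)
   also have "... = (\<Prod>i\<in>insert (Suc m) {i\<in>P. i \<le> m}. real (cnt b i (b i)))"
    using fP by (subst prod.insert) (auto simp: c_def)
   also have "insert (Suc m) {i\<in>P. i \<le> m} = {i\<in>P. i \<le> Suc m}" using True by auto
   finally show ?thesis .
  qed
 qed
 from this[of l] have "(\<Prod>a\<in>S. fact (card {i\<in>P. i \<le> l \<and> b i = a})) \<le> (\<Prod>i\<in>{i\<in>P. i \<le> l}. real (cnt b i (b i)))" by simp
 moreover have "{i\<in>P. i \<le> l} = P" "\<And>a. {i\<in>P. i \<le> l \<and> b i = a} = {i\<in>P. b i = a}" using P by auto
 ultimately show ?thesis by simp
qed

text \<open>
 On a set \<open>P\<close> of few levels, the inverse weights of the letters multiply to little: by the multinomial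
 structure their product is at most \<open>n ^ \<bar>P\<bar>\<close> divided by factorials of the numbers \<open>\<bar>P\<^sub>a\<bar>\<close> of occurrences in \<open>P\<close>,
 and \<open>(x n) ^ m / m! \<le> exp (x n)\<close>.
\<close>

lemma prod_inverse_ranks_le:
 assumes S: "finite S" and b: "b \<in> {1..l} \<rightarrow>\<^sub>E S" and P: "P \<subseteq> {1..l}" and l: "l \<le> n" and x: "0 < x"
 shows "(\<Prod>i\<in>P. real i / real (cnt b i (b i))) \<le> exp (real (card S) * x * real n) * (1 / x) ^ card P"
proof -
 have fP: "finite P" using P finite_subset by blast
 let ?q = "\<lambda>a. card {i\<in>P. b i = a}"
 have cq: "(\<Sum>a\<in>S. ?q a) = card P"
 proof -
  have "(\<Sum>a\<in>S. \<Sum>i\<in>{i\<in>P. b i = a}. 1) = (\<Sum>i\<in>P. 1::nat)"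
   using S fP PiE_mem[OF b] P by (intro sum.group) blast+
  then show ?thesis by simp
 qed
 have pos: "0 < (\<Prod>a\<in>S. fact (?q a) :: real)" by (intro prod_pos) auto
 have "(\<Prod>i\<in>P. real i / real (cnt b i (b i))) = (\<Prod>i\<in>P. real i) / (\<Prod>i\<in>P. real (cnt b i (b i)))" by (rule prod_dividef)
 also have "... \<le> real n ^ card P / (\<Prod>a\<in>S. fact (?q a))"
 proof (rule frac_le)
  have "(\<Prod>i\<in>P. real i) \<le> (\<Prod>i\<in>P. real n)" using P l by (intro prod_mono) auto
  then show "(\<Prod>i\<in>P. real i) \<le> real n ^ card P" by simp
 qed (use pos prod_ranks_subset[OF S b P] in auto)
 also have "... = (\<Prod>a\<in>S. real n ^ ?q a / fact (?q a))"
  unfolding cq[symmetric] by (simp add: power_sum prod_dividef)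
 also have "... \<le> (\<Prod>a\<in>S. exp (x * real n) * (1 / x) ^ ?q a)"
 proof (rule prod_mono)
  fix a
  have "(x * real n) ^ ?q a / fact (?q a) \<le> exp (x * real n)" using x by (intro power_div_fact_le_exp) auto
  then have "((x * real n) ^ ?q a / fact (?q a)) * (1 / x) ^ ?q a \<le> exp (x * real n) * (1 / x) ^ ?q a"
   using x by (intro mult_right_mono) auto
  moreover have "((x * real n) ^ ?q a / fact (?q a)) * (1 / x) ^ ?q a = real n ^ ?q a / fact (?q a)"
   using x by (simp add: power_mult_distrib power_divide)
  ultimately show "0 \<le> real n ^ ?q a / fact (?q a) \<and> real n ^ ?q a / fact (?q a) \<le> exp (x * real n) * (1 / x) ^ ?q a" by simp
 qed
 also have "... = exp (real (card S) * x * real n) * (1 / x) ^ card P"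
  unfolding cq[symmetric] by (simp add: prod.distrib power_sum exp_of_nat_mult[symmetric] mult.assoc)
 finally show ?thesis .
qed

section \<open>A supremum bound whose constant depends on the exponent\<close>

lemma rival_mono: "rival S f b t0 i y X \<Longrightarrow> y' \<le> y \<Longrightarrow> rival S f b t0 i y' X"
 unfolding rival_def by force

lemma rival_indep:
 assumes "i < j"
 shows "rival S f b t0 i y (X(j := x)) = rival S f b t0 i y X"
proof -
 have "favg S f (X(j := x)) (i - 1) s t = favg S f X (i - 1) s t" for s t
  using assms by (intro favg_cong_X) auto
 moreover have "dot b (X(j := x)) (i - 1) = dot b X (i - 1)"
  using assms by (intro dot_cong) auto
 ultimately show ?thesis unfolding rival_def using assms by simp
qed

lemma eventually_sqrt_le_exp:
 assumes "0 < w"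
 shows "\<forall>\<^sub>F n in at_top. sqrt (real n) \<le> exp (w * real n)"
 using assms by real_asymp

context alphabet
begin

lemma dS_nonneg: "0 \<le> dS"
 using two_letters dS by (metis abs_ge_zero order_trans)

lemma card_slice_le: "card (slice S l s) \<le> card S ^ l"
proof -
 have "card (slice S l s) \<le> card ({1..l} \<rightarrow>\<^sub>E S)"
  unfolding slice_def using S by (intro card_mono finite_PiE) auto
 then show ?thesis by (simp add: card_PiE)
qed

lemma tame_favg_round:
 assumes f: "tame (dS + 1) f" and h: "\<bar>h\<bar> \<le> 1"
 shows "favg S f X l s (t + h) \<le> 2 * favg S f X l s t"
 using tameD(4)[OF f] h dS_nonneg by (intro favg_shift_le) auto

lemma rival_round:
 assumes f: "tame (dS + 1) f" and r: "rival S f b t0 i y X"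
 shows "rival S f b (real_of_int \<lfloor>t0\<rfloor>) i (y / 2) X"
proof -
 obtain a where a: "a \<in> S" "a \<noteq> b i" "0 < cnt b i a"
  and y: "y \<le> favg S f X (i - 1) (dec (cnt b i) a) (t0 - dot b X (i - 1) + (a - b i) * real_of_int (X i))"
  using r unfolding rival_def by blast
 have "t0 - dot b X (i - 1) + (a - b i) * real_of_int (X i)
   = (real_of_int \<lfloor>t0\<rfloor> - dot b X (i - 1) + (a - b i) * real_of_int (X i)) + (t0 - real_of_int \<lfloor>t0\<rfloor>)" by simp
 moreover have "\<bar>t0 - real_of_int \<lfloor>t0\<rfloor>\<bar> \<le> 1" by linarith
 ultimately have "y \<le> 2 * favg S f X (i - 1) (dec (cnt b i) a) (real_of_int \<lfloor>t0\<rfloor> - dot b X (i - 1) + (a - b i) * real_of_int (X i))"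
  using y tame_favg_round[OF f] by (metis order_trans)
 then show ?thesis unfolding rival_def using a by (intro bexI[of _ a]) auto
qed

text \<open>
 Markov's inequality over the single coordinate \<open>X i\<close>, with a union bound over the letters.
\<close>

lemma rival_prob:
 assumes y: "0 < y" and bd: "\<And>a. a \<in> S \<Longrightarrow> a \<noteq> b i \<Longrightarrow> 0 < cnt b i a \<Longrightarrow>
   (\<Sum>x\<in>A i. favg S f Z (i - 1) (dec (cnt b i) a) (t0 - dot b Z (i - 1) + (a - b i) * real_of_int x)) \<le> B * real (card (A i))"
  and A: "finite (A i)" "A i \<noteq> {}" and f0: "\<And>t. 0 \<le> f t" and i: "1 \<le> i" and B: "0 \<le> B"
 shows "(\<Sum>x\<in>A i. unif A i x * of_bool (rival S f b t0 i y (Z(i := x)))) \<le> real (card S) * B / y"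
proof -
 let ?S' = "{a\<in>S. a \<noteq> b i \<and> 0 < cnt b i a}"
 let ?g = "\<lambda>a x. favg S f Z (i - 1) (dec (cnt b i) a) (t0 - dot b Z (i - 1) + (a - b i) * real_of_int x)"
 have c: "0 < real (card (A i))" using A by (simp add: card_gt_0_iff)
 have Zx: "favg S f (Z(i := x)) (i - 1) s t = favg S f Z (i - 1) s t" "dot b (Z(i := x)) (i - 1) = dot b Z (i - 1)" for x s t
  using i by (intro favg_cong_X dot_cong; auto)+
 have g0: "0 \<le> ?g a x" for a x by (rule favg_nonneg[OF f0])
 have one: "of_bool (rival S f b t0 i y (Z(i := x))) \<le> (\<Sum>a\<in>?S'. ?g a x / y)" for x
 proof (cases "rival S f b t0 i y (Z(i := x))")
  case True
  then obtain a where a: "a \<in> ?S'" "y \<le> ?g a x" unfolding rival_def Zx by auto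
  have "1 \<le> ?g a x / y" using a y by (simp add: le_divide_eq)
  also have "... \<le> (\<Sum>a\<in>?S'. ?g a x / y)" using a S g0 y by (intro member_le_sum) auto
  finally show ?thesis using True by simp
 next
  case False
  then show ?thesis using g0 y by (auto intro!: sum_nonneg)
 qed
 have "(\<Sum>x\<in>A i. unif A i x * of_bool (rival S f b t0 i y (Z(i := x)))) \<le> (\<Sum>x\<in>A i. unif A i x * (\<Sum>a\<in>?S'. ?g a x / y))"
  by (intro sum_mono mult_left_mono one) (simp add: unif_def)
 also have "... = (\<Sum>x\<in>A i. \<Sum>a\<in>?S'. ?g a x / (y * real (card (A i))))"
  unfolding unif_def by (simp add: sum_distrib_left divide_simps mult.commute)
 also have "... = (\<Sum>a\<in>?S'. \<Sum>x\<in>A i. ?g a x / (y * real (card (A i))))" by (rule sum.swap)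
 also have "... = (\<Sum>a\<in>?S'. (\<Sum>x\<in>A i. ?g a x) / (y * real (card (A i))))" by (simp only: sum_divide_distrib)
 also have "... \<le> (\<Sum>a\<in>?S'. B / y)"
 proof (rule sum_mono)
  fix a assume "a \<in> ?S'"
  then have "(\<Sum>x\<in>A i. ?g a x) / (y * real (card (A i))) \<le> B * real (card (A i)) / (y * real (card (A i)))"
   using bd[of a] y c by (intro divide_right_mono) auto
  then show "(\<Sum>x\<in>A i. ?g a x) / (y * real (card (A i))) \<le> B / y" using c by simp
 qed
 also have "... \<le> real (card S) * (B / y)"
 proof -
  have "card ?S' \<le> card S" using S by (intro card_mono) auto
  then show ?thesis using B y by (simp add: mult_right_mono divide_right_mono)
 qed
 finally show ?thesis by simp
qed

text \<open>
 The deterministic part. Let \<open>P\<close> be the set of levels with a rival on the path of largest children. If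
 \<open>P\<close> has fewer than \<open>cc\<close> elements among the top \<open>tt\<close> levels, the value has grown by the factor \<open>G\<close> on these
 levels, because each letter has weight at most \<open>1 - pm / 2\<close> there. If \<open>P\<close> is small below them as well, the
 product of all inverse weights is the size of the slice, the weights in \<open>P\<close> account for little of it, and the value at
 the bottom would exceed the bound \<open>f \<le> 2\<close>. The level \<open>i0\<close> may be ignored at the cost of one.
\<close>

lemma many_rivals:
 fixes n l tt cc :: nat and \<mu> \<tau> x :: real
 assumes f: "tame (dS + 1) f" and s: "(\<Sum>a\<in>S. s a) = l" and ln: "l \<le> n" and tt: "tt \<le> l"
  and \<mu>: "0 < \<mu>" "\<mu> \<le> pm / 8" and \<tau>: "0 < \<tau>" and x: "0 < x" "x < 1" and big: "\<tau> \<le> favg S f X l s t"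
  and ratio: "\<And>i s' a. i \<le> l \<Longrightarrow> l - tt < i \<Longrightarrow> (\<forall>a\<in>S. s' a \<le> s a) \<Longrightarrow> (\<Sum>a\<in>S. s' a) = i \<Longrightarrow> a \<in> S \<Longrightarrow>
    real (s' a) \<le> (1 - pm / 2) * real i"
  and gain: "G \<le> (1 + pm / 4) ^ (tt - cc)" and G: "1 \<le> G"
  and contra: "2 * (exp (real (card S) * x * real n) * (1 / x) ^ (2 * cc + 1)) < \<tau> * (1 - \<mu>) ^ n * real (card (slice S l s))"
 shows "\<exists>b\<in>slice S l s. \<exists>z::int. \<tau> / 2 \<le> f (real_of_int z) \<and>
   ((\<exists>Y. Y \<subseteq> {l - tt<..l} \<and> card Y = cc \<and> (\<forall>i\<in>Y. rival S f b (real_of_int z) i (\<mu> * \<tau> / 2) X)) \<or>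
   (\<exists>Y. Y \<subseteq> {1..l - tt} - {i0} \<and> card Y = cc \<and> (\<forall>i\<in>Y. rival S f b (real_of_int z) i (\<mu> * (\<tau> * G) / 2) X)))"
proof -
 have f0: "\<And>t. 0 \<le> f t" by (rule tameD(1)[OF f])
 have \<mu>1: "\<mu> < 1" using \<mu> pm_le by simp
 obtain b where b: "b \<in> {1..l} \<rightarrow>\<^sub>E S" and cb: "\<And>a. a \<in> S \<Longrightarrow> cnt b l a = s a"
  and step: "\<And>i. i \<in> {1..l} \<Longrightarrow> lev S f X b (t + dot b X l) i \<le> lev S f X b (t + dot b X l) (i - 1) \<and>
   ((1 - \<mu>) * (real i / real (cnt b i (b i))) * lev S f X b (t + dot b X l) i \<le> lev S f X b (t + dot b X l) (i - 1)
    \<or> rival S f b (t + dot b X l) i (\<mu> * lev S f X b (t + dot b X l) i) X)"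
 proof -
  from max_path[where X = X and t = t, OF S(1) f0 \<mu>(1) \<mu>1 s]
  obtain b where b: "b \<in> {1..l} \<rightarrow>\<^sub>E S" and hb: "(\<forall>a\<in>S. cnt b l a = s a) \<and>
   (\<forall>i\<in>{1..l}. lev S f X b (t + dot b X l) i \<le> lev S f X b (t + dot b X l) (i - 1) \<and>
   ((1 - \<mu>) * (real i / real (cnt b i (b i))) * lev S f X b (t + dot b X l) i \<le> lev S f X b (t + dot b X l) (i - 1)
    \<or> rival S f b (t + dot b X l) i (\<mu> * lev S f X b (t + dot b X l) i) X))"
   by (rule bexE)
  show thesis by (rule that[OF b hb[THEN conjunct1, THEN bspec] hb[THEN conjunct2, THEN bspec]])
 qed
 define t0 where "t0 = t + dot b X l"
 define v where "v = lev S f X b t0"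
 define P where "P = {i\<in>{1..l}. rival S f b t0 i (\<mu> * v i) X}"
 note step = step[folded t0_def, folded v_def]
 have bs: "b \<in> slice S l s" using b cb by (intro sliceI)
 have bS: "b i \<in> S" if "1 \<le> i" "i \<le> l" for i using PiE_mem[OF b, of i] that by simp
 have mono: "v i \<le> v (i - 1)" if "1 \<le> i" "i \<le> l" for i using step[of i] that by simp
 have jump: "(1 - \<mu>) * (real i / real (cnt b i (b i))) * v i \<le> v (i - 1)" if "1 \<le> i" "i \<le> l" "i \<notin> P" for i
  using step[of i] that unfolding P_def by auto
 have v0: "0 \<le> v i" for i unfolding v_def lev_def by (rule favg_nonneg[OF f0])
 have vl: "\<tau> \<le> v l"
 proof -
  have "v l = favg S f X l (cnt b l) t" unfolding v_def lev_def t0_def by (simp only: add_diff_cancel_right')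
  also have "... = favg S f X l s t" by (rule favg_cong_type) (rule cb)
  finally show ?thesis using big by simp
 qed
 have vge: "v l \<le> v (l - j)" if "j \<le> l" for j
  using that
 proof (induction j)
  case (Suc j)
  then have "v (l - j) \<le> v (l - j - 1)" by (intro mono) auto
  then show ?case using Suc by simp
 qed simp
 have vge': "v l \<le> v i" if "i \<le> l" for i using vge[of "l - i"] that by simp
 have vj: "v (i + d) \<le> v i" if "i + d \<le> l" for i d
  using that
 proof (induction d)
  case (Suc d)
  then have "v (i + Suc d) \<le> v (i + Suc d - 1)" by (intro mono) auto
  then show ?case using Suc by simp
 qed simp
 have f0v: "f t0 = v 0" unfolding v_def lev_def dot_def by simp
 define z where "z = \<lfloor>t0\<rfloor>"
 have fz: "\<tau> / 2 \<le> f (real_of_int z)"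
 proof -
  have "f (real_of_int z + (t0 - real_of_int z)) \<le> 2 * f (real_of_int z)"
   using dS_nonneg unfolding z_def by (intro tameD(4)[OF f]) linarith
  then show ?thesis using f0v vl vge'[of 0] by simp
 qed
 have rz: "rival S f b (real_of_int z) i (y / 2) X" if "i \<in> P" "y \<le> \<mu> * v i" for i y
  using that rival_round[OF f, of b t0 i y X] rival_mono[of S f b t0 i "\<mu> * v i" X y] unfolding P_def z_def by simp
 let ?Top = "{l - tt<..l}" and ?Low = "{1..l - tt} - {i0}"
 have finP: "finite P" unfolding P_def by simp
 have "(\<exists>Y. Y \<subseteq> ?Top \<and> card Y = cc \<and> (\<forall>i\<in>Y. rival S f b (real_of_int z) i (\<mu> * \<tau> / 2) X)) \<or>
   (\<exists>Y. Y \<subseteq> ?Low \<and> card Y = cc \<and> (\<forall>i\<in>Y. rival S f b (real_of_int z) i (\<mu> * (\<tau> * G) / 2) X))"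
 proof (cases "cc \<le> card (P \<inter> ?Top)")
  case True
  then obtain Y where Y: "Y \<subseteq> P \<inter> ?Top" "card Y = cc" by (meson obtain_subset_with_card_n)
  have "rival S f b (real_of_int z) i (\<mu> * \<tau> / 2) X" if "i \<in> Y" for i
  proof (rule rz)
   show "i \<in> P" using Y that by auto
   have "\<tau> \<le> v i" using Y that vl vge'[of i] by fastforce
   then show "\<mu> * \<tau> \<le> \<mu> * v i" using \<mu> by simp
  qed
  then show ?thesis using Y by blast
 next
  case False
  have cnt_pos: "0 < cnt b i (b i)" if "1 \<le> i" "i \<le> l" for i
   unfolding cnt_def using that by (auto simp: card_gt_0_iff)
  have g: "(1 + pm / 4) * v i \<le> v (i - 1)" if i: "i \<in> ?Top" "i \<notin> P" for i
  proof -
   have i1: "1 \<le> i" "i \<le> l" "l - tt < i" using i by auto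
   have "real (cnt b i (b i)) \<le> (1 - pm / 2) * real i"
   proof (rule ratio[OF i1(2,3)])
    show "\<forall>a\<in>S. cnt b i a \<le> s a"
    proof
     fix a assume "a \<in> S"
     have "cnt b i a \<le> cnt b l a" unfolding cnt_def using i1 by (intro card_mono) auto
     then show "cnt b i a \<le> s a" using cb[OF \<open>a \<in> S\<close>] by simp
    qed
    show "(\<Sum>a\<in>S. cnt b i a) = i" using bS i1 by (intro sum_cnt S) auto
    show "b i \<in> S" by (rule bS[OF i1(1,2)])
   qed
   moreover have "(1 + pm / 4) * (1 - pm / 2) \<le> 1 - \<mu>"
   proof -
    have "(1 + pm / 4) * (1 - pm / 2) = 1 - pm / 4 - pm * pm / 8" by (simp add: field_simps)
    moreover have "0 \<le> pm * pm" using pm by simp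
    ultimately show ?thesis using \<mu> pm by linarith
   qed
   ultimately have "(1 + pm / 4) * real (cnt b i (b i)) \<le> (1 - \<mu>) * real i"
   proof -
    assume 1: "real (cnt b i (b i)) \<le> (1 - pm / 2) * real i" and 2: "(1 + pm / 4) * (1 - pm / 2) \<le> 1 - \<mu>"
    have "(1 + pm / 4) * real (cnt b i (b i)) \<le> (1 + pm / 4) * ((1 - pm / 2) * real i)"
     using 1 pm by (intro mult_left_mono) auto
    also have "... \<le> (1 - \<mu>) * real i" using mult_right_mono[OF 2, of "real i"] by (simp only: mult.assoc)
    finally show ?thesis .
   qed
   then have "1 + pm / 4 \<le> (1 - \<mu>) * (real i / real (cnt b i (b i)))"
    using cnt_pos[OF i1(1,2)] by (simp add: le_divide_eq)
   then have "(1 + pm / 4) * v i \<le> (1 - \<mu>) * (real i / real (cnt b i (b i))) * v i"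
    using v0 by (rule mult_right_mono)
   also have "... \<le> v (i - 1)" by (rule jump[OF i1(1,2) i(2)])
   finally show ?thesis .
  qed
  have climb: "(1 + pm / 4) ^ card ({l - j<..l} - P) * v l \<le> v (l - j)" if "j \<le> tt" for j
   using that
  proof (induction j)
   case 0
   then show ?case by simp
  next
   case (Suc j)
   let ?i = "l - j"
   have i: "?i \<in> ?Top" "1 \<le> ?i" "?i \<le> l" using Suc.prems tt by auto
   have ins: "{l - Suc j<..l} = insert ?i {l - j<..l}" using i by auto
   show ?case
   proof (cases "?i \<in> P")
    case True
    then have "{l - Suc j<..l} - P = {l - j<..l} - P" unfolding ins by auto
    then show ?thesis using Suc mono[OF i(2,3)] by simp
   next
    case False
    then have "{l - Suc j<..l} - P = insert ?i ({l - j<..l} - P)" unfolding ins by auto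
    then have c: "card ({l - Suc j<..l} - P) = Suc (card ({l - j<..l} - P))" by simp
    have "(1 + pm / 4) ^ card ({l - Suc j<..l} - P) * v l = (1 + pm / 4) * ((1 + pm / 4) ^ card ({l - j<..l} - P) * v l)"
     unfolding c by simp
    also have "... \<le> (1 + pm / 4) * v ?i" using Suc pm by (intro mult_left_mono) auto
    also have "... \<le> v (?i - 1)" by (rule g[OF i(1) False])
    finally show ?thesis by simp
   qed
  qed
  have "tt - cc \<le> card (?Top - P)"
  proof -
   have "card ?Top = tt" using tt by simp
   moreover have "card ?Top = card (?Top - P) + card (P \<inter> ?Top)"
   proof -
    have "?Top = (?Top - P) \<union> (P \<inter> ?Top)" by blast
    then have "card ?Top = card ((?Top - P) \<union> (P \<inter> ?Top))" by (rule arg_cong)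
    also have "... = card (?Top - P) + card (P \<inter> ?Top)" by (rule card_Un_disjoint) auto
    finally show ?thesis .
   qed
   ultimately show ?thesis using False by linarith
  qed
  then have "(1 + pm / 4) ^ (tt - cc) \<le> (1 + pm / 4) ^ card (?Top - P)" using pm by (intro power_increasing) auto
  then have "G * v l \<le> (1 + pm / 4) ^ card (?Top - P) * v l"
   using gain v0 by (intro mult_right_mono) (auto intro: order_trans)
  also have "... \<le> v (l - tt)" by (rule climb) simp
  finally have "G * v l \<le> v (l - tt)" .
  moreover have "G * \<tau> \<le> G * v l" using vl G by (intro mult_left_mono) auto
  ultimately have Gv: "\<tau> * G \<le> v (l - tt)" by (simp add: mult.commute)
  show ?thesis
  proof (cases "cc \<le> card (P \<inter> ?Low)")
   case True
   then obtain Y where Y: "Y \<subseteq> P \<inter> ?Low" "card Y = cc" by (meson obtain_subset_with_card_n)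
   have "rival S f b (real_of_int z) i (\<mu> * (\<tau> * G) / 2) X" if "i \<in> Y" for i
   proof (rule rz)
    show "i \<in> P" using Y that by auto
    have il: "i \<le> l - tt" using subsetD[OF Y(1) that] by simp
    have "v (i + (l - tt - i)) \<le> v i" using il by (intro vj) linarith
    moreover have "i + (l - tt - i) = l - tt" using il by linarith
    ultimately have "v (l - tt) \<le> v i" by simp
    then show "\<mu> * (\<tau> * G) \<le> \<mu> * v i" using \<mu> Gv by simp
   qed
   then show ?thesis using Y by blast
  next
   case few: False
   have "P \<subseteq> (P \<inter> ?Top) \<union> (P \<inter> ?Low) \<union> {i0}" unfolding P_def by auto
   then have "card P \<le> card ((P \<inter> ?Top) \<union> (P \<inter> ?Low) \<union> {i0})" using finP by (intro card_mono) auto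
   also have "... \<le> card (P \<inter> ?Top) + card (P \<inter> ?Low) + card {i0}"
    by (meson add_mono card_Un_le order_refl order_trans)
   finally have cP: "card P \<le> 2 * cc + 1" using few \<open>\<not> cc \<le> card (P \<inter> ?Top)\<close> by simp
   let ?r = "\<lambda>i. real i / real (cnt b i (b i))"
   have rpos: "0 < ?r i" if "i \<in> {1..l}" for i using that cnt_pos[of i] by simp
   have fall: "(\<Prod>i\<in>{1..m} - P. (1 - \<mu>) * ?r i) * v m \<le> v 0" if "m \<le> l" for m
    using that
   proof (induction m)
    case (Suc m)
    have pn: "0 \<le> (\<Prod>i\<in>{1..m} - P. (1 - \<mu>) * ?r i)"
     using \<mu>1 by (intro prod_nonneg) auto
    show ?case
    proof (cases "Suc m \<in> P")
     case True
     then have "{1..Suc m} - P = {1..m} - P" by (auto simp: le_Suc_eq)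
     moreover have "v (Suc m) \<le> v m" using mono[of "Suc m"] Suc.prems by simp
     ultimately show ?thesis using Suc mult_left_mono[OF _ pn, of "v (Suc m)" "v m"] by fastforce
    next
     case False
     then have "{1..Suc m} - P = insert (Suc m) ({1..m} - P)" by (auto simp: le_Suc_eq)
     then have "(\<Prod>i\<in>{1..Suc m} - P. (1 - \<mu>) * ?r i) * v (Suc m)
      = (\<Prod>i\<in>{1..m} - P. (1 - \<mu>) * ?r i) * ((1 - \<mu>) * ?r (Suc m) * v (Suc m))" by simp
     also have "... \<le> (\<Prod>i\<in>{1..m} - P. (1 - \<mu>) * ?r i) * v m"
      using jump[of "Suc m"] False Suc.prems pn by (intro mult_left_mono) auto
     also have "... \<le> v 0" using Suc by simp
     finally show ?thesis .
    qed
   qed simp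
   have all: "(\<Prod>i\<in>{1..l}. ?r i) = real (card (slice S l s))"
   proof -
    have "(\<Prod>i\<in>{1..l}. ?r i) = (\<Prod>i\<in>{1..l}. real i) / (\<Prod>i\<in>{1..l}. real (cnt b i (b i)))" by (rule prod_dividef)
    also have "(\<Prod>i\<in>{1..l}. real i) = fact l" by (simp add: fact_prod)
    also have "(\<Prod>i\<in>{1..l}. real (cnt b i (b i))) = (\<Prod>a\<in>S. fact (s a))"
     using prod_ranks[OF S(1) b] cb by simp
    also have "fact l / (\<Prod>a\<in>S. fact (s a) :: real) = real (card (slice S l s))"
    proof -
     have "(\<Prod>a\<in>S. fact (s a) :: real) \<noteq> 0" using S by simp
     then show ?thesis using card_slice[OF S(1) s] by (simp add: field_simps)
    qed
    finally show ?thesis .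
   qed
   have sp: "real (card (slice S l s)) = (\<Prod>i\<in>{1..l} - P. ?r i) * (\<Prod>i\<in>P. ?r i)"
   proof -
    have "P \<subseteq> {1..l}" unfolding P_def by blast
    then show ?thesis unfolding all[symmetric] by (rule prod.subset_diff) simp
   qed
   have PP: "(\<Prod>i\<in>P. ?r i) \<le> exp (real (card S) * x * real n) * (1 / x) ^ (2 * cc + 1)"
   proof -
    have "(\<Prod>i\<in>P. ?r i) \<le> exp (real (card S) * x * real n) * (1 / x) ^ card P"
     by (rule prod_inverse_ranks_le[OF S(1) b _ ln x(1)]) (auto simp: P_def)
    also have "... \<le> exp (real (card S) * x * real n) * (1 / x) ^ (2 * cc + 1)"
     using cP x by (intro mult_left_mono power_increasing) auto
    finally show ?thesis .
   qed
   have R0: "0 \<le> (\<Prod>i\<in>{1..l} - P. ?r i)" by (intro prod_nonneg) auto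
   have "(1 - \<mu>) ^ n \<le> (1 - \<mu>) ^ card ({1..l} - P)"
   proof (rule power_decreasing)
    have "card ({1..l} - P) \<le> card {1..l}" by (intro card_mono) auto
    then show "card ({1..l} - P) \<le> n" using ln by simp
   qed (use \<mu> \<mu>1 in auto)
   then have "(1 - \<mu>) ^ n * (\<Prod>i\<in>{1..l} - P. ?r i) \<le> (\<Prod>i\<in>{1..l} - P. (1 - \<mu>) * ?r i)"
    unfolding prod.distrib prod_constant using R0 by (rule mult_right_mono)
   then have "(1 - \<mu>) ^ n * (\<Prod>i\<in>{1..l} - P. ?r i) * \<tau> \<le> (\<Prod>i\<in>{1..l} - P. (1 - \<mu>) * ?r i) * v l"
    using vl \<tau> \<mu>1 R0 by (intro mult_mono) (auto intro!: prod_nonneg)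
   also have "... \<le> 2" using fall[of l] f0v tame_le_2[OF f, of t0] dS_nonneg by simp
   finally have le2: "(1 - \<mu>) ^ n * (\<Prod>i\<in>{1..l} - P. ?r i) * \<tau> \<le> 2" .
   have "\<tau> * (1 - \<mu>) ^ n * real (card (slice S l s)) = ((1 - \<mu>) ^ n * (\<Prod>i\<in>{1..l} - P. ?r i) * \<tau>) * (\<Prod>i\<in>P. ?r i)"
    unfolding sp by simp
   also have "... \<le> 2 * (\<Prod>i\<in>P. ?r i)" using le2 by (rule mult_right_mono) (auto intro!: prod_nonneg)
   also have "... \<le> 2 * (exp (real (card S) * x * real n) * (1 / x) ^ (2 * cc + 1))" using PP by simp
   finally show ?thesis using contra by simp
  qed
 qed
 then show ?thesis using bs fz by blast
qed

text \<open>
 Union bound over the alternatives in \<open>many_rivals\<close>. On the top levels a rival has probability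
 \<open>O(1 / L)\<close> by the hypothesis on sums over \<open>A i\<close>, which carries the factor \<open>1 / sqrt n\<close>. Further down this factor is
 not available, but there the value has already grown by \<open>G = sqrt n\<close>, so the trivial bound \<open>favg_progression_total\<close> suffices. The
 exception \<open>i0\<close> is for a coordinate whose range may be shorter than \<open>N\<close>.
\<close>

lemma sup_bound_depending_on_exponent:
 assumes e: "0 < e" and \<theta>: "0 < \<theta>" and M: "0 < M" and C2: "0 < C2" and Hb: "0 \<le> Hb"
 obtains L :: real and n1 :: nat where "1 \<le> L"
  "\<And>(n::nat) (N::nat) f (A :: nat \<Rightarrow> int set) l s i0 Z0. n1 \<le> n \<Longrightarrow> 1 \<le> N \<Longrightarrow> real N \<le> exp (Hb * real n) \<Longrightarrow>
   tame (dS + 1) f \<Longrightarrow> l \<le> n \<Longrightarrow> \<theta> * real n \<le> real l \<Longrightarrow> (\<Sum>a\<in>S. s a) = l \<Longrightarrow>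
   exp (e * real n) * real N \<le> real (card (slice S l s)) \<Longrightarrow>
   (\<And>i. 1 \<le> i \<Longrightarrow> i \<le> l \<Longrightarrow> finite (A i) \<and> A i \<noteq> {}) \<Longrightarrow>
   (\<And>i. 1 \<le> i \<Longrightarrow> i \<le> l \<Longrightarrow> i \<noteq> i0 \<Longrightarrow> N \<le> card (A i)) \<Longrightarrow>
   (\<And>i X s' c t. 1 \<le> i \<Longrightarrow> i \<le> l \<Longrightarrow> real l - \<theta> * real n < real i \<Longrightarrow> (\<forall>j. 1 \<le> j \<and> j < i \<longrightarrow> X j \<in> A j) \<Longrightarrow>
     (\<forall>a\<in>S. s' a \<le> s a) \<Longrightarrow> (\<Sum>a\<in>S. s' a) = i - 1 \<Longrightarrow> gS \<le> \<bar>c\<bar> \<Longrightarrow> \<bar>c\<bar> \<le> dS \<Longrightarrow>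
     (\<Sum>x\<in>A i. favg S f X (i - 1) s' (t + c * real_of_int x)) \<le> C2 / (real N * sqrt (real n)) * real (card (A i))) \<Longrightarrow>
   (\<And>i s' a. i \<le> l \<Longrightarrow> real l - \<theta> * real n < real i \<Longrightarrow> (\<forall>a\<in>S. s' a \<le> s a) \<Longrightarrow> (\<Sum>a\<in>S. s' a) = i \<Longrightarrow> a \<in> S \<Longrightarrow>
     real (s' a) \<le> (1 - pm / 2) * real i) \<Longrightarrow>
   avg (unif A) A [1..<l + 1] (\<lambda>X. of_bool (\<exists>t. L / (real N * sqrt (real n)) \<le> favg S f X l s t)) Z0 \<le> exp (- M * real n)"
proof -
 define k where "k = real (card S)"
 have k: "2 \<le> k" unfolding k_def using S by simp
 define \<mu> where "\<mu> = min (pm / 8) (1 - exp (- e / 8))"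
 have \<mu>: "0 < \<mu>" "\<mu> \<le> pm / 8" "exp (- e / 8) \<le> 1 - \<mu>"
 proof -
  have "exp (- e / 8) < 1" using e by simp
  then show "0 < \<mu>" unfolding \<mu>_def using pm by simp
  show "\<mu> \<le> pm / 8" unfolding \<mu>_def by (rule min.cobounded1)
  have "\<mu> \<le> 1 - exp (- e / 8)" unfolding \<mu>_def by (rule min.cobounded2)
  then show "exp (- e / 8) \<le> 1 - \<mu>" by linarith
 qed
 define x where "x = min (e / (8 * k)) (1 / 2)"
 have x: "0 < x" "x < 1" "k * x \<le> e / 8" unfolding x_def using e k by (auto simp: min_def field_simps)
 define lx where "lx = ln (1 / x)"
 have lx: "0 < lx" unfolding lx_def using x by simp
 define c where "c = min (e / (32 * lx)) (\<theta> / 4)"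
 have c: "0 < c" "2 * c * lx \<le> e / 16" "c \<le> \<theta> / 4" unfolding c_def using e lx \<theta> by (auto simp: min_def field_simps)
 define C3 where "C3 = (2 * k * C2 + 4 * k / gS) / \<mu>"
 have C3: "0 < C3" unfolding C3_def using k C2 gS \<mu> by (intro divide_pos_pos add_pos_pos) auto
 define W where "W = M + Hb + ln (2 * k) + 1"
 have W: "0 < W" unfolding W_def using M Hb k by (simp add: add_pos_pos add_nonneg_pos)
 define L where "L = max 1 (C3 * exp (W / c))"
 have L: "1 \<le> L" "C3 * exp (W / c) \<le> L" unfolding L_def by auto
 have a0: "C3 / L \<le> exp (- W / c)"
 proof -
  have "C3 \<le> L * exp (- W / c)"
  proof -
   have "C3 = C3 * exp (W / c) * exp (- W / c)" by (simp add: mult.assoc flip: exp_add)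
   also have "... \<le> L * exp (- W / c)" using L(2) by (intro mult_right_mono) auto
   finally show ?thesis .
  qed
  then show ?thesis using L by (simp add: divide_le_eq mult.commute)
 qed
 define lg where "lg = ln (1 + pm / 4)"
 have lg: "0 < lg" unfolding lg_def using pm by simp
 have "\<forall>\<^sub>F n in at_top. 2 * sqrt (real n) < exp (e / 2 * real n - 3 * lx)" using e by real_asymp
 moreover have "\<forall>\<^sub>F n in at_top. sqrt (real n) \<le> exp (\<theta> / 2 * lg * real n)"
 proof -
  have "0 < \<theta> / 2 * lg" using \<theta> lg by simp
  then show ?thesis by (rule eventually_sqrt_le_exp)
 qed
 moreover have "\<forall>\<^sub>F n in at_top. 2 \<le> \<theta> / 4 * real n" using \<theta> by real_asymp
 moreover have "\<forall>\<^sub>F n in at_top. 8 * sqrt (real n) \<le> exp (real n)" by real_asymp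
 moreover have "\<forall>\<^sub>F n::nat in at_top. 1 \<le> n" by (rule eventually_ge_at_top)
 ultimately have "\<forall>\<^sub>F n in at_top. 2 * sqrt (real n) < exp (e / 2 * real n - 3 * lx) \<and> sqrt (real n) \<le> exp (\<theta> / 2 * lg * real n)
   \<and> 2 \<le> \<theta> / 4 * real n \<and> 8 * sqrt (real n) \<le> exp (real n) \<and> 1 \<le> n"
  by eventually_elim auto
 then obtain n1 where n1: "\<And>n. n1 \<le> n \<Longrightarrow> 2 * sqrt (real n) < exp (e / 2 * real n - 3 * lx) \<and> sqrt (real n) \<le> exp (\<theta> / 2 * lg * real n)
   \<and> 2 \<le> \<theta> / 4 * real n \<and> 8 * sqrt (real n) \<le> exp (real n) \<and> 1 \<le> n"
  unfolding eventually_sequentially by blast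
 show thesis
 proof (rule that[OF L(1), of n1], goal_cases)
  case (1 n N f A l s i0 Z0)
  note n = 1(1) and N = 1(2,3) and f = 1(4) and l = 1(5,6) and s = 1(7) and ent = 1(8)
   and A = 1(9) and AN = 1(10) and top = 1(11) and ratio = 1(12)
  note n1 = n1[OF n]
  have n0: "1 \<le> n" "0 < sqrt (real n)" "1 \<le> sqrt (real n)" using n1 by auto
  have f0: "\<And>t. 0 \<le> f t" by (rule tameD(1)[OF f])
  define tt where "tt = nat \<lfloor>\<theta> * real n\<rfloor>"
  have tt: "real tt \<le> \<theta> * real n" "\<theta> * real n - 1 < real tt" unfolding tt_def using \<theta> by (simp_all add: of_nat_nat)
  have ttl: "tt \<le> l" using tt l by linarith
  define cc where "cc = nat \<lceil>c * real n\<rceil>"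
  have cc: "c * real n \<le> real cc" "real cc < c * real n + 1"
  proof -
   have "0 \<le> c * real n" using c by simp
   then have "0 \<le> \<lceil>c * real n\<rceil>" by linarith
   then have "real cc = real_of_int \<lceil>c * real n\<rceil>" unfolding cc_def by simp
   then show "c * real n \<le> real cc" "real cc < c * real n + 1" by linarith+
  qed
  have topi: "real l - \<theta> * real n < real i" if "l - tt < i" for i using that tt by linarith
  define \<tau> where "\<tau> = L / (real N * sqrt (real n))"
  have \<tau>: "0 < \<tau>" unfolding \<tau>_def using L N n0 by simp
  define Zs where "Zs = {z::int. \<tau> / 2 \<le> f (real_of_int z)}"
  have Zs: "finite Zs" "real (card Zs) \<le> 4 / \<tau>"
   using tame_level_finite[OF f, of "\<tau> / 2"] \<tau> dS_nonneg unfolding Zs_def by auto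
  define Yt where "Yt = {Y. Y \<subseteq> {l - tt<..l} \<and> card Y = cc}"
  define Yl where "Yl = {Y. Y \<subseteq> {1..l - tt} - {i0} \<and> card Y = cc}"
  have finY: "finite Yt" "finite Yl" unfolding Yt_def Yl_def
   by (rule finite_subset[of _ "Pow {1..l}"]; force)+
  have cardY: "real (card Yt) \<le> 2 ^ n" "real (card Yl) \<le> 2 ^ n"
  proof -
   have p: "card (Pow {1..l}) \<le> 2 ^ n" using l by (simp add: card_Pow)
   have "card Yt \<le> card (Pow {1..l})" "card Yl \<le> card (Pow {1..l})"
    unfolding Yt_def Yl_def by (rule card_mono; force)+
   then have "card Yt \<le> 2 ^ n" "card Yl \<le> 2 ^ n" using p by linarith+
   then show "real (card Yt) \<le> 2 ^ n" "real (card Yl) \<le> 2 ^ n" by (metis of_nat_le_iff of_nat_numeral of_nat_power)+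
  qed
  define yt where "yt = \<mu> * \<tau> / 2"
  define yl where "yl = \<mu> * (\<tau> * sqrt (real n)) / 2"
  have y0: "0 < yt" "0 < yl" unfolding yt_def yl_def using \<mu> \<tau> n0 by auto
  let ?a = "C3 / L"
  have apos: "0 \<le> ?a" using C3 L by simp
  let ?sl = "slice S l s"
  have finsl: "finite ?sl" by (rule finite_slice[OF S(1)])
  have law: "law (unif A) A i" if "1 \<le> i" "i \<le> l" for i using A[OF that] by (intro law_unif) auto
  have law': "\<forall>i\<in>set [1..<l + 1]. law (unif A) A i" using law by auto
  have bE: "b i \<in> S" if "b \<in> ?sl" "1 \<le> i" "i \<le> l" for b i
  proof -
   have "b \<in> {1..l} \<rightarrow>\<^sub>E S" using that(1) unfolding slice_def by simp
   then show ?thesis by (rule PiE_mem) (use that in simp)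
  qed
  have decs: "(\<forall>c\<in>S. dec (cnt b i) a c \<le> s c) \<and> (\<Sum>c\<in>S. dec (cnt b i) a c) = i - 1"
   if b: "b \<in> ?sl" and i: "1 \<le> i" "i \<le> l" and a: "a \<in> S" "0 < cnt b i a" for b i a
  proof
   have cb: "cnt b l c = s c" if "c \<in> S" for c using b that unfolding slice_def by auto
   have "cnt b i c \<le> s c" if "c \<in> S" for c
    unfolding cb[OF that, symmetric] cnt_def using i by (intro card_mono) auto
   then show "\<forall>c\<in>S. dec (cnt b i) a c \<le> s c" unfolding dec_def by (auto intro: le_trans[OF diff_le_self])
   have "(\<Sum>c\<in>S. cnt b i c) = Suc (i - 1)" using bE[OF b] i by (subst sum_cnt[OF S(1)]) auto
   then show "(\<Sum>c\<in>S. dec (cnt b i) a c) = i - 1" using S(1) a by (intro sum_dec)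
  qed
  have gd: "gS \<le> \<bar>a - b i\<bar> \<and> \<bar>a - b i\<bar> \<le> dS" if "b \<in> ?sl" "1 \<le> i" "i \<le> l" "a \<in> S" "a \<noteq> b i" for b i a
   using gS(2)[OF that(4) bE[OF that(1-3)] that(5)] dS[OF that(4) bE[OF that(1-3)]] by simp
  have event: "avg (unif A) A [1..<l + 1] (\<lambda>X. \<Prod>i\<in>Y. of_bool (rival S f b z i y X)) Z0 \<le> ?a ^ card Y"
   if b: "b \<in> ?sl" and Y: "Y \<subseteq> {1..l}" and y: "0 < y"
    and B: "0 \<le> B" "k * B / y \<le> ?a"
    and bd: "\<And>i Z a. i \<in> Y \<Longrightarrow> (\<forall>j. 1 \<le> j \<and> j < i \<longrightarrow> Z j \<in> A j) \<Longrightarrow> a \<in> S \<Longrightarrow> a \<noteq> b i \<Longrightarrow> 0 < cnt b i a \<Longrightarrow>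
      (\<Sum>x\<in>A i. favg S f Z (i - 1) (dec (cnt b i) a) (z - dot b Z (i - 1) + (a - b i) * real_of_int x)) \<le> B * real (card (A i))"
   for b z Y y B
  proof (rule avg_coords[where w = "unif A" and A = A and a = ?a, OF law Y])
   show "of_bool (rival S f b z i y (Z(j := x))) = of_bool (rival S f b z i y Z)" if "i < j" for i j Z x
    using rival_indep[OF that] by simp
   fix i and Z :: "nat \<Rightarrow> int" assume i: "i \<in> Y" and Z: "\<forall>j. 1 \<le> j \<and> j < i \<longrightarrow> Z j \<in> A j"
   have i1: "1 \<le> i" "i \<le> l" using i Y by auto
   have "(\<Sum>x\<in>A i. unif A i x * of_bool (rival S f b z i y (Z(i := x)))) \<le> real (card S) * B / y"
    using A[OF i1] by (intro rival_prob[where A = A and Z = Z and b = b and i = i and ?t0.0 = z and B = B and f = f and y = y] y bd[OF i Z] f0 i1 B(1)) auto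
   then show "(\<Sum>x\<in>A i. unif A i x * of_bool (rival S f b z i y (Z(i := x)))) \<le> ?a"
    using B(2) unfolding k_def by simp
  qed (use apos in auto)
  have evt: "avg (unif A) A [1..<l + 1] (\<lambda>X. \<Prod>i\<in>Y. of_bool (rival S f b z i yt X)) Z0 \<le> ?a ^ cc"
   if b: "b \<in> ?sl" and Y: "Y \<in> Yt" for b z Y
  proof -
   have YY: "Y \<subseteq> {1..l}" "card Y = cc" using Y unfolding Yt_def by auto
   have "avg (unif A) A [1..<l + 1] (\<lambda>X. \<Prod>i\<in>Y. of_bool (rival S f b z i yt X)) Z0 \<le> ?a ^ card Y"
   proof (rule event[OF b YY(1) y0(1), of "C2 / (real N * sqrt (real n))"])
    show "0 \<le> C2 / (real N * sqrt (real n))" using C2 by simp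
    have "k * (C2 / (real N * sqrt (real n))) / yt = (2 * k * C2) / \<mu> / L"
     unfolding yt_def \<tau>_def using N n0 L \<mu> by (simp add: field_simps)
    also have "... \<le> C3 / L" unfolding C3_def using L \<mu> k gS by (intro divide_right_mono) auto
    finally show "k * (C2 / (real N * sqrt (real n))) / yt \<le> ?a" .
    fix i Z a assume i: "i \<in> Y" and Z: "\<forall>j. 1 \<le> j \<and> j < i \<longrightarrow> Z j \<in> A j" and a: "a \<in> S" "a \<noteq> b i" "0 < cnt b i a"
    have i1: "1 \<le> i" "i \<le> l" "l - tt < i" using i Y unfolding Yt_def by auto
    show "(\<Sum>x\<in>A i. favg S f Z (i - 1) (dec (cnt b i) a) (z - dot b Z (i - 1) + (a - b i) * real_of_int x))
     \<le> C2 / (real N * sqrt (real n)) * real (card (A i))"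
     using decs[OF b i1(1,2) a(1,3)] gd[OF b i1(1,2) a(1,2)] by (intro top[OF i1(1,2) topi[OF i1(3)] Z]) auto
   qed
   then show ?thesis using YY by simp
  qed
  have evl: "avg (unif A) A [1..<l + 1] (\<lambda>X. \<Prod>i\<in>Y. of_bool (rival S f b z i yl X)) Z0 \<le> ?a ^ cc"
   if b: "b \<in> ?sl" and Y: "Y \<in> Yl" for b z Y
  proof -
   have YY: "Y \<subseteq> {1..l}" "card Y = cc" using Y unfolding Yl_def by auto
   have "avg (unif A) A [1..<l + 1] (\<lambda>X. \<Prod>i\<in>Y. of_bool (rival S f b z i yl X)) Z0 \<le> ?a ^ card Y"
   proof (rule event[OF b YY(1) y0(2), of "2 / gS / real N"])
    show "0 \<le> 2 / gS / real N" using gS by simp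
    have "k * (2 / gS / real N) / yl = (4 * k / gS) / \<mu> / L"
     unfolding yl_def \<tau>_def using N n0 L \<mu> gS by (simp add: field_simps)
    also have "... \<le> C3 / L" unfolding C3_def using L \<mu> k gS C2 by (intro divide_right_mono) auto
    finally show "k * (2 / gS / real N) / yl \<le> ?a" .
    fix i Z a assume i: "i \<in> Y" and Z: "\<forall>j. 1 \<le> j \<and> j < i \<longrightarrow> Z j \<in> A j" and a: "a \<in> S" "a \<noteq> b i" "0 < cnt b i a"
    have i1: "1 \<le> i" "i \<le> l" "i \<noteq> i0" using i Y unfolding Yl_def by auto
    have g: "gS \<le> \<bar>a - b i\<bar>" "\<bar>a - b i\<bar> \<le> dS" using gd[OF b i1(1,2) a(1,2)] by auto
    have "(\<Sum>x\<in>A i. favg S f Z (i - 1) (dec (cnt b i) a) (z - dot b Z (i - 1) + (a - b i) * real_of_int x)) \<le> 2 / \<bar>a - b i\<bar>"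
     using decs[OF b i1(1,2) a(1,3)] g gS A[OF i1(1,2)] by (intro favg_progression_total[OF f]) auto
    also have "... \<le> 2 / gS" using g gS by (intro divide_left_mono) auto
    also have "... = 2 / gS / real N * real N" using N by simp
    also have "... \<le> 2 / gS / real N * real (card (A i))" using AN[OF i1] gS by (intro mult_left_mono) auto
    finally show "(\<Sum>x\<in>A i. favg S f Z (i - 1) (dec (cnt b i) a) (z - dot b Z (i - 1) + (a - b i) * real_of_int x))
     \<le> 2 / gS / real N * real (card (A i))" .
   qed
   then show ?thesis using YY by simp
  qed
  let ?qt = "\<lambda>z b Y X. \<Prod>i\<in>Y. of_bool (rival S f b (real_of_int z) i yt X) :: real"
  let ?ql = "\<lambda>z b Y X. \<Prod>i\<in>Y. of_bool (rival S f b (real_of_int z) i yl X) :: real"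
  have q0: "0 \<le> ?qt z b Y X" "0 \<le> ?ql z b Y X" for z b Y X by (auto intro!: prod_nonneg)
  let ?\<Phi> = "\<lambda>X. \<Sum>z\<in>Zs. \<Sum>b\<in>?sl. (\<Sum>Y\<in>Yt. ?qt z b Y X) + (\<Sum>Y\<in>Yl. ?ql z b Y X)"
  have det: "of_bool (\<exists>t. L / (real N * sqrt (real n)) \<le> favg S f X l s t) \<le> ?\<Phi> X" for X
  proof (cases "\<exists>t. L / (real N * sqrt (real n)) \<le> favg S f X l s t")
   case True
   then obtain t where t: "\<tau> \<le> favg S f X l s t" unfolding \<tau>_def by blast
   have contra: "2 * (exp (real (card S) * x * real n) * (1 / x) ^ (2 * cc + 1)) < \<tau> * (1 - \<mu>) ^ n * real (card ?sl)"
   proof -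
    have xp: "(1 / x) ^ (2 * cc + 1) = exp (real (2 * cc + 1) * lx)"
    proof -
     have "exp (real (2 * cc + 1) * lx) = exp lx ^ (2 * cc + 1)" by (rule exp_of_nat_mult)
     moreover have "exp lx = 1 / x" unfolding lx_def using x by simp
     ultimately show ?thesis by (simp only:)
    qed
    have "real (2 * cc + 1) * lx \<le> (2 * c * real n + 3) * lx" using cc lx by (intro mult_right_mono) auto
    also have "... = (2 * c * lx) * real n + 3 * lx" by (simp add: algebra_simps)
    also have "... \<le> e / 16 * real n + 3 * lx" using mult_right_mono[OF c(2), of "real n"] by simp
    finally have 1: "(1 / x) ^ (2 * cc + 1) \<le> exp (e / 16 * real n + 3 * lx)" unfolding xp by simp
    have "real (card S) * x * real n \<le> e / 8 * real n" using x(3) unfolding k_def by (intro mult_right_mono) auto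
    then have 2: "exp (real (card S) * x * real n) \<le> exp (e / 8 * real n)" by simp
    have "exp (- e / 8) ^ n \<le> (1 - \<mu>) ^ n" using \<mu> by (intro power_mono) auto
    then have 3: "exp (- e / 8 * real n) \<le> (1 - \<mu>) ^ n" by (simp add: exp_of_nat_mult[symmetric] mult.commute)
    have "1 / sqrt (real n) \<le> \<tau> * real N" unfolding \<tau>_def using L N n0 by (simp add: divide_right_mono)
    have "2 * (exp (real (card S) * x * real n) * (1 / x) ^ (2 * cc + 1)) \<le> 2 * (exp (e / 8 * real n) * exp (e / 16 * real n + 3 * lx))"
     using 1 2 x by (intro mult_left_mono mult_mono) auto
    also have "... = 2 * sqrt (real n) * (exp (3 * e / 16 * real n + 3 * lx) / sqrt (real n))"
     using n0 by (simp add: algebra_simps flip: exp_add)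
    also have "... < exp (e / 2 * real n - 3 * lx) * (exp (3 * e / 16 * real n + 3 * lx) / sqrt (real n))"
     using n1 n0 by (intro mult_strict_right_mono) auto
    also have "... = exp (11 * e / 16 * real n) / sqrt (real n)" by (simp add: algebra_simps flip: exp_add)
    also have "... \<le> exp (- e / 8 * real n) * exp (e * real n) * (1 / sqrt (real n))"
     using e n0 by (simp add: divide_right_mono flip: exp_add)
    also have "... \<le> (1 - \<mu>) ^ n * exp (e * real n) * (\<tau> * real N)"
     using 3 \<open>1 / sqrt (real n) \<le> \<tau> * real N\<close> \<mu> pm_le by (intro mult_mono) auto
    also have "... = \<tau> * (1 - \<mu>) ^ n * (exp (e * real n) * real N)" by simp
    also have "... \<le> \<tau> * (1 - \<mu>) ^ n * real (card ?sl)"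
     using ent \<tau> \<mu> pm_le by (intro mult_left_mono) auto
    finally show ?thesis .
   qed
   have gain: "sqrt (real n) \<le> (1 + pm / 4) ^ (tt - cc)"
   proof -
    have "\<theta> / 2 * real n \<le> real tt - real cc"
    proof -
     have "c * real n \<le> \<theta> / 4 * real n" using c(3) by (rule mult_right_mono) simp
     moreover have "2 \<le> \<theta> / 4 * real n" using n1 by (elim conjE)
     ultimately show ?thesis using tt cc by linarith
    qed
    then have d: "\<theta> / 2 * real n \<le> real (tt - cc)" by linarith
    have "sqrt (real n) \<le> exp (\<theta> / 2 * lg * real n)" using n1 by simp
    also have "... \<le> exp (real (tt - cc) * lg)" using mult_right_mono[OF d, of lg] lg by (simp add: algebra_simps)
    also have "... = (1 + pm / 4) ^ (tt - cc)" unfolding lg_def using pm by (simp add: exp_of_nat_mult add_pos_pos)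
    finally show ?thesis .
   qed
   have ratio': "real (s' a) \<le> (1 - pm / 2) * real i"
    if "i \<le> l" "l - tt < i" "\<forall>a\<in>S. s' a \<le> s a" "(\<Sum>a\<in>S. s' a) = i" "a \<in> S" for i s' a
    by (rule ratio[OF that(1) topi[OF that(2)] that(3,4,5)])
   have "\<exists>b\<in>?sl. \<exists>z::int. \<tau> / 2 \<le> f (real_of_int z) \<and>
     ((\<exists>Y. Y \<subseteq> {l - tt<..l} \<and> card Y = cc \<and> (\<forall>i\<in>Y. rival S f b (real_of_int z) i (\<mu> * \<tau> / 2) X)) \<or>
     (\<exists>Y. Y \<subseteq> {1..l - tt} - {i0} \<and> card Y = cc \<and> (\<forall>i\<in>Y. rival S f b (real_of_int z) i (\<mu> * (\<tau> * sqrt (real n)) / 2) X)))"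
   proof (rule many_rivals[where \<mu> = \<mu> and \<tau> = \<tau> and x = x and n = n and t = t])
    show "real (s' a) \<le> (1 - pm / 2) * real i"
     if "i \<le> l" "l - tt < i" "\<forall>a\<in>S. s' a \<le> s a" "(\<Sum>a\<in>S. s' a) = i" "a \<in> S" for i s' a
     by (rule ratio'[OF that])
   qed (fact f s l(1) ttl \<mu>(1) \<mu>(2) \<tau> x(1) x(2) t gain n0(3) contra)+
   then obtain b where b: "b \<in> ?sl" and "\<exists>z::int. \<tau> / 2 \<le> f (real_of_int z) \<and>
     ((\<exists>Y. Y \<subseteq> {l - tt<..l} \<and> card Y = cc \<and> (\<forall>i\<in>Y. rival S f b (real_of_int z) i (\<mu> * \<tau> / 2) X)) \<or>
     (\<exists>Y. Y \<subseteq> {1..l - tt} - {i0} \<and> card Y = cc \<and> (\<forall>i\<in>Y. rival S f b (real_of_int z) i (\<mu> * (\<tau> * sqrt (real n)) / 2) X)))"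
    by (rule bexE)
   then obtain z :: int where z: "\<tau> / 2 \<le> f (real_of_int z)"
    and alt: "(\<exists>Y. Y \<subseteq> {l - tt<..l} \<and> card Y = cc \<and> (\<forall>i\<in>Y. rival S f b (real_of_int z) i (\<mu> * \<tau> / 2) X)) \<or>
     (\<exists>Y. Y \<subseteq> {1..l - tt} - {i0} \<and> card Y = cc \<and> (\<forall>i\<in>Y. rival S f b (real_of_int z) i (\<mu> * (\<tau> * sqrt (real n)) / 2) X))"
    by (elim exE conjE)
   have "1 \<le> (\<Sum>Y\<in>Yt. ?qt z b Y X) + (\<Sum>Y\<in>Yl. ?ql z b Y X)"
   proof -
    have "(\<exists>Y. Y \<in> Yt \<and> ?qt z b Y X = 1) \<or> (\<exists>Y. Y \<in> Yl \<and> ?ql z b Y X = 1)"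
     using alt
    proof
     assume "\<exists>Y. Y \<subseteq> {l - tt<..l} \<and> card Y = cc \<and> (\<forall>i\<in>Y. rival S f b (real_of_int z) i (\<mu> * \<tau> / 2) X)"
     then obtain Y where Y: "Y \<in> Yt" "\<forall>i\<in>Y. rival S f b (real_of_int z) i yt X" unfolding Yt_def yt_def by auto
     have "?qt z b Y X = 1" by (rule prod.neutral) (use Y(2) in auto)
     then show ?thesis using Y(1) by blast
    next
     assume "\<exists>Y. Y \<subseteq> {1..l - tt} - {i0} \<and> card Y = cc \<and> (\<forall>i\<in>Y. rival S f b (real_of_int z) i (\<mu> * (\<tau> * sqrt (real n)) / 2) X)"
     then obtain Y where Y: "Y \<in> Yl" "\<forall>i\<in>Y. rival S f b (real_of_int z) i yl X" unfolding Yl_def yl_def by auto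
     have "?ql z b Y X = 1" by (rule prod.neutral) (use Y(2) in auto)
     then show ?thesis using Y(1) by blast
    qed
    then consider Y where "Y \<in> Yt" "?qt z b Y X = 1" | Y where "Y \<in> Yl" "?ql z b Y X = 1" by blast
    then show ?thesis
    proof cases
     case (1 Y)
     then have "1 \<le> (\<Sum>Y\<in>Yt. ?qt z b Y X)" using member_le_sum[of Y Yt "\<lambda>Y. ?qt z b Y X"] finY q0 by simp
     then show ?thesis using q0 by (simp add: add_increasing2 sum_nonneg)
    next
     case (2 Y)
     then have "1 \<le> (\<Sum>Y\<in>Yl. ?ql z b Y X)" using member_le_sum[of Y Yl "\<lambda>Y. ?ql z b Y X"] finY q0 by simp
     then show ?thesis using q0 by (simp add: add_increasing sum_nonneg)
    qed
   qed
   also have "... \<le> (\<Sum>b\<in>?sl. (\<Sum>Y\<in>Yt. ?qt z b Y X) + (\<Sum>Y\<in>Yl. ?ql z b Y X))"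
    by (rule member_le_sum[OF b]) (use finsl q0 in \<open>auto intro!: add_nonneg_nonneg sum_nonneg\<close>)
   also have "... \<le> ?\<Phi> X"
    by (rule member_le_sum[of z Zs "\<lambda>z. \<Sum>b\<in>?sl. (\<Sum>Y\<in>Yt. ?qt z b Y X) + (\<Sum>Y\<in>Yl. ?ql z b Y X)"])
      (use Zs z q0 in \<open>auto simp: Zs_def intro!: add_nonneg_nonneg sum_nonneg\<close>)
   finally show ?thesis using True by simp
  next
   case False
   then show ?thesis using q0 by (auto intro!: add_nonneg_nonneg sum_nonneg)
  qed
  have "avg (unif A) A [1..<l + 1] (\<lambda>X. of_bool (\<exists>t. L / (real N * sqrt (real n)) \<le> favg S f X l s t)) Z0
    \<le> avg (unif A) A [1..<l + 1] ?\<Phi> Z0"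
   by (rule avg_mono[OF law' det])
  also have "... = (\<Sum>z\<in>Zs. \<Sum>b\<in>?sl. (\<Sum>Y\<in>Yt. avg (unif A) A [1..<l + 1] (?qt z b Y) Z0) + (\<Sum>Y\<in>Yl. avg (unif A) A [1..<l + 1] (?ql z b Y) Z0))"
   by (simp only: avg_sum[OF Zs(1)] avg_sum[OF finsl] avg_sum[OF finY(1)] avg_sum[OF finY(2)] avg_add)
  also have "... \<le> (\<Sum>z\<in>Zs. \<Sum>b\<in>?sl. (\<Sum>Y\<in>Yt. ?a ^ cc) + (\<Sum>Y\<in>Yl. ?a ^ cc))"
   by (intro sum_mono add_mono evt evl)
  also have "... = real (card Zs) * real (card ?sl) * ((real (card Yt) + real (card Yl)) * ?a ^ cc)"
   by (simp add: distrib_right mult.assoc)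
  also have "... \<le> (4 / \<tau>) * k ^ n * ((2 ^ n + 2 ^ n) * exp (- W * real n))"
  proof (intro mult_mono)
   show "real (card Zs) \<le> 4 / \<tau>" by (rule Zs)
   have "real (card ?sl) \<le> real (card S ^ l)" using card_slice_le by (simp only: of_nat_le_iff)
   also have "... = k ^ l" unfolding k_def by simp
   also have "... \<le> k ^ n" using l k by (intro power_increasing) auto
   finally show "real (card ?sl) \<le> k ^ n" .
   show "real (card Yt) + real (card Yl) \<le> 2 ^ n + 2 ^ n" using cardY by linarith
   have "?a ^ cc \<le> exp (- W / c) ^ cc" using a0 apos by (rule power_mono)
   also have "... = exp (real cc * (- W / c))" by (simp only: exp_of_nat_mult)
   also have "... \<le> exp (- W * real n)"
   proof -
    have "W / c * (c * real n) \<le> W / c * real cc" using cc W c by (intro mult_left_mono) auto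
    then show ?thesis using c by (simp add: algebra_simps)
   qed
   finally show "?a ^ cc \<le> exp (- W * real n)" .
  qed (use \<tau> k apos in auto)
  also have "... = 8 / \<tau> * ((2 * k) ^ n * exp (- W * real n))" by (simp add: power_mult_distrib)
  also have "(2 * k) ^ n = exp (real n * ln (2 * k))" using k by (simp add: exp_of_nat_mult)
  also have "8 / \<tau> * (exp (real n * ln (2 * k)) * exp (- W * real n)) \<le> 8 * (real N * sqrt (real n)) * (exp (real n * ln (2 * k)) * exp (- W * real n))"
  proof (rule mult_right_mono)
   have "1 / \<tau> = real N * sqrt (real n) / L" unfolding \<tau>_def by simp
   also have "... \<le> real N * sqrt (real n)" 
   proof -
    have "real N * sqrt (real n) * 1 \<le> real N * sqrt (real n) * L" using L(1) by (intro mult_left_mono) auto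
    then show ?thesis using L(1) by (simp add: divide_le_eq)
   qed
   finally show "8 / \<tau> \<le> 8 * (real N * sqrt (real n))" by simp
  qed simp
  also have "... \<le> (exp (real n) * exp (Hb * real n)) * (exp (real n * ln (2 * k)) * exp (- W * real n))"
  proof (rule mult_right_mono)
   have "8 * sqrt (real n) * real N \<le> exp (real n) * exp (Hb * real n)" using n1 N by (intro mult_mono) auto
   then show "8 * (real N * sqrt (real n)) \<le> exp (real n) * exp (Hb * real n)" by (simp add: mult.commute mult.left_commute)
  qed simp
  also have "... = exp (- M * real n)" unfolding W_def by (simp add: algebra_simps flip: exp_add)
  finally show "avg (unif A) A [1..<l + 1] (\<lambda>X. of_bool (\<exists>t. L / (real N * sqrt (real n)) \<le> favg S f X l s t)) Z0 \<le> exp (- M * real n)" .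
 qed
qed

end

section \<open>Blocks of levels\<close>

definition wcnt :: "(nat \<Rightarrow> real) \<Rightarrow> nat \<Rightarrow> nat \<Rightarrow> real \<Rightarrow> nat" where
 "wcnt w l r a = card {i\<in>{l<..l + r}. w i = a}"

definition wdot :: "(nat \<Rightarrow> real) \<Rightarrow> (nat \<Rightarrow> int) \<Rightarrow> nat \<Rightarrow> nat \<Rightarrow> real" where
 "wdot w X l r = (\<Sum>i\<in>{l<..l + r}. w i * real_of_int (X i))"

text \<open>
 The value at level \<open>l\<close> reached from type \<open>s\<close> and argument \<open>t\<close> at level \<open>l + r\<close> along the letters \<open>w\<close> of the block.
\<close>

definition descend :: "real set \<Rightarrow> (real \<Rightarrow> real) \<Rightarrow> (nat \<Rightarrow> int) \<Rightarrow> nat \<Rightarrow> nat \<Rightarrow> (real \<Rightarrow> nat) \<Rightarrow> real \<Rightarrow> (nat \<Rightarrow> real) \<Rightarrow> real" where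
 "descend S f X l r s t w = favg S f X l (\<lambda>a. s a - wcnt w l r a) (t + wdot w X l r)"

lemma Ioc_Suc: "{l<..l + Suc r} = insert (l + Suc r) {l<..l + r}"
 by auto

lemma wcnt_Suc: "wcnt w l (Suc r) a = wcnt w l r a + (if w (l + Suc r) = a then 1 else 0)"
proof -
 have "{i\<in>{l<..l + Suc r}. w i = a}
   = (if w (l + Suc r) = a then insert (l + Suc r) {i\<in>{l<..l + r}. w i = a} else {i\<in>{l<..l + r}. w i = a})"
  unfolding Ioc_Suc by auto
 then show ?thesis unfolding wcnt_def by simp
qed

lemma wcnt_0 [simp]: "wcnt w l 0 a = 0"
 by (simp add: wcnt_def)

lemma wdot_Suc: "wdot w X l (Suc r) = wdot w X l r + w (l + Suc r) * real_of_int (X (l + Suc r))"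
 unfolding wdot_def Ioc_Suc by simp

lemma wdot_0 [simp]: "wdot w X l 0 = 0"
 by (simp add: wdot_def)

lemma wcnt_cong: "(\<And>i. l < i \<Longrightarrow> i \<le> l + r \<Longrightarrow> w i = w' i) \<Longrightarrow> wcnt w l r a = wcnt w' l r a"
 unfolding wcnt_def by (intro arg_cong[where f = card]) auto

lemma wdot_cong: "(\<And>i. l < i \<Longrightarrow> i \<le> l + r \<Longrightarrow> w i = w' i) \<Longrightarrow> wdot w X l r = wdot w' X l r"
 unfolding wdot_def by (intro sum.cong) auto

lemma descend_cong:
 assumes "\<And>i. l < i \<Longrightarrow> i \<le> l + r \<Longrightarrow> w i = w' i"
 shows "descend S f X l r s t w = descend S f X l r s t w'"
proof -
 have "wcnt w l r = wcnt w' l r" by (rule ext, rule wcnt_cong) (use assms in auto)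
 moreover have "wdot w X l r = wdot w' X l r" by (rule wdot_cong) (use assms in auto)
 ultimately show ?thesis unfolding descend_def by simp
qed

lemma cnt_add: "cnt b (l + r) a = cnt b l a + wcnt b l r a"
 by (induction r) (auto simp: cnt_Suc wcnt_Suc)

lemma dot_add: "dot b X (l + r) = dot b X l + wdot b X l r"
 by (induction r) (auto simp: dot_Suc wdot_Suc)

lemma descend_Suc:
 assumes "a = w (l + Suc r)"
 shows "descend S f X l (Suc r) s t w = descend S f X l r (dec s a) (t + a * real_of_int (X (l + Suc r))) w"
proof -
 have "favg S f X l (\<lambda>c. s c - wcnt w l (Suc r) c) u = favg S f X l (\<lambda>c. dec s a c - wcnt w l r c) u" for u
  by (rule favg_cong_type) (auto simp: wcnt_Suc dec_def assms)
 then show ?thesis unfolding descend_def wdot_Suc assms by (simp add: add.commute add.left_commute)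
qed

text \<open>
 If no descendant exceeds \<open>y\<close> and every letter has weight at least \<open>\<pi>\<close> at each level, a single descendant below \<open>y\<close> lowers the
 average by its deficit times the weight \<open>\<pi> ^ r\<close> of its word.
\<close>

lemma block_average:
 assumes S: "finite S" and f0: "\<And>t. 0 \<le> f t" and \<pi>: "0 \<le> \<pi>"
 shows "r \<le> R \<Longrightarrow> (\<Sum>a\<in>S. s a) = l + r \<Longrightarrow> (\<And>a. a \<in> S \<Longrightarrow> \<pi> * real (l + R) + real r \<le> real (s a)) \<Longrightarrow>
  (\<And>w. (\<And>i. l < i \<Longrightarrow> i \<le> l + r \<Longrightarrow> w i \<in> S) \<Longrightarrow> descend S f X l r s t w \<le> y) \<Longrightarrow>
  (\<And>i. l < i \<Longrightarrow> i \<le> l + r \<Longrightarrow> w i \<in> S) \<Longrightarrow>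
  favg S f X (l + r) s t \<le> y - \<pi> ^ r * (y - descend S f X l r s t w)"
proof (induction r arbitrary: s t w)
 case 0
 then show ?case by (simp add: descend_def)
next
 case (Suc r)
 let ?i = "l + Suc r"
 have lr: "Suc (l + r) = ?i" by simp
 have wS: "w ?i \<in> S" using Suc.prems(5)[of ?i] by simp
 have sp: "0 < s a" if "a \<in> S" for a
 proof -
  have "0 < \<pi> * real (l + R) + real (Suc r)" using \<pi> by (intro add_nonneg_pos mult_nonneg_nonneg) auto
  then show ?thesis using Suc.prems(3)[OF that] by linarith
 qed
 have ext: "\<And>i. l < i \<Longrightarrow> i \<le> ?i \<Longrightarrow> (w'(?i := a)) i \<in> S" if "a \<in> S" "\<And>i. l < i \<Longrightarrow> i \<le> l + r \<Longrightarrow> w' i \<in> S" for w' a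
 proof -
  fix i assume "l < i" "i \<le> ?i"
  then show "(w'(?i := a)) i \<in> S" using that by (cases "i = ?i") auto
 qed
 have bound: "favg S f X (l + r) (dec s a) (t + a * real_of_int (X ?i))
   \<le> y - \<pi> ^ r * (y - descend S f X l r (dec s a) (t + a * real_of_int (X ?i)) w')"
  if a: "a \<in> S" and w': "\<And>i. l < i \<Longrightarrow> i \<le> l + r \<Longrightarrow> w' i \<in> S" for a w'
 proof (rule Suc.IH)
  show "r \<le> R" using Suc.prems(1) by simp
  show "(\<Sum>c\<in>S. dec s a c) = l + r" using Suc.prems(2) S a sp[OF a] by (intro sum_dec) simp_all
  show "\<pi> * real (l + R) + real r \<le> real (dec s a c)" if "c \<in> S" for c
   using Suc.prems(3)[OF that] sp[OF that] unfolding dec_def by (auto simp: of_nat_diff)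
  show "l < i \<Longrightarrow> i \<le> l + r \<Longrightarrow> w' i \<in> S" for i by (rule w')
  fix w'' assume w'': "\<And>i. l < i \<Longrightarrow> i \<le> l + r \<Longrightarrow> w'' i \<in> S"
  have "descend S f X l r (dec s a) (t + a * real_of_int (X ?i)) w'' = descend S f X l r (dec s a) (t + a * real_of_int (X ?i)) (w''(?i := a))"
   by (rule descend_cong) simp
  also have "... = descend S f X l (Suc r) s t (w''(?i := a))"
   by (rule descend_Suc[symmetric]) simp
  also have "... \<le> y" by (rule Suc.prems(4)) (rule ext[OF a w''])
  finally show "descend S f X l r (dec s a) (t + a * real_of_int (X ?i)) w'' \<le> y" .
 qed
 let ?V = "\<lambda>a. favg S f X (l + r) (dec s a) (t + a * real_of_int (X ?i))"
 let ?\<alpha> = "\<lambda>a. real (s a) / real (Suc (l + r))"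
 have w1: "(\<Sum>a\<in>S. ?\<alpha> a) = 1" by (rule favg_weights) (use Suc.prems(2) in simp)
 have wr: "\<And>i. l < i \<Longrightarrow> i \<le> l + r \<Longrightarrow> w i \<in> S" using Suc.prems(5) by simp
 define D where "D = y - descend S f X l (Suc r) s t w"
 have D0: "0 \<le> D" unfolding D_def using Suc.prems(4)[OF Suc.prems(5)] by simp
 have Vy: "?V a \<le> y" if a: "a \<in> S" for a
 proof -
  let ?w' = "w(?i := a)"
  have "descend S f X l r (dec s a) (t + a * real_of_int (X ?i)) w = descend S f X l (Suc r) s t ?w'"
   using descend_cong[of l r w ?w' S f X "dec s a" "t + a * real_of_int (X ?i)"] descend_Suc[of a ?w' l r S f X s t] by simp
  also have "... \<le> y" by (rule Suc.prems(4)) (rule ext[OF a wr])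
  finally have "0 \<le> \<pi> ^ r * (y - descend S f X l r (dec s a) (t + a * real_of_int (X ?i)) w)" using \<pi> by simp
  then show ?thesis using bound[where w' = w, OF a wr] by linarith
 qed
 have Vw: "?V (w ?i) \<le> y - \<pi> ^ r * D"
  unfolding D_def descend_Suc[OF refl] by (rule bound[OF wS wr])
 have "favg S f X (l + Suc r) s t = (\<Sum>a\<in>S. ?\<alpha> a * ?V a)" unfolding lr[symmetric] by (simp only: favg.simps add_Suc_right)
 also have "... = ?\<alpha> (w ?i) * ?V (w ?i) + (\<Sum>a\<in>S - {w ?i}. ?\<alpha> a * ?V a)" by (rule sum.remove[OF S wS])
 also have "... \<le> ?\<alpha> (w ?i) * (y - \<pi> ^ r * D) + (\<Sum>a\<in>S - {w ?i}. ?\<alpha> a * y)"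
 proof (rule add_mono)
  show "?\<alpha> (w ?i) * ?V (w ?i) \<le> ?\<alpha> (w ?i) * (y - \<pi> ^ r * D)" by (rule mult_left_mono[OF Vw]) simp
  show "(\<Sum>a\<in>S - {w ?i}. ?\<alpha> a * ?V a) \<le> (\<Sum>a\<in>S - {w ?i}. ?\<alpha> a * y)"
  proof (rule sum_mono)
   fix a assume "a \<in> S - {w ?i}"
   then show "?\<alpha> a * ?V a \<le> ?\<alpha> a * y" by (intro mult_left_mono Vy) simp_all
  qed
 qed
 also have "... = (\<Sum>a\<in>S. ?\<alpha> a * y) - ?\<alpha> (w ?i) * (\<pi> ^ r * D)"
  using sum.remove[OF S wS, of "\<lambda>a. ?\<alpha> a * y"] by (simp add: right_diff_distrib)
 also have "(\<Sum>a\<in>S. ?\<alpha> a * y) = y" unfolding sum_distrib_right[symmetric] w1 by simp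
 also have "y - ?\<alpha> (w ?i) * (\<pi> ^ r * D) \<le> y - \<pi> * (\<pi> ^ r * D)"
 proof -
  have "\<pi> * real (Suc (l + r)) \<le> \<pi> * real (l + R)" using \<pi> Suc.prems(1) by (intro mult_left_mono) auto
  then have "\<pi> * real (Suc (l + r)) \<le> real (s (w ?i))" using Suc.prems(3)[OF wS] by linarith
  then have "\<pi> \<le> ?\<alpha> (w ?i)" by (simp add: le_divide_eq del: of_nat_Suc)
  then have "\<pi> * (\<pi> ^ r * D) \<le> ?\<alpha> (w ?i) * (\<pi> ^ r * D)" using \<pi> D0 by (intro mult_right_mono) auto
  then show ?thesis by linarith
 qed
 finally show ?case unfolding D_def by (simp add: mult.assoc)
qed

text \<open>
 If some descendant is below half of the ancestor, the others must compensate for it, so the largest one gains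
 the factor \<open>1 + \<pi> ^ r / 2\<close>.
\<close>

lemma good_block_or_gain:
 fixes X :: "nat \<Rightarrow> int" and t :: real and s :: "real \<Rightarrow> nat" and f :: "real \<Rightarrow> real"
 assumes S: "finite S" "S \<noteq> {}" and f0: "\<And>t. 0 \<le> f t" and \<pi>: "0 \<le> \<pi>"
  and s: "(\<Sum>a\<in>S. s a) = l + r" and big: "\<And>a. a \<in> S \<Longrightarrow> \<pi> * real (l + r) + real r \<le> real (s a)"
 defines "v \<equiv> favg S f X (l + r) s t"
 shows "\<exists>w. (\<forall>i\<in>{l<..l + r}. w i \<in> S) \<and> v \<le> descend S f X l r s t w \<and>
  ((\<forall>w'. (\<forall>i\<in>{l<..l + r}. w' i \<in> S) \<longrightarrow> v / 2 \<le> descend S f X l r s t w') \<or>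
   (1 + \<pi> ^ r / 2) * v \<le> descend S f X l r s t w)"
proof -
 let ?W = "{l<..l + r} \<rightarrow>\<^sub>E S"
 let ?d = "descend S f X l r s t"
 have finW: "finite (?d ` ?W)" using S by (intro finite_imageI finite_PiE) auto
 have neW: "?d ` ?W \<noteq> {}" using S by (simp add: PiE_eq_empty_iff)
 define y where "y = Max (?d ` ?W)"
 have "y \<in> ?d ` ?W" unfolding y_def by (rule Max_in[OF finW neW])
 then obtain w where w: "w \<in> ?W" "?d w = y" by blast
 have wS: "\<forall>i\<in>{l<..l + r}. w i \<in> S" using w(1) by (simp add: PiE_iff)
 have le: "?d w' \<le> y" if "\<And>i. l < i \<Longrightarrow> i \<le> l + r \<Longrightarrow> w' i \<in> S" for w'
 proof -
  have "?d w' = ?d (restrict w' {l<..l + r})" by (rule descend_cong) simp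
  moreover have "restrict w' {l<..l + r} \<in> ?W" using that by (intro restrict_PiE_iff[THEN iffD2]) auto
  ultimately show ?thesis unfolding y_def using Max_ge[OF finW] by simp
 qed
 have main: "v \<le> y - \<pi> ^ r * (y - ?d w')" if "\<And>i. l < i \<Longrightarrow> i \<le> l + r \<Longrightarrow> w' i \<in> S" for w'
  unfolding v_def by (rule block_average[where R = r, OF S(1) f0 \<pi> order_refl s big le that])
 have vy: "v \<le> y" using main[of w] wS w(2) by simp
 show ?thesis
 proof (cases "\<forall>w'. (\<forall>i\<in>{l<..l + r}. w' i \<in> S) \<longrightarrow> v / 2 \<le> ?d w'")
  case True
  then show ?thesis using wS vy w(2) by blast
 next
  case False
  then obtain w' where w': "\<forall>i\<in>{l<..l + r}. w' i \<in> S" "?d w' < v / 2" by (auto simp: not_le)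
  have "v \<le> y - \<pi> ^ r * (y - ?d w')" using w'(1) by (intro main) simp
  moreover have "\<pi> ^ r * (v / 2) \<le> \<pi> ^ r * (y - ?d w')" using w'(2) vy \<pi> by (intro mult_left_mono) auto
  ultimately have "(1 + \<pi> ^ r / 2) * v \<le> y" by (simp add: algebra_simps)
  then show ?thesis using wS vy w(2) by blast
 qed
qed

text \<open>
 All descendants of the path \<open>b\<close> across the block of levels from \<open>l + r\<close> to \<open>l\<close> are at least \<open>y\<close>, also those that leave the path.
\<close>

definition good_block :: "real set \<Rightarrow> (real \<Rightarrow> real) \<Rightarrow> (nat \<Rightarrow> real) \<Rightarrow> real \<Rightarrow> nat \<Rightarrow> nat \<Rightarrow> real \<Rightarrow> (nat \<Rightarrow> int) \<Rightarrow> bool" where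
 "good_block S f b t0 l r y X \<longleftrightarrow>
  (\<forall>w. (\<forall>i\<in>{l<..l + r}. w i \<in> S) \<longrightarrow> y \<le> descend S f X l r (cnt b (l + r)) (t0 - dot b X (l + r)) w)"

text \<open>
 The path follows the largest descendant through the \<open>B\<close> top blocks; below them it only has to reach a point where \<open>f\<close> is
 at least the average.
\<close>

lemma block_path:
 assumes S: "finite S" "S \<noteq> {}" and f0: "\<And>t. 0 \<le> f t" and \<pi>: "0 \<le> \<pi>"
 shows "(\<Sum>a\<in>S. s a) = l0 + B * r \<Longrightarrow> (\<And>a. a \<in> S \<Longrightarrow> \<pi> * real (l0 + B * r) + real (B * r) \<le> real (s a)) \<Longrightarrow>
  \<exists>b \<in> slice S (l0 + B * r) s.
   lev S f X b (t + dot b X (l0 + B * r)) l0 \<le> lev S f X b (t + dot b X (l0 + B * r)) 0 \<and>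
   (\<forall>\<beta><B. lev S f X b (t + dot b X (l0 + B * r)) (l0 + \<beta> * r + r) \<le> lev S f X b (t + dot b X (l0 + B * r)) (l0 + \<beta> * r) \<and>
    (good_block S f b (t + dot b X (l0 + B * r)) (l0 + \<beta> * r) r (lev S f X b (t + dot b X (l0 + B * r)) (l0 + \<beta> * r + r) / 2) X \<or>
     (1 + \<pi> ^ r / 2) * lev S f X b (t + dot b X (l0 + B * r)) (l0 + \<beta> * r + r) \<le> lev S f X b (t + dot b X (l0 + B * r)) (l0 + \<beta> * r)))"
proof (induction B arbitrary: s t)
 case 0
 have s: "(\<Sum>a\<in>S. s a) = l0" using 0 by simp
 let ?sl = "slice S l0 s"
 have pos: "0 < real (card ?sl)" using card_slice_pos[OF S(1) s] by simp
 have "\<exists>b\<in>?sl. favg S f X l0 s t \<le> f (t + dot b X l0)"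
 proof (rule ccontr)
  assume "\<not> ?thesis"
  then have "\<forall>b\<in>?sl. f (t + dot b X l0) < favg S f X l0 s t" by (auto simp: not_le)
  moreover have "?sl \<noteq> {}" using pos by auto
  ultimately have "(\<Sum>b\<in>?sl. f (t + dot b X l0)) < (\<Sum>b\<in>?sl. favg S f X l0 s t)"
   using finite_slice[OF S(1)] by (intro sum_strict_mono) auto
  then show False using favg_eq_slice[OF S(1) s, of f X t] pos by (simp add: field_simps)
 qed
 then obtain b where b: "b \<in> ?sl" "favg S f X l0 s t \<le> f (t + dot b X l0)" by (rule bexE)
 have cb: "cnt b l0 a = s a" if "a \<in> S" for a using b(1) that unfolding slice_def by simp
 have "lev S f X b (t + dot b X l0) l0 = favg S f X l0 s t"
 proof -
  have "lev S f X b (t + dot b X l0) l0 = favg S f X l0 (cnt b l0) t" unfolding lev_def by (simp only: add_diff_cancel_right')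
  also have "... = favg S f X l0 s t" by (rule favg_cong_type) (rule cb)
  finally show ?thesis .
 qed
 moreover have "lev S f X b (t + dot b X l0) 0 = f (t + dot b X l0)" unfolding lev_def dot_def by simp
 ultimately have le: "lev S f X b (t + dot b X l0) l0 \<le> lev S f X b (t + dot b X l0) 0" using b(2) by simp
 have e: "l0 + 0 * r = l0" by simp
 show ?case unfolding e
  by (rule bexI[OF _ b(1)]) (use le in \<open>simp only: not_less_zero simp_thms\<close>)
next
 case (Suc B)
 let ?l = "l0 + B * r"
 have e: "l0 + Suc B * r = ?l + r" by simp
 have s: "(\<Sum>a\<in>S. s a) = ?l + r" using Suc.prems(1) by simp
 have big: "\<pi> * real (?l + r) + real r \<le> real (s a)" if "a \<in> S" for a
 proof -
  have "real r \<le> real (Suc B * r)" by simp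
  then show ?thesis using Suc.prems(2)[OF that] unfolding e by linarith
 qed
 define v where "v = favg S f X (?l + r) s t"
 from good_block_or_gain[where X = X and t = t, OF S f0 \<pi> s big]
 obtain w where hw: "(\<forall>i\<in>{?l<..?l + r}. w i \<in> S) \<and> v \<le> descend S f X ?l r s t w \<and>
  ((\<forall>w'. (\<forall>i\<in>{?l<..?l + r}. w' i \<in> S) \<longrightarrow> v / 2 \<le> descend S f X ?l r s t w') \<or>
   (1 + \<pi> ^ r / 2) * v \<le> descend S f X ?l r s t w)"
  unfolding v_def by (rule exE)
 note wS = hw[THEN conjunct1] and wv = hw[THEN conjunct2, THEN conjunct1] and alt = hw[THEN conjunct2, THEN conjunct2]
 define s' where "s' = (\<lambda>a. s a - wcnt w ?l r a)"
 define t' where "t' = t + wdot w X ?l r"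
 have wc: "wcnt w ?l r a \<le> r" for a
 proof -
  have "card {i\<in>{?l<..?l + r}. w i = a} \<le> card {?l<..?l + r}" by (intro card_mono) auto
  then show ?thesis unfolding wcnt_def by simp
 qed
 have rs: "r \<le> s a" if "a \<in> S" for a
 proof -
  have "0 \<le> \<pi> * real (?l + r)" using \<pi> by simp
  then have "real r \<le> real (s a)" using big[OF that] by linarith
  then show ?thesis by simp
 qed
 have ss: "s a = s' a + wcnt w ?l r a" if "a \<in> S" for a unfolding s'_def using wc[of a] rs[OF that] by simp
 have swc: "(\<Sum>a\<in>S. wcnt w ?l r a) = r"
 proof -
  have "(\<Sum>a\<in>S. \<Sum>i\<in>{i\<in>{?l<..?l + r}. w i = a}. 1) = (\<Sum>i\<in>{?l<..?l + r}. 1::nat)"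
   using S wS by (intro sum.group) auto
  then show ?thesis unfolding wcnt_def by simp
 qed
 have s': "(\<Sum>a\<in>S. s' a) = ?l"
 proof -
  have "(\<Sum>a\<in>S. s a) = (\<Sum>a\<in>S. s' a) + (\<Sum>a\<in>S. wcnt w ?l r a)"
   unfolding sum.distrib[symmetric] by (intro sum.cong refl ss)
  then show ?thesis using s swc by simp
 qed
 have big': "\<pi> * real ?l + real (B * r) \<le> real (s' a)" if "a \<in> S" for a
 proof -
  have "\<pi> * real ?l \<le> \<pi> * real (?l + r)" using \<pi> by (intro mult_left_mono) auto
  moreover have "real (s a) = real (s' a) + real (wcnt w ?l r a)" using ss[OF that] by simp
  moreover have "real (wcnt w ?l r a) \<le> real r" using wc by simp
  moreover have "real (Suc B * r) = real (B * r) + real r" by simp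
  ultimately show ?thesis using Suc.prems(2)[OF that] unfolding e by linarith
 qed
 from Suc.IH[OF s' big', of t']
 obtain b where b: "b \<in> slice S ?l s'" and hb: "lev S f X b (t' + dot b X ?l) l0 \<le> lev S f X b (t' + dot b X ?l) 0 \<and>
   (\<forall>\<beta><B. lev S f X b (t' + dot b X ?l) (l0 + \<beta> * r + r) \<le> lev S f X b (t' + dot b X ?l) (l0 + \<beta> * r) \<and>
    (good_block S f b (t' + dot b X ?l) (l0 + \<beta> * r) r (lev S f X b (t' + dot b X ?l) (l0 + \<beta> * r + r) / 2) X \<or>
     (1 + \<pi> ^ r / 2) * lev S f X b (t' + dot b X ?l) (l0 + \<beta> * r + r) \<le> lev S f X b (t' + dot b X ?l) (l0 + \<beta> * r)))"
  by (rule bexE)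
 note base = hb[THEN conjunct1] and step = hb[THEN conjunct2, rule_format]
 have bE: "b \<in> {1..?l} \<rightarrow>\<^sub>E S" and cb: "\<And>a. a \<in> S \<Longrightarrow> cnt b ?l a = s' a" using b unfolding slice_def by simp_all
 define c where "c = (\<lambda>i. if i \<in> {?l<..?l + r} then w i else b i)"
 have cl: "c i = b i" if "i \<le> ?l" for i unfolding c_def using that by simp
 have cu: "c i = w i" if "?l < i" "i \<le> ?l + r" for i unfolding c_def using that by simp
 have cntc: "cnt c i = cnt b i" if "i \<le> ?l" for i by (rule ext, rule cnt_cong) (use cl that in simp)
 have dotc: "dot c X i = dot b X i" if "i \<le> ?l" for i by (rule dot_cong) (use cl that in simp)
 have wcc: "wcnt c ?l r a = wcnt w ?l r a" for a by (rule wcnt_cong) (rule cu)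
 have wdc: "wdot c X ?l r = wdot w X ?l r" by (rule wdot_cong) (rule cu)
 have cS: "cnt c (?l + r) a = s a" if "a \<in> S" for a
  unfolding cnt_add[of c ?l r] cntc[OF order_refl] wcc cb[OF that] using ss[OF that] by (rule sym)
 have cE: "c \<in> {1..?l + r} \<rightarrow>\<^sub>E S"
 proof (rule PiE_I)
  fix i assume i: "i \<in> {1..?l + r}"
  show "c i \<in> S"
  proof (cases "i \<le> ?l")
   case True
   have "b i \<in> S" by (rule PiE_mem[OF bE]) (use i True in simp)
   then show ?thesis using cl[OF True] by simp
  next
   case False
   then have "?l < i" "i \<le> ?l + r" using i by auto
   then show ?thesis using cu[of i] wS by simp
  qed
 next
  fix i assume "i \<notin> {1..?l + r}"
  then have i: "i \<notin> {1..?l}" "i \<notin> {?l<..?l + r}" by auto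
  have "c i = b i" unfolding c_def using i(2) by (rule if_not_P)
  then show "c i = undefined" using PiE_arb[OF bE i(1)] by (rule trans)
 qed
 have cslice: "c \<in> slice S (?l + r) s" using cE cS by (rule sliceI)
 have t0: "t + dot c X (?l + r) = t' + dot b X ?l"
  unfolding dot_add[of c X ?l r] dotc[OF order_refl] wdc t'_def by (simp only: ac_simps)
 have levc: "lev S f X c u i = lev S f X b u i" if "i \<le> ?l" for i u
  unfolding lev_def cntc[OF that] dotc[OF that] ..
 have top: "lev S f X c (t' + dot b X ?l) (?l + r) = v"
 proof -
  have "lev S f X c (t' + dot b X ?l) (?l + r) = favg S f X (?l + r) (cnt c (?l + r)) t"
   unfolding lev_def t0[symmetric] by (simp only: add_diff_cancel_right')
  also have "... = v" unfolding v_def by (rule favg_cong_type) (rule cS)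
  finally show ?thesis .
 qed
 have low: "lev S f X c (t' + dot b X ?l) ?l = descend S f X ?l r s t w"
 proof -
  have "lev S f X c (t' + dot b X ?l) ?l = favg S f X ?l (cnt b ?l) t'"
   unfolding levc[OF order_refl] unfolding lev_def by (simp only: add_diff_cancel_right')
  also have "... = favg S f X ?l s' t'" by (rule favg_cong_type) (rule cb)
  finally show ?thesis unfolding descend_def s'_def t'_def .
 qed
 have dsc: "descend S f X ?l r (cnt c (?l + r)) (t' + dot b X ?l - dot c X (?l + r)) w' = descend S f X ?l r s t w'" for w'
 proof -
  have "t' + dot b X ?l - dot c X (?l + r) = t" unfolding t0[symmetric] by simp
  moreover have "favg S f X ?l (\<lambda>a. cnt c (?l + r) a - wcnt w' ?l r a) u = favg S f X ?l (\<lambda>a. s a - wcnt w' ?l r a) u" for u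
   by (rule favg_cong_type) (simp add: cS)
  ultimately show ?thesis unfolding descend_def by (simp only:)
 qed
 have gb: "good_block S f c u l r y X = good_block S f b u l r y X" if "l + r \<le> ?l" for u l y
  unfolding good_block_def cntc[OF that] dotc[OF that] ..
 have goal: "lev S f X c (t' + dot b X ?l) l0 \<le> lev S f X c (t' + dot b X ?l) 0 \<and>
   (\<forall>\<beta><Suc B. lev S f X c (t' + dot b X ?l) (l0 + \<beta> * r + r) \<le> lev S f X c (t' + dot b X ?l) (l0 + \<beta> * r) \<and>
    (good_block S f c (t' + dot b X ?l) (l0 + \<beta> * r) r (lev S f X c (t' + dot b X ?l) (l0 + \<beta> * r + r) / 2) X \<or>
     (1 + \<pi> ^ r / 2) * lev S f X c (t' + dot b X ?l) (l0 + \<beta> * r + r) \<le> lev S f X c (t' + dot b X ?l) (l0 + \<beta> * r)))"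
 proof (intro conjI allI impI)
  show "lev S f X c (t' + dot b X ?l) l0 \<le> lev S f X c (t' + dot b X ?l) 0"
   using base levc[of l0] levc[of 0] by simp
 next
  fix \<beta> assume "\<beta> < Suc B"
  then consider "\<beta> < B" | "\<beta> = B" by linarith
  then show "lev S f X c (t' + dot b X ?l) (l0 + \<beta> * r + r) \<le> lev S f X c (t' + dot b X ?l) (l0 + \<beta> * r)"
  proof cases
   case 1
   then have i: "l0 + \<beta> * r + r \<le> ?l" "l0 + \<beta> * r \<le> ?l"
    using mult_le_mono1[of "Suc \<beta>" B r] by auto
   show ?thesis unfolding levc[OF i(1)] levc[OF i(2)] by (rule step[OF 1, THEN conjunct1])
  next
   case 2
   show ?thesis unfolding 2 top low by (rule wv)
  qed
 next
  fix \<beta> assume "\<beta> < Suc B"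
  then consider "\<beta> < B" | "\<beta> = B" by linarith
  then show "good_block S f c (t' + dot b X ?l) (l0 + \<beta> * r) r (lev S f X c (t' + dot b X ?l) (l0 + \<beta> * r + r) / 2) X \<or>
     (1 + \<pi> ^ r / 2) * lev S f X c (t' + dot b X ?l) (l0 + \<beta> * r + r) \<le> lev S f X c (t' + dot b X ?l) (l0 + \<beta> * r)"
  proof cases
   case 1
   then have i: "l0 + \<beta> * r + r \<le> ?l" "l0 + \<beta> * r \<le> ?l"
    using mult_le_mono1[of "Suc \<beta>" B r] by auto
   show ?thesis unfolding levc[OF i(1)] levc[OF i(2)] gb[OF i(1)] by (rule step[OF 1, THEN conjunct2])
  next
   case 2
   from alt show ?thesis unfolding 2 top low good_block_def dsc .
  qed
 qed
 show ?case unfolding e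
  by (rule bexI[OF _ cslice], unfold t0, rule goal)
qed

text \<open>
 Coordinates on which the integrand does not depend may be left out.
\<close>

lemma avg_drop:
 assumes "distinct is" "\<forall>i\<in>set is. law w A i" "\<And>i Y x. i \<in> set is \<Longrightarrow> i \<notin> C \<Longrightarrow> \<phi> (Y(i := x)) = \<phi> Y"
 shows "avg w A is \<phi> Z = avg w A (filter (\<lambda>i. i \<in> C) is) \<phi> Z"
 using assms
proof (induction "is" arbitrary: Z)
 case (Cons i "is")
 have IH: "avg w A is \<phi> Y = avg w A (filter (\<lambda>i. i \<in> C) is) \<phi> Y" for Y
  by (rule Cons.IH) (use Cons.prems in auto)
 show ?case
 proof (cases "i \<in> C")
  case True
  then show ?thesis by (simp add: avg_Cons IH)
 next
  case False
  have "avg w A is \<phi> (Z(i := x)) = avg w A is \<phi> Z" for x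
   by (rule avg_indep_upd) (rule Cons.prems(3), use False in auto)
  then have "avg w A (i # is) \<phi> Z = (\<Sum>x\<in>A i. w i x) * avg w A is \<phi> Z"
   unfolding avg_Cons by (simp only: sum_distrib_right)
  then show ?thesis using False IH Cons.prems(2) by (simp add: law_def)
 qed
qed simp

lemma sum_wcnt:
 assumes S: "finite S" and w: "\<And>i. l < i \<Longrightarrow> i \<le> l + r \<Longrightarrow> w i \<in> S"
 shows "(\<Sum>a\<in>S. wcnt w l r a) = r"
proof -
 have "(\<Sum>a\<in>S. \<Sum>i\<in>{i\<in>{l<..l + r}. w i = a}. 1) = (\<Sum>i\<in>{l<..l + r}. 1::nat)"
  using S w by (intro sum.group) auto
 then show ?thesis unfolding wcnt_def by simp
qed

lemma min_ratio_close:
 fixes a b y \<zeta> :: real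
 assumes "0 \<le> a" "0 \<le> b" "0 \<le> y" "0 \<le> \<zeta>" "a \<le> (1 + \<zeta>) * b" "b \<le> (1 + \<zeta>) * a"
 shows "\<bar>min a y - min b y\<bar> \<le> \<zeta> * y"
proof -
 have *: "min a y - min b y \<le> \<zeta> * y" if "0 \<le> b" "a \<le> (1 + \<zeta>) * b" for a b
 proof (cases "y \<le> b")
  case True
  have "0 \<le> \<zeta> * y" using assms by simp
  then show ?thesis using True by (simp add: min_def)
 next
  case False
  then have "\<zeta> * b \<le> \<zeta> * y" using assms by (intro mult_left_mono) auto
  moreover have "a \<le> b + \<zeta> * b" using that by (simp add: algebra_simps)
  ultimately show ?thesis using False by (simp add: min_def)
 qed
 show ?thesis using *[of b a] *[of a b] assms by linarith
qed

lemma good_block_cong: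
 assumes "\<And>i. 1 \<le> i \<Longrightarrow> i \<le> l + r \<Longrightarrow> X i = X' i"
 shows "good_block S f b t0 l r y X = good_block S f b t0 l r y X'"
proof -
 have "dot b X (l + r) = dot b X' (l + r)" by (rule dot_cong) (use assms in simp)
 moreover have "descend S f X l r s t w = descend S f X' l r s t w" for s t w
 proof -
  have "wdot w X l r = wdot w X' l r" unfolding wdot_def by (intro sum.cong) (use assms in auto)
  moreover have "favg S f X l s' u = favg S f X' l s' u" for s' u by (rule favg_cong_X) (use assms in auto)
  ultimately show ?thesis unfolding descend_def by simp
 qed
 ultimately show ?thesis unfolding good_block_def by simp
qed

context alphabet
begin

text \<open>
 Some letter \<open>a0\<close> occurs at \<open>16 g\<close> positions \<open>C\<close> of the block. Flipping it to \<open>a1\<close> at a set \<open>I \<subseteq> C\<close> of positions moves the argument at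
 level \<open>l\<close> by \<open>a1 - a0\<close> times \<open>\<Sum>i\<in>I. X i\<close> and changes the type by \<open>card I\<close> letters. In a good block all these
 descendants are at least \<open>y\<close>, which says that the truncation \<open>G\<close> of \<open>favg\<close> at level \<open>l\<close> is \<open>1\<close> on the whole cube with sides
 \<open>X i\<close>, \<open>i \<in> C\<close>. The function \<open>G\<close> is supported where \<open>favg\<close> exceeds \<open>y / 2\<close>, and is therefore sparse by Markov's inequality.
\<close>

lemma good_block_prob:
 fixes N g l r :: nat and A :: "nat \<Rightarrow> int set" and Z :: "nat \<Rightarrow> int"
 assumes rare: "rare_cubes \<omega> g \<eta>" and g: "1 \<le> g" and N: "1 \<le> N" and \<eta>: "0 < \<eta>"
  and f0: "\<And>t. 0 \<le> f t" and slow: "\<And>t h. \<bar>h\<bar> \<le> dS \<Longrightarrow> f (t + h) \<le> (1 + \<eta> / 2) * f t"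
  and b: "\<And>i. 1 \<le> i \<Longrightarrow> i \<le> l + r \<Longrightarrow> b i \<in> S" and r: "r = 16 * g * card S" and y: "0 < y"
  and A: "\<And>i. l < i \<Longrightarrow> i \<le> l + r \<Longrightarrow> \<exists>x1 x2. A i = {x1..x2} \<and> int N \<le> x2 - x1 + 1"
  and sparse: "\<And>s' c t. (\<forall>a\<in>S. s' a \<le> cnt b (l + r) a) \<Longrightarrow> (\<Sum>a\<in>S. s' a) = l \<Longrightarrow> gS \<le> \<bar>c\<bar> \<Longrightarrow> \<bar>c\<bar> \<le> dS \<Longrightarrow>
   (\<Sum>x\<in>{0..int N}. favg S f Z l s' (t + c * real_of_int x)) \<le> y / 4 * real (N + 1)"
  and many: "\<And>a. a \<in> S \<Longrightarrow> r \<le> cnt b l a"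
 shows "avg (unif A) A [l + 1..<l + r + 1] (\<lambda>X. of_bool (good_block S f b t0 l r y X)) Z \<le> \<omega> ^ g"
proof -
 let ?B = "{l<..l + r}"
 have bS: "b i \<in> S" if "l < i" "i \<le> l + r" for i using b[of i] that by simp
 have k: "1 \<le> card S" using S by simp
 obtain a0 where a0: "a0 \<in> S" "16 * g \<le> wcnt b l r a0"
 proof (rule ccontr)
  assume "\<not> thesis"
  then have "\<forall>a\<in>S. wcnt b l r a < 16 * g" using that by (auto simp: not_le[symmetric])
  moreover have "S \<noteq> {}" using k by auto
  ultimately have "(\<Sum>a\<in>S. wcnt b l r a) < (\<Sum>a\<in>S. 16 * g)" using S by (intro sum_strict_mono) auto
  then show False using sum_wcnt[OF S(1) bS] r by (simp add: mult.commute)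
 qed
 obtain a1 where a1: "a1 \<in> S" "a1 \<noteq> a0" using other_letter[OF a0(1)] by blast
 define c where "c = a1 - a0"
 have c: "gS \<le> \<bar>c\<bar>" "\<bar>c\<bar> \<le> dS" unfolding c_def using gS(2)[OF a1(1) a0(1) a1(2)] dS[OF a1(1) a0(1)] by auto
 obtain C where C: "C \<subseteq> {i\<in>?B. b i = a0}" "card C = 16 * g"
  using a0(2) unfolding wcnt_def by (meson obtain_subset_with_card_n)
 have finC: "finite C" using C(1) by (rule finite_subset) simp
 define cs where "cs = filter (\<lambda>i. i \<in> C) [l + 1..<l + r + 1]"
 have setcs: "set cs = C" unfolding cs_def using C(1) by auto
 have dcs: "distinct cs" unfolding cs_def by simp
 have lcs: "length cs = 16 * g" using distinct_card[OF dcs] setcs C(2) by simp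
 define sd where "sd = (\<lambda>d a. cnt b l a + (if a = a0 then d else 0) - (if a = a1 then d else 0))"
 define h where "h = (\<lambda>d (u::int). favg S f Z l (sd d) (t0 - dot b Z l + c * real_of_int u))"
 define G where "G = (\<lambda>d u. if d \<le> 16 * g then max 0 (2 * min (h d u) y / y - 1) else 0)"
 have h0: "0 \<le> h d u" for d u unfolding h_def by (rule favg_nonneg[OF f0])
 have gr: "16 * g \<le> r" unfolding r using k by simp
 have G01: "0 \<le> G d u \<and> G d u \<le> 1" for d u
 proof -
  have "2 * min (h d u) y / y \<le> 2 * y / y" using y by (intro divide_right_mono mult_left_mono) auto
  then show ?thesis unfolding G_def using y by auto
 qed
 have hr: "h d (u + 1) \<le> (1 + \<eta> / 2) * h d u" "h d u \<le> (1 + \<eta> / 2) * h d (u + 1)" for d u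
 proof -
  have "favg S f Z l (sd d) ((t0 - dot b Z l + c * real_of_int u) + c) \<le> (1 + \<eta> / 2) * h d u"
   unfolding h_def by (rule favg_shift_le) (rule slow[OF c(2)])
  then show "h d (u + 1) \<le> (1 + \<eta> / 2) * h d u" unfolding h_def by (simp add: algebra_simps)
  have "favg S f Z l (sd d) ((t0 - dot b Z l + c * real_of_int (u + 1)) + - c) \<le> (1 + \<eta> / 2) * h d (u + 1)"
   unfolding h_def by (rule favg_shift_le) (rule slow, use c in simp)
  then show "h d u \<le> (1 + \<eta> / 2) * h d (u + 1)" unfolding h_def by (simp add: algebra_simps)
 qed
 have Glip: "\<bar>G d (u + 1) - G d u\<bar> \<le> \<eta>" for d u
 proof (cases "d \<le> 16 * g")
  case True
  let ?m1 = "min (h d (u + 1)) y" and ?m0 = "min (h d u) y"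
  have "\<bar>?m1 - ?m0\<bar> \<le> \<eta> / 2 * y" using h0 hr y \<eta> by (intro min_ratio_close) auto
  then have "2 * \<bar>?m1 - ?m0\<bar> / y \<le> \<eta>" using y by (simp add: divide_le_eq)
  moreover have "\<bar>2 * ?m1 / y - 2 * ?m0 / y\<bar> = 2 * \<bar>?m1 - ?m0\<bar> / y"
  proof -
   have "2 * ?m1 / y - 2 * ?m0 / y = 2 * (?m1 - ?m0) / y" by (simp add: diff_divide_distrib right_diff_distrib)
   also have "\<bar>...\<bar> = 2 * \<bar>?m1 - ?m0\<bar> / y" unfolding abs_divide abs_mult using y by (simp only: abs_numeral abs_of_pos)
   finally show ?thesis .
  qed
  moreover have "\<bar>G d (u + 1) - G d u\<bar> \<le> \<bar>2 * ?m1 / y - 2 * ?m0 / y\<bar>" unfolding G_def using True by (simp add: max_def)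
  ultimately show ?thesis by linarith
 next
  case False
  then show ?thesis unfolding G_def using \<eta> by simp
 qed
 have sd1: "sd d a \<le> cnt b (l + r) a" if "d \<le> 16 * g" for d a
  unfolding sd_def cnt_add using a0(2) that by auto
 have sd2: "(\<Sum>a\<in>S. sd d a) = l" if d: "d \<le> 16 * g" for d
 proof -
  have "sd d a + (if a = a1 then d else 0) = cnt b l a + (if a = a0 then d else 0)" if "a \<in> S" for a
   using many[OF that] d gr a1(2) unfolding sd_def by auto
  then have "(\<Sum>a\<in>S. sd d a + (if a = a1 then d else 0)) = (\<Sum>a\<in>S. cnt b l a + (if a = a0 then d else 0))"
   by (intro sum.cong) auto
  then have "(\<Sum>a\<in>S. sd d a) + d = (\<Sum>a\<in>S. cnt b l a) + d"
   unfolding sum.distrib using S a0(1) a1(1) by simp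
  moreover have "(\<Sum>a\<in>S. cnt b l a) = l" using b by (intro sum_cnt S) auto
  ultimately show ?thesis by simp
 qed
 have Gsparse: "2 * int (card {z\<in>{0..int N}. 0 < G d (u + z)}) \<le> int N + 1" for d u
 proof (cases "d \<le> 16 * g")
  case True
  let ?P = "{z\<in>{0..int N}. 0 < G d (u + z)}"
  have big: "y / 2 \<le> h d (u + z)" if "z \<in> ?P" for z
  proof -
   have "0 < 2 * min (h d (u + z)) y / y - 1" using that True unfolding G_def by (simp add: less_max_iff_disj)
   then have "y < 2 * min (h d (u + z)) y" using y by (simp add: less_divide_eq)
   then show ?thesis by linarith
  qed
  have "real (card ?P) * (y / 2) = (\<Sum>z\<in>?P. y / 2)" by simp
  also have "... \<le> (\<Sum>z\<in>?P. h d (u + z))" by (rule sum_mono) (rule big)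
  also have "... \<le> (\<Sum>z\<in>{0..int N}. h d (u + z))" using h0 by (intro sum_mono2) auto
  also have "... = (\<Sum>z\<in>{0..int N}. favg S f Z l (sd d) ((t0 - dot b Z l + c * real_of_int u) + c * real_of_int z))"
   unfolding h_def by (simp add: algebra_simps)
  also have "... \<le> y / 4 * real (N + 1)" using sd1[OF True] by (intro sparse sd2[OF True] c) auto
  finally have "y * (2 * real (card ?P)) \<le> y * real (N + 1)" by (simp only: mult_ac times_divide_eq_right times_divide_eq_left)
  then have "2 * real (card ?P) \<le> real (N + 1)" using y by (simp only: mult_le_cancel_left_pos)
  then show ?thesis by linarith
 next
  case False
  then show ?thesis unfolding G_def by simp
 qed
 have law: "\<forall>i\<in>set [l + 1..<l + r + 1]. law (unif A) A i"
 proof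
  fix i assume "i \<in> set [l + 1..<l + r + 1]"
  then have "l < i" "i \<le> l + r" by auto
  from A[OF this] obtain x1 x2 where "A i = {x1..x2}" "int N \<le> x2 - x1 + 1" by (elim exE conjE)
  then show "law (unif A) A i" using N by (intro law_unif) auto
 qed
 have flip: "1 \<le> G (card I) (\<Sum>i\<in>I. X i)"
  if X: "\<And>i. i \<le> l \<Longrightarrow> X i = Z i" and gd: "good_block S f b t0 l r y X" and I: "I \<subseteq> C" for X I
 proof -
  define w where "w = (\<lambda>i. if i \<in> I then a1 else b i)"
  have finI: "finite I" using I finC by (rule finite_subset)
  have cI: "card I \<le> 16 * g" using card_mono[OF finC I] C(2) by simp
  have IB: "I \<subseteq> {i\<in>?B. b i = a0}" using I C(1) by (rule subset_trans)
  have wS: "\<forall>i\<in>?B. w i \<in> S" unfolding w_def using bS a1 by auto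
  have w0: "wcnt w l r a0 = wcnt b l r a0 - card I"
  proof -
   have "{i\<in>?B. w i = a0} = {i\<in>?B. b i = a0} - I" unfolding w_def using a1(2) by auto
   then show ?thesis unfolding wcnt_def using card_Diff_subset[OF finI IB] by simp
  qed
  have w1: "wcnt w l r a1 = wcnt b l r a1 + card I"
  proof -
   have "{i\<in>?B. w i = a1} = {i\<in>?B. b i = a1} \<union> I" unfolding w_def using IB by auto
   moreover have "card ({i\<in>?B. b i = a1} \<union> I) = card {i\<in>?B. b i = a1} + card I"
    using IB a1(2) finI by (intro card_Un_disjoint) auto
   ultimately show ?thesis unfolding wcnt_def by simp
  qed
  have w2: "wcnt w l r a = wcnt b l r a" if "a \<noteq> a0" "a \<noteq> a1" for a
  proof -
   have "{i\<in>?B. w i = a} = {i\<in>?B. b i = a}" unfolding w_def using IB that by auto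
   then show ?thesis unfolding wcnt_def by simp
  qed
  have types: "cnt b (l + r) a - wcnt w l r a = sd (card I) a" for a
  proof -
   consider "a = a0" | "a = a1" | "a \<noteq> a0" "a \<noteq> a1" by blast
   then show ?thesis
   proof cases
    case 1
    then show ?thesis unfolding sd_def cnt_add using w0 a0(2) a1(2) cI by simp
   next
    case 2
    then show ?thesis unfolding sd_def cnt_add using w1 a1(2) by simp
   next
    case 3
    then show ?thesis unfolding sd_def cnt_add using w2 by simp
   qed
  qed
  have wd: "wdot w X l r = wdot b X l r + c * real_of_int (\<Sum>i\<in>I. X i)"
  proof -
   have "wdot w X l r = (\<Sum>i\<in>?B. b i * real_of_int (X i) + (if i \<in> I then c * real_of_int (X i) else 0))"
    unfolding wdot_def w_def c_def using IB by (intro sum.cong) (auto simp: algebra_simps)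
   also have "... = wdot b X l r + (\<Sum>i\<in>?B. if i \<in> I then c * real_of_int (X i) else 0)"
    unfolding wdot_def sum.distrib ..
   also have "(\<Sum>i\<in>?B. if i \<in> I then c * real_of_int (X i) else 0) = (\<Sum>i\<in>?B \<inter> I. c * real_of_int (X i))"
    by (simp add: sum.inter_restrict)
   also have "?B \<inter> I = I" using IB by auto
   finally show ?thesis by (simp add: sum_distrib_left)
  qed
  have dZ: "dot b X l = dot b Z l" by (rule dot_cong) (use X in simp)
  have "y \<le> descend S f X l r (cnt b (l + r)) (t0 - dot b X (l + r)) w"
   using gd wS unfolding good_block_def by blast
  also have "... = favg S f X l (sd (card I)) (t0 - dot b X (l + r) + wdot w X l r)"
   unfolding descend_def types ..
  also have "... = favg S f Z l (sd (card I)) (t0 - dot b X (l + r) + wdot w X l r)"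
   by (rule favg_cong_X) (use X in simp)
  also have "t0 - dot b X (l + r) + wdot w X l r = t0 - dot b Z l + c * real_of_int (\<Sum>i\<in>I. X i)"
   unfolding dot_add wd dZ by simp
  finally have "y \<le> h (card I) (\<Sum>i\<in>I. X i)" unfolding h_def .
  then have "min (h (card I) (\<Sum>i\<in>I. X i)) y = y" by simp
  then show ?thesis unfolding G_def using cI y by simp
 qed
 have "avg (unif A) A [l + 1..<l + r + 1] (\<lambda>X. of_bool (good_block S f b t0 l r y X)) Z
   \<le> avg (unif A) A [l + 1..<l + r + 1] (\<lambda>X. of_bool (cube G C X)) Z"
 proof (rule avg_mono_on[OF law])
  fix X :: "nat \<Rightarrow> int" assume "\<forall>i. i \<notin> set [l + 1..<l + r + 1] \<longrightarrow> X i = Z i"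
  then have X: "X i = Z i" if "i \<le> l" for i using that by auto
  show "of_bool (good_block S f b t0 l r y X) \<le> (of_bool (cube G C X) :: real)"
  proof (cases "good_block S f b t0 l r y X")
   case True
   have "cube G C X" unfolding cube_def using flip[OF X True] by blast
   then show ?thesis by simp
  qed simp
 qed
 also have "... = avg (unif A) A cs (\<lambda>X. of_bool (cube G C X)) Z"
  unfolding cs_def
 proof (rule avg_drop[OF _ law])
  fix i x and X :: "nat \<Rightarrow> int" assume i: "i \<notin> C"
  have "(\<Sum>j\<in>I. (X(i := x)) j) = (\<Sum>j\<in>I. X j)" if "I \<subseteq> C" for I
   using that i by (intro sum.cong) auto
  then have "cube G C (X(i := x)) = cube G C X" unfolding cube_def by auto
  then show "of_bool (cube G C (X(i := x))) = (of_bool (cube G C X) :: real)" by simp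
 qed simp
 also have "... \<le> \<omega> ^ g"
  unfolding setcs[symmetric]
 proof (rule rare_cubesD[OF rare _ G01 Glip Gsparse dcs lcs])
  show "1 \<le> int N" using N by simp
  fix i assume "i \<in> set cs"
  then show "\<exists>x1 x2. A i = {x1..x2} \<and> int N \<le> x2 - x1 + 1" using C(1) setcs by (intro A) auto
 qed
 finally show ?thesis .
qed

end

lemma concat_blocks: "concat (map (\<lambda>\<beta>. [l + \<beta> * r + 1..<l + \<beta> * r + r + 1]) [0..<B]) = [l + 1..<l + B * r + 1]"
proof (induction B)
 case (Suc B)
 have "[l + 1..<l + Suc B * r + 1] = [l + 1..<(l + B * r + 1) + r]" by (simp add: algebra_simps)
 also have "... = [l + 1..<l + B * r + 1] @ [l + B * r + 1..<(l + B * r + 1) + r]"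
  by (rule upt_add_eq_append) simp
 finally have e: "[l + 1..<l + Suc B * r + 1] = [l + 1..<l + B * r + 1] @ [l + B * r + 1..<l + B * r + r + 1]"
  by (simp add: algebra_simps)
 have "concat (map (\<lambda>\<beta>. [l + \<beta> * r + 1..<l + \<beta> * r + r + 1]) [0..<Suc B])
   = concat (map (\<lambda>\<beta>. [l + \<beta> * r + 1..<l + \<beta> * r + r + 1]) [0..<B]) @ [l + B * r + 1..<l + B * r + r + 1]"
  by (simp only: upt_Suc_append[OF le0] map_append concat_append list.map concat.simps append_Nil2)
 then show ?case unfolding e Suc.IH .
qed simp

lemma avg_level_blocks:
 fixes l r B :: nat and q :: "nat \<Rightarrow> (nat \<Rightarrow> int) \<Rightarrow> real"
 assumes law: "\<And>i. 1 \<le> i \<Longrightarrow> i \<le> l + B * r \<Longrightarrow> law w A i" and Y: "Y \<subseteq> {..<B}"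
  and q0: "\<And>\<beta> Z. \<beta> \<in> Y \<Longrightarrow> 0 \<le> q \<beta> Z"
  and qi: "\<And>\<beta> i Z x. \<beta> \<in> Y \<Longrightarrow> l + \<beta> * r + r < i \<Longrightarrow> q \<beta> (Z(i := x)) = q \<beta> Z"
  and qa: "\<And>\<beta> Z. \<beta> \<in> Y \<Longrightarrow> (\<forall>i. 1 \<le> i \<and> i \<le> l + \<beta> * r \<longrightarrow> Z i \<in> A i) \<Longrightarrow>
    avg w A [l + \<beta> * r + 1..<l + \<beta> * r + r + 1] (q \<beta>) Z \<le> a"
  and a: "0 \<le> a"
 shows "avg w A [1..<l + B * r + 1] (\<lambda>Z. \<Prod>\<beta>\<in>Y. q \<beta> Z) Z0 \<le> a ^ card Y"
proof -
 let ?bl = "\<lambda>\<beta>. [l + \<beta> * r + 1..<l + \<beta> * r + r + 1]"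
 define bls where "bls = [1..<l + 1] # map ?bl [0..<B]"
 have len: "length bls = Suc B" unfolding bls_def by simp
 have nth: "bls ! Suc \<beta> = ?bl \<beta>" if "\<beta> < B" for \<beta> unfolding bls_def using that by (simp add: nth_upt)
 have tk: "concat (take (Suc \<beta>) bls) = [1..<l + \<beta> * r + 1]" if "\<beta> \<le> B" for \<beta>
 proof -
  have "take \<beta> [0..<B] = [0..<\<beta>]" using that by simp
  then have "take (Suc \<beta>) bls = [1..<l + 1] # map ?bl [0..<\<beta>]" unfolding bls_def by (simp only: take_Suc_Cons take_map)
  then have "concat (take (Suc \<beta>) bls) = [1..<l + 1] @ [l + 1..<l + \<beta> * r + 1]" by (simp only: concat.simps concat_blocks)
  also have "... = [1..<(l + 1) + \<beta> * r]"
   using upt_add_eq_append[of 1 "l + 1" "\<beta> * r"] by (simp only: le_add2 ac_simps)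
  finally show ?thesis by (simp only: ac_simps)
 qed
 have all: "concat bls = [1..<l + B * r + 1]" using tk[of B] len by simp
 have "avg w A (concat bls) (\<lambda>Z. \<Prod>\<beta>\<in>Suc ` Y. q (\<beta> - 1) Z) Z0 \<le> a ^ card (Suc ` Y)"
 proof (rule avg_blocks)
  show "\<forall>i\<in>set (concat bls). law w A i" unfolding all using law by auto
  show "Suc ` Y \<subseteq> {..<length bls}" unfolding len using Y by auto
  fix \<beta>' and Z :: "nat \<Rightarrow> int" assume "\<beta>' \<in> Suc ` Y"
  then obtain \<beta> where \<beta>: "\<beta>' = Suc \<beta>" "\<beta> \<in> Y" "\<beta> < B" using Y by auto
  show "0 \<le> q (\<beta>' - 1) Z" using q0 \<beta> by simp
  show "q (\<beta>' - 1) (Z(i := x)) = q (\<beta>' - 1) Z" if "\<beta>' < \<gamma>" "\<gamma> < length bls" "i \<in> set (bls ! \<gamma>)" for \<gamma> i x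
  proof -
   obtain \<gamma>' where g: "\<gamma> = Suc \<gamma>'" "\<beta> < \<gamma>'" "\<gamma>' < B" using \<beta> \<open>\<beta>' < \<gamma>\<close> \<open>\<gamma> < length bls\<close> len by (cases \<gamma>) auto
   have "i \<in> set (?bl \<gamma>')" using \<open>i \<in> set (bls ! \<gamma>)\<close> nth[OF g(3)] g(1) by simp
   then have "l + \<gamma>' * r < i" by auto
   moreover have "\<beta> * r + r \<le> \<gamma>' * r" using mult_le_mono1[of "Suc \<beta>" \<gamma>' r] g(2) by simp
   ultimately show ?thesis using qi[OF \<beta>(2), of i Z x] \<beta>(1) by simp
  qed
  assume Z: "\<forall>i\<in>set (concat (take \<beta>' bls)). Z i \<in> A i"
  have "\<forall>i. 1 \<le> i \<and> i \<le> l + \<beta> * r \<longrightarrow> Z i \<in> A i"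
   using Z \<beta> tk[of \<beta>] by auto
  then show "avg w A (bls ! \<beta>') (q (\<beta>' - 1)) Z \<le> a"
   using qa[OF \<beta>(2)] nth[OF \<beta>(3)] \<beta>(1) by simp
 qed (rule a)
 moreover have "card (Suc ` Y) = card Y" by (rule card_image) simp
 moreover have "(\<Prod>\<beta>\<in>Suc ` Y. q (\<beta> - 1) Z) = (\<Prod>\<beta>\<in>Y. q \<beta> Z)" for Z by (subst prod.reindex) auto
 ultimately show ?thesis unfolding all by simp
qed

text \<open>
 This bounds the number of levels in \<open>D\<close> once \<open>u 0 / u B\<close> is bounded.
\<close>

lemma gains_accumulate:
 fixes u :: "nat \<Rightarrow> real"
 assumes "\<And>\<beta>. \<beta> < B \<Longrightarrow> u (Suc \<beta>) \<le> u \<beta>" "\<And>\<beta>. \<beta> < B \<Longrightarrow> \<beta> \<in> D \<Longrightarrow> (1 + \<kappa>) * u (Suc \<beta>) \<le> u \<beta>" "0 \<le> \<kappa>"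
 shows "(1 + \<kappa>) ^ card (D \<inter> {..<B}) * u B \<le> u 0"
 using assms(1,2)
proof (induction B)
 case (Suc B)
 have IH: "(1 + \<kappa>) ^ card (D \<inter> {..<B}) * u B \<le> u 0" using Suc by simp
 have e: "{..<Suc B} = insert B {..<B}" by auto
 show ?case
 proof (cases "B \<in> D")
  case True
  have "card (D \<inter> {..<Suc B}) = Suc (card (D \<inter> {..<B}))" unfolding e using True by simp
  then have "(1 + \<kappa>) ^ card (D \<inter> {..<Suc B}) * u (Suc B) = (1 + \<kappa>) ^ card (D \<inter> {..<B}) * ((1 + \<kappa>) * u (Suc B))" by simp
  also have "... \<le> (1 + \<kappa>) ^ card (D \<inter> {..<B}) * u B" using Suc.prems(2)[of B] True assms(3) by (intro mult_left_mono) auto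
  finally show ?thesis using IH by simp
 next
  case False
  then have "D \<inter> {..<Suc B} = D \<inter> {..<B}" unfolding e by simp
  moreover have "(1 + \<kappa>) ^ card (D \<inter> {..<B}) * u (Suc B) \<le> (1 + \<kappa>) ^ card (D \<inter> {..<B}) * u B"
   using Suc.prems(1)[of B] assms(3) by (intro mult_left_mono) auto
  ultimately show ?thesis using IH by simp
 qed
qed simp

lemma good_block_mono: "good_block S f b t0 l r y X \<Longrightarrow> y' \<le> y \<Longrightarrow> good_block S f b t0 l r y' X"
 unfolding good_block_def by force

context alphabet
begin

lemma good_block_round:
 assumes f: "tame (dS + 1) f" and g: "good_block S f b t0 l r y X"
 shows "good_block S f b (real_of_int \<lfloor>t0\<rfloor>) l r (y / 2) X"
 unfolding good_block_def
proof (intro allI impI)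
 fix w assume w: "\<forall>i\<in>{l<..l + r}. w i \<in> S"
 let ?d = "\<lambda>t. descend S f X l r (cnt b (l + r)) (t - dot b X (l + r)) w"
 have "\<bar>t0 - real_of_int \<lfloor>t0\<rfloor>\<bar> \<le> 1" by linarith
 from tame_favg_round[OF f this, of X l "\<lambda>a. cnt b (l + r) a - wcnt w l r a" "real_of_int \<lfloor>t0\<rfloor> - dot b X (l + r) + wdot w X l r"]
 have "?d t0 \<le> 2 * ?d (real_of_int \<lfloor>t0\<rfloor>)" unfolding descend_def by (simp add: algebra_simps)
 moreover have "y \<le> ?d t0" using g w unfolding good_block_def by blast
 ultimately show "y / 2 \<le> ?d (real_of_int \<lfloor>t0\<rfloor>)" by linarith
qed

text \<open>
 The deterministic part: as long as the values below the blocks stay under \<open>(1 + \<kappa>) ^ b0 * v\<close>, fewer than \<open>b0\<close> blocks can gain, and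
 all others are good.
\<close>

lemma many_good_blocks:
 fixes v :: real
 assumes f: "tame (dS + 1) f" and s: "(\<Sum>a\<in>S. s a) = l0 + B * r"
  and big: "\<And>a. a \<in> S \<Longrightarrow> pm / 2 * real (l0 + B * r) + real (B * r) \<le> real (s a)"
  and v: "0 < v" "v \<le> favg S f X (l0 + B * r) s t"
  and low: "\<And>b t. b \<in> slice S (l0 + B * r) s \<Longrightarrow> favg S f X l0 (cnt b l0) t < (1 + (pm / 2) ^ r / 2) ^ b0 * v"
 shows "\<exists>b\<in>slice S (l0 + B * r) s. \<exists>z::int. v / 2 \<le> f (real_of_int z) \<and>
  (\<exists>Y. Y \<subseteq> {..<B} \<and> card Y = B - b0 \<and> (\<forall>\<beta>\<in>Y. good_block S f b (real_of_int z) (l0 + \<beta> * r) r (v / 4) X))"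
proof -
 have f0: "\<And>t. 0 \<le> f t" by (rule tameD(1)[OF f])
 have ne: "S \<noteq> {}" using S by auto
 have p0: "0 \<le> pm / 2" using pm by simp
 from block_path[where X = X and t = t, OF S(1) ne f0 p0 s big]
 obtain b where b: "b \<in> slice S (l0 + B * r) s" and hb:
  "lev S f X b (t + dot b X (l0 + B * r)) l0 \<le> lev S f X b (t + dot b X (l0 + B * r)) 0 \<and>
   (\<forall>\<beta><B. lev S f X b (t + dot b X (l0 + B * r)) (l0 + \<beta> * r + r) \<le> lev S f X b (t + dot b X (l0 + B * r)) (l0 + \<beta> * r) \<and>
    (good_block S f b (t + dot b X (l0 + B * r)) (l0 + \<beta> * r) r (lev S f X b (t + dot b X (l0 + B * r)) (l0 + \<beta> * r + r) / 2) X \<or>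
     (1 + (pm / 2) ^ r / 2) * lev S f X b (t + dot b X (l0 + B * r)) (l0 + \<beta> * r + r) \<le> lev S f X b (t + dot b X (l0 + B * r)) (l0 + \<beta> * r)))"
  by (rule bexE)
 define t0 where "t0 = t + dot b X (l0 + B * r)"
 define u where "u = (\<lambda>\<beta>. lev S f X b t0 (l0 + \<beta> * r))"
 define \<kappa> where "\<kappa> = (pm / 2) ^ r / 2"
 have \<kappa>: "0 < \<kappa>" unfolding \<kappa>_def using pm by simp
 define D where "D = {\<beta>. (1 + \<kappa>) * u (Suc \<beta>) \<le> u \<beta>}"
 note hb = hb[folded t0_def \<kappa>_def]
 have uS: "u (Suc \<beta>) = lev S f X b t0 (l0 + \<beta> * r + r)" for \<beta> unfolding u_def by (simp add: algebra_simps)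
 have mono: "u (Suc \<beta>) \<le> u \<beta>" if "\<beta> < B" for \<beta>
  using hb[THEN conjunct2, rule_format, OF that, THEN conjunct1] unfolding uS unfolding u_def .
 have good: "good_block S f b t0 (l0 + \<beta> * r) r (u (Suc \<beta>) / 2) X" if "\<beta> < B" "\<beta> \<notin> D" for \<beta>
  using hb[THEN conjunct2, rule_format, OF that(1), THEN conjunct2] that(2) unfolding D_def mem_Collect_eq uS unfolding u_def by blast
 have cb: "cnt b (l0 + B * r) a = s a" if "a \<in> S" for a using b that unfolding slice_def by simp
 have uB: "v \<le> u B"
 proof -
  have "u B = favg S f X (l0 + B * r) (cnt b (l0 + B * r)) t" unfolding u_def lev_def t0_def by (simp only: add_diff_cancel_right')
  also have "... = favg S f X (l0 + B * r) s t" by (rule favg_cong_type) (rule cb)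
  finally show ?thesis using v by simp
 qed
 have u0: "u 0 < (1 + \<kappa>) ^ b0 * v" unfolding u_def lev_def \<kappa>_def using low[OF b] by simp
 have acc: "(1 + \<kappa>) ^ card (D \<inter> {..<B}) * u B \<le> u 0"
  using \<kappa> by (intro gains_accumulate mono) (auto simp: D_def)
 have "(1 + \<kappa>) ^ card (D \<inter> {..<B}) * v \<le> (1 + \<kappa>) ^ card (D \<inter> {..<B}) * u B"
  using uB \<kappa> by (intro mult_left_mono) auto
 then have "(1 + \<kappa>) ^ card (D \<inter> {..<B}) * v < (1 + \<kappa>) ^ b0 * v" using acc u0 by linarith
 then have "(1 + \<kappa>) ^ card (D \<inter> {..<B}) < (1 + \<kappa>) ^ b0" using v(1) by (simp add: mult_less_cancel_right)
 then have few: "card (D \<inter> {..<B}) < b0" using \<kappa> by (intro power_less_imp_less_exp[of "1 + \<kappa>"]) auto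
 have "card ({..<B} - D) = B - card (D \<inter> {..<B})"
  using card_Diff_subset_Int[of "{..<B}" D] by (simp add: Int_commute)
 then have "B - b0 \<le> card ({..<B} - D)" using few by linarith
 then obtain Y where Y: "Y \<subseteq> {..<B} - D" "card Y = B - b0" by (meson obtain_subset_with_card_n)
 have ge: "u (\<beta> + d) \<le> u \<beta>" if "\<beta> + d \<le> B" for \<beta> d
  using that
 proof (induction d)
  case (Suc d)
  then have "u (Suc (\<beta> + d)) \<le> u (\<beta> + d)" by (intro mono) simp
  then show ?case using Suc by simp
 qed simp
 have vz: "v / 2 \<le> f (real_of_int \<lfloor>t0\<rfloor>)"
 proof -
  have "v \<le> u 0" using uB ge[of 0 B] by simp
  also have "... \<le> lev S f X b t0 0" using hb[THEN conjunct1] unfolding u_def by simp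
  also have "... = f t0" unfolding lev_def dot_def by simp
  also have "f t0 = f (real_of_int \<lfloor>t0\<rfloor> + (t0 - real_of_int \<lfloor>t0\<rfloor>))" by simp
  also have "... \<le> 2 * f (real_of_int \<lfloor>t0\<rfloor>)" using dS_nonneg by (intro tameD(4)[OF f]) linarith
  finally show ?thesis by simp
 qed
 have "good_block S f b (real_of_int \<lfloor>t0\<rfloor>) (l0 + \<beta> * r) r (v / 4) X" if "\<beta> \<in> Y" for \<beta>
 proof -
  have \<beta>: "\<beta> < B" "\<beta> \<notin> D" using Y that by auto
  have "v \<le> u (Suc \<beta>)" using uB ge[of "Suc \<beta>" "B - Suc \<beta>"] \<beta> by simp
  then have "v / 4 \<le> u (Suc \<beta>) / 2 / 2" by simp
  then show ?thesis by (rule good_block_mono[OF good_block_round[OF f good[OF \<beta>]]])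
 qed
 then show ?thesis using b vz Y by blast
qed

text \<open>
 Here \<open>L\<close> is given in advance, only large with respect to the anticoncentration constant, and the second
 condition in the event is what the bound with a constant depending on \<open>M\<close> provides. The number \<open>b0\<close> of lost blocks does not
 grow with \<open>n\<close>, so at least half of the blocks remain, and \<open>\<omega>\<close> is chosen such that \<open>\<omega>\<close> to the power
 \<open>\<theta> n / (32 k)\<close> is \<open>exp (- W n)\<close>, where \<open>W\<close> pays for the union bound over start points, words and sets of blocks.
\<close>

lemma sup_bound_uniform:
 assumes \<theta>: "0 < \<theta>" and M: "0 < M" and C2: "0 < C2" and Hb: "0 \<le> Hb" and L: "1 \<le> L" "16 * C2 \<le> L" and L': "0 < L'"
 obtains r n1 :: nat and \<eta> :: real where "1 \<le> r" "0 < \<eta>"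
  "\<And>(n::nat) (N::nat) f (A :: nat \<Rightarrow> int set) l0 B s Z0. n1 \<le> n \<Longrightarrow> 1 \<le> N \<Longrightarrow> real N \<le> exp (Hb * real n) \<Longrightarrow>
   tame (dS + 1) f \<Longrightarrow> (\<And>t h. \<bar>h\<bar> \<le> dS \<Longrightarrow> f (t + h) \<le> (1 + \<eta>) * f t) \<Longrightarrow> (\<Sum>a\<in>S. s a) = n \<Longrightarrow>
   B = nat \<lfloor>\<theta> * real n\<rfloor> div r \<Longrightarrow> n = l0 + B * r \<Longrightarrow>
   (\<And>a. a \<in> S \<Longrightarrow> (pm / 2 + \<theta>) * real n \<le> real (s a)) \<Longrightarrow>
   (\<And>i. 1 \<le> i \<Longrightarrow> i \<le> n \<Longrightarrow> finite (A i) \<and> A i \<noteq> {}) \<Longrightarrow>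
   (\<And>i. l0 < i \<Longrightarrow> i \<le> n \<Longrightarrow> \<exists>x1 x2. A i = {x1..x2} \<and> int N \<le> x2 - x1 + 1) \<Longrightarrow>
   (\<And>l X s' c t. l0 \<le> l \<Longrightarrow> l \<le> n \<Longrightarrow> (\<forall>j. 1 \<le> j \<and> j \<le> l \<longrightarrow> X j \<in> A j) \<Longrightarrow>
     (\<forall>a\<in>S. s' a \<le> s a) \<Longrightarrow> (\<Sum>a\<in>S. s' a) = l \<Longrightarrow> gS \<le> \<bar>c\<bar> \<Longrightarrow> \<bar>c\<bar> \<le> dS \<Longrightarrow>
     (\<Sum>x\<in>{0..int N}. favg S f X l s' (t + c * real_of_int x)) \<le> C2 / (real N * sqrt (real n)) * real (N + 1)) \<Longrightarrow>
   avg (unif A) A [1..<n + 1] (\<lambda>X. of_bool ((\<exists>t. L / (real N * sqrt (real n)) \<le> favg S f X n s t) \<and>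
     (\<forall>b\<in>slice S n s. \<forall>t. favg S f X l0 (cnt b l0) t < L' / (real N * sqrt (real n))))) Z0 \<le> exp (- M * real n)"
proof -
 define k where "k = real (card S)"
 have k: "2 \<le> k" unfolding k_def using S by simp
 define W where "W = M + Hb + ln (2 * k) + 1"
 have W: "0 < W" unfolding W_def using M Hb k by (simp add: add_pos_pos add_nonneg_pos)
 define \<omega> where "\<omega> = exp (- (32 * k * W / \<theta>))"
 have \<omega>: "0 < \<omega>" "\<omega> \<le> 1" unfolding \<omega>_def using k W \<theta> by auto
 obtain g \<eta>1 where g: "1 \<le> g" "0 < \<eta>1" and rare: "rare_cubes \<omega> g \<eta>1" by (rule cube_bound[OF \<omega>])
 define r where "r = 16 * g * card S"
 have r1: "1 \<le> r" unfolding r_def using g S by simp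
 have rk: "real r = 16 * real g * k" unfolding r_def k_def by simp
 define \<kappa> where "\<kappa> = (pm / 2) ^ r / 2"
 have \<kappa>: "0 < \<kappa>" unfolding \<kappa>_def using pm by simp
 obtain b0 where b0: "L' / L < (1 + \<kappa>) ^ b0" using real_arch_pow[of "1 + \<kappa>" "L' / L"] \<kappa> by auto
 have b0': "L' \<le> (1 + \<kappa>) ^ b0 * L" using b0 L by (simp add: divide_less_eq)
 have "\<forall>\<^sub>F n in at_top. 4 * sqrt (real n) \<le> exp (real n)" by real_asymp
 moreover have "\<forall>\<^sub>F n in at_top. real g * (2 + real b0) \<le> \<theta> / (32 * k) * real n" using \<theta> k by real_asymp
 moreover have "\<forall>\<^sub>F n in at_top. real r \<le> pm / 2 * real n" using pm by real_asymp
 moreover have "\<forall>\<^sub>F n::nat in at_top. 1 \<le> n" by (rule eventually_ge_at_top)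
 ultimately have "\<forall>\<^sub>F n in at_top. 4 * sqrt (real n) \<le> exp (real n) \<and> real g * (2 + real b0) \<le> \<theta> / (32 * k) * real n
  \<and> real r \<le> pm / 2 * real n \<and> 1 \<le> n" by eventually_elim auto
 then obtain n1 where n1: "\<And>n. n1 \<le> n \<Longrightarrow> 4 * sqrt (real n) \<le> exp (real n) \<and> real g * (2 + real b0) \<le> \<theta> / (32 * k) * real n
  \<and> real r \<le> pm / 2 * real n \<and> 1 \<le> n" unfolding eventually_sequentially by blast
 show thesis
 proof (rule that[OF r1, of "\<eta>1 / 2" n1], goal_cases)
  case 1
  show ?case using g by simp
 next
  case (2 n N f A l0 B s Z0)
  note n = 2(1) and N = 2(2,3) and f = 2(4) and slow = 2(5) and s = 2(6) and B = 2(7) and nl = 2(8)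
   and big = 2(9) and A = 2(10) and AI = 2(11) and sparse = 2(12)
  note n1 = n1[OF n]
  have n0: "1 \<le> n" "0 < sqrt (real n)" using n1 by auto
  have f0: "\<And>t. 0 \<le> f t" by (rule tameD(1)[OF f])
  define v where "v = L / (real N * sqrt (real n))"
  have v: "0 < v" unfolding v_def using L N n0 by simp
  have Br: "real (B * r) \<le> \<theta> * real n"
  proof -
   have "B * r \<le> nat \<lfloor>\<theta> * real n\<rfloor>" unfolding B by simp
   moreover have "0 \<le> \<theta> * real n" using \<theta> by simp
   ultimately show ?thesis by linarith
  qed
  have gB: "\<theta> / (32 * k) * real n \<le> real g * real (B - b0)"
  proof -
   have "nat \<lfloor>\<theta> * real n\<rfloor> = B * r + nat \<lfloor>\<theta> * real n\<rfloor> mod r" unfolding B by simp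
   moreover have "nat \<lfloor>\<theta> * real n\<rfloor> mod r < r" using r1 by simp
   ultimately have "nat \<lfloor>\<theta> * real n\<rfloor> \<le> B * r + r" by linarith
   then have "real (nat \<lfloor>\<theta> * real n\<rfloor>) \<le> real (B * r + r)" by (simp only: of_nat_le_iff)
   moreover have "\<theta> * real n - 1 \<le> real (nat \<lfloor>\<theta> * real n\<rfloor>)" by linarith
   moreover have "1 \<le> real r" using r1 by simp
   ultimately have "\<theta> * real n \<le> real (B * r + r) + real r" by linarith
   also have "... = (real B + 2) * real r" by (simp add: algebra_simps)
   also have "... = (16 * k) * (real g * (real B + 2))" unfolding rk by (simp add: algebra_simps)
   finally have "\<theta> / (16 * k) * real n \<le> real g * (real B + 2)" using k by (simp add: field_simps)
   moreover have "\<theta> / (16 * k) * real n = \<theta> / (32 * k) * real n + \<theta> / (32 * k) * real n" by (simp add: field_simps)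
   moreover have "real g * (real B + 2) = real g * (real B - real b0) + real g * (2 + real b0)" by (simp add: algebra_simps)
   moreover have "real g * (2 + real b0) \<le> \<theta> / (32 * k) * real n" using n1 by simp
   ultimately have "\<theta> / (32 * k) * real n \<le> real g * (real B - real b0)" by linarith
   also have "... \<le> real g * real (B - b0)" by (intro mult_left_mono) auto
   finally show ?thesis .
  qed
  define Zs where "Zs = {z::int. v / 2 \<le> f (real_of_int z)}"
  have Zs: "finite Zs" "real (card Zs) \<le> 4 / v"
   using tame_level_finite[OF f, of "v / 2"] v dS_nonneg unfolding Zs_def by auto
  let ?sl = "slice S n s"
  have finsl: "finite ?sl" by (rule finite_slice[OF S(1)])
  define Ys where "Ys = {Y. Y \<subseteq> {..<B} \<and> card Y = B - b0}"
  have finY: "finite Ys" unfolding Ys_def by (rule finite_subset[of _ "Pow {..<B}"]) auto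
  have Bn: "B \<le> n"
  proof -
   have "B * 1 \<le> B * r" using r1 by (intro mult_le_mono2)
   then show ?thesis using nl by linarith
  qed
  have cardY: "real (card Ys) \<le> 2 ^ n"
  proof -
   have "card Ys \<le> card (Pow {..<B})" unfolding Ys_def by (rule card_mono) auto
   also have "... = 2 ^ B" by (simp add: card_Pow)
   finally have "real (card Ys) \<le> real (2 ^ B)" by (simp only: of_nat_le_iff)
   also have "... \<le> 2 ^ n" using Bn by (simp add: power_increasing)
   finally show ?thesis .
  qed
  have law: "law (unif A) A i" if "1 \<le> i" "i \<le> n" for i using A[OF that] by (intro law_unif) auto
  have law': "\<forall>i\<in>set [1..<n + 1]. law (unif A) A i" using law by auto
  let ?q = "\<lambda>z b Y X. \<Prod>\<beta>\<in>Y. of_bool (good_block S f b (real_of_int z) (l0 + \<beta> * r) r (v / 4) X) :: real"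
  have q0: "0 \<le> ?q z b Y X" for z b Y X by (auto intro!: prod_nonneg)
  have one: "avg (unif A) A [1..<n + 1] (?q z b Y) Z0 \<le> exp (- W * real n)" if b: "b \<in> ?sl" and Y: "Y \<in> Ys" for z b Y
  proof -
   have Yp: "Y \<subseteq> {..<B}" "card Y = B - b0" using Y unfolding Ys_def by auto
   have bE: "b i \<in> S" if "1 \<le> i" "i \<le> n" for i
   proof -
    have "b \<in> {1..n} \<rightarrow>\<^sub>E S" using b unfolding slice_def by simp
    then show ?thesis by (rule PiE_mem) (use that in simp)
   qed
   have cb: "cnt b n a = s a" if "a \<in> S" for a using b that unfolding slice_def by simp
   have "avg (unif A) A [1..<l0 + B * r + 1] (?q z b Y) Z0 \<le> (\<omega> ^ g) ^ card Y"
   proof (rule avg_level_blocks)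
    fix \<beta> and Z :: "nat \<Rightarrow> int" assume \<beta>: "\<beta> \<in> Y"
    let ?l = "l0 + \<beta> * r"
    have "Suc \<beta> \<le> B" using \<beta> Yp by auto
    then have lr: "?l + r \<le> n" using mult_le_mono1[of "Suc \<beta>" B r] nl by simp
    show "of_bool (good_block S f b (real_of_int z) ?l r (v / 4) (Z(i := x))) =
     (of_bool (good_block S f b (real_of_int z) ?l r (v / 4) Z) :: real)" if "?l + r < i" for i x
     using good_block_cong[of ?l r "Z(i := x)" Z S f b "real_of_int z" "v / 4"] that by simp
    assume Z: "\<forall>i. 1 \<le> i \<and> i \<le> ?l \<longrightarrow> Z i \<in> A i"
    have cle: "cnt b i a \<le> cnt b n a" if "i \<le> n" for i a
     unfolding cnt_def using that by (intro card_mono) auto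
    show "avg (unif A) A [?l + 1..<?l + r + 1] (\<lambda>X. of_bool (good_block S f b (real_of_int z) ?l r (v / 4) X)) Z \<le> \<omega> ^ g"
    proof (rule good_block_prob[OF rare g(1) N(1) g(2) f0 slow _ r_def])
     show "b i \<in> S" if "1 \<le> i" "i \<le> ?l + r" for i using bE that lr by simp
     show "0 < v / 4" using v by simp
     show "\<exists>x1 x2. A i = {x1..x2} \<and> int N \<le> x2 - x1 + 1" if "?l < i" "i \<le> ?l + r" for i
      using that lr by (intro AI) auto
     show "(\<Sum>x\<in>{0..int N}. favg S f Z ?l s' (t + c * real_of_int x)) \<le> v / 4 / 4 * real (N + 1)"
      if s': "\<forall>a\<in>S. s' a \<le> cnt b (?l + r) a" "(\<Sum>a\<in>S. s' a) = ?l" "gS \<le> \<bar>c\<bar>" "\<bar>c\<bar> \<le> dS" for s' c t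
     proof -
      have "\<forall>a\<in>S. s' a \<le> s a"
      proof
       fix a assume a: "a \<in> S"
       show "s' a \<le> s a" using s'(1)[rule_format, OF a] cle[OF lr, of a] cb[OF a] by simp
      qed
      then have "(\<Sum>x\<in>{0..int N}. favg S f Z ?l s' (t + c * real_of_int x)) \<le> C2 / (real N * sqrt (real n)) * real (N + 1)"
       using lr Z s' by (intro sparse) auto
      also have "... \<le> v / 4 / 4 * real (N + 1)"
      proof (rule mult_right_mono)
       have "C2 / (real N * sqrt (real n)) \<le> (L / 16) / (real N * sqrt (real n))"
        using L by (intro divide_right_mono) auto
       then show "C2 / (real N * sqrt (real n)) \<le> v / 4 / 4" unfolding v_def by simp
      qed simp
      finally show ?thesis .
     qed
     show "r \<le> cnt b ?l a" if a: "a \<in> S" for a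
     proof -
      have "n = ?l + (n - ?l)" using lr by simp
      then have "cnt b n a = cnt b ?l a + wcnt b ?l (n - ?l) a" using cnt_add[of b ?l "n - ?l" a] by simp
      moreover have "wcnt b ?l (n - ?l) a \<le> B * r"
      proof -
       have "wcnt b ?l (n - ?l) a \<le> card {?l<..?l + (n - ?l)}" unfolding wcnt_def by (intro card_mono) auto
       also have "... \<le> B * r" using nl by simp
       finally show ?thesis .
      qed
      ultimately have "s a \<le> cnt b ?l a + B * r" using cb[OF a] by linarith
      then have "real (s a) \<le> real (cnt b ?l a + B * r)" by (simp only: of_nat_le_iff)
      then have "real (s a) \<le> real (cnt b ?l a) + real (B * r)" by (simp only: of_nat_add)
      moreover have "(pm / 2 + \<theta>) * real n = pm / 2 * real n + \<theta> * real n" by (simp add: algebra_simps)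
      moreover have "real r \<le> pm / 2 * real n" using n1 by simp
      ultimately have "real r \<le> real (cnt b ?l a)" using big[OF a] Br by linarith
      then show ?thesis by simp
     qed
    qed
   qed (use law nl Yp \<omega> in auto)
   also have "(\<omega> ^ g) ^ card Y = exp (real (g * (B - b0)) * (- (32 * k * W / \<theta>)))"
    unfolding Yp \<omega>_def power_mult[symmetric] exp_of_nat_mult ..
   also have "... \<le> exp (- W * real n)"
   proof -
    have "(32 * k * W / \<theta>) * (\<theta> / (32 * k) * real n) \<le> (32 * k * W / \<theta>) * (real g * real (B - b0))"
     using gB k W \<theta> by (intro mult_left_mono) auto
    moreover have "(32 * k * W / \<theta>) * (\<theta> / (32 * k) * real n) = W * real n" using k \<theta> by simp
    moreover have "real (g * (B - b0)) * (- (32 * k * W / \<theta>)) = - ((32 * k * W / \<theta>) * (real g * real (B - b0)))"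
     unfolding of_nat_mult by (simp only: mult_minus_right mult_ac)
    ultimately have "real (g * (B - b0)) * (- (32 * k * W / \<theta>)) \<le> - W * real n" by linarith
    then show ?thesis by (simp only: exp_le_cancel_iff)
   qed
   finally show ?thesis unfolding nl .
  qed
  let ?E = "\<lambda>X. (\<exists>t. L / (real N * sqrt (real n)) \<le> favg S f X n s t) \<and>
     (\<forall>b\<in>?sl. \<forall>t. favg S f X l0 (cnt b l0) t < L' / (real N * sqrt (real n)))"
  let ?\<Phi> = "\<lambda>X. \<Sum>z\<in>Zs. \<Sum>b\<in>?sl. \<Sum>Y\<in>Ys. ?q z b Y X"
  have det: "of_bool (?E X) \<le> ?\<Phi> X" for X
  proof (cases "?E X")
   case True
   then obtain t where t: "v \<le> favg S f X n s t" unfolding v_def by blast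
   have low: "favg S f X l0 (cnt b l0) t < (1 + (pm / 2) ^ r / 2) ^ b0 * v" if "b \<in> slice S (l0 + B * r) s" for b t
   proof -
    have "favg S f X l0 (cnt b l0) t < L' / (real N * sqrt (real n))" using True that nl by blast
    also have "... \<le> ((1 + \<kappa>) ^ b0 * L) / (real N * sqrt (real n))" using b0' by (intro divide_right_mono) auto
    finally show ?thesis unfolding v_def \<kappa>_def by simp
   qed
   have big': "pm / 2 * real (l0 + B * r) + real (B * r) \<le> real (s a)" if "a \<in> S" for a
   proof -
    have "(pm / 2 + \<theta>) * real n = pm / 2 * real n + \<theta> * real n" by (simp add: algebra_simps)
    then show ?thesis using big[OF that] Br unfolding nl[symmetric] by linarith
   qed
   have "\<exists>b\<in>slice S (l0 + B * r) s. \<exists>z::int. v / 2 \<le> f (real_of_int z) \<and>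
    (\<exists>Y. Y \<subseteq> {..<B} \<and> card Y = B - b0 \<and> (\<forall>\<beta>\<in>Y. good_block S f b (real_of_int z) (l0 + \<beta> * r) r (v / 4) X))"
    by (rule many_good_blocks[OF f s[unfolded nl] big' v t[unfolded nl] low])
   then obtain b z Y where b: "b \<in> ?sl" and z: "z \<in> Zs" and Y: "Y \<in> Ys"
    and gd: "\<forall>\<beta>\<in>Y. good_block S f b (real_of_int z) (l0 + \<beta> * r) r (v / 4) X"
    unfolding Zs_def Ys_def nl[symmetric] mem_Collect_eq by blast
   have "?q z b Y X = 1" by (rule prod.neutral) (use gd in auto)
   then have "1 \<le> (\<Sum>Y\<in>Ys. ?q z b Y X)" using member_le_sum[of Y Ys "\<lambda>Y. ?q z b Y X"] finY q0 Y by simp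
   also have "... \<le> (\<Sum>b\<in>?sl. \<Sum>Y\<in>Ys. ?q z b Y X)"
    by (rule member_le_sum[OF b]) (use finsl q0 in \<open>auto intro!: sum_nonneg\<close>)
   also have "... \<le> ?\<Phi> X"
    by (rule member_le_sum[of z Zs "\<lambda>z. \<Sum>b\<in>?sl. \<Sum>Y\<in>Ys. ?q z b Y X"])
      (use Zs z q0 in \<open>auto intro!: sum_nonneg\<close>)
   finally show ?thesis using True by simp
  next
   case False
   then have "of_bool (?E X) = (0::real)" by simp
   then show ?thesis using q0 by (auto intro!: sum_nonneg)
  qed
  have "avg (unif A) A [1..<n + 1] (\<lambda>X. of_bool (?E X)) Z0 \<le> avg (unif A) A [1..<n + 1] ?\<Phi> Z0"
   by (rule avg_mono[OF law' det])
  also have "... = (\<Sum>z\<in>Zs. \<Sum>b\<in>?sl. \<Sum>Y\<in>Ys. avg (unif A) A [1..<n + 1] (?q z b Y) Z0)"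
   by (simp only: avg_sum[OF Zs(1)] avg_sum[OF finsl] avg_sum[OF finY])
  also have "... \<le> (\<Sum>z\<in>Zs. \<Sum>b\<in>?sl. \<Sum>Y\<in>Ys. exp (- W * real n))"
   by (intro sum_mono one)
  also have "... = real (card Zs) * (real (card ?sl) * (real (card Ys) * exp (- W * real n)))" by simp
  also have "... \<le> (4 / v) * (k ^ n * (2 ^ n * exp (- W * real n)))"
  proof (intro mult_mono)
   have "real (card ?sl) \<le> real (card S ^ n)" using card_slice_le by (simp only: of_nat_le_iff)
   then show "real (card ?sl) \<le> k ^ n" unfolding k_def by simp
  qed (use Zs cardY v k in auto)
  also have "... = 4 / v * ((2 * k) ^ n * exp (- W * real n))" by (simp add: power_mult_distrib)
  also have "(2 * k) ^ n = exp (real n * ln (2 * k))" using k by (simp add: exp_of_nat_mult)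
  also have "4 / v * (exp (real n * ln (2 * k)) * exp (- W * real n)) \<le> 4 * (real N * sqrt (real n)) * (exp (real n * ln (2 * k)) * exp (- W * real n))"
  proof (rule mult_right_mono)
   have "1 / v = real N * sqrt (real n) / L" unfolding v_def by simp
   also have "... \<le> real N * sqrt (real n)"
   proof -
    have "real N * sqrt (real n) * 1 \<le> real N * sqrt (real n) * L" using L(1) by (intro mult_left_mono) auto
    then show ?thesis using L(1) by (simp add: divide_le_eq)
   qed
   finally show "4 / v \<le> 4 * (real N * sqrt (real n))" by simp
  qed simp
  also have "... \<le> (exp (real n) * exp (Hb * real n)) * (exp (real n * ln (2 * k)) * exp (- W * real n))"
  proof (rule mult_right_mono)
   have "4 * sqrt (real n) * real N \<le> exp (real n) * exp (Hb * real n)" using n1 N by (intro mult_mono) auto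
   then show "4 * (real N * sqrt (real n)) \<le> exp (real n) * exp (Hb * real n)" by (simp add: mult.commute mult.left_commute)
  qed simp
  also have "... = exp (- M * real n)" unfolding W_def by (simp add: algebra_simps flip: exp_add)
  finally show "avg (unif A) A [1..<n + 1] (\<lambda>X. of_bool (?E X)) Z0 \<le> exp (- M * real n)" .
 qed
qed

end

section \<open>From arbitrary constants to a uniform constant\<close>

lemma favg_measurable [measurable]:
 assumes [measurable]: "f \<in> borel_measurable borel"
 shows "favg S f X l s \<in> borel_measurable borel"
proof (induction l arbitrary: s)
 case 0
 have "favg S f X 0 s = f" by (rule ext) simp
 then show ?case by simp
next
 case (Suc l)
 have [measurable]: "favg S f X l s' \<in> borel_measurable borel" for s' by (rule Suc.IH)
 have "favg S f X (Suc l) s = (\<lambda>t. \<Sum>a\<in>S. real (s a) / real (Suc l) * favg S f X l (dec s a) (t + a * real_of_int (X (Suc l))))"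
  by (rule ext) simp
 also have "... \<in> borel_measurable borel" by measurable
 finally show ?case .
qed

context alphabet
begin

text \<open>
 Removing \<open>3 \<theta> n\<close> letters from a typical word changes every frequency by \<open>O(\<theta> n)\<close>.
\<close>

lemma near_top_types:
 assumes m: "(\<Sum>a\<in>S. m a) = n" "\<And>a. a \<in> S \<Longrightarrow> \<bar>real (m a) - p a * real n\<bar> \<le> \<theta> * real n"
  and l: "l \<le> n" "real n - 3 * \<theta> * real n \<le> real l"
  and s': "\<forall>a\<in>S. s' a \<le> m a" "(\<Sum>a\<in>S. s' a) = l" and a: "a \<in> S"
 shows "\<bar>real (s' a) - p a * real l\<bar> \<le> 4 * \<theta> * real n" "p a * real n - 4 * \<theta> * real n \<le> real (s' a)"
proof -
 have pa: "0 \<le> p a" "p a \<le> 1" using ppos[OF a] p_le[OF a] pm by auto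
 have "p a * (real n - real l) \<le> 1 * (real n - real l)" using pa l by (intro mult_right_mono) auto
 then have 1: "p a * real n - p a * real l \<le> 3 * \<theta> * real n" using l by (simp add: algebra_simps)
 have 2: "p a * real l \<le> p a * real n" using pa l by (intro mult_left_mono) auto
 have "real (m a) - real (s' a) \<le> (\<Sum>c\<in>S. real (m c) - real (s' c))"
  by (rule member_le_sum[OF a]) (use s' S in auto)
 also have "... = real n - real l" unfolding sum_subtractf m(1)[symmetric] s'(2)[symmetric] by simp
 finally have 3: "real (m a) - real (s' a) \<le> 3 * \<theta> * real n" using l by simp
 have 4: "real (s' a) \<le> real (m a)" using s' a by simp
 have 5: "\<bar>real (m a) - p a * real n\<bar> \<le> \<theta> * real n" by (rule m(2)[OF a])
 show "p a * real n - 4 * \<theta> * real n \<le> real (s' a)" using 3 5 by linarith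
 then show "\<bar>real (s' a) - p a * real l\<bar> \<le> 4 * \<theta> * real n" using 1 2 4 5 by linarith
qed

text \<open>
 The size of the slice is \<open>exp (H n)\<close> up to \<open>exp (\<epsilon> n / 2)\<close>, and this is where \<open>N \<le> exp ((H - \<epsilon>) n)\<close> enters.
\<close>

lemma slice_large:
 defines "\<Lambda> \<equiv> (\<Sum>a\<in>S. - ln (p a))" and "H \<equiv> - (\<Sum>a\<in>S. p a * ln (p a))"
 assumes \<theta>: "0 < \<theta>" "\<theta> * (5 * \<Lambda> + 4 * real (card S) / pm) \<le> \<epsilon> / 4"
  and n: "real (card S) * (1 + ln (real n)) \<le> \<epsilon> / 4 * real n"
  and l: "1 \<le> l" "l \<le> n" "real n - \<theta> * real n \<le> real l" and s: "(\<Sum>a\<in>S. s a) = l"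
  and typc: "\<And>a. a \<in> S \<Longrightarrow> \<bar>real (s a) - p a * real l\<bar> \<le> 4 * \<theta> * real n" and s1: "\<And>a. a \<in> S \<Longrightarrow> 1 \<le> s a"
  and N: "real N \<le> exp ((H - \<epsilon>) * real n)"
 shows "exp (\<epsilon> / 2 * real n) * real N \<le> real (card (slice S l s))"
proof -
 have lnp: "0 \<le> - ln (p a)" if "a \<in> S" for a using ppos[OF that] p_le[OF that] pm(1) by simp
 have \<Lambda>0: "0 \<le> \<Lambda>" unfolding \<Lambda>_def by (intro sum_nonneg lnp)
 have H\<Lambda>: "H \<le> \<Lambda>"
 proof -
  have "H = (\<Sum>a\<in>S. p a * (- ln (p a)))" unfolding H_def by (simp add: sum_negf)
  also have "... \<le> (\<Sum>a\<in>S. 1 * (- ln (p a)))"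
   using lnp p_le pm(1) by (intro sum_mono mult_right_mono) force+
  finally show ?thesis unfolding \<Lambda>_def by simp
 qed
 have "(\<Sum>a\<in>S. real (s a) * ln (p a)) \<le> (\<Sum>a\<in>S. (p a * real l) * ln (p a) + 4 * \<theta> * real n * (- ln (p a)))"
 proof (rule sum_mono)
  fix a assume a: "a \<in> S"
  have "(p a * real l - real (s a)) * (- ln (p a)) \<le> 4 * \<theta> * real n * (- ln (p a))"
   using typc[OF a] by (intro mult_right_mono lnp a) linarith
  then show "real (s a) * ln (p a) \<le> (p a * real l) * ln (p a) + 4 * \<theta> * real n * (- ln (p a))"
   by (simp add: algebra_simps)
 qed
 also have "... = - (real l * H) + 4 * \<theta> * real n * \<Lambda>"
  unfolding sum.distrib \<Lambda>_def H_def sum_distrib_left[symmetric] by (simp add: sum_distrib_left mult_ac)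
 finally have A: "(\<Sum>a\<in>S. real (s a) * ln (p a)) \<le> - (real l * H) + 4 * \<theta> * real n * \<Lambda>" .
 have H0: "0 \<le> H"
 proof -
  have "H = (\<Sum>a\<in>S. p a * (- ln (p a)))" unfolding H_def by (simp add: sum_negf)
  also have "0 \<le> ..." by (intro sum_nonneg mult_nonneg_nonneg lnp) (auto intro: less_imp_le ppos)
  finally show ?thesis .
 qed
 have B: "real n * H - \<theta> * real n * \<Lambda> \<le> real l * H"
 proof -
  have "(real n - \<theta> * real n) * H \<le> real l * H" using l(3) H0 by (rule mult_right_mono)
  moreover have "\<theta> * real n * H \<le> \<theta> * real n * \<Lambda>" using \<theta> H\<Lambda> by (intro mult_left_mono) auto
  ultimately show ?thesis by (simp add: algebra_simps)
 qed
 have C: "- (real (card S) * (4 * \<theta> * real n / pm + 1 + ln (real n))) \<le> ln (real (card (slice S l s))) + (\<Sum>a\<in>S. real (s a) * ln (p a))"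
  by (rule slice_weight_ge[OF s l(1,2) typc s1])
 have D: "\<theta> * (5 * \<Lambda> + 4 * real (card S) / pm) * real n \<le> \<epsilon> / 4 * real n" using \<theta>(2) by (rule mult_right_mono) simp
 have "real n * H - \<epsilon> / 2 * real n \<le> ln (real (card (slice S l s)))"
 proof -
  have "real (card S) * (4 * \<theta> * real n / pm + 1 + ln (real n)) = 4 * \<theta> * real n * real (card S) / pm + real (card S) * (1 + ln (real n))"
   by (simp add: algebra_simps)
  moreover have "\<theta> * (5 * \<Lambda> + 4 * real (card S) / pm) * real n = 5 * (\<theta> * real n * \<Lambda>) + 4 * \<theta> * real n * real (card S) / pm"
   by (simp add: algebra_simps)
  moreover have "4 * \<theta> * real n * \<Lambda> = 4 * (\<theta> * real n * \<Lambda>)" by simp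
  ultimately show ?thesis using A B C D n by linarith
 qed
 then have E: "exp (real n * H - \<epsilon> / 2 * real n) \<le> real (card (slice S l s))"
  using card_slice_pos[OF S(1) s] by (simp add: ln_ge_iff)
 have "exp (\<epsilon> / 2 * real n) * real N \<le> exp (\<epsilon> / 2 * real n) * exp ((H - \<epsilon>) * real n)" using N by (intro mult_left_mono) auto
 also have "... = exp (real n * H - \<epsilon> / 2 * real n)" by (simp add: algebra_simps flip: exp_add)
 finally show ?thesis using E by linarith
qed

lemma progression_sum_le:
 assumes \<delta>: "0 < \<delta>" and d0: "0 < d0"
 obtains C2 \<tau> :: real and n1 :: nat where "0 < C2" "0 < \<tau>"
  "\<And>(n::nat) (N::nat) f (A :: nat \<Rightarrow> int set) l X s' c t x1 x2. n1 \<le> n \<Longrightarrow> 1 \<le> N \<Longrightarrow> tame (dS + 1) f \<Longrightarrow>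
   1 \<le> l \<Longrightarrow> l \<le> n \<Longrightarrow> 2 * \<delta> * real n \<le> real l \<Longrightarrow>
   (\<And>j x y. 1 \<le> j \<Longrightarrow> real j \<le> \<delta> * real n \<Longrightarrow> x \<in> A (2 * j - 1) \<Longrightarrow> y \<in> A (2 * j) \<Longrightarrow> d0 * real N \<le> \<bar>real_of_int (x - y)\<bar>) \<Longrightarrow>
   (\<forall>j. 1 \<le> j \<and> j \<le> l \<longrightarrow> X j \<in> A j) \<Longrightarrow> (\<Sum>a\<in>S. s' a) = l \<Longrightarrow>
   (\<And>a. a \<in> S \<Longrightarrow> \<bar>real (s' a) - p a * real l\<bar> \<le> \<tau> * real n) \<Longrightarrow> (\<And>a. a \<in> S \<Longrightarrow> 1 \<le> s' a) \<Longrightarrow>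
   gS \<le> \<bar>c\<bar> \<Longrightarrow> \<bar>c\<bar> \<le> dS \<Longrightarrow> int N \<le> x2 - x1 + 1 \<Longrightarrow>
   (\<Sum>x\<in>{x1..x2}. favg S f X l s' (t + c * real_of_int x)) \<le> C2 / (real N * sqrt (real n)) * real (card {x1..x2})"
proof (rule anticoncentration[OF \<delta> d0], goal_cases)
 case (1 C \<tau> n0)
 note C = 1(2,3) and ac = 1(4)
 define C2 where "C2 = 2 * C * (1 + 1 / gS)"
 have C2: "0 < C2" unfolding C2_def using C gS by (simp add: add_pos_pos)
 show thesis
 proof (rule that[OF C2 C(2), of n0])
  fix n N l :: nat and f and A :: "nat \<Rightarrow> int set" and X s' c t and x1 x2 :: int
  assume n: "n0 \<le> n" and N: "1 \<le> N" and f: "tame (dS + 1) f" and l: "1 \<le> l" "l \<le> n" "2 * \<delta> * real n \<le> real l"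
   and gap: "\<And>j x y. 1 \<le> j \<Longrightarrow> real j \<le> \<delta> * real n \<Longrightarrow> x \<in> A (2 * j - 1) \<Longrightarrow> y \<in> A (2 * j) \<Longrightarrow> d0 * real N \<le> \<bar>real_of_int (x - y)\<bar>"
   and X: "\<forall>j. 1 \<le> j \<and> j \<le> l \<longrightarrow> X j \<in> A j" and s': "(\<Sum>a\<in>S. s' a) = l"
   and typc: "\<And>a. a \<in> S \<Longrightarrow> \<bar>real (s' a) - p a * real l\<bar> \<le> \<tau> * real n" and s1: "\<And>a. a \<in> S \<Longrightarrow> 1 \<le> s' a"
   and c: "gS \<le> \<bar>c\<bar>" "\<bar>c\<bar> \<le> dS" and x: "int N \<le> x2 - x1 + 1"
  define Q where "Q = nat \<lfloor>\<delta> * real n\<rfloor>"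
  have dn: "0 \<le> \<delta> * real n" using \<delta> by simp
  have Q: "\<delta> * real n - 1 \<le> real Q" "real Q \<le> \<delta> * real n" unfolding Q_def using dn by linarith+
  have Ql: "2 * Q \<le> l" using Q(2) l(3) by linarith
  have c0: "0 < \<bar>c\<bar>" using c gS by simp
  have xx: "x1 \<le> x2" using x N by linarith
  have rN: "0 < real N" using N by simp
  let ?I = "{x1..x2}"
  let ?K = "C * (\<bar>c\<bar> * real (card ?I) / real N + 1) / sqrt (real n)"
  have gapX: "d0 * real N \<le> \<bar>real_of_int (X (2 * j - 1) - X (2 * j))\<bar>" if j: "1 \<le> j" "j \<le> Q" for j
  proof (rule gap[OF j(1)])
   show "real j \<le> \<delta> * real n" using j Q by linarith
   have "1 \<le> 2 * j - 1" "2 * j - 1 \<le> l" "1 \<le> 2 * j" "2 * j \<le> l" using j Ql by auto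
   then show "X (2 * j - 1) \<in> A (2 * j - 1)" "X (2 * j) \<in> A (2 * j)" using X by blast+
  qed
  have conc: "real (card {b \<in> slice S l s'. y \<le> dot b X l \<and> dot b X l \<le> y + \<bar>c\<bar> * real (card ?I)}) \<le> ?K * real (card (slice S l s'))" for y
   by (rule ac[OF n l(1,2) s' typc s1 Q(1) Ql rN _ gapX]) simp_all
  have "(\<Sum>x\<in>?I. favg S f X l s' (t + c * real_of_int x)) \<le> 2 / \<bar>c\<bar> * ?K"
   by (rule favg_progression_interval[OF f c0 _ refl xx s' conc]) (use c in simp)
  also have "... = 2 * C / sqrt (real n) * (real (card ?I) / real N + 1 / \<bar>c\<bar>)"
   using c0 by (simp add: field_simps)
  also have "... \<le> 2 * C / sqrt (real n) * (real (card ?I) / real N * (1 + 1 / gS))"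
  proof (rule mult_left_mono)
   have "real N \<le> real (card ?I)" using x xx by simp
   then have 1: "1 \<le> real (card ?I) / real N" using rN by (simp add: le_divide_eq)
   have "1 / \<bar>c\<bar> \<le> 1 * (1 / gS)" using c gS by (simp add: frac_le)
   also have "... \<le> real (card ?I) / real N * (1 / gS)" by (rule mult_right_mono[OF 1]) (use gS in simp)
   finally show "real (card ?I) / real N + 1 / \<bar>c\<bar> \<le> real (card ?I) / real N * (1 + 1 / gS)" by (simp add: distrib_left)
  qed (use C in simp)
  also have "... = C2 / (real N * sqrt (real n)) * real (card ?I)" unfolding C2_def by (simp add: mult_ac)
  finally show "(\<Sum>x\<in>?I. favg S f X l s' (t + c * real_of_int x)) \<le> C2 / (real N * sqrt (real n)) * real (card ?I)" .
 qed
qed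

text \<open>
 The conclusion for fixed constants, with the admissible set replaced by what the argument needs of its
 factors: at most one factor \<open>A i0\<close> is short, the top factors are intervals, and paired factors are separated by
 \<open>d0 * N\<close>.
\<close>

definition sup_rare :: "real \<Rightarrow> real \<Rightarrow> real \<Rightarrow> real \<Rightarrow> real \<Rightarrow> real \<Rightarrow> nat \<Rightarrow> real \<Rightarrow> bool" where
 "sup_rare \<delta> d0 \<epsilon> L \<gamma> M n0 \<eta> \<longleftrightarrow>
  (\<forall>(n::nat) (N::nat) f (A :: nat \<Rightarrow> int set) m i0 Z0.
   n0 \<le> n \<and> 1 \<le> N \<and> real N \<le> exp ((- (\<Sum>a\<in>S. p a * ln (p a)) - \<epsilon>) * real n) \<and>
   tame (dS + 1) f \<and> (\<forall>t h. \<bar>h\<bar> \<le> dS \<longrightarrow> f (t + h) \<le> (1 + \<eta>) * f t) \<and>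
   (\<forall>i. 1 \<le> i \<and> i \<le> n \<longrightarrow> finite (A i) \<and> A i \<noteq> {} \<and> (i \<noteq> i0 \<longrightarrow> N \<le> card (A i))) \<and>
   (\<forall>i. 2 * \<delta> * real n < real i \<and> i \<le> n \<longrightarrow> (\<exists>x1 x2. A i = {x1..x2} \<and> int N \<le> x2 - x1 + 1)) \<and>
   (\<forall>j x y. 1 \<le> j \<and> real j \<le> \<delta> * real n \<and> x \<in> A (2 * j - 1) \<and> y \<in> A (2 * j) \<longrightarrow> d0 * real N \<le> \<bar>real_of_int (x - y)\<bar>) \<and>
   (\<Sum>a\<in>S. m a) = n \<and> (\<forall>a\<in>S. \<bar>real (m a) - p a * real n\<bar> \<le> \<gamma> * real n) \<longrightarrow>
   avg (unif A) A [1..<n + 1] (\<lambda>X. of_bool (\<exists>t. L / (real N * sqrt (real n)) \<le> favg S f X n m t)) Z0 \<le> exp (- M * real n))"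

text \<open>
 If the average is large at the top, then either the average over the lowest \<open>l0\<close> coordinates already exceeds
 \<open>L' / (N sqrt n)\<close> for some type that the path may have at level \<open>l0\<close>, or the event of \<open>sup_bound_uniform\<close> occurs. The
 parameter \<open>\<theta>\<close> is small enough for all types within \<open>3 \<theta> n\<close> levels of the top to be typical.
\<close>

lemma sup_favg_bound:
 fixes \<delta> d0 \<epsilon> :: real
 assumes \<delta>: "0 < \<delta>" "\<delta> < 1 / 4" and d0: "0 < d0" and \<epsilon>: "0 < \<epsilon>"
 obtains L \<gamma> :: real where "0 < L" "0 < \<gamma>" "\<gamma> < \<epsilon>"
  "\<And>M. 0 < M \<Longrightarrow> \<exists>(n0::nat) (\<eta>::real). 1 \<le> n0 \<and> 0 < \<eta> \<and> sup_rare \<delta> d0 \<epsilon> L \<gamma> M n0 \<eta>"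
proof (rule progression_sum_le[OF \<delta>(1) d0], goal_cases)
 case (1 C2 \<tau> n1)
 note C2 = 1(2) and \<tau> = 1(3) and prog = 1(4)
 define k where "k = real (card S)"
 have k: "2 \<le> k" unfolding k_def using S by simp
 define \<Lambda> where "\<Lambda> = (\<Sum>a\<in>S. - ln (p a))"
 define H where "H = - (\<Sum>a\<in>S. p a * ln (p a))"
 have lnp: "0 \<le> - ln (p a)" if "a \<in> S" for a using ppos[OF that] p_le[OF that] pm(1) by simp
 have \<Lambda>0: "0 \<le> \<Lambda>" unfolding \<Lambda>_def by (intro sum_nonneg lnp)
 have H\<Lambda>: "H \<le> \<Lambda>"
 proof -
  have "H = (\<Sum>a\<in>S. p a * (- ln (p a)))" unfolding H_def by (simp add: sum_negf)
  also have "... \<le> (\<Sum>a\<in>S. 1 * (- ln (p a)))"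
   using lnp p_le pm(1) by (intro sum_mono mult_right_mono) force+
  finally show ?thesis unfolding \<Lambda>_def by simp
 qed
 define q where "q = 5 * \<Lambda> + 4 * k / pm"
 have q: "0 < q" unfolding q_def using \<Lambda>0 k pm by (intro add_nonneg_pos) auto
 (* in this order: top levels stay above 2 \<delta> n; types remain typical; letters keep weight between pm / 2 and
  1 - pm / 2; \<theta> < \<epsilon>; the entropy loss stays below \<epsilon> / 2 *)
 define \<theta> where "\<theta> = Min {1 / 8, \<tau> / 4, pm / 16, \<epsilon> / 2, \<epsilon> / (4 * q)}"
 have \<theta>: "0 < \<theta>" "\<theta> \<le> 1 / 8" "\<theta> \<le> \<tau> / 4" "\<theta> \<le> pm / 16" "\<theta> \<le> \<epsilon> / 2" "\<theta> \<le> \<epsilon> / (4 * q)"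
 proof -
  let ?T = "{1 / 8, \<tau> / 4, pm / 16, \<epsilon> / 2, \<epsilon> / (4 * q)}"
  show "0 < \<theta>" unfolding \<theta>_def using \<tau> pm \<epsilon> q by (subst Min_gr_iff) auto
  have le: "\<theta> \<le> x" if "x \<in> ?T" for x unfolding \<theta>_def by (rule Min_le[OF _ that]) simp
  show "\<theta> \<le> 1 / 8" "\<theta> \<le> \<tau> / 4" "\<theta> \<le> pm / 16" "\<theta> \<le> \<epsilon> / 2" "\<theta> \<le> \<epsilon> / (4 * q)"
   by (rule le, simp)+
 qed
 have \<theta>q: "\<theta> * q \<le> \<epsilon> / 4"
 proof -
  have "\<theta> * q \<le> \<epsilon> / (4 * q) * q" using \<theta>(6) q by (intro mult_right_mono) auto
  then show ?thesis using q by simp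
 qed
 define L where "L = 16 * C2 + 1"
 have L: "1 \<le> L" "16 * C2 \<le> L" unfolding L_def using C2 by auto
 show thesis
 proof (rule that[of L \<theta>])
  show "0 < L" "0 < \<theta>" "\<theta> < \<epsilon>" using L \<theta> \<epsilon> by auto
  fix M :: real assume M: "0 < M"
  (* the summand ln k pays for the union bound over the at most k ^ n words of the slice *)
  define M1 where "M1 = M + 1 + ln k"
  have M1: "0 < M1" unfolding M1_def using M k by (simp add: add_pos_nonneg)
  have e2: "0 < \<epsilon> / 2" using \<epsilon> by simp
  have M2: "0 < M + 1" using M by simp
  show "\<exists>(n0::nat) (\<eta>::real). 1 \<le> n0 \<and> 0 < \<eta> \<and> sup_rare \<delta> d0 \<epsilon> L \<theta> M n0 \<eta>"
  proof (rule sup_bound_depending_on_exponent[OF e2 \<theta>(1) M1 C2 \<Lambda>0], goal_cases)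
   case (1 L' n2)
   note L' = 1(1) and first = 1(2)
   have L'0: "0 < L'" using L' by simp
   show ?thesis
   proof (rule sup_bound_uniform[OF \<theta>(1) M2 C2 \<Lambda>0 L L'0], goal_cases)
    case (1 r n3 \<eta>)
    note r = 1(1) and \<eta> = 1(2) and second = 1(3)
    have "\<forall>\<^sub>F n in at_top. k * (1 + ln (real n)) \<le> \<epsilon> / 4 * real n" using \<epsilon> by real_asymp
    moreover have "\<forall>\<^sub>F n in at_top. 1 \<le> \<theta> * real n" using \<theta>(1) by real_asymp
    moreover have "\<forall>\<^sub>F n in at_top. 1 \<le> pm / 2 * real n" using pm(1) by real_asymp
    moreover have "\<forall>\<^sub>F n::nat in at_top. max 1 (max n1 (max n2 n3)) \<le> n" by (rule eventually_ge_at_top)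
    ultimately have "\<forall>\<^sub>F n in at_top. k * (1 + ln (real n)) \<le> \<epsilon> / 4 * real n \<and> 1 \<le> \<theta> * real n \<and> 1 \<le> pm / 2 * real n
     \<and> max 1 (max n1 (max n2 n3)) \<le> n" by eventually_elim auto
    then obtain n4 where n4: "\<And>n. n4 \<le> n \<Longrightarrow> k * (1 + ln (real n)) \<le> \<epsilon> / 4 * real n \<and> 1 \<le> \<theta> * real n \<and> 1 \<le> pm / 2 * real n
     \<and> max 1 (max n1 (max n2 n3)) \<le> n" unfolding eventually_sequentially by blast
    show ?thesis
    proof (intro exI[of _ "max 1 n4"] exI[of _ \<eta>] conjI)
     show "1 \<le> max 1 n4" by simp
     show "0 < \<eta>" by (rule \<eta>)
     show "sup_rare \<delta> d0 \<epsilon> L \<theta> M (max 1 n4) \<eta>"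
      unfolding sup_rare_def
     proof (intro allI impI)
     fix n N :: nat and f and A :: "nat \<Rightarrow> int set" and m i0 and Z0 :: "nat \<Rightarrow> int"
     assume asm: "max 1 n4 \<le> n \<and> 1 \<le> N \<and> real N \<le> exp ((- (\<Sum>a\<in>S. p a * ln (p a)) - \<epsilon>) * real n) \<and>
      tame (dS + 1) f \<and> (\<forall>t h. \<bar>h\<bar> \<le> dS \<longrightarrow> f (t + h) \<le> (1 + \<eta>) * f t) \<and>
      (\<forall>i. 1 \<le> i \<and> i \<le> n \<longrightarrow> finite (A i) \<and> A i \<noteq> {} \<and> (i \<noteq> i0 \<longrightarrow> N \<le> card (A i))) \<and>
      (\<forall>i. 2 * \<delta> * real n < real i \<and> i \<le> n \<longrightarrow> (\<exists>x1 x2. A i = {x1..x2} \<and> int N \<le> x2 - x1 + 1)) \<and>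
      (\<forall>j x y. 1 \<le> j \<and> real j \<le> \<delta> * real n \<and> x \<in> A (2 * j - 1) \<and> y \<in> A (2 * j) \<longrightarrow> d0 * real N \<le> \<bar>real_of_int (x - y)\<bar>) \<and>
      (\<Sum>a\<in>S. m a) = n \<and> (\<forall>a\<in>S. \<bar>real (m a) - p a * real n\<bar> \<le> \<theta> * real n)"
     from asm have n: "n4 \<le> n" "1 \<le> n" and N: "1 \<le> N" and NH: "real N \<le> exp ((H - \<epsilon>) * real n)" and f: "tame (dS + 1) f"
      unfolding H_def by simp_all
     from asm have slow: "f (t + h) \<le> (1 + \<eta>) * f t" if "\<bar>h\<bar> \<le> dS" for t h using that by blast
     from asm have A: "finite (A i) \<and> A i \<noteq> {}" if "1 \<le> i" "i \<le> n" for i using that by blast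
     from asm have AN: "N \<le> card (A i)" if "1 \<le> i" "i \<le> n" "i \<noteq> i0" for i using that by blast
     from asm have AI: "\<exists>x1 x2. A i = {x1..x2} \<and> int N \<le> x2 - x1 + 1" if "2 * \<delta> * real n < real i" "i \<le> n" for i using that by blast
     from asm have gap: "d0 * real N \<le> \<bar>real_of_int (x - y)\<bar>" if "1 \<le> j" "real j \<le> \<delta> * real n" "x \<in> A (2 * j - 1)" "y \<in> A (2 * j)" for j x y
      using that by blast
     from asm have m: "(\<Sum>a\<in>S. m a) = n" and md: "\<And>a. a \<in> S \<Longrightarrow> \<bar>real (m a) - p a * real n\<bar> \<le> \<theta> * real n" by blast+
     have big: "k * (1 + ln (real n)) \<le> \<epsilon> / 4 * real n" "1 \<le> \<theta> * real n" "1 \<le> pm / 2 * real n" "n1 \<le> n" "n2 \<le> n" "n3 \<le> n"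
      using n4[OF n(1)] by auto
     have NL: "real N \<le> exp (\<Lambda> * real n)"
     proof -
      have "(H - \<epsilon>) * real n \<le> \<Lambda> * real n" using H\<Lambda> \<epsilon> by (intro mult_right_mono) auto
      then have "exp ((H - \<epsilon>) * real n) \<le> exp (\<Lambda> * real n)" by simp
      then show ?thesis using NH by linarith
     qed
     define B where "B = nat \<lfloor>\<theta> * real n\<rfloor> div r"
     have Br: "real (B * r) \<le> \<theta> * real n"
     proof -
      have "B * r \<le> nat \<lfloor>\<theta> * real n\<rfloor>" unfolding B_def by simp
      then show ?thesis using big(2) by linarith
     qed
     have \<theta>n: "\<theta> * real n \<le> real n / 8" using mult_right_mono[OF \<theta>(2), of "real n"] by simp
     define l0 where "l0 = n - B * r"
     have "real (B * r) \<le> real n" using Br \<theta>n by linarith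
     then have Brn: "B * r \<le> n" by (simp only: of_nat_le_iff)
     have nl: "n = l0 + B * r" unfolding l0_def using Brn by simp
     have l0: "l0 \<le> n" "real n - \<theta> * real n \<le> real l0"
     proof -
      show "l0 \<le> n" using nl by simp
      have "real n = real l0 + real (B * r)" by (subst nl) (simp only: of_nat_add)
      then show "real n - \<theta> * real n \<le> real l0" using Br by linarith
     qed
     have \<delta>n: "2 * \<delta> * real n \<le> real n / 2" using mult_right_mono[of "2 * \<delta>" "1 / 2" "real n"] \<delta> by simp
     have typ1: "\<bar>real (s' a) - p a * real l\<bar> \<le> 4 * \<theta> * real n" "1 \<le> s' a" "real (s' a) \<le> (1 - pm / 2) * real l"
      if l: "l \<le> n" "real n - 3 * \<theta> * real n \<le> real l" and s': "\<forall>a\<in>S. s' a \<le> m a" "(\<Sum>a\<in>S. s' a) = l" and a: "a \<in> S" for l s' a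
     proof -
      show t: "\<bar>real (s' a) - p a * real l\<bar> \<le> 4 * \<theta> * real n" by (rule near_top_types(1)[OF m md l s' a])
      have 1: "p a * real n - 4 * \<theta> * real n \<le> real (s' a)" by (rule near_top_types(2)[OF m md l s' a])
      have 2: "pm * real n \<le> p a * real n" using pm(2)[OF a] by (intro mult_right_mono) auto
      have 3: "4 * \<theta> * real n \<le> pm / 4 * real n" using \<theta>(4) by (intro mult_right_mono) auto
      have "1 \<le> real (s' a)" using 1 2 3 big(3) by linarith
      then show "1 \<le> s' a" by simp
      have "p a * real l \<le> (1 - pm) * real l" using p_le[OF a] by (intro mult_right_mono) auto
      moreover have "(1 - pm) * real l = (1 - pm / 2) * real l - pm / 2 * real l" by (simp add: algebra_simps)
      moreover have "real n / 2 \<le> real l" using l(2) \<theta>n by linarith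
      then have "pm / 2 * (real n / 2) \<le> pm / 2 * real l" using pm(1) by (intro mult_left_mono) auto
      ultimately show "real (s' a) \<le> (1 - pm / 2) * real l" using t 3 by linarith
     qed
     have sums: "(\<Sum>x\<in>{x1..x2}. favg S f X l s' (t + c * real_of_int x)) \<le> C2 / (real N * sqrt (real n)) * real (card {x1..x2})"
      if l: "l \<le> n" "real n - 3 * \<theta> * real n \<le> real l" and X: "\<forall>j. 1 \<le> j \<and> j \<le> l \<longrightarrow> X j \<in> A j"
       and s': "\<forall>a\<in>S. s' a \<le> m a" "(\<Sum>a\<in>S. s' a) = l" and c: "gS \<le> \<bar>c\<bar>" "\<bar>c\<bar> \<le> dS" and x: "int N \<le> x2 - x1 + 1"
      for l X s' c t x1 x2
     proof (rule prog[OF big(4) N f _ l(1) _ gap X s'(2) _ _ c x])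
      have h: "real n / 2 \<le> real l" using l(2) \<theta>n by linarith
      then have "0 < real l" using n(2) by simp
      then show "1 \<le> l" by simp
      show "2 * \<delta> * real n \<le> real l" using h \<delta>n by linarith
      have "4 * \<theta> * real n \<le> \<tau> * real n" using \<theta>(3) by (intro mult_right_mono) auto
      then show "\<bar>real (s' a) - p a * real l\<bar> \<le> \<tau> * real n" if "a \<in> S" for a
       using typ1(1)[OF l s' that] by linarith
      show "1 \<le> s' a" if "a \<in> S" for a by (rule typ1(2)[OF l s' that])
     qed
     let ?sl = "slice S n m"
     let ?y = "L' / (real N * sqrt (real n))"
     have finsl: "finite ?sl" by (rule finite_slice[OF S(1)])
     have law: "law (unif A) A i" if "1 \<le> i" "i \<le> n" for i using A[OF that] by (intro law_unif) auto
     have law': "\<forall>i\<in>set [1..<n + 1]. law (unif A) A i" using law by auto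
     have part1: "avg (unif A) A [1..<n + 1] (\<lambda>X. of_bool (\<exists>t. ?y \<le> favg S f X l0 (cnt b l0) t)) Z0 \<le> exp (- M1 * real n)"
      if b: "b \<in> ?sl" for b
     proof -
      let ?\<phi> = "\<lambda>X. of_bool (\<exists>t. ?y \<le> favg S f X l0 (cnt b l0) t) :: real"
      have cm: "\<forall>a\<in>S. cnt b l0 a \<le> m a"
      proof
       fix a assume a: "a \<in> S"
       have "cnt b l0 a \<le> cnt b n a" unfolding cnt_def using l0(1) by (intro card_mono) auto
       also have "... = m a" using b a unfolding slice_def by simp
       finally show "cnt b l0 a \<le> m a" .
      qed
      have bE: "b \<in> {1..n} \<rightarrow>\<^sub>E S" using b unfolding slice_def by simp
      have cs: "(\<Sum>a\<in>S. cnt b l0 a) = l0"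
      proof (rule sum_cnt[OF S(1)])
       fix i assume "1 \<le> i" "i \<le> l0"
       then show "b i \<in> S" using l0(1) by (intro PiE_mem[OF bE]) auto
      qed
      have l3: "real n - 3 * \<theta> * real n \<le> real l0" using l0(2) big(2) by linarith
      have "[1..<n + 1] = [1..<(l0 + 1) + (n - l0)]" using l0(1) by simp
      also have "... = [1..<l0 + 1] @ [l0 + 1..<(l0 + 1) + (n - l0)]" by (rule upt_add_eq_append) simp
      finally have split: "[1..<n + 1] = [1..<l0 + 1] @ [l0 + 1..<n + 1]" using l0(1) by simp
      have indep: "avg (unif A) A [l0 + 1..<n + 1] ?\<phi> Z = ?\<phi> Z" for Z
      proof (rule avg_indep)
       show "\<forall>i\<in>set [l0 + 1..<n + 1]. law (unif A) A i" using law by auto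
       fix i x and Y :: "nat \<Rightarrow> int" assume "i \<in> set [l0 + 1..<n + 1]"
       then have i: "l0 < i" by auto
       have "favg S f (Y(i := x)) l0 (cnt b l0) t = favg S f Y l0 (cnt b l0) t" for t
        by (rule favg_cong_X) (use i in auto)
       then show "?\<phi> (Y(i := x)) = ?\<phi> Y" by simp
      qed
      have indep': "avg (unif A) A [l0 + 1..<n + 1] ?\<phi> = ?\<phi>" by (rule ext) (rule indep)
      have "avg (unif A) A [1..<n + 1] ?\<phi> Z0 = avg (unif A) A [1..<l0 + 1] ?\<phi> Z0"
       unfolding split avg_append indep' ..
      also have "... \<le> exp (- M1 * real n)"
      proof (rule first[OF big(5) N NL f l0(1) _ cs, where ?i0.0 = i0])
       show "\<theta> * real n \<le> real l0" using l0(2) \<theta>n by linarith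
       show "exp (\<epsilon> / 2 * real n) * real N \<le> real (card (slice S l0 (cnt b l0)))"
       proof (rule slice_large[OF \<theta>(1) _ _ _ l0(1,2) cs])
        show "\<theta> * (5 * (\<Sum>a\<in>S. - ln (p a)) + 4 * real (card S) / pm) \<le> \<epsilon> / 4"
         using \<theta>q unfolding q_def \<Lambda>_def k_def .
        show "real (card S) * (1 + ln (real n)) \<le> \<epsilon> / 4 * real n" using big(1) unfolding k_def .
        have "0 < real l0" using l0(2) \<theta>n n(2) by linarith
        then show "1 \<le> l0" by simp
        show "\<bar>real (cnt b l0 a) - p a * real l0\<bar> \<le> 4 * \<theta> * real n" if "a \<in> S" for a
         by (rule typ1(1)[OF l0(1) l3 cm cs that])
        show "1 \<le> cnt b l0 a" if "a \<in> S" for a by (rule typ1(2)[OF l0(1) l3 cm cs that])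
        show "real N \<le> exp ((- (\<Sum>a\<in>S. p a * ln (p a)) - \<epsilon>) * real n)" using NH unfolding H_def .
       qed
       show "finite (A i) \<and> A i \<noteq> {}" if "1 \<le> i" "i \<le> l0" for i using that l0(1) by (intro A) auto
       show "N \<le> card (A i)" if "1 \<le> i" "i \<le> l0" "i \<noteq> i0" for i using that l0(1) by (intro AN) auto
       show "(\<Sum>x\<in>A i. favg S f X (i - 1) s' (t + c * real_of_int x)) \<le> C2 / (real N * sqrt (real n)) * real (card (A i))"
        if i: "1 \<le> i" "i \<le> l0" "real l0 - \<theta> * real n < real i" and X: "\<forall>j. 1 \<le> j \<and> j < i \<longrightarrow> X j \<in> A j"
         and s': "\<forall>a\<in>S. s' a \<le> cnt b l0 a" "(\<Sum>a\<in>S. s' a) = i - 1" and c: "gS \<le> \<bar>c\<bar>" "\<bar>c\<bar> \<le> dS" for i X s' c t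
       proof -
        have "2 * \<delta> * real n < real i" using i(3) l0(2) \<theta>n \<delta>n n(2) by linarith
        moreover have "i \<le> n" using i l0 by simp
        ultimately obtain x1 x2 where AIi: "A i = {x1..x2}" and x: "int N \<le> x2 - x1 + 1" using AI by blast
        have i1: "i - 1 \<le> n" using i l0 by simp
        have "real (i - 1) = real i - 1" using i(1) by (simp add: of_nat_diff)
        then have i2: "real n - 3 * \<theta> * real n \<le> real (i - 1)" using i(3) l0(2) big(2) by linarith
        have X': "\<forall>j. 1 \<le> j \<and> j \<le> i - 1 \<longrightarrow> X j \<in> A j" using X by auto
        have s'': "\<forall>a\<in>S. s' a \<le> m a" using s'(1) cm by (meson order_trans)
        show ?thesis unfolding AIi by (rule sums[OF i1 i2 X' s'' s'(2) c x])
       qed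
       show "real (s' a) \<le> (1 - pm / 2) * real i"
        if i: "i \<le> l0" "real l0 - \<theta> * real n < real i" and s': "\<forall>a\<in>S. s' a \<le> cnt b l0 a" "(\<Sum>a\<in>S. s' a) = i" and a: "a \<in> S" for i s' a
       proof (rule typ1(3)[OF _ _ _ s'(2) a])
        show "i \<le> n" using i l0 by simp
        show "real n - 3 * \<theta> * real n \<le> real i" using i l0(2) big(2) by linarith
        show "\<forall>a\<in>S. s' a \<le> m a" using s'(1) cm by (meson order_trans)
       qed
      qed
      finally show ?thesis .
     qed
     let ?E = "\<lambda>X. (\<exists>t. L / (real N * sqrt (real n)) \<le> favg S f X n m t) \<and>
       (\<forall>b\<in>?sl. \<forall>t. favg S f X l0 (cnt b l0) t < ?y)"
     have part2: "avg (unif A) A [1..<n + 1] (\<lambda>X. of_bool (?E X)) Z0 \<le> exp (- (M + 1) * real n)"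
     proof (rule second[OF big(6) N NL f slow m B_def nl])
      show "(pm / 2 + \<theta>) * real n \<le> real (m a)" if a: "a \<in> S" for a
      proof -
       have "pm * real n \<le> p a * real n" using pm(2)[OF a] by (intro mult_right_mono) auto
       moreover have "\<theta> * real n \<le> pm / 16 * real n" using \<theta>(4) by (intro mult_right_mono) auto
       moreover have "(pm / 2 + \<theta>) * real n = pm * real n / 2 + \<theta> * real n" by (simp add: algebra_simps)
       moreover have "0 \<le> pm * real n" using pm(1) by simp
       ultimately show ?thesis using md[OF a] by linarith
      qed
      show "finite (A i) \<and> A i \<noteq> {}" if "1 \<le> i" "i \<le> n" for i by (rule A[OF that])
      show "\<exists>x1 x2. A i = {x1..x2} \<and> int N \<le> x2 - x1 + 1" if "l0 < i" "i \<le> n" for i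
      proof (rule AI[OF _ that(2)])
       have "real l0 < real i" using that(1) by simp
       then show "2 * \<delta> * real n < real i" using l0(2) \<theta>n \<delta>n n(2) by linarith
      qed
      show "(\<Sum>x\<in>{0..int N}. favg S f X l s' (t + c * real_of_int x)) \<le> C2 / (real N * sqrt (real n)) * real (N + 1)"
       if l: "l0 \<le> l" "l \<le> n" and X: "\<forall>j. 1 \<le> j \<and> j \<le> l \<longrightarrow> X j \<in> A j" and s': "\<forall>a\<in>S. s' a \<le> m a" "(\<Sum>a\<in>S. s' a) = l"
        and c: "gS \<le> \<bar>c\<bar>" "\<bar>c\<bar> \<le> dS" for l X s' c t
      proof -
       have "real l0 \<le> real l" using l by simp
       then have l3: "real n - 3 * \<theta> * real n \<le> real l" using l0(2) big(2) by linarith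
       have "card {0..int N} = N + 1" by simp
       then show ?thesis using sums[OF l(2) l3 X s' c, of "int N" 0 t] by simp
      qed
     qed
     have "avg (unif A) A [1..<n + 1] (\<lambda>X. of_bool (\<exists>t. L / (real N * sqrt (real n)) \<le> favg S f X n m t)) Z0
      \<le> avg (unif A) A [1..<n + 1] (\<lambda>X. (\<Sum>b\<in>?sl. of_bool (\<exists>t. ?y \<le> favg S f X l0 (cnt b l0) t)) + of_bool (?E X)) Z0"
     proof (rule avg_mono[OF law'])
      fix X :: "nat \<Rightarrow> int"
      let ?P = "\<lambda>b. \<exists>t. ?y \<le> favg S f X l0 (cnt b l0) t"
      show "of_bool (\<exists>t. L / (real N * sqrt (real n)) \<le> favg S f X n m t) \<le> (\<Sum>b\<in>?sl. of_bool (?P b)) + (of_bool (?E X) :: real)"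
      proof (cases "\<exists>b\<in>?sl. ?P b")
       case True
       then obtain b where b: "b \<in> ?sl" "?P b" by (rule bexE)
       have "of_bool (?P b) \<le> (\<Sum>b\<in>?sl. of_bool (?P b) :: real)" by (rule member_le_sum[OF b(1)]) (use finsl in auto)
       moreover have "of_bool (?P b) = (1::real)" using b(2) by (simp only: of_bool_eq)
       moreover have "of_bool (\<exists>t. L / (real N * sqrt (real n)) \<le> favg S f X n m t) \<le> (1::real)" "0 \<le> (of_bool (?E X) :: real)" by auto
       ultimately show ?thesis by linarith
      next
       case False
       then have "\<forall>b\<in>?sl. \<forall>t. favg S f X l0 (cnt b l0) t < ?y" by (auto simp: not_le)
       then have "of_bool (\<exists>t. L / (real N * sqrt (real n)) \<le> favg S f X n m t) = (of_bool (?E X) :: real)" by simp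
       moreover have "0 \<le> (\<Sum>b\<in>?sl. of_bool (?P b) :: real)" by (intro sum_nonneg) auto
       ultimately show ?thesis by linarith
      qed
     qed
     also have "... = (\<Sum>b\<in>?sl. avg (unif A) A [1..<n + 1] (\<lambda>X. of_bool (\<exists>t. ?y \<le> favg S f X l0 (cnt b l0) t)) Z0)
       + avg (unif A) A [1..<n + 1] (\<lambda>X. of_bool (?E X)) Z0"
      unfolding avg_add avg_sum[OF finsl] ..
     also have "... \<le> (\<Sum>b\<in>?sl. exp (- M1 * real n)) + exp (- (M + 1) * real n)"
      by (intro add_mono sum_mono part1 part2)
     also have "... = real (card ?sl) * exp (- M1 * real n) + exp (- (M + 1) * real n)" by simp
     also have "... \<le> k ^ n * exp (- M1 * real n) + exp (- (M + 1) * real n)"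
     proof (intro add_right_mono mult_right_mono)
      have "real (card ?sl) \<le> real (card S ^ n)" using card_slice_le by (simp only: of_nat_le_iff)
      then show "real (card ?sl) \<le> k ^ n" unfolding k_def by simp
     qed simp
     also have "k ^ n * exp (- M1 * real n) = exp (- (M + 1) * real n)"
     proof -
      have "k ^ n = exp (real n * ln k)" using k by (simp add: exp_of_nat_mult)
      then show ?thesis unfolding M1_def by (simp add: algebra_simps flip: exp_add)
     qed
     also have "exp (- (M + 1) * real n) + exp (- (M + 1) * real n) = 2 * exp (- real n) * exp (- M * real n)"
      by (simp add: algebra_simps flip: exp_add)
     also have "... \<le> 1 * exp (- M * real n)"
     proof (rule mult_right_mono)
      have "2 \<le> 1 + real n" using n(2) by simp
      also have "... \<le> exp (real n)" by (rule exp_ge_add_one_self)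
      finally show "2 * exp (- real n) \<le> 1" by (simp add: exp_minus field_simps)
     qed simp
     finally show "avg (unif A) A [1..<n + 1] (\<lambda>X. of_bool (\<exists>t. L / (real N * sqrt (real n)) \<le> favg S f X n m t)) Z0 \<le> exp (- M * real n)"
      by simp
     qed
    qed
   qed
  qed
 qed
qed

end

section \<open>Admissible sets\<close>

lemma discrete_rv_alphabet:
 assumes "discrete_rv \<xi>"
 obtains gS dS where "alphabet (set_pmf \<xi>) (pmf \<xi>) (min_prob \<xi>) gS dS"
proof -
 let ?S = "set_pmf \<xi>"
 have S: "finite ?S" "2 \<le> card ?S" using assms unfolding discrete_rv_def by auto
 have ne: "?S \<noteq> {}" by (rule set_pmf_not_empty)
 have mp: "min_prob \<xi> \<le> pmf \<xi> a" if "a \<in> ?S" for a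
  unfolding min_prob_def by (rule Min_le) (use S that in auto)
 have mp0: "0 < min_prob \<xi>"
  unfolding min_prob_def using S ne by (subst Min_gr_iff) (auto simp: set_pmf_iff pmf_pos)
 let ?D = "(\<lambda>(a, b). \<bar>a - b\<bar>) ` {(a, b). a \<in> ?S \<and> b \<in> ?S}"
 let ?G = "(\<lambda>(a, b). \<bar>a - b\<bar>) ` {(a, b). a \<in> ?S \<and> b \<in> ?S \<and> a \<noteq> b}"
 have sq: "{(a, b). a \<in> ?S \<and> b \<in> ?S} = ?S \<times> ?S" by auto
 have finD: "finite ?D" unfolding sq using S by auto
 have finG: "finite (insert 1 ?G)"
  by (rule finite.insertI, rule finite_subset[OF _ finD]) auto
 have "alphabet ?S (pmf \<xi>) (min_prob \<xi>) (Min (insert 1 ?G)) (Max ?D)"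
 proof
  show "finite ?S" "2 \<le> card ?S" by (rule S)+
  show "0 < min_prob \<xi>" by (rule mp0)
  show "min_prob \<xi> \<le> pmf \<xi> a" if "a \<in> ?S" for a by (rule mp[OF that])
  show "(\<Sum>a\<in>?S. pmf \<xi> a) = 1" by (rule sum_pmf_eq_1[OF S(1)]) simp
  show "0 < Min (insert 1 ?G)" using finG by (subst Min_gr_iff) auto
  show "Min (insert 1 ?G) \<le> \<bar>a - b\<bar>" if "a \<in> ?S" "b \<in> ?S" "a \<noteq> b" for a b
   by (rule Min_le[OF finG]) (use that in auto)
  show "\<bar>a - b\<bar> \<le> Max ?D" if "a \<in> ?S" "b \<in> ?S" for a b
   by (rule Max_ge[OF finD]) (use that in auto)
 qed
 then show thesis by (rule that)
qed

lemma log2_lipschitz_shift: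
 assumes f: "log2_lipschitz \<eta> f" and h: "\<bar>h\<bar> \<le> d"
 shows "f (t + h) \<le> 2 powr (\<eta> * d) * f t"
proof -
 have pos: "0 < f t" for t using f unfolding log2_lipschitz_def by blast
 have lip: "\<eta>-lipschitz_on UNIV (\<lambda>t. log 2 (f t))" using f unfolding log2_lipschitz_def by blast
 have \<eta>: "0 \<le> \<eta>" by (rule lipschitz_on_nonneg[OF lip])
 have "dist (log 2 (f (t + h))) (log 2 (f t)) \<le> \<eta> * dist (t + h) t" by (rule lipschitz_onD[OF lip]) auto
 then have "log 2 (f (t + h)) - log 2 (f t) \<le> \<eta> * \<bar>h\<bar>" by (simp add: dist_real_def)
 also have "... \<le> \<eta> * d" using \<eta> h by (rule mult_left_mono[rotated])
 finally have "log 2 (f (t + h)) \<le> \<eta> * d + log 2 (f t)" by simp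
 then have "2 powr log 2 (f (t + h)) \<le> 2 powr (\<eta> * d + log 2 (f t))" by (intro powr_mono) auto
 then show ?thesis using pos by (simp add: powr_add)
qed

lemma tame_log2_lipschitz:
 assumes f: "log2_lipschitz \<eta> f" "integrable lborel f" "L1_norm f = 1" and \<eta>: "\<eta> * d \<le> 1"
 shows "tame d f"
 unfolding tame_def
proof (intro conjI allI impI)
 have pos: "0 < f t" for t using f(1) unfolding log2_lipschitz_def by blast
 then show "0 \<le> f t" for t by (simp add: less_imp_le)
 show "integrable lborel f" by (rule f(2))
 show "(\<integral>t. f t \<partial>lborel) = 1" using f(3) pos unfolding L1_norm_def by (simp add: less_imp_le)
 fix t h :: real assume "\<bar>h\<bar> \<le> d"
 then have "f (t + h) \<le> 2 powr (\<eta> * d) * f t" by (rule log2_lipschitz_shift[OF f(1)])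
 also have "... \<le> 2 powr 1 * f t" using \<eta> pos by (intro mult_right_mono powr_mono) (auto intro: less_imp_le)
 finally show "f (t + h) \<le> 2 * f t" by simp
qed

text \<open>
 A product set carries the product of the uniform laws of its factors.
\<close>

lemma prob_eq_avg:
 fixes A :: "nat \<Rightarrow> int set"
 assumes A: "\<And>i. i \<in> {1..n} \<Longrightarrow> finite (A i) \<and> A i \<noteq> {}"
 shows "measure_pmf.prob (pmf_of_set (Pi\<^sub>E {1..n} A)) E = avg (unif A) A [1..<n + 1] (\<lambda>X. of_bool (X \<in> E)) (\<lambda>_. undefined)"
proof -
 let ?P = "Pi\<^sub>E {1..n} A"
 have set: "set [1..<n + 1] = {1..n}" by auto
 have fin: "finite ?P" using A by (intro finite_PiE) auto
 have ne: "?P \<noteq> {}" using A by (subst PiE_eq_empty_iff) auto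
 have c: "(\<Prod>i\<in>{1..n}. unif A i (X i)) = 1 / real (card ?P)" for X
  unfolding unif_def card_PiE[OF finite_atLeastAtMost] by (simp add: prod_dividef)
 have "avg (unif A) A [1..<n + 1] (\<lambda>X. of_bool (X \<in> E)) (\<lambda>_. undefined) = (\<Sum>X\<in>?P. 1 / real (card ?P) * of_bool (X \<in> E))"
  using avg_eq_sum[of "[1..<n + 1]" A "unif A" "\<lambda>X. of_bool (X \<in> E)"] A unfolding set c by simp
 also have "... = real (card (?P \<inter> E)) / real (card ?P)"
  using fin by (simp add: sum_divide_distrib[symmetric] Int_def)
 also have "... = measure_pmf.prob (pmf_of_set ?P) E"
  by (rule measure_pmf_of_set[OF ne fin, symmetric])
 finally show ?thesis by simp
qed

text \<open>
 Pointwise suprema dominate essential ones; measurability matters since \<open>esssup\<close> of a nonmeasurable function is \<open>\<infinity>\<close>.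
\<close>

lemma Linf_norm_lower_witness:
 assumes g: "g \<in> borel_measurable borel" and y: "ereal y \<le> Linf_norm g" and y': "y' < y"
 shows "\<exists>t. y' \<le> \<bar>g t\<bar>"
proof (rule ccontr)
 assume "\<not> ?thesis"
 then have "AE t in lborel. ereal \<bar>g t\<bar> \<le> ereal y'" by (auto simp: not_le less_imp_le)
 then have "Linf_norm g \<le> ereal y'" unfolding Linf_norm_def using g by (intro esssup_I) auto
 then show False using y y' by (meson ereal_less_eq(3) not_le order_trans)
qed

text \<open>
 The exceptional index arises when \<open>2 j - 1 \<le> 2 \<delta> n < 2 j\<close>: the factor \<open>A (2 j - 1)\<close> is then neither a top interval
 nor covered by the conditions on pairs. A union of two intervals of total size at least \<open>2 N\<close> still has at least \<open>N\<close>
 elements.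
\<close>

lemma admissible_factors:
 assumes adm: "admissible N n K1 K2 K3 \<delta> \<A>" and N: "1 \<le> N" and K: "1 < K1" "K1 < K2"
 obtains A :: "nat \<Rightarrow> int set" and i0 :: nat where "\<A> = Pi\<^sub>E {1..n} A"
  "\<And>i. 1 \<le> i \<Longrightarrow> i \<le> n \<Longrightarrow> finite (A i) \<and> A i \<noteq> {} \<and> (i \<noteq> i0 \<longrightarrow> N \<le> card (A i))"
  "\<And>i. 2 * \<delta> * real n < real i \<Longrightarrow> 1 \<le> i \<Longrightarrow> i \<le> n \<Longrightarrow> \<exists>x1 x2. A i = {x1..x2} \<and> int N \<le> x2 - x1 + 1"
  "\<And>j x y. 1 \<le> j \<Longrightarrow> real j \<le> \<delta> * real n \<Longrightarrow> x \<in> A (2 * j - 1) \<Longrightarrow> y \<in> A (2 * j) \<Longrightarrow>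
    min (K2 - K1) 2 * real N \<le> \<bar>real_of_int (x - y)\<bar>"
proof -
 obtain A where A: "\<A> = Pi\<^sub>E {1..n} A" and ne: "\<forall>i\<in>{1..n}. A i \<noteq> {}"
  and bd: "\<forall>i\<in>{1..n}. \<forall>a\<in>A i. \<bar>a\<bar> \<le> int n * int N"
  and top: "\<forall>i\<in>{1..n}. real i > 2 * \<delta> * real n \<longrightarrow> int_interval (A i) \<and> 2 * N + 1 \<le> card (A i)"
  and low: "(cond_P1 N n K1 \<delta> A \<and> cond_P2 N n K2 \<delta> A) \<or> (cond_Q1 N n K1 K2 \<delta> A \<and> cond_Q2 N n K1 K2 \<delta> A)"
 proof -
  from adm[unfolded admissible_def] obtain A where h: "\<A> = (\<Pi>\<^sub>E i\<in>{1..n}. A i) \<and>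
     (\<forall>i\<in>{1..n}. A i \<noteq> {}) \<and>
     real (\<Prod>i=1..n. card (A i)) \<le> (K3 * real N) ^ n \<and>
     (\<forall>i\<in>{1..n}. \<forall>a\<in>A i. \<bar>a\<bar> \<le> int n * int N) \<and>
     (\<forall>i\<in>{1..n}. real i > 2 * \<delta> * real n \<longrightarrow>
       int_interval (A i) \<and> 2 * N + 1 \<le> card (A i)) \<and>
     ((cond_P1 N n K1 \<delta> A \<and> cond_P2 N n K2 \<delta> A) \<or>
      (cond_Q1 N n K1 K2 \<delta> A \<and> cond_Q2 N n K1 K2 \<delta> A))" by (rule exE)
  from h show thesis by (elim conjE) (rule that)
 qed
 have fin: "finite (A i)" if "i \<in> {1..n}" for i
  by (rule finite_subset[of _ "{- (int n * int N)..int n * int N}"]) (use bd that in force)+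
 define i0 where "i0 = 2 * nat \<lfloor>\<delta> * real n\<rfloor> + 1"
 have even: "2 * N + 1 \<le> card (A (2 * j))" if "1 \<le> j" "real j \<le> \<delta> * real n" for j
  using low
 proof
  assume P: "cond_P1 N n K1 \<delta> A \<and> cond_P2 N n K2 \<delta> A"
  from P[THEN conjunct1, unfolded cond_P1_def, rule_format, OF that] show ?thesis by (elim conjE)
 next
  assume Q: "cond_Q1 N n K1 K2 \<delta> A \<and> cond_Q2 N n K1 K2 \<delta> A"
  from Q[THEN conjunct1, unfolded cond_Q1_def, rule_format, OF that] show ?thesis by (elim conjE)
 qed
 have odd: "N \<le> card (A (2 * j - 1))" if j: "1 \<le> j" "real j \<le> \<delta> * real n" "2 * j - 1 \<le> n" for j
  using low
 proof
  assume P: "cond_P1 N n K1 \<delta> A \<and> cond_P2 N n K2 \<delta> A"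
  from P[THEN conjunct2, unfolded cond_P2_def, rule_format, OF j(1,2)]
  obtain I J where IJ: "A (2 * j - 1) = I \<union> J" "2 * N \<le> card I + card J" by (elim conjE exE)
  have f: "finite (A (2 * j - 1))" using j by (intro fin) auto
  have "card I \<le> card (A (2 * j - 1))" "card J \<le> card (A (2 * j - 1))" using f IJ(1) by (auto intro!: card_mono)
  then show ?thesis using IJ(2) by linarith
 next
  assume Q: "cond_Q1 N n K1 K2 \<delta> A \<and> cond_Q2 N n K1 K2 \<delta> A"
  from Q[THEN conjunct2, unfolded cond_Q2_def, rule_format, OF j(1,2)] have "2 * N + 1 \<le> card (A (2 * j - 1))" by (elim conjE)
  then show ?thesis by simp
 qed
 show thesis
 proof (rule that[OF A, of i0])
  fix i assume i: "1 \<le> i" "i \<le> n"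
  have "N \<le> card (A i)" if i0: "i \<noteq> i0"
  proof (cases "real i > 2 * \<delta> * real n")
   case True
   then have "2 * N + 1 \<le> card (A i)" using top i by simp
   then show ?thesis by simp
  next
   case False
   show ?thesis
   proof (cases "even i")
    case True
    then obtain j where j: "i = 2 * j" by (rule evenE)
    have "2 * N + 1 \<le> card (A (2 * j))" by (rule even) (use j i False in auto)
    then show ?thesis using j by simp
   next
    case odd_i: False
    then obtain j' where j': "i = 2 * j' + 1" by (rule oddE)
    have i': "i = 2 * (j' + 1) - 1" using j' by simp
    have "real (j' + 1) \<le> \<delta> * real n"
    proof (rule ccontr)
     assume "\<not> ?thesis"
     then have 1: "\<delta> * real n < real j' + 1" by simp
     have "2 * real j' + 1 \<le> 2 * (\<delta> * real n)" using False j' by simp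
     then have "real j' \<le> \<delta> * real n" by linarith
     then have "\<lfloor>\<delta> * real n\<rfloor> = int j'" using 1 by (intro floor_unique) auto
     then show False using i0 j' unfolding i0_def by simp
    qed
    then show ?thesis unfolding i' using i i' by (intro odd) auto
   qed
  qed
  then show "finite (A i) \<and> A i \<noteq> {} \<and> (i \<noteq> i0 \<longrightarrow> N \<le> card (A i))" using fin[of i] ne i by simp
 next
  fix i assume i: "2 * \<delta> * real n < real i" "1 \<le> i" "i \<le> n"
  have t: "int_interval (A i)" "2 * N + 1 \<le> card (A i)" using top i by simp_all
  from t(1)[unfolded int_interval_def] obtain x1 x2 where x1: "A i = {x1..x2}" by (elim exE)
  note x = x1 t(2)
  have "int N \<le> x2 - x1 + 1" using x(2) unfolding x(1) by simp
  then show "\<exists>x1 x2. A i = {x1..x2} \<and> int N \<le> x2 - x1 + 1" using x(1) by blast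
 next
  fix j and x y :: int assume j: "1 \<le> j" "real j \<le> \<delta> * real n" and x: "x \<in> A (2 * j - 1)" and y: "y \<in> A (2 * j)"
  have dN: "min (K2 - K1) 2 * real N \<le> (K2 - K1) * real N" "min (K2 - K1) 2 * real N \<le> 2 * real N"
   by (intro mult_right_mono; simp)+
  show "min (K2 - K1) 2 * real N \<le> \<bar>real_of_int (x - y)\<bar>"
   using low
  proof
   assume P: "cond_P1 N n K1 \<delta> A \<and> cond_P2 N n K2 \<delta> A"
   from P[THEN conjunct1, unfolded cond_P1_def, rule_format, OF j]
   have "real_of_int ` A (2 * j) \<subseteq> {- (K1 * real N)..K1 * real N}" by (elim conjE)
   then have 1: "- (K1 * real N) \<le> real_of_int y" "real_of_int y \<le> K1 * real N" using y by auto
   from P[THEN conjunct2, unfolded cond_P2_def, rule_format, OF j]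
   have "real_of_int ` A (2 * j - 1) \<inter> {- (K2 * real N)..K2 * real N} = {}" by (elim conjE)
   then have "real_of_int x \<notin> {- (K2 * real N)..K2 * real N}" using x by blast
   then have 2: "real_of_int x < - (K2 * real N) \<or> K2 * real N < real_of_int x" by auto
   have "(K2 - K1) * real N = K2 * real N - K1 * real N" by (simp add: algebra_simps)
   then show ?thesis using 1 2 dN(1) by (auto simp: abs_if)
  next
   assume Q: "cond_Q1 N n K1 K2 \<delta> A \<and> cond_Q2 N n K1 K2 \<delta> A"
   from Q[THEN conjunct1, unfolded cond_Q1_def, rule_format, OF j]
   have "real_of_int ` A (2 * j) \<subseteq> {K1 * real N..K2 * real N}" by (elim conjE)
   then have 1: "K1 * real N \<le> real_of_int y" using y by auto
   from Q[THEN conjunct2, unfolded cond_Q2_def, rule_format, OF j]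
   have "real_of_int ` A (2 * j - 1) \<subseteq> {- (K2 * real N)..- (K1 * real N)}" by (elim conjE)
   then have 2: "real_of_int x \<le> - (K1 * real N)" using x by auto
   have "1 * real N \<le> K1 * real N" using K by (intro mult_right_mono) auto
   then show ?thesis using 1 2 dN(2) by simp
  qed
 qed
qed

lemma of_bool_le: "(P \<Longrightarrow> Q) \<Longrightarrow> of_bool P \<le> (of_bool Q :: real)"
 by (cases P) auto

theorem theorem2p1:
  shows "\<exists>\<epsilon>0 :: real \<Rightarrow> real. \<forall>\<xi> :: real pmf. discrete_rv \<xi> \<longrightarrow>
    0 < \<epsilon>0 (min_prob \<xi>) \<and>
    (\<forall>(\<delta>::real) (K1::real) (K2::real) (K3::real) (\<epsilon>::real).
       0 < \<delta> \<and> \<delta> < 1/4 \<and> 1 < K1 \<and> K1 < K2 \<and> K2 < K3 \<and> 0 < \<epsilon> \<and> \<epsilon> \<le> \<epsilon>0 (min_prob \<xi>) \<longrightarrow>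
       (\<exists>(L::real) (\<gamma>::real). 0 < L \<and> 0 < \<gamma> \<and> \<gamma> < \<epsilon> \<and>
         (\<forall>M::real. 1 \<le> M \<longrightarrow>
           (\<exists>(n0::nat) (\<eta>::real). 1 \<le> n0 \<and> 0 < \<eta> \<and>
             (\<forall>(n::nat) (N::nat) (f :: real \<Rightarrow> real) (\<A> :: (nat \<Rightarrow> int) set) (m :: real \<Rightarrow> nat).
                n0 \<le> n \<and>
                1 \<le> N \<and> real N \<le> exp ((shannon_entropy \<xi> - \<epsilon>) * real n) \<and>
                integrable lborel f \<and> (\<forall>t. 0 \<le> f t) \<and> L1_norm f = 1 \<and> log2_lipschitz \<eta> f \<and>
                admissible N n K1 K2 K3 \<delta> \<A> \<and>
                (\<Sum>a\<in>set_pmf \<xi>. m a) = n \<and>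
                (\<forall>a\<in>set_pmf \<xi>. \<bar>real (m a) - pmf \<xi> a * real n\<bar> \<le> \<gamma> * real n) \<longrightarrow>
                measure_pmf.prob (pmf_of_set \<A>)
                  {X. Linf_norm (random_average \<xi> f m n X) \<ge> ereal (L / (real N * sqrt (real n)))}
                \<le> exp (- M * real n))))))"
proof (rule exI[of _ "\<lambda>_. 1"], intro allI impI conjI)
 fix \<xi> :: "real pmf" assume rv: "discrete_rv \<xi>"
 show "0 < (1::real)" by simp
 fix \<delta> K1 K2 K3 \<epsilon> :: real
 assume asm: "0 < \<delta> \<and> \<delta> < 1/4 \<and> 1 < K1 \<and> K1 < K2 \<and> K2 < K3 \<and> 0 < \<epsilon> \<and> \<epsilon> \<le> 1"
 have \<delta>: "0 < \<delta>" "\<delta> < 1 / 4" and K: "1 < K1" "K1 < K2" and \<epsilon>: "0 < \<epsilon>" using asm by auto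
 let ?S = "set_pmf \<xi>"
 have finS: "finite ?S" using rv unfolding discrete_rv_def by simp
 obtain gS dS where "alphabet ?S (pmf \<xi>) (min_prob \<xi>) gS dS" using discrete_rv_alphabet[OF rv] .
 then interpret alphabet ?S "pmf \<xi>" "min_prob \<xi>" gS dS .
 (* separation of paired factors: (K2 - K1) N under the conditions P, at least 2 N under the conditions Q *)
 define d0 where "d0 = min (K2 - K1) 2"
 have d0: "0 < d0" unfolding d0_def using K by simp
 show "\<exists>(L::real) (\<gamma>::real). 0 < L \<and> 0 < \<gamma> \<and> \<gamma> < \<epsilon> \<and>
     (\<forall>M::real. 1 \<le> M \<longrightarrow>
      (\<exists>(n0::nat) (\<eta>::real). 1 \<le> n0 \<and> 0 < \<eta> \<and>
       (\<forall>(n::nat) (N::nat) (f :: real \<Rightarrow> real) (\<A> :: (nat \<Rightarrow> int) set) (m :: real \<Rightarrow> nat).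
        n0 \<le> n \<and>
        1 \<le> N \<and> real N \<le> exp ((shannon_entropy \<xi> - \<epsilon>) * real n) \<and>
        integrable lborel f \<and> (\<forall>t. 0 \<le> f t) \<and> L1_norm f = 1 \<and> log2_lipschitz \<eta> f \<and>
        admissible N n K1 K2 K3 \<delta> \<A> \<and>
        (\<Sum>a\<in>set_pmf \<xi>. m a) = n \<and>
        (\<forall>a\<in>set_pmf \<xi>. \<bar>real (m a) - pmf \<xi> a * real n\<bar> \<le> \<gamma> * real n) \<longrightarrow>
        measure_pmf.prob (pmf_of_set \<A>)
         {X. Linf_norm (random_average \<xi> f m n X) \<ge> ereal (L / (real N * sqrt (real n)))}
        \<le> exp (- M * real n))))"
 proof (rule sup_favg_bound[OF \<delta> d0 \<epsilon>])
  fix L \<gamma> :: real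
  assume L: "0 < L" and \<gamma>: "0 < \<gamma>" "\<gamma> < \<epsilon>" and bound: "\<And>M. 0 < M \<Longrightarrow> \<exists>(n0::nat) (\<eta>::real). 1 \<le> n0 \<and> 0 < \<eta> \<and> sup_rare \<delta> d0 \<epsilon> L \<gamma> M n0 \<eta>"
  show ?thesis
  proof (rule exI[of _ "2 * L"], rule exI[of _ \<gamma>], intro conjI allI impI)
   show "0 < 2 * L" using L by simp
   show "0 < \<gamma>" "\<gamma> < \<epsilon>" by (rule \<gamma>)+
   fix M :: real assume "1 \<le> M"
   then have "0 < M" by simp
   from bound[OF this] obtain n0 :: nat and \<zeta> :: real where n0: "1 \<le> n0" and \<zeta>: "0 < \<zeta>" and
    main: "sup_rare \<delta> d0 \<epsilon> L \<gamma> M n0 \<zeta>"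
    by (elim exE conjE)
   (* makes f constant up to a factor 2 on intervals of length dS + 1 and up to 1 + \<zeta> on length dS *)
   define \<eta> where "\<eta> = min 1 (log 2 (1 + \<zeta>)) / (dS + 1)"
   have d1: "0 < dS + 1" using dS_nonneg by simp
   have \<eta>: "0 < \<eta>" unfolding \<eta>_def using \<zeta> d1 by simp
   have \<eta>d: "\<eta> * (dS + 1) \<le> 1" "\<eta> * dS \<le> log 2 (1 + \<zeta>)"
   proof -
    have e: "\<eta> * (dS + 1) = min 1 (log 2 (1 + \<zeta>))" unfolding \<eta>_def using d1 by simp
    then show "\<eta> * (dS + 1) \<le> 1" by simp
    have "\<eta> * dS \<le> \<eta> * (dS + 1)" using \<eta> by (intro mult_left_mono) auto
    then show "\<eta> * dS \<le> log 2 (1 + \<zeta>)" using e by simp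
   qed
   show "\<exists>(n0::nat) (\<eta>::real). 1 \<le> n0 \<and> 0 < \<eta> \<and>
       (\<forall>(n::nat) (N::nat) (f :: real \<Rightarrow> real) (\<A> :: (nat \<Rightarrow> int) set) (m :: real \<Rightarrow> nat).
        n0 \<le> n \<and>
        1 \<le> N \<and> real N \<le> exp ((shannon_entropy \<xi> - \<epsilon>) * real n) \<and>
        integrable lborel f \<and> (\<forall>t. 0 \<le> f t) \<and> L1_norm f = 1 \<and> log2_lipschitz \<eta> f \<and>
        admissible N n K1 K2 K3 \<delta> \<A> \<and>
        (\<Sum>a\<in>set_pmf \<xi>. m a) = n \<and>
        (\<forall>a\<in>set_pmf \<xi>. \<bar>real (m a) - pmf \<xi> a * real n\<bar> \<le> \<gamma> * real n) \<longrightarrow>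
        measure_pmf.prob (pmf_of_set \<A>)
         {X. Linf_norm (random_average \<xi> f m n X) \<ge> ereal (2 * L / (real N * sqrt (real n)))}
        \<le> exp (- M * real n))"
   proof (intro exI[of _ n0] exI[of _ \<eta>] conjI allI impI)
    show "1 \<le> n0" by (rule n0)
    show "0 < \<eta>" by (rule \<eta>)
    fix n N :: nat and f :: "real \<Rightarrow> real" and \<A> :: "(nat \<Rightarrow> int) set" and m :: "real \<Rightarrow> nat"
    assume h: "n0 \<le> n \<and>
        1 \<le> N \<and> real N \<le> exp ((shannon_entropy \<xi> - \<epsilon>) * real n) \<and>
        integrable lborel f \<and> (\<forall>t. 0 \<le> f t) \<and> L1_norm f = 1 \<and> log2_lipschitz \<eta> f \<and>
        admissible N n K1 K2 K3 \<delta> \<A> \<and>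
        (\<Sum>a\<in>set_pmf \<xi>. m a) = n \<and>
        (\<forall>a\<in>set_pmf \<xi>. \<bar>real (m a) - pmf \<xi> a * real n\<bar> \<le> \<gamma> * real n)"
    have n: "n0 \<le> n" and N: "1 \<le> N" and NH: "real N \<le> exp ((shannon_entropy \<xi> - \<epsilon>) * real n)"
     and f: "integrable lborel f" "L1_norm f = 1" "log2_lipschitz \<eta> f" and adm: "admissible N n K1 K2 K3 \<delta> \<A>"
     and m: "(\<Sum>a\<in>?S. m a) = n" and md: "\<forall>a\<in>?S. \<bar>real (m a) - pmf \<xi> a * real n\<bar> \<le> \<gamma> * real n"
     by (rule h[THEN conjunct1] h[THEN conjunct2, THEN conjunct1]
      h[THEN conjunct2, THEN conjunct2, THEN conjunct1]
      h[THEN conjunct2, THEN conjunct2, THEN conjunct2, THEN conjunct1]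
      h[THEN conjunct2, THEN conjunct2, THEN conjunct2, THEN conjunct2, THEN conjunct2, THEN conjunct1]
      h[THEN conjunct2, THEN conjunct2, THEN conjunct2, THEN conjunct2, THEN conjunct2, THEN conjunct2, THEN conjunct1]
      h[THEN conjunct2, THEN conjunct2, THEN conjunct2, THEN conjunct2, THEN conjunct2, THEN conjunct2, THEN conjunct2, THEN conjunct1]
      h[THEN conjunct2, THEN conjunct2, THEN conjunct2, THEN conjunct2, THEN conjunct2, THEN conjunct2, THEN conjunct2, THEN conjunct2, THEN conjunct1]
      h[THEN conjunct2, THEN conjunct2, THEN conjunct2, THEN conjunct2, THEN conjunct2, THEN conjunct2, THEN conjunct2, THEN conjunct2, THEN conjunct2])+
    show "measure_pmf.prob (pmf_of_set \<A>) {X. Linf_norm (random_average \<xi> f m n X) \<ge> ereal (2 * L / (real N * sqrt (real n)))} \<le> exp (- M * real n)"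
    proof (rule admissible_factors[OF adm N K], goal_cases)
     case (1 A i0)
     note A = 1(1) and Ai = 1(2) and At = 1(3) and Ag = 1(4)
     have tame: "tame (dS + 1) f" by (rule tame_log2_lipschitz[OF f(3,1,2) \<eta>d(1)])
     have fpos: "0 \<le> f t" for t by (rule tameD(1)[OF tame])
     have slow: "f (t + h) \<le> (1 + \<zeta>) * f t" if "\<bar>h\<bar> \<le> dS" for t h
     proof -
      have "f (t + h) \<le> 2 powr (\<eta> * dS) * f t" by (rule log2_lipschitz_shift[OF f(3) that])
      also have "... \<le> 2 powr log 2 (1 + \<zeta>) * f t" using \<eta>d(2) fpos by (intro mult_right_mono powr_mono) auto
      also have "2 powr log 2 (1 + \<zeta>) = 1 + \<zeta>" using \<zeta> by simp
      finally show ?thesis .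
     qed
     have pos: "0 \<le> 2 * \<delta> * real n" using \<delta> by simp
     let ?y = "L / (real N * sqrt (real n))"
     have n1: "1 \<le> n" using n n0 by simp
     have y: "?y < 2 * L / (real N * sqrt (real n))" using L N n1 by (intro divide_strict_right_mono) auto
     have [measurable]: "f \<in> borel_measurable borel" using borel_measurable_integrable[OF f(1)] by simp
     have avgb: "avg (unif A) A [1..<n + 1] (\<lambda>X. of_bool (\<exists>t. ?y \<le> favg ?S f X n m t)) (\<lambda>_. undefined) \<le> exp (- M * real n)"
     proof (rule main[unfolded sup_rare_def, THEN spec, THEN spec, THEN spec, THEN spec, THEN spec, THEN spec, THEN spec, THEN mp], intro conjI allI impI ballI)
      show "real N \<le> exp ((- (\<Sum>a\<in>?S. pmf \<xi> a * ln (pmf \<xi> a)) - \<epsilon>) * real n)" using NH unfolding shannon_entropy_def .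
      show "finite (A i)" if "1 \<le> i \<and> i \<le> n" for i using Ai that by blast
      show "A i \<noteq> {}" if "1 \<le> i \<and> i \<le> n" for i using Ai that by blast
      show "N \<le> card (A i)" if "1 \<le> i \<and> i \<le> n" "i \<noteq> i0" for i using Ai that by blast
      show "\<exists>x1 x2. A i = {x1..x2} \<and> int N \<le> x2 - x1 + 1" if i: "2 * \<delta> * real n < real i \<and> i \<le> n" for i
      proof (rule At)
       have "0 < real i" using i pos by linarith
       then show "1 \<le> i" by simp
      qed (use i in auto)
      show "d0 * real N \<le> \<bar>real_of_int (x - y)\<bar>" if "1 \<le> j \<and> real j \<le> \<delta> * real n \<and> x \<in> A (2 * j - 1) \<and> y \<in> A (2 * j)" for j x y
       unfolding d0_def using that by (intro Ag) auto
      show "\<bar>real (m a) - pmf \<xi> a * real n\<bar> \<le> \<gamma> * real n" if "a \<in> ?S" for a using md that by blast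
     qed (fact n N tame slow m)+
     have incl: "\<exists>t. ?y \<le> favg ?S f X n m t" if X: "Linf_norm (random_average \<xi> f m n X) \<ge> ereal (2 * L / (real N * sqrt (real n)))" for X
     proof -
      have e: "random_average \<xi> f m n X = favg ?S f X n m" by (rule ext) (rule random_average_eq_favg[OF finS m])
      have "favg ?S f X n m \<in> borel_measurable borel" by measurable
      from Linf_norm_lower_witness[OF this X[unfolded e] y] obtain t where "?y \<le> \<bar>favg ?S f X n m t\<bar>" by (rule exE)
      then show ?thesis using favg_nonneg[of f ?S X n m t] fpos by (intro exI[of _ t]) simp
     qed
     have law: "\<forall>i\<in>set [1..<n + 1]. law (unif A) A i" using Ai by (auto intro!: law_unif)
     have "measure_pmf.prob (pmf_of_set \<A>) {X. Linf_norm (random_average \<xi> f m n X) \<ge> ereal (2 * L / (real N * sqrt (real n)))}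
      = avg (unif A) A [1..<n + 1] (\<lambda>X. of_bool (X \<in> {X. Linf_norm (random_average \<xi> f m n X) \<ge> ereal (2 * L / (real N * sqrt (real n)))})) (\<lambda>_. undefined)"
      unfolding A by (rule prob_eq_avg) (use Ai in auto)
     also have "... \<le> avg (unif A) A [1..<n + 1] (\<lambda>X. of_bool (\<exists>t. ?y \<le> favg ?S f X n m t)) (\<lambda>_. undefined)"
      unfolding mem_Collect_eq by (rule avg_mono[OF law], rule of_bool_le, rule incl)
     also have "... \<le> exp (- M * real n)" by (rule avgb)
     finally show ?thesis .
    qed
   qed
  qed
 qed
qed

end
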